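(* Both of the following assertions, understood for all holomorphic vector bundles $E$ over compact complex manifolds $X$, are false: (1) If $E$ is weakly RC-positive, then $S^kE\otimes\det E$ is RC-positive for every integer $k\ge 0$. (2) If $E$ is weakly RC-positive, then $S^kE$ is RC-positive for all sufficiently large $k$.
   Context: Let $E\to X$ be a holomorphic vector bundle of rank $r$ over a complex manifold with a smooth Hermitian metric $h$. Its Chern connection $\nabla$ is the unique connection compatible with $h$ and the holomorphic structure of $E$, and $R^h=\nabla^2$ is its Chern curvature, a $(1,1)$-form with values in $\mathrm{End}\,E$. For $u\in T^{1,0}_xX$ and $v\in E_x$, $\langle R^h v,v\rangle_h$ is the $(1,1)$-form at $x$ with $\langle R^hv,v\rangle_h(u,\bar u)=\langle R^h(u,\bar u)v,v\rangle_h=\sum R_{i\bar j\alpha\bar\beta}u_i\bar u_jv_\alpha\bar v_\beta$, where, in local coordinates $z_i$ and a local holomorphic frame $e_\alpha$ with $h_{\alpha\bar\beta}=\langle e_\alpha,e_\beta\rangle_h$, $R_{i\bar j\alpha\bar\beta}=-\frac{\partial^2 h_{\alpha\bar\beta}}{\partial z_i\partial\bar z_j}+h^{\gamma\bar\delta}\frac{\partial h_{\alpha\bar\delta}}{\partial z_i}\frac{\partial h_{\gamma\bar\beta}}{\partial\bar z_j}$. The metric $h$ is RC-positive at $x\in X$ if for every nonzero $v\in E_x$ there is a nonzero $u\in T^{1,0}_xX$ with $\langle R^hv,v\rangle_h(u,\bar u)>0$; $h$ is RC-positive if it is so at every point of $X$; $E$ is RC-positive if it admits an RC-positive Hermitian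 metric. Let $P(E^* )\to X$ be the projectivized bundle of lines in the dual bundle $E^*$, and let $O_{P(E^* )}(1)$ be the hyperplane section bundle (the dual of the tautological line subbundle). The bundle $E$ is weakly RC-positive if there is a Hermitian metric $h$ on the line bundle $O_{P(E^* )}(1)$ whose curvature $R^h$ is positive on the fiber $P(E^*_x)$ for every $x\in X$ and has at least $r=\operatorname{rank}E$ positive eigenvalues at every point of $P(E^* )$ (positivity and eigenvalues refer to the real $(1,1)$-form $\sqrt{-1}R^h$, equivalently to the Hermitian form $u\mapsto R^h(u,\bar u)$). *)

theory Defs
  imports
    "HOL-Analysis.Analysis"
    "HOL-Combinatorics.Multiset_Permutations"
    "Jordan_Normal_Form.Char_Poly"
begin

section \<open>Functions of several complex variables\<close>

text \<open>
  \<open>\<complex>\<^sup>n\<close> is the set of sequences that vanish from index \<open>n\<close> on (the convention of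
  \<^const>\<open>Euclidean_space\<close>).  The topology that it inherits from the product topology on
  \<^typ>\<open>nat \<Rightarrow> complex\<close> is the usual one.  The dimension is a term and not a type because the
  dimension of the manifold and the rank of the bundle are quantified variables.
\<close>

definition Cn :: "nat \<Rightarrow> (nat \<Rightarrow> complex) set" where
  "Cn n = {z. \<forall>k\<ge>n. z k = 0}"

definition Cn_topology :: "nat \<Rightarrow> (nat \<Rightarrow> complex) topology" where
  "Cn_topology n = top_of_set (Cn n)"

text \<open>Holomorphic on an open subset of \<open>\<complex>\<^sup>n\<close>: continuous, and complex differentiable in each
  variable separately.\<close>

definition holomorphic_Cn :: "nat \<Rightarrow> (nat \<Rightarrow> complex) set \<Rightarrow> ((nat \<Rightarrow> complex) \<Rightarrow> complex) \<Rightarrow> bool" where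
  "holomorphic_Cn n U f \<longleftrightarrow>
     continuous_on U f \<and>
     (\<forall>z\<in>U. \<forall>k<n. (\<lambda>w. f (z(k := w))) field_differentiable at (z k))"

text \<open>The real partial derivative of \<open>f\<close> in the direction \<open>c\<close> of the \<open>k\<close>-th complex variable;
  with \<open>z\<^sub>k = x\<^sub>k + \<i> y\<^sub>k\<close>, \<open>c = 1\<close> gives \<open>\<partial>f/\<partial>x\<^sub>k\<close> and \<open>c = \<i>\<close> gives \<open>\<partial>f/\<partial>y\<^sub>k\<close>.\<close>

definition real_slice :: "complex \<Rightarrow> nat \<Rightarrow> ((nat \<Rightarrow> complex) \<Rightarrow> complex) \<Rightarrow> (nat \<Rightarrow> complex) \<Rightarrow> real \<Rightarrow> complex" where
  "real_slice c k f z t = f (z(k := z k + of_real t * c))"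

definition real_partial :: "complex \<Rightarrow> nat \<Rightarrow> ((nat \<Rightarrow> complex) \<Rightarrow> complex) \<Rightarrow> (nat \<Rightarrow> complex) \<Rightarrow> complex" where
  "real_partial c k f z = vector_derivative (real_slice c k f z) (at 0)"

primrec C_diff :: "nat \<Rightarrow> nat \<Rightarrow> (nat \<Rightarrow> complex) set \<Rightarrow> ((nat \<Rightarrow> complex) \<Rightarrow> complex) \<Rightarrow> bool" where
  "C_diff 0 n U f \<longleftrightarrow> continuous_on U f"
| "C_diff (Suc m) n U f \<longleftrightarrow>
     continuous_on U f \<and>
     (\<forall>k<n. \<forall>c\<in>{1, \<i>}.
        (\<forall>z\<in>U. real_slice c k f z differentiable (at 0)) \<and>
        C_diff m n U (real_partial c k f))"

definition smooth_Cn :: "nat \<Rightarrow> (nat \<Rightarrow> complex) set \<Rightarrow> ((nat \<Rightarrow> complex) \<Rightarrow> complex) \<Rightarrow> bool" where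
  "smooth_Cn n U f \<longleftrightarrow> (\<forall>m. C_diff m n U f)"

text \<open>The Wirtinger derivatives \<open>\<partial>f/\<partial>z\<^sub>k\<close> and \<open>\<partial>f/\<partial>\<bar>z\<^sub>k\<close>.\<close>

definition dz :: "nat \<Rightarrow> ((nat \<Rightarrow> complex) \<Rightarrow> complex) \<Rightarrow> (nat \<Rightarrow> complex) \<Rightarrow> complex" where
  "dz k f z = (real_partial 1 k f z - \<i> * real_partial \<i> k f z) / 2"

definition dzbar :: "nat \<Rightarrow> ((nat \<Rightarrow> complex) \<Rightarrow> complex) \<Rightarrow> (nat \<Rightarrow> complex) \<Rightarrow> complex" where
  "dzbar k f z = (real_partial 1 k f z + \<i> * real_partial \<i> k f z) / 2"


section \<open>Complex manifolds\<close>

type_synonym 'a chart = "'a set \<times> ('a \<Rightarrow> nat \<Rightarrow> complex)"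

record 'a cmanifold =
  points :: "'a set"
  cdim :: nat
  atlas :: "'a chart set"

text \<open>The topology is the one that makes all charts homeomorphisms onto open subsets of \<open>\<complex>\<^sup>n\<close>.\<close>

definition manifold_topology :: "'a cmanifold \<Rightarrow> 'a topology" where
  "manifold_topology X = topology (\<lambda>W. W \<subseteq> points X \<and>
     (\<forall>(D, \<phi>)\<in>atlas X. openin (Cn_topology (cdim X)) (\<phi> ` (W \<inter> D))))"

text \<open>\<open>f\<close>, defined on an open set \<open>W\<close> of \<open>X\<close>, is holomorphic (smooth) if it is so in all charts.\<close>

definition in_chart :: "'a chart \<Rightarrow> ('a \<Rightarrow> complex) \<Rightarrow> (nat \<Rightarrow> complex) \<Rightarrow> complex" where
  "in_chart c f z = f (inv_into (fst c) (snd c) z)"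

definition holomorphic_fun :: "'a cmanifold \<Rightarrow> 'a set \<Rightarrow> ('a \<Rightarrow> complex) \<Rightarrow> bool" where
  "holomorphic_fun X W f \<longleftrightarrow>
     (\<forall>(D, \<phi>)\<in>atlas X. holomorphic_Cn (cdim X) (\<phi> ` (W \<inter> D)) (in_chart (D, \<phi>) f))"

definition smooth_fun :: "'a cmanifold \<Rightarrow> 'a set \<Rightarrow> ('a \<Rightarrow> complex) \<Rightarrow> bool" where
  "smooth_fun X W f \<longleftrightarrow>
     (\<forall>(D, \<phi>)\<in>atlas X. smooth_Cn (cdim X) (\<phi> ` (W \<inter> D)) (in_chart (D, \<phi>) f))"

definition complex_manifold :: "'a cmanifold \<Rightarrow> bool" where
  "complex_manifold X \<longleftrightarrow>
     (\<Union>(D, \<phi>)\<in>atlas X. D) = points X \<and>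
     (\<forall>(D, \<phi>)\<in>atlas X. inj_on \<phi> D \<and> openin (Cn_topology (cdim X)) (\<phi> ` D)) \<and>
     (\<forall>(D, \<phi>)\<in>atlas X. \<forall>(D', \<phi>')\<in>atlas X.
        openin (Cn_topology (cdim X)) (\<phi> ` (D \<inter> D')) \<and>
        (\<forall>k<cdim X. holomorphic_Cn (cdim X) (\<phi> ` (D \<inter> D')) (in_chart (D, \<phi>) (\<lambda>x. \<phi>' x k)))) \<and>
     Hausdorff_space (manifold_topology X) \<and>
     second_countable (manifold_topology X)"

lemma openin_manifold_topology:
  assumes "\<forall>(D, \<phi>)\<in>atlas X. inj_on \<phi> D"
  shows "openin (manifold_topology X) W \<longleftrightarrow>
     W \<subseteq> points X \<and> (\<forall>(D, \<phi>)\<in>atlas X. openin (Cn_topology (cdim X)) (\<phi> ` (W \<inter> D)))"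
proof -
  let ?T = "Cn_topology (cdim X)"
  let ?P = "\<lambda>W. W \<subseteq> points X \<and> (\<forall>(D, \<phi>)\<in>atlas X. openin ?T (\<phi> ` (W \<inter> D)))"
  have "istopology ?P"
    unfolding istopology_def
  proof (intro conjI allI impI)
    fix S T assume S: "?P S" and T: "?P T"
    show "S \<inter> T \<subseteq> points X" using S by blast
    show "\<forall>(D, \<phi>)\<in>atlas X. openin ?T (\<phi> ` (S \<inter> T \<inter> D))"
    proof clarify
      fix D \<phi> assume c: "(D, \<phi>) \<in> atlas X"
      with assms have "inj_on \<phi> D" by blast
      hence "\<phi> ` (S \<inter> T \<inter> D) = \<phi> ` (S \<inter> D) \<inter> \<phi> ` (T \<inter> D)"
        by (auto simp: inj_on_def image_iff)
      moreover have "openin ?T (\<phi> ` (S \<inter> D))" "openin ?T (\<phi> ` (T \<inter> D))"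
        using S T c by blast+
      ultimately show "openin ?T (\<phi> ` (S \<inter> T \<inter> D))" by (simp add: openin_Int)
    qed
  next
    fix K assume K: "\<forall>W\<in>K. ?P W"
    show "\<Union>K \<subseteq> points X" using K by blast
    show "\<forall>(D, \<phi>)\<in>atlas X. openin ?T (\<phi> ` (\<Union>K \<inter> D))"
    proof clarify
      fix D \<phi> assume c: "(D, \<phi>) \<in> atlas X"
      have "\<phi> ` (\<Union>K \<inter> D) = (\<Union>W\<in>K. \<phi> ` (W \<inter> D))" by blast
      moreover have "openin ?T (\<Union>W\<in>K. \<phi> ` (W \<inter> D))"
        using K c by (intro openin_clauses(3)) blast
      ultimately show "openin ?T (\<phi> ` (\<Union>K \<inter> D))" by simp
    qed
  qed
  thus ?thesis unfolding manifold_topology_def by (simp add: topology_inverse')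
qed

definition compact_complex_manifold :: "'a cmanifold \<Rightarrow> bool" where
  "compact_complex_manifold X \<longleftrightarrow> complex_manifold X \<and> compact_space (manifold_topology X)"


section \<open>Holomorphic vector bundles\<close>

text \<open>
  A vector bundle is given by an open cover \<open>U\<^sub>i\<close> (\<open>cover E i\<close>; some \<open>U\<^sub>i\<close> may be empty),
  holomorphic frames \<open>e\<^sub>\<alpha>\<close> over each \<open>U\<^sub>i\<close>, labelled by a finite set \<open>frame E\<close>, and the transition
  matrices \<open>g\<^sub>i\<^sub>j\<close>.  If a vector in the fibre over \<open>x \<in> U\<^sub>i \<inter> U\<^sub>j\<close> has components \<open>v\<^sub>i\<close> and \<open>v\<^sub>j\<close>, then
  \<open>v\<^sub>i = g\<^sub>i\<^sub>j(x) v\<^sub>j\<close>.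
\<close>

record ('a, 'i, 'b) vbundle =
  frame :: "'b set"
  cover :: "'i \<Rightarrow> 'a set"
  cocycle :: "'i \<Rightarrow> 'i \<Rightarrow> 'a \<Rightarrow> 'b \<Rightarrow> 'b \<Rightarrow> complex"

definition rank :: "('a, 'i, 'b) vbundle \<Rightarrow> nat" where
  "rank E = card (frame E)"

text \<open>The rank is positive.  The zero bundle would be weakly RC-positive for void reasons.\<close>

definition holomorphic_vbundle :: "'a cmanifold \<Rightarrow> ('a, 'i, 'b) vbundle \<Rightarrow> bool" where
  "holomorphic_vbundle X E \<longleftrightarrow>
     finite (frame E) \<and> frame E \<noteq> {} \<and>
     (\<forall>i. openin (manifold_topology X) (cover E i)) \<and>
     (\<Union>i. cover E i) = points X \<and>
     (\<forall>i j. \<forall>\<alpha>\<in>frame E. \<forall>\<beta>\<in>frame E.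
        holomorphic_fun X (cover E i \<inter> cover E j) (\<lambda>x. cocycle E i j x \<alpha> \<beta>)) \<and>
     (\<forall>i. \<forall>x\<in>cover E i. \<forall>\<alpha>\<in>frame E. \<forall>\<beta>\<in>frame E.
        cocycle E i i x \<alpha> \<beta> = (if \<alpha> = \<beta> then 1 else 0)) \<and>
     (\<forall>i j k. \<forall>x\<in>cover E i \<inter> cover E j \<inter> cover E k. \<forall>\<alpha>\<in>frame E. \<forall>\<gamma>\<in>frame E.
        cocycle E i k x \<alpha> \<gamma> = (\<Sum>\<beta>\<in>frame E. cocycle E i j x \<alpha> \<beta> * cocycle E j k x \<beta> \<gamma>))"

text \<open>The fibre \<open>E\<^sub>x\<close>: a vector is the family of its component vectors in all the frames over
  neighbourhoods of \<open>x\<close>.\<close>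

definition fibre :: "('a, 'i, 'b) vbundle \<Rightarrow> 'a \<Rightarrow> ('i \<Rightarrow> 'b \<Rightarrow> complex) set" where
  "fibre E x = {v.
     (\<forall>i \<alpha>. x \<notin> cover E i \<or> \<alpha> \<notin> frame E \<longrightarrow> v i \<alpha> = 0) \<and>
     (\<forall>i j. x \<in> cover E i \<inter> cover E j \<longrightarrow>
        (\<forall>\<alpha>\<in>frame E. v i \<alpha> = (\<Sum>\<beta>\<in>frame E. cocycle E i j x \<alpha> \<beta> * v j \<beta>)))}"

text \<open>In the dual frames the transition matrices are the inverse transposes \<open>(g\<^sub>j\<^sub>i)\<^sup>T\<close>.\<close>

definition dual_bundle :: "('a, 'i, 'b) vbundle \<Rightarrow> ('a, 'i, 'b) vbundle" where
  "dual_bundle E = \<lparr> frame = frame E, cover = cover E,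
     cocycle = (\<lambda>i j x \<alpha> \<beta>. cocycle E j i x \<beta> \<alpha>) \<rparr>"

text \<open>Here both bundles have to be given over the same cover.\<close>

definition tensor_bundle :: "('a, 'i, 'b) vbundle \<Rightarrow> ('a, 'i, 'c) vbundle \<Rightarrow> ('a, 'i, 'b \<times> 'c) vbundle" where
  "tensor_bundle E F = \<lparr> frame = frame E \<times> frame F, cover = (\<lambda>i. cover E i \<inter> cover F i),
     cocycle = (\<lambda>i j x (\<alpha>, \<alpha>') (\<beta>, \<beta>'). cocycle E i j x \<alpha> \<beta> * cocycle F i j x \<alpha>' \<beta>') \<rparr>"

text \<open>\<open>S\<^sup>kE\<close> has as frame the monomials of degree \<open>k\<close> in the \<open>e\<^sub>\<alpha>\<close>, encoded as multisets.
  The \<open>(a, b)\<close> entry of its transition matrix is the coefficient of the monomial \<open>a\<close> in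
  \<open>\<Prod>\<^sub>j g e\<^bsub>b\<^sub>j\<^esub> = \<Prod>\<^sub>j (\<Sum>\<^sub>\<alpha> g\<^bsub>\<alpha> b\<^sub>j\<^esub> e\<^sub>\<alpha>)\<close>, where \<open>b\<^sub>1, \<dots>, b\<^sub>k\<close> lists the elements of \<open>b\<close>.\<close>

definition sym_power :: "nat \<Rightarrow> ('a, 'i, 'b::linorder) vbundle \<Rightarrow> ('a, 'i, 'b multiset) vbundle" where
  "sym_power k E = \<lparr> frame = {a. set_mset a \<subseteq> frame E \<and> size a = k}, cover = cover E,
     cocycle = (\<lambda>i j x a b. \<Sum>cs\<in>permutations_of_multiset a.
        prod_list (map2 (cocycle E i j x) cs (sorted_list_of_multiset b))) \<rparr>"

text \<open>The determinant line bundle, for a bundle with frame labels \<open>0, \<dots>, r - 1\<close>.\<close>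

definition det_bundle :: "('a, 'i, nat) vbundle \<Rightarrow> ('a, 'i, unit) vbundle" where
  "det_bundle E = \<lparr> frame = {()}, cover = cover E,
     cocycle = (\<lambda>i j x _ _. Determinant.det
        (Matrix.mat (rank E) (rank E) (\<lambda>(\<alpha>, \<beta>). cocycle E i j x \<alpha> \<beta>))) \<rparr>"


section \<open>Hermitian metrics and Chern curvature\<close>

text \<open>A Hermitian metric is given by its Gram matrices \<open>h i x \<alpha> \<beta> = \<langle>e\<^sub>\<alpha>, e\<^sub>\<beta>\<rangle>\<close> in the frame over \<open>U\<^sub>i\<close>;
  the last clause says that they define the same inner product \<open>\<Sum> h\<^bsub>\<alpha>\<beta>\<^esub> v\<^sub>\<alpha> \<bar>w\<^sub>\<beta>\<close> on \<open>E\<^sub>x\<close>.\<close>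

type_synonym ('a, 'i, 'b) metric = "'i \<Rightarrow> 'a \<Rightarrow> 'b \<Rightarrow> 'b \<Rightarrow> complex"

definition hermitian_metric :: "'a cmanifold \<Rightarrow> ('a, 'i, 'b) vbundle \<Rightarrow> ('a, 'i, 'b) metric \<Rightarrow> bool" where
  "hermitian_metric X E h \<longleftrightarrow>
     (\<forall>i. \<forall>\<alpha>\<in>frame E. \<forall>\<beta>\<in>frame E. smooth_fun X (cover E i) (\<lambda>x. h i x \<alpha> \<beta>)) \<and>
     (\<forall>i. \<forall>x\<in>cover E i. \<forall>\<alpha>\<in>frame E. \<forall>\<beta>\<in>frame E. h i x \<beta> \<alpha> = cnj (h i x \<alpha> \<beta>)) \<and>
     (\<forall>i. \<forall>x\<in>cover E i. \<forall>v. (\<exists>\<alpha>\<in>frame E. v \<alpha> \<noteq> 0) \<longrightarrow>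
        0 < Re (\<Sum>\<alpha>\<in>frame E. \<Sum>\<beta>\<in>frame E. h i x \<alpha> \<beta> * v \<alpha> * cnj (v \<beta>))) \<and>
     (\<forall>i j. \<forall>x\<in>cover E i \<inter> cover E j. \<forall>\<gamma>\<in>frame E. \<forall>\<delta>\<in>frame E.
        h j x \<gamma> \<delta> = (\<Sum>\<alpha>\<in>frame E. \<Sum>\<beta>\<in>frame E.
          h i x \<alpha> \<beta> * cocycle E i j x \<alpha> \<gamma> * cnj (cocycle E i j x \<beta> \<delta>)))"

text \<open>\<open>h\<^bsup>\<gamma>\<bar>\<delta>\<^esup>\<close>, characterised by \<open>\<Sum>\<^sub>\<delta> h\<^bsup>\<gamma>\<bar>\<delta>\<^esup> h\<^bsub>\<alpha>\<bar>\<delta>\<^esub> = \<delta>\<^bsub>\<alpha>\<gamma>\<^esub>\<close>.\<close>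

definition inverse_metric :: "'b set \<Rightarrow> ('b \<Rightarrow> 'b \<Rightarrow> complex) \<Rightarrow> 'b \<Rightarrow> 'b \<Rightarrow> complex" where
  "inverse_metric B H = (SOME K. \<forall>\<alpha>\<in>B. \<forall>\<gamma>\<in>B.
     (\<Sum>\<delta>\<in>B. K \<gamma> \<delta> * H \<alpha> \<delta>) = (if \<alpha> = \<gamma> then 1 else 0))"

text \<open>The components
  \<open>R\<^bsub>p\<bar>q\<alpha>\<bar>\<beta>\<^esub> = - \<partial>\<^sub>p \<partial>\<^bsub>\<bar>q\<^esub> h\<^bsub>\<alpha>\<bar>\<beta>\<^esub> + h\<^bsup>\<gamma>\<bar>\<delta>\<^esup> \<partial>\<^sub>p h\<^bsub>\<alpha>\<bar>\<delta>\<^esub> \<partial>\<^bsub>\<bar>q\<^esub> h\<^bsub>\<gamma>\<bar>\<beta>\<^esub>\<close> of the Chern curvature at \<open>x\<close>, in the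
  coordinates of the chart \<open>c\<close> and the frame over \<open>U\<^sub>i\<close>.\<close>

definition chern_curvature ::
    "('a, 'i, 'b) vbundle \<Rightarrow> ('a, 'i, 'b) metric \<Rightarrow> 'a chart \<Rightarrow> 'i \<Rightarrow> 'a \<Rightarrow>
     nat \<Rightarrow> nat \<Rightarrow> 'b \<Rightarrow> 'b \<Rightarrow> complex" where
  "chern_curvature E h c i x p q \<alpha> \<beta> =
     (let H = (\<lambda>\<alpha> \<beta>. in_chart c (\<lambda>y. h i y \<alpha> \<beta>)); z = snd c x
      in - dz p (dzbar q (H \<alpha> \<beta>)) z +
         (\<Sum>\<gamma>\<in>frame E. \<Sum>\<delta>\<in>frame E.
            inverse_metric (frame E) (h i x) \<gamma> \<delta> * dz p (H \<alpha> \<delta>) z * dzbar q (H \<gamma> \<beta>) z))"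

text \<open>\<open>\<langle>R\<^sup>h(u, \<bar>u) v, v\<rangle>\<close> for \<open>u = \<Sum> u\<^sub>p \<partial>/\<partial>z\<^sub>p\<close> and \<open>v = \<Sum> v\<^sub>\<alpha> e\<^sub>\<alpha>\<close>; it is a real number.\<close>

definition curvature_pairing ::
    "'a cmanifold \<Rightarrow> ('a, 'i, 'b) vbundle \<Rightarrow> ('a, 'i, 'b) metric \<Rightarrow> 'a chart \<Rightarrow> 'i \<Rightarrow> 'a \<Rightarrow>
     (nat \<Rightarrow> complex) \<Rightarrow> ('b \<Rightarrow> complex) \<Rightarrow> real" where
  "curvature_pairing X E h c i x u v =
     Re (\<Sum>p<cdim X. \<Sum>q<cdim X. \<Sum>\<alpha>\<in>frame E. \<Sum>\<beta>\<in>frame E.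
       chern_curvature E h c i x p q \<alpha> \<beta> * u p * cnj (u q) * v \<alpha> * cnj (v \<beta>))"


section \<open>RC-positivity\<close>

text \<open>The condition does not depend on the chart and the frame around \<open>x\<close>.\<close>

definition RC_positive_at ::
    "'a cmanifold \<Rightarrow> ('a, 'i, 'b) vbundle \<Rightarrow> ('a, 'i, 'b) metric \<Rightarrow> 'a \<Rightarrow> bool" where
  "RC_positive_at X E h x \<longleftrightarrow>
     (\<forall>c\<in>atlas X. \<forall>i. x \<in> fst c \<inter> cover E i \<longrightarrow>
        (\<forall>v. (\<exists>\<alpha>\<in>frame E. v \<alpha> \<noteq> 0) \<longrightarrow>
           (\<exists>u\<in>Cn (cdim X). u \<noteq> (\<lambda>_. 0) \<and> 0 < curvature_pairing X E h c i x u v)))"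

definition RC_positive :: "'a cmanifold \<Rightarrow> ('a, 'i, 'b) vbundle \<Rightarrow> bool" where
  "RC_positive X E \<longleftrightarrow>
     (\<exists>h. hermitian_metric X E h \<and> (\<forall>x\<in>points X. RC_positive_at X E h x))"


section \<open>Projectivized bundles and weak RC-positivity\<close>

definition lines_in_fibre :: "('a, 'i, 'b) vbundle \<Rightarrow> 'a \<Rightarrow> ('i \<Rightarrow> 'b \<Rightarrow> complex) set set" where
  "lines_in_fibre F x =
     {{(\<lambda>i \<alpha>. c * v i \<alpha>) |c. True} |v. v \<in> fibre F x \<and> v \<noteq> (\<lambda>_ _. 0)}"

type_synonym ('a, 'i) proj_point = "'a \<times> ('i \<Rightarrow> nat \<Rightarrow> complex) set"

definition proj_points :: "'a cmanifold \<Rightarrow> ('a, 'i, nat) vbundle \<Rightarrow> ('a, 'i) proj_point set" where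
  "proj_points X F = (SIGMA x : points X. lines_in_fibre F x)"

text \<open>\<open>proj_cover X F (i, \<alpha>)\<close> is the open set of the lines over \<open>U\<^sub>i\<close> on which the \<open>\<alpha>\<close>-th
  homogeneous coordinate with respect to the frame over \<open>U\<^sub>i\<close> does not vanish identically.  Such a
  line has a unique element with \<open>\<alpha>\<close>-th coordinate 1.\<close>

definition proj_cover ::
    "'a cmanifold \<Rightarrow> ('a, 'i, nat) vbundle \<Rightarrow> 'i \<times> nat \<Rightarrow> ('a, 'i) proj_point set" where
  "proj_cover X F = (\<lambda>(i, \<alpha>). {(x, L) \<in> proj_points X F.
     x \<in> cover F i \<and> \<alpha> \<in> frame F \<and> (\<exists>v\<in>L. v i \<alpha> \<noteq> 0)})"

definition normalized_vector ::
    "'i \<times> nat \<Rightarrow> ('i \<Rightarrow> nat \<Rightarrow> complex) set \<Rightarrow> 'i \<Rightarrow> nat \<Rightarrow> complex" where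
  "normalized_vector = (\<lambda>(i, \<alpha>) L. THE v. v \<in> L \<and> v i \<alpha> = 1)"

text \<open>\<open>P(F) \<rightarrow> X\<close>, the bundle of lines in the fibres of a bundle \<open>F\<close> with frame labels
  \<open>0, \<dots>, r - 1\<close>.  The first \<open>n = dim X\<close> coordinates are coordinates of \<open>X\<close>; the others are the
  affine coordinates \<open>v\<^sub>\<beta>/v\<^sub>\<alpha>\<close>, \<open>\<beta> \<noteq> \<alpha>\<close>, of the line.\<close>

definition proj_chart ::
    "'a cmanifold \<Rightarrow> ('a, 'i, nat) vbundle \<Rightarrow> 'a chart \<Rightarrow> 'i \<times> nat \<Rightarrow> ('a, 'i) proj_point chart" where
  "proj_chart X F c = (\<lambda>(i, \<alpha>).
     ({(x, L) \<in> proj_cover X F (i, \<alpha>). x \<in> fst c},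
      \<lambda>(x, L) k.
        if k < cdim X then snd c x k
        else if k < cdim X + rank F - 1
        then (let m = k - cdim X; \<beta> = (if m < \<alpha> then m else Suc m)
              in normalized_vector (i, \<alpha>) L i \<beta>)
        else 0))"

definition projectivization ::
    "'a cmanifold \<Rightarrow> ('a, 'i, nat) vbundle \<Rightarrow> ('a, 'i) proj_point cmanifold" where
  "projectivization X F = \<lparr> points = proj_points X F, cdim = cdim X + rank F - 1,
     atlas = {proj_chart X F c (i, \<alpha>) |c i \<alpha>. c \<in> atlas X \<and> \<alpha> \<in> frame F} \<rparr>"

text \<open>The tautological line subbundle of the pull-back of \<open>F\<close>, with frame \<open>normalized_vector (i, \<alpha>)\<close>
  over \<open>proj_cover X F (i, \<alpha>)\<close>: \<open>normalized_vector (j, \<beta>) L\<close> is its \<open>(i, \<alpha>)\<close> coordinate times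
  \<open>normalized_vector (i, \<alpha>) L\<close>.\<close>

definition tautological_bundle ::
    "'a cmanifold \<Rightarrow> ('a, 'i, nat) vbundle \<Rightarrow> (('a, 'i) proj_point, 'i \<times> nat, unit) vbundle" where
  "tautological_bundle X F = \<lparr> frame = {()}, cover = proj_cover X F,
     cocycle = (\<lambda>(i, \<alpha>) (j, \<beta>) (x, L) _ _. normalized_vector (j, \<beta>) L i \<alpha>) \<rparr>"

abbreviation P_dual :: "'a cmanifold \<Rightarrow> ('a, 'i, nat) vbundle \<Rightarrow> ('a, 'i) proj_point cmanifold" where
  "P_dual X E \<equiv> projectivization X (dual_bundle E)"

definition hyperplane_bundle ::
    "'a cmanifold \<Rightarrow> ('a, 'i, nat) vbundle \<Rightarrow> (('a, 'i) proj_point, 'i \<times> nat, unit) vbundle" where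
  "hyperplane_bundle X E = dual_bundle (tautological_bundle X (dual_bundle E))"

text \<open>The curvature of a line bundle as a scalar \<open>(1,1)\<close>-form: \<open>R\<^bsub>p\<bar>q\<^esub> = R\<^bsub>p\<bar>q e \<bar>e\<^esub> / \<langle>e, e\<rangle>\<close>, that is,
  \<open>- \<partial>\<^sub>p \<partial>\<^bsub>\<bar>q\<^esub> log \<langle>e, e\<rangle>\<close>.\<close>

definition line_curvature ::
    "('a, 'i, unit) vbundle \<Rightarrow> ('a, 'i, unit) metric \<Rightarrow> 'a chart \<Rightarrow> 'i \<Rightarrow> 'a \<Rightarrow> nat \<Rightarrow> nat \<Rightarrow> complex" where
  "line_curvature L h c i x p q = chern_curvature L h c i x p q () () / h i x () ()"

text \<open>The number of positive eigenvalues of a Hermitian matrix, with multiplicity.  For the matrix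
  of a Hermitian form it does not depend on the basis.\<close>

definition num_positive_eigenvalues :: "complex mat \<Rightarrow> nat" where
  "num_positive_eigenvalues A =
     (\<Sum>l\<in>{l::real. 0 < l \<and> eigenvalue A (of_real l)}. Polynomial.order (of_real l) (char_poly A))"

text \<open>In the charts of \<open>P(E\<^sup>*)\<close>, the vectors tangent to the fibres of \<open>P(E\<^sup>*) \<rightarrow> X\<close> are those whose
  first \<open>dim X\<close> components vanish.\<close>

definition weakly_RC_positive :: "'a cmanifold \<Rightarrow> ('a, 'i, nat) vbundle \<Rightarrow> bool" where
  "weakly_RC_positive X E \<longleftrightarrow>
     (\<exists>h. hermitian_metric (P_dual X E) (hyperplane_bundle X E) h \<and>
        (\<forall>y\<in>points (P_dual X E). \<forall>c\<in>atlas (P_dual X E). \<forall>i.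
           y \<in> fst c \<inter> cover (hyperplane_bundle X E) i \<longrightarrow>
           (let N = cdim (P_dual X E); R = line_curvature (hyperplane_bundle X E) h c i y
            in (\<forall>u\<in>Cn N. u \<noteq> (\<lambda>_. 0) \<and> (\<forall>k<cdim X. u k = 0) \<longrightarrow>
                  0 < Re (\<Sum>p<N. \<Sum>q<N. R p q * u p * cnj (u q))) \<and>
               rank E \<le> num_positive_eigenvalues (Matrix.mat N N (\<lambda>(p, q). R p q)))))"

text \<open>
  A statement about all compact complex manifolds has to fix a type of points.  Compact complex
  manifolds are second countable, hence have at most the cardinality of the continuum, so each of them is
  biholomorphic to one whose points belong to the following type (the topology comes from the atlas
  and not from the type).  Sets of sequences are used so that points of projective
  spaces and of complex tori can be taken literally as lines and as cosets.  Similarly, by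
  compactness, countably many frame domains are enough for every bundle.
\<close>

type_synonym pt = "(nat \<Rightarrow> complex) set"

end

theory Submission
  imports Defs "Jordan_Normal_Form.Schur_Decomposition"
begin

text \<open>
  One bundle refutes both assertions: the null-correlation bundle \<open>E\<close> on \<open>\<complex>P\<^sup>3\<close>, whose dual has the fibre
  \<open>z\<^sup>\<bottom>/z\<close> over the line of \<open>z\<close>, with \<open>\<bottom>\<close> taken for a symplectic form on \<open>\<complex>\<^sup>4\<close>.  A point of \<open>P(E\<^sup>*)\<close> is a flag
  of a line \<open>z\<close> inside an isotropic plane \<open>z \<and> w\<close>, and \<open>\<bar>z\<bar>\<^sup>2 / \<bar>z \<and> w\<bar>\<^sup>2\<close> is a metric on \<open>O(1)\<close> with curvature the
  Fubini-Study form of the Pluecker embedding of the planes minus that of \<open>\<complex>P\<^sup>3\<close>.  It is positive on the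
  fibres, and it has two positive eigenvalues.

  The structure group of \<open>E\<close> is \<open>SL\<^sub>2\<close>.  Hence \<open>det E\<close> is trivial, and for even \<open>k\<close> the area form induces an
  invariant quadratic form \<open>q\<close> on \<open>S\<^sup>kE\<close>.  For a Hermitian metric \<open>h\<close> on a bundle with such a \<open>q\<close>, take the maximum
  of \<open>\<bar>q(v)\<bar> / h(v, v)\<close> over all \<open>v \<noteq> 0\<close>.  Along a local holomorphic section through a maximizing \<open>v\<close> the function
  \<open>log \<bar>q\<bar>\<close> is pluriharmonic and \<open>log h - log \<bar>q\<bar>\<close> has a minimum.  So \<open>\<langle>R\<^sup>h(u, \<bar>u)v, v\<rangle> \<le> 0\<close> for all \<open>u\<close>, by
  choosing the section horizontal to first order.
\<close>

section \<open>Calculus of Wirtinger derivatives\<close>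

text \<open>The obstruction is general: an invariant quadratic form makes a bundle partly self-dual,
  and positivity in even one direction at a maximizing vector contradicts the maximum principle.
  Weak RC-positivity does not see this, because the curvature on the flag manifold may be negative
  in all but two directions. For assertion (1) the exponent 0 suffices, where \<open>det E\<close>
  itself carries the form; for (2) the even exponents are unbounded. For odd exponents the induced
  form is alternating and says nothing. Logarithms are avoided throughout. In the maximum principle,
  adding up the four directions 1, i, -1, -i replaces pluriharmonicity of log |q|: the values of q
  along the rotated curve add up to exactly 4 q(v0), and the (2,0) and (0,2) second derivatives of
  the metric cancel. In the curvature of O(1), logarithmic derivatives are written as quotients.
  Eigenvalues are counted as roots of a characteristic polynomial, so the two positive ones come
  from a plane on which the form is positive. That plane is found in homogeneous coordinates, where
  the symmetry is visible, and then transported to a chart.\<close>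

definition has_wirtinger ::
    "nat \<Rightarrow> ((nat \<Rightarrow> complex) \<Rightarrow> complex) \<Rightarrow> complex \<Rightarrow> complex \<Rightarrow> (nat \<Rightarrow> complex) \<Rightarrow> bool" where
  "has_wirtinger k f a b z \<longleftrightarrow>
     ((\<lambda>w. f (z(k := w))) has_derivative (\<lambda>h. a * h + b * cnj h)) (at (z k))"

lemma has_wirtinger_slice:
  assumes "has_wirtinger k f a b z"
  shows "(real_slice c k f z has_vector_derivative a * c + b * cnj c) (at 0)"
proof -
  have 1: "((\<lambda>w. f (z(k := w))) has_derivative (\<lambda>h. a * h + b * cnj h)) (at (z k + of_real 0 * c))"
    using assms unfolding has_wirtinger_def by simp
  have 2: "((\<lambda>t::real. z k + of_real t * c) has_derivative (\<lambda>t. of_real t * c)) (at 0)"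
    by (auto intro!: derivative_eq_intros)
  have "((\<lambda>t. f (z(k := z k + of_real t * c))) has_derivative
      (\<lambda>t. a * (of_real t * c) + b * cnj (of_real t * c))) (at 0)"
    by (rule has_derivative_compose[OF 2 1])
  moreover have "(\<lambda>t. a * (of_real t * c) + b * cnj (of_real t * c)) = (\<lambda>t. t *\<^sub>R (a * c + b * cnj c))"
    by (auto simp: scaleR_conv_of_real algebra_simps)
  ultimately show ?thesis unfolding has_vector_derivative_def real_slice_def[abs_def] by simp
qed

lemma has_wirtinger_partial:
  assumes "has_wirtinger k f a b z"
  shows "real_partial c k f z = a * c + b * cnj c"
  unfolding real_partial_def by (rule vector_derivative_at[OF has_wirtinger_slice[OF assms]])

text \<open>\<open>dz\<close> and \<open>dzbar\<close> rest on \<open>vector_derivative\<close>,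
  which returns a value even where no derivative exists. \<open>has_wirtinger\<close> asserts
  existence, so explicit values of these operators are read off through it.\<close>

lemma has_wirtinger_dz: "has_wirtinger k f a b z \<Longrightarrow> dz k f z = a"
  unfolding dz_def by (simp add: has_wirtinger_partial algebra_simps)

lemma has_wirtinger_dzbar: "has_wirtinger k f a b z \<Longrightarrow> dzbar k f z = b"
  unfolding dzbar_def by (simp add: has_wirtinger_partial algebra_simps)

lemma has_wirtinger_const: "has_wirtinger k (\<lambda>z. c) 0 0 z"
  unfolding has_wirtinger_def by simp

lemma has_wirtinger_coord: "has_wirtinger k (\<lambda>z. z j) (if j = k then 1 else 0) 0 z"
  unfolding has_wirtinger_def by (auto intro!: derivative_eq_intros)

lemma has_wirtinger_add:
  "has_wirtinger k f a b z \<Longrightarrow> has_wirtinger k g c d z \<Longrightarrow>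
    has_wirtinger k (\<lambda>z. f z + g z) (a + c) (b + d) z"
  unfolding has_wirtinger_def by (drule (1) has_derivative_add) (simp add: algebra_simps)

lemma has_wirtinger_diff:
  "has_wirtinger k f a b z \<Longrightarrow> has_wirtinger k g c d z \<Longrightarrow>
    has_wirtinger k (\<lambda>z. f z - g z) (a - c) (b - d) z"
  unfolding has_wirtinger_def by (drule (1) has_derivative_diff) (simp add: algebra_simps)

lemma has_wirtinger_mult:
  "has_wirtinger k f a b z \<Longrightarrow> has_wirtinger k g c d z \<Longrightarrow>
    has_wirtinger k (\<lambda>z. f z * g z) (a * g z + f z * c) (b * g z + f z * d) z"
  unfolding has_wirtinger_def by (drule (1) has_derivative_mult) (simp add: algebra_simps)

lemma has_wirtinger_sum:
  assumes "\<And>j. j \<in> J \<Longrightarrow> has_wirtinger k (f j) (a j) (b j) z"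
  shows "has_wirtinger k (\<lambda>z. \<Sum>j\<in>J. f j z) (\<Sum>j\<in>J. a j) (\<Sum>j\<in>J. b j) z"
  using assms
proof (induction J rule: infinite_finite_induct)
  case (insert j J)
  then show ?case by (simp add: has_wirtinger_add)
qed (simp_all add: has_wirtinger_const)

lemma has_wirtinger_cnj:
  assumes "has_wirtinger k f a b z"
  shows "has_wirtinger k (\<lambda>z. cnj (f z)) (cnj b) (cnj a) z"
  using bounded_linear.has_derivative[OF bounded_linear_cnj assms[unfolded has_wirtinger_def]]
  unfolding has_wirtinger_def by (simp add: add.commute)

lemma has_wirtinger_inverse:
  assumes "has_wirtinger k f a b z" "f z \<noteq> 0"
  shows "has_wirtinger k (\<lambda>z. inverse (f z)) (- a / (f z)\<^sup>2) (- b / (f z)\<^sup>2) z"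
proof -
  have "((\<lambda>w. inverse (f (z(k := w)))) has_derivative
     (\<lambda>h. - (inverse (f z) * (a * h + b * cnj h) * inverse (f z)))) (at (z k))"
    using Deriv.has_derivative_inverse[OF _ assms(1)[unfolded has_wirtinger_def]] assms(2) by simp
  thus ?thesis unfolding has_wirtinger_def
    by (rule has_derivative_eq_rhs) (use assms(2) in \<open>auto simp: divide_simps power2_eq_square algebra_simps\<close>)
qed

lemma has_wirtinger_transform:
  assumes "has_wirtinger k f a b z" "\<forall>\<^sub>F w in nhds (z k). f (z(k := w)) = g (z(k := w))"
  shows "has_wirtinger k g a b z"
proof -
  have "((\<lambda>w. g (z(k := w))) has_derivative (\<lambda>h. a * h + b * cnj h)) (at (z k))"
    using assms(1) unfolding has_wirtinger_def
    by (rule has_derivative_transform_eventually)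
       (use assms(2) eventually_nhds_x_imp_x[OF assms(2)] in \<open>auto intro: eventually_mono simp: eventually_at_filter\<close>)
  thus ?thesis unfolding has_wirtinger_def .
qed

lemma continuous_fun_upd: "continuous_on UNIV (\<lambda>w::complex. z(k := w))"
proof (rule continuous_on_coordinatewise_then_product)
  show "continuous_on UNIV (\<lambda>w. (z(k := w)) i)" for i by (cases "i = k") (auto intro: continuous_intros)
qed

text \<open>Openness refers to the subspace of sequences vanishing from index \<open>n\<close> on;
  the bound \<open>k < n\<close> keeps the altered point in it.\<close>

lemma eventually_fun_upd_in:
  assumes "openin (Cn_topology n) U" "z \<in> U" "k < n"
  shows "\<forall>\<^sub>F w in nhds (z k). z(k := w) \<in> U"
proof -
  obtain T where T: "open T" "U = Cn n \<inter> T"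
    using assms(1) unfolding Cn_topology_def openin_open by blast
  have "open ((\<lambda>w. z(k := w)) -` T)"
    using open_vimage[OF T(1) continuous_fun_upd] .
  moreover have "z k \<in> (\<lambda>w. z(k := w)) -` T" using assms(2) T by simp
  ultimately have "\<forall>\<^sub>F w in nhds (z k). w \<in> (\<lambda>w. z(k := w)) -` T" by (rule eventually_nhds_in_open)
  moreover have "z(k := w) \<in> Cn n" for w using assms(2,3) T unfolding Cn_def by auto
  ultimately show ?thesis unfolding T(2) by (auto elim: eventually_mono)
qed

lemma eventually_real_slice_in:
  assumes "openin (Cn_topology n) U" "z \<in> U" "k < n"
  shows "\<forall>\<^sub>F t in nhds (0::real). z(k := z k + of_real t * c) \<in> U"
proof -
  have "((\<lambda>t::real. z k + of_real t * c) \<longlongrightarrow> z k + of_real 0 * c) (nhds 0)"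
    by (intro tendsto_intros filterlim_ident)
  hence "filterlim (\<lambda>t::real. z k + of_real t * c) (nhds (z k)) (nhds 0)" by simp
  from eventually_compose_filterlim[OF eventually_fun_upd_in[OF assms] this] show ?thesis .
qed

lemma real_slice_cong:
  assumes "openin (Cn_topology n) U" "z \<in> U" "k < n" "\<And>z. z \<in> U \<Longrightarrow> f z = g z"
  shows "(real_slice c k f z has_vector_derivative d) (at 0) \<longleftrightarrow>
         (real_slice c k g z has_vector_derivative d) (at 0)"
proof -
  have "\<forall>\<^sub>F t in nhds 0. real_slice c k f z t = real_slice c k g z t"
    using eventually_real_slice_in[OF assms(1-3), of c] unfolding real_slice_def
    by (rule eventually_mono) (rule assms(4))
  thus ?thesis by (intro has_vector_derivative_cong_ev) (auto elim: eventually_mono dest: eventually_nhds_x_imp_x)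
qed

lemma real_partial_works:
  "real_slice c k f z differentiable (at 0) \<longleftrightarrow>
     (real_slice c k f z has_vector_derivative real_partial c k f z) (at 0)"
  unfolding real_partial_def
  by (rule vector_derivative_works)

lemma real_partialI:
  "(real_slice c k f z has_vector_derivative d) (at 0) \<Longrightarrow> real_partial c k f z = d"
  unfolding real_partial_def by (rule vector_derivative_at)

section \<open>Closure properties of finitely often differentiable functions\<close>

lemma C_diff_SucD: "C_diff (Suc m) n U f \<Longrightarrow> C_diff m n U f"
proof (induction m arbitrary: f)
  case (Suc m)
  show ?case
    unfolding C_diff.simps(2)[of m]
    using Suc.prems[unfolded C_diff.simps(2)[of "Suc m"]] Suc.IH by blast
qed simp

lemma C_diff_continuous: "C_diff m n U f \<Longrightarrow> continuous_on U f"
  by (cases m) auto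

lemma C_diff_SucI:
  assumes "continuous_on U f"
    and "\<And>k c z. k < n \<Longrightarrow> c \<in> {1, \<i>} \<Longrightarrow> z \<in> U \<Longrightarrow> (real_slice c k f z has_vector_derivative D c k z) (at 0)"
    and "\<And>k c. k < n \<Longrightarrow> c \<in> {1, \<i>} \<Longrightarrow> C_diff m n U (real_partial c k f)"
  shows "C_diff (Suc m) n U f"
  unfolding C_diff.simps(2) using assms differentiableI_vector by blast

lemma C_diff_SucD':
  assumes "C_diff (Suc m) n U f" "k < n" "c \<in> {1, \<i>}"
  shows "C_diff m n U (real_partial c k f)"
    and "z \<in> U \<Longrightarrow> (real_slice c k f z has_vector_derivative real_partial c k f z) (at 0)"
  using assms unfolding C_diff.simps(2) real_partial_works by blast+

text \<open>Derivatives at a point of an open set see only nearby values, so equality on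
  \<open>U\<close> survives to every order. This carries smoothness of explicit formulas over to
  chart representatives, which agree with them only on \<open>U\<close>.\<close>

lemma C_diff_cong:
  assumes U: "openin (Cn_topology n) U"
  shows "C_diff m n U f \<Longrightarrow> (\<And>z. z \<in> U \<Longrightarrow> f z = g z) \<Longrightarrow> C_diff m n U g"
proof (induction m arbitrary: f g)
  case 0
  then show ?case by (simp cong: continuous_on_cong)
next
  case (Suc m)
  have s: "(real_slice c k g z has_vector_derivative real_partial c k f z) (at 0)"
    if "k < n" "c \<in> {1, \<i>}" "z \<in> U" for k c z
    using C_diff_SucD'(2)[OF Suc.prems(1) that] real_slice_cong[OF U that(3,1), of f g c] Suc.prems(2) by blast
  show ?case
  proof (rule C_diff_SucI[OF _ s])
    show "continuous_on U g"
      using C_diff_continuous[OF Suc.prems(1)] Suc.prems(2) by (simp cong: continuous_on_cong)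
    fix k c assume kc: "k < n" "c \<in> {1, \<i>}"
    show "C_diff m n U (real_partial c k g)"
      by (rule Suc.IH[OF C_diff_SucD'(1)[OF Suc.prems(1) kc]]) (simp add: real_partialI[OF s[OF kc]])
  qed
qed

lemma C_diff_const: "C_diff m n U (\<lambda>z. a)"
proof (induction m arbitrary: a)
  case (Suc m)
  have "real_partial c k (\<lambda>z. a) = (\<lambda>z. 0)" for c k
    by (rule ext) (auto intro!: real_partialI simp: real_slice_def[abs_def])
  with Suc show ?case by (intro C_diff_SucI[where D = "\<lambda>_ _ _. 0"]) (auto simp: real_slice_def[abs_def])
qed simp

lemma C_diff_coord: "C_diff m n U (\<lambda>z. z j)"
proof (cases m)
  case 0
  then show ?thesis by (simp add: continuous_on_subset[OF continuous_on_product_coordinates])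
next
  case (Suc m)
  have s: "(real_slice c k (\<lambda>z. z j) z has_vector_derivative (if j = k then c else 0)) (at 0)" for c k z
    unfolding real_slice_def[abs_def]
    by (auto intro!: derivative_eq_intros simp: has_vector_derivative_def scaleR_conv_of_real)
  hence "real_partial c k (\<lambda>z. z j) = (\<lambda>z. if j = k then c else 0)" for c k
    by (intro ext real_partialI)
  with s C_diff_const show ?thesis unfolding Suc
    by (intro C_diff_SucI[OF _ s]) (auto simp: continuous_on_subset[OF continuous_on_product_coordinates])
qed

lemma C_diff_cnj: "C_diff m n U f \<Longrightarrow> openin (Cn_topology n) U \<Longrightarrow> C_diff m n U (\<lambda>z. cnj (f z))"
proof (induction m arbitrary: f)
  case 0 then show ?case by (auto intro: continuous_intros)
next
  case (Suc m)
  have s: "(real_slice c k (\<lambda>z. cnj (f z)) z has_vector_derivative cnj (real_partial c k f z)) (at 0)"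
    if "k < n" "c \<in> {1, \<i>}" "z \<in> U" for k c z
    using bounded_linear.has_vector_derivative[OF bounded_linear_cnj C_diff_SucD'(2)[OF Suc.prems(1) that]]
    unfolding real_slice_def[abs_def] .
  show ?case
  proof (rule C_diff_SucI[OF _ s])
    show "continuous_on U (\<lambda>z. cnj (f z))" using C_diff_continuous[OF Suc.prems(1)] by (intro continuous_intros)
    fix k c assume kc: "k < n" "c \<in> {1, \<i>}"
    show "C_diff m n U (real_partial c k (\<lambda>z. cnj (f z)))"
      by (rule C_diff_cong[OF Suc.prems(2) Suc.IH[OF C_diff_SucD'(1)[OF Suc.prems(1) kc] Suc.prems(2)]])
         (simp add: real_partialI[OF s[OF kc]])
  qed
qed

lemma C_diff_add:
  "C_diff m n U f \<Longrightarrow> C_diff m n U g \<Longrightarrow> openin (Cn_topology n) U \<Longrightarrow> C_diff m n U (\<lambda>z. f z + g z)"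
proof (induction m arbitrary: f g)
  case 0 then show ?case by (auto intro: continuous_intros)
next
  case (Suc m)
  have s: "(real_slice c k (\<lambda>z. f z + g z) z has_vector_derivative real_partial c k f z + real_partial c k g z) (at 0)"
    if "k < n" "c \<in> {1, \<i>}" "z \<in> U" for k c z
    using has_vector_derivative_add[OF C_diff_SucD'(2)[OF Suc.prems(1) that] C_diff_SucD'(2)[OF Suc.prems(2) that]]
    unfolding real_slice_def[abs_def] .
  show ?case
  proof (rule C_diff_SucI[OF _ s])
    show "continuous_on U (\<lambda>z. f z + g z)"
      using C_diff_continuous[OF Suc.prems(1)] C_diff_continuous[OF Suc.prems(2)] by (intro continuous_intros)
    fix k c assume kc: "k < n" "c \<in> {1, \<i>}"
    show "C_diff m n U (real_partial c k (\<lambda>z. f z + g z))"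
      by (rule C_diff_cong[OF Suc.prems(3) Suc.IH[OF C_diff_SucD'(1)[OF Suc.prems(1) kc]
            C_diff_SucD'(1)[OF Suc.prems(2) kc] Suc.prems(3)]])
         (simp add: real_partialI[OF s[OF kc]])
  qed
qed

lemma C_diff_mult:
  "C_diff m n U f \<Longrightarrow> C_diff m n U g \<Longrightarrow> openin (Cn_topology n) U \<Longrightarrow> C_diff m n U (\<lambda>z. f z * g z)"
proof (induction m arbitrary: f g)
  case 0 then show ?case by (auto intro: continuous_intros)
next
  case (Suc m)
  have s: "(real_slice c k (\<lambda>z. f z * g z) z has_vector_derivative
      f z * real_partial c k g z + real_partial c k f z * g z) (at 0)"
    if "k < n" "c \<in> {1, \<i>}" "z \<in> U" for k c z
    using has_vector_derivative_mult[OF C_diff_SucD'(2)[OF Suc.prems(1) that] C_diff_SucD'(2)[OF Suc.prems(2) that]]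
    unfolding real_slice_def[abs_def] by simp
  note f = Suc.prems(1) and g = Suc.prems(2) and U = Suc.prems(3)
  show ?case
  proof (rule C_diff_SucI[OF _ s])
    show "continuous_on U (\<lambda>z. f z * g z)"
      using C_diff_continuous[OF f] C_diff_continuous[OF g] by (intro continuous_intros)
    fix k c assume kc: "k < n" "c \<in> {1, \<i>}"
    have "C_diff m n U (\<lambda>z. f z * real_partial c k g z + real_partial c k f z * g z)"
      by (intro C_diff_add Suc.IH C_diff_SucD[OF f] C_diff_SucD[OF g] C_diff_SucD'(1)[OF f kc]
          C_diff_SucD'(1)[OF g kc] U)
    thus "C_diff m n U (real_partial c k (\<lambda>z. f z * g z))"
      by (rule C_diff_cong[OF U]) (simp add: real_partialI[OF s[OF kc]])
  qed
qed

text \<open>Bootstrapping: the derivative of 1/f again contains 1/f, which has the lower order of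
  smoothness by induction.\<close>

lemma C_diff_inverse:
  "C_diff m n U f \<Longrightarrow> (\<And>z. z \<in> U \<Longrightarrow> f z \<noteq> 0) \<Longrightarrow> openin (Cn_topology n) U \<Longrightarrow>
    C_diff m n U (\<lambda>z. inverse (f z))"
proof (induction m)
  case 0 then show ?case by (auto intro: continuous_intros)
next
  case (Suc m)
  note f = Suc.prems(1) and nz = Suc.prems(2) and U = Suc.prems(3)
  have s: "(real_slice c k (\<lambda>z. inverse (f z)) z has_vector_derivative
      - (inverse (f z) * real_partial c k f z * inverse (f z))) (at 0)"
    if "k < n" "c \<in> {1, \<i>}" "z \<in> U" for k c z
  proof -
    have "f (z(k := z k + of_real 0 * c)) \<noteq> 0" using nz that by simp
    from Deriv.has_derivative_inverse[OF this C_diff_SucD'(2)[OF f that, unfolded has_vector_derivative_def real_slice_def[abs_def]]]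
    show ?thesis unfolding has_vector_derivative_def real_slice_def[abs_def] by simp
  qed
  have I: "C_diff m n U (\<lambda>z. inverse (f z))" using Suc.IH[OF C_diff_SucD[OF f] nz U] .
  show ?case
  proof (rule C_diff_SucI[OF _ s])
    show "continuous_on U (\<lambda>z. inverse (f z))"
      using C_diff_continuous[OF f] nz by (intro continuous_intros) auto
    fix k c assume kc: "k < n" "c \<in> {1, \<i>}"
    have "C_diff m n U (\<lambda>z. (- 1) * (inverse (f z) * real_partial c k f z * inverse (f z)))"
      by (intro C_diff_mult C_diff_const I C_diff_SucD'(1)[OF f kc] U)
    thus "C_diff m n U (real_partial c k (\<lambda>z. inverse (f z)))"
      by (rule C_diff_cong[OF U]) (simp add: real_partialI[OF s[OF kc]])
  qed
qed

lemma C_diff_sum: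
  assumes "\<And>j. j \<in> J \<Longrightarrow> C_diff m n U (f j)" "openin (Cn_topology n) U"
  shows "C_diff m n U (\<lambda>z. \<Sum>j\<in>J. f j z)"
  using assms(1)
proof (induction J rule: infinite_finite_induct)
  case (insert j J)
  then show ?case by (simp add: C_diff_add assms(2))
qed (simp_all add: C_diff_const)

lemma C_diff_dz:
  assumes "C_diff (Suc m) n U f" "k < n" "openin (Cn_topology n) U"
  shows "C_diff m n U (dz k f)" "C_diff m n U (dzbar k f)"
proof -
  have 1: "C_diff m n U (real_partial 1 k f)" "C_diff m n U (real_partial \<i> k f)"
    using C_diff_SucD'(1)[OF assms(1,2)] by auto
  have "dz k f = (\<lambda>z. (1/2) * (real_partial 1 k f z + (- \<i>) * real_partial \<i> k f z))"
       "dzbar k f = (\<lambda>z. (1/2) * (real_partial 1 k f z + \<i> * real_partial \<i> k f z))"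
    by (simp_all add: dz_def dzbar_def fun_eq_iff)
  note eq = this
  show "C_diff m n U (dz k f)" "C_diff m n U (dzbar k f)"
    unfolding eq by (intro C_diff_mult C_diff_add C_diff_const 1 assms(3))+
qed

section \<open>Directional derivatives from continuous partial derivatives\<close>

lemma openin_Cn: "openin (Cn_topology n) (Cn n)"
  unfolding Cn_topology_def by simp

lemma continuous_on_apply:
  fixes g :: "'a::topological_space \<Rightarrow> 'i \<Rightarrow> 'b::topological_space"
  assumes "continuous_on S g"
  shows "continuous_on S (\<lambda>t. g t i)"
  by (rule continuous_on_compose2[OF continuous_on_product_coordinates assms]) simp

text \<open>\<open>real_slice\<close> is differentiated at parameter 0 only. Moving the base point
  along the slice gives the derivative at every parameter, as the mean value inequality
  requires.\<close>

lemma real_slice_shift: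
  assumes "(real_slice c k f (z(k := z k + of_real t * c)) has_vector_derivative d) (at 0)"
  shows "((\<lambda>s::real. f (z(k := z k + of_real s * c))) has_vector_derivative d) (at t)"
proof -
  have "((\<lambda>s. s - t) has_real_derivative 1) (at t)" by (auto intro!: derivative_eq_intros)
  moreover have "(real_slice c k f (z(k := z k + of_real t * c)) has_vector_derivative d) (at (t - t))"
    using assms by simp
  ultimately have "((real_slice c k f (z(k := z k + of_real t * c)) \<circ> (\<lambda>s. s - t)) has_vector_derivative 1 *\<^sub>R d) (at t)"
    using vector_diff_chain_at[of "\<lambda>s. s - t" 1 t] by (simp add: has_real_derivative_iff_has_vector_derivative)
  moreover have "real_slice c k f (z(k := z k + of_real t * c)) \<circ> (\<lambda>s. s - t) = (\<lambda>s. f (z(k := z k + of_real s * c)))"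
    by (auto simp: real_slice_def fun_eq_iff algebra_simps)
  ultimately show ?thesis by simp
qed

text \<open>The mean value inequality for t \<mapsto> f t - t d, whose derivative is bounded by
  e.\<close>

lemma real_increment_bound:
  fixes f :: "real \<Rightarrow> complex"
  assumes "\<And>t. (f has_vector_derivative f' t) (at t)"
    and "\<And>t. \<bar>t\<bar> \<le> \<bar>s\<bar> \<Longrightarrow> cmod (f' t - d) \<le> e"
  shows "cmod (f s - f 0 - s *\<^sub>R d) \<le> e * \<bar>s\<bar>"
proof -
  define g where "g = (\<lambda>t. f t - t *\<^sub>R d)"
  have "(g has_derivative (\<lambda>h. h *\<^sub>R (f' t - d))) (at t within closed_segment 0 s)" for t
  proof -
    have "(g has_vector_derivative f' t - 1 *\<^sub>R d) (at t)"
      unfolding g_def by (auto intro!: derivative_eq_intros assms(1))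
    thus ?thesis unfolding has_vector_derivative_def by (auto intro: has_derivative_at_withinI)
  qed
  moreover have "onorm (\<lambda>h. h *\<^sub>R (f' t - d)) \<le> e" if "t \<in> closed_segment 0 s" for t
  proof -
    have "\<bar>t\<bar> \<le> \<bar>s\<bar>" using that by (auto simp: closed_segment_eq_real_ivl split: if_splits)
    thus ?thesis using assms(2) onorm_scaleR_left[OF bounded_linear_ident, of "f' t - d"]
      by (simp add: onorm_id)
  qed
  ultimately have "norm (g s - g 0) \<le> e * norm (s - 0)"
    by (intro differentiable_bound[of "closed_segment 0 s"]) auto
  thus ?thesis unfolding g_def by (simp add: algebra_simps)
qed

text \<open>One stage of a chain rule that switches on the real coordinates one at a time: the
  derivative of f along the curve g is the outcome of the earlier stages. Continuity of the new
  partial derivative at \<open>g 0\<close> makes the mean value inequality along the slice uniform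
  in t.\<close>

lemma directional_step:
  assumes f: "C_diff (Suc 0) n (Cn n) f" and k: "k < n" and c: "c \<in> {1, \<i>}"
    and g: "continuous_on UNIV g" "\<And>t. g t \<in> Cn n"
    and D: "((\<lambda>t::real. f (g t)) has_vector_derivative D) (at 0)"
  shows "((\<lambda>t. f ((g t)(k := g t k + of_real (t * s) * c))) has_vector_derivative
            D + s *\<^sub>R real_partial c k f (g 0)) (at 0)"
proof -
  define F where "F = real_partial c k f"
  have F: "continuous_on (Cn n) F" using C_diff_SucD'(1)[OF f k c] unfolding F_def by simp
  \<comment> \<open>Time and displacement along the new coordinate are separated into two variables,
    so that continuity near (0, 0) controls both at once.\<close>
  define P where "P = (\<lambda>x::real \<times> real. (g (fst x))(k := g (fst x) k + of_real (snd x) * c))"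
  have PC: "P x \<in> Cn n" for x using g(2)[of "fst x"] k unfolding P_def Cn_def by auto
  have gk: "continuous_on UNIV (\<lambda>t. g t i)" for i
    by (rule continuous_on_apply[OF g(1)])
  have cP: "continuous_on UNIV P"
  proof (rule continuous_on_coordinatewise_then_product)
    fix i
    have "continuous_on UNIV (\<lambda>x::real \<times> real. g (fst x) i)" for i
      by (rule continuous_on_compose2[OF gk[of i]]) (auto intro: continuous_intros)
    note * = this
    show "continuous_on UNIV (\<lambda>x. P x i)"
    proof (cases "i = k")
      case True
      then show ?thesis unfolding P_def fun_upd_apply if_P[OF True] by (intro continuous_intros *)
    next
      case False
      then show ?thesis unfolding P_def fun_upd_apply if_not_P[OF False] by (intro *)
    qed
  qed
  have "continuous_on UNIV (\<lambda>x. F (P x))" by (rule continuous_on_compose2[OF F cP]) (use PC in auto)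
  hence cont: "continuous (at (0, 0)) (\<lambda>x. F (P x))" by (simp add: continuous_on_eq_continuous_at)
  have P0: "P (0, 0) = g 0" unfolding P_def by simp
  \<comment> \<open>The part of the increment that comes from the new coordinate alone; the rest is
    differentiated by the hypothesis on D.\<close>
  define r where "r = (\<lambda>t. f (P (t, t * s)) - f (g t))"
  have fd: "((\<lambda>\<tau>. f (P (t, \<tau>))) has_vector_derivative F (P (t, \<tau>))) (at \<tau>)" for t \<tau>
    unfolding P_def fst_conv snd_conv F_def
    by (rule real_slice_shift, rule C_diff_SucD'(2)[OF f k c]) (use PC[of "(t, \<tau>)"] in \<open>simp add: P_def\<close>)
  have "(r has_vector_derivative s *\<^sub>R F (g 0)) (at 0)"
    unfolding has_vector_derivative_def has_derivative_at_alt
  proof (intro conjI allI impI)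
    show "bounded_linear (\<lambda>h. h *\<^sub>R s *\<^sub>R F (g 0))" by (rule bounded_linear_scaleR_left)
    fix e :: real assume e: "0 < e"
    \<comment> \<open>The summand 1 covers s = 0. The same divisor applied to d below keeps all
      points (t, \<tau>) with \<tau> between 0 and t s within distance d.\<close>
    define e' where "e' = e / (\<bar>s\<bar> + 1)"
    have e': "e' > 0" using e unfolding e'_def by simp
    obtain d where d: "d > 0" "\<And>x. dist x (0, 0) < d \<Longrightarrow> cmod (F (P x) - F (g 0)) < e'"
      using cont[unfolded continuous_at_eps_delta P0] e' unfolding dist_norm by metis
    show "\<exists>d>0. \<forall>y. norm (y - 0) < d \<longrightarrow> norm (r y - r 0 - (y - 0) *\<^sub>R s *\<^sub>R F (g 0)) \<le> e * norm (y - 0)"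
    proof (intro exI[of _ "d / (\<bar>s\<bar> + 1)"] conjI allI impI)
      show "d / (\<bar>s\<bar> + 1) > 0" using d by simp
      fix t :: real assume t: "norm (t - 0) < d / (\<bar>s\<bar> + 1)"
      hence t': "\<bar>t\<bar> * (\<bar>s\<bar> + 1) < d" by (simp add: pos_less_divide_eq)
      have "cmod (f (P (t, t * s)) - f (P (t, 0)) - (t * s) *\<^sub>R F (g 0)) \<le> e' * \<bar>t * s\<bar>"
      proof (rule real_increment_bound[OF fd])
        fix \<tau> assume "\<bar>\<tau>\<bar> \<le> \<bar>t * s\<bar>"
        hence "\<bar>t\<bar> + \<bar>\<tau>\<bar> < d" using t' by (simp add: abs_mult algebra_simps)
        moreover have "dist (t, \<tau>) (0, 0) \<le> \<bar>t\<bar> + \<bar>\<tau>\<bar>"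
          by (simp add: dist_Pair_Pair sqrt_sum_squares_le_sum_abs)
        ultimately show "cmod (F (P (t, \<tau>)) - F (g 0)) \<le> e'" using d(2)[of "(t, \<tau>)"] by linarith
      qed
      also have "e' * \<bar>t * s\<bar> \<le> e * \<bar>t\<bar>"
      proof -
        have "e' * \<bar>s\<bar> \<le> e" unfolding e'_def using e by (simp add: field_simps)
        thus ?thesis using mult_right_mono[of "e' * \<bar>s\<bar>" e "\<bar>t\<bar>"] by (simp add: abs_mult mult_ac)
      qed
      finally show "norm (r t - r 0 - (t - 0) *\<^sub>R s *\<^sub>R F (g 0)) \<le> e * norm (t - 0)"
        unfolding r_def by (simp add: P_def)
    qed
  qed
  from has_vector_derivative_add[OF D this] show ?thesis
    unfolding r_def F_def P_def by simp
qed

text \<open>The parameter is complex so that a single line contains all the rotated real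
  rays.\<close>

definition line_point :: "(nat \<Rightarrow> complex) \<Rightarrow> (nat \<Rightarrow> complex) \<Rightarrow> complex \<Rightarrow> nat \<Rightarrow> complex" where
  "line_point z u t = (\<lambda>k. z k + t * u k)"

lemma line_point_Cn: "z \<in> Cn n \<Longrightarrow> u \<in> Cn n \<Longrightarrow> line_point z u t \<in> Cn n"
  unfolding Cn_def line_point_def by simp

lemma line_point_0 [simp]: "line_point z u 0 = z"
  unfolding line_point_def by simp

definition directional :: "nat \<Rightarrow> (nat \<Rightarrow> complex) \<Rightarrow> ((nat \<Rightarrow> complex) \<Rightarrow> complex) \<Rightarrow> (nat \<Rightarrow> complex) \<Rightarrow> complex" where
  "directional n u f z = (\<Sum>p<n. u p * dz p f z + cnj (u p) * dzbar p f z)"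

text \<open>The C^1 chain rule along a line, by induction on the number of coordinates already
  moving.\<close>

lemma has_directional_derivative_0:
  assumes f: "C_diff (Suc 0) n (Cn n) f" and z: "z \<in> Cn n" and u: "u \<in> Cn n"
  shows "((\<lambda>t::real. f (line_point z u (of_real t))) has_vector_derivative directional n u f z) (at 0)"
proof -
  define g where "g = (\<lambda>m (t::real) k. if k < m then z k + of_real t * u k else z k)"
  have gC: "g m t \<in> Cn n" if "m \<le> n" for m t using z u that unfolding g_def Cn_def by auto
  have gcont: "continuous_on UNIV (g m)" for m
  proof (rule continuous_on_coordinatewise_then_product)
    show "continuous_on UNIV (\<lambda>t. g m t k)" for k
      unfolding g_def by (cases "k < m") (auto intro!: continuous_intros)
  qed
  have "((\<lambda>t. f (g m t)) has_vector_derivative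
      (\<Sum>p<m. u p * dz p f z + cnj (u p) * dzbar p f z)) (at 0)" if "m \<le> n" for m
    using that
  proof (induction m)
    case 0
    have "g 0 = (\<lambda>t. z)" unfolding g_def by auto
    then show ?case by simp
  next
    case (Suc m)
    hence m: "m < n" and m': "m \<le> n" by simp_all
    \<comment> \<open>Coordinate m is switched on in two halves, first the real part of u m and then
      the imaginary part. Both stages start at z, so the partial derivatives are taken at z.\<close>
    define g' where "g' = (\<lambda>t. (g m t)(m := g m t m + of_real (t * Re (u m)) * 1))"
    have g'C: "g' t \<in> Cn n" for t using gC[of m t] m unfolding g'_def Cn_def by auto
    have g'cont: "continuous_on UNIV g'"
    proof (rule continuous_on_coordinatewise_then_product)
      show "continuous_on UNIV (\<lambda>t. g' t k)" for k
        unfolding g'_def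
        by (cases "k = m") (simp_all add: continuous_on_add continuous_on_mult_right
            continuous_on_apply[OF gcont] continuous_intros)
    qed
    have g0: "g m 0 = z" "g' 0 = z" unfolding g'_def g_def by auto
    have 1: "((\<lambda>t. f (g' t)) has_vector_derivative
      (\<Sum>p<m. u p * dz p f z + cnj (u p) * dzbar p f z) + Re (u m) *\<^sub>R real_partial 1 m f z) (at 0)"
      unfolding g'_def
      by (rule directional_step[OF f m insertI1 gcont gC[OF m'] Suc.IH[OF m'], unfolded g0(1)])
    have 2: "((\<lambda>t. f ((g' t)(m := g' t m + of_real (t * Im (u m)) * \<i>))) has_vector_derivative
      (\<Sum>p<m. u p * dz p f z + cnj (u p) * dzbar p f z) + Re (u m) *\<^sub>R real_partial 1 m f z
        + Im (u m) *\<^sub>R real_partial \<i> m f z) (at 0)"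
      by (rule directional_step[OF f m insertI2[OF singletonI] g'cont g'C 1, unfolded g0(2)])
    have 3: "(g' t)(m := g' t m + of_real (t * Im (u m)) * \<i>) = g (Suc m) t" for t
      unfolding g'_def g_def by (auto simp: fun_eq_iff complex_eq_iff algebra_simps less_Suc_eq)
    have 4: "Re (u m) *\<^sub>R real_partial 1 m f z + Im (u m) *\<^sub>R real_partial \<i> m f z =
        u m * dz m f z + cnj (u m) * dzbar m f z"
      unfolding dz_def dzbar_def by (simp add: complex_eq_iff field_simps)
    show ?case using 2 unfolding 3 by (simp add: 4[symmetric] add.assoc)
  qed
  from this[OF order.refl] have "((\<lambda>t. f (g n t)) has_vector_derivative directional n u f z) (at 0)"
    unfolding directional_def .
  moreover have "g n t = line_point z u (of_real t)" for t
    using z u unfolding g_def line_point_def Cn_def by auto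
  ultimately show ?thesis by simp
qed

lemma has_directional_derivative:
  assumes f: "C_diff (Suc 0) n (Cn n) f" and z: "z \<in> Cn n" and u: "u \<in> Cn n"
  shows "((\<lambda>s::real. f (line_point z u (of_real s))) has_vector_derivative
            directional n u f (line_point z u (of_real t))) (at t)"
proof -
  let ?z = "line_point z u (of_real t)"
  have "((\<lambda>s. s - t) has_vector_derivative 1) (at t)"
    by (auto intro!: derivative_eq_intros)
  moreover have "((\<lambda>s::real. f (line_point ?z u (of_real s))) has_vector_derivative directional n u f ?z) (at (t - t))"
    using has_directional_derivative_0[OF f line_point_Cn[OF z u, of "of_real t"] u] by simp
  ultimately have "(((\<lambda>s::real. f (line_point ?z u (of_real s))) \<circ> (\<lambda>s. s - t)) has_vector_derivative
      1 *\<^sub>R directional n u f ?z) (at t)"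
    by (rule vector_diff_chain_at)
  moreover have "(\<lambda>s::real. f (line_point ?z u (of_real s))) \<circ> (\<lambda>s. s - t) = (\<lambda>s. f (line_point z u (of_real s)))"
    unfolding line_point_def by (auto simp: fun_eq_iff algebra_simps)
  ultimately show ?thesis by simp
qed

section \<open>Second-order conditions at a minimum\<close>

text \<open>The second derivative is available at 0 only. If it were negative, then from G'(0) = 0
  the first derivative would be negative just to the right of 0, and the mean value theorem would
  push G below its minimum.\<close>

lemma second_derivative_test:
  fixes G :: "real \<Rightarrow> real"
  assumes G: "\<And>t. (G has_real_derivative G' t) (at t)" and G': "(G' has_real_derivative c) (at 0)"
    and min: "\<And>t. G 0 \<le> G t"
  shows "0 \<le> c"
proof (rule ccontr)
  assume "\<not> 0 \<le> c"
  hence c: "c < 0" by simp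
  have G0: "G' 0 = 0" using DERIV_local_min[OF G, of 1 0] min by simp
  obtain d where d: "d > 0" "\<And>h. h > 0 \<Longrightarrow> h < d \<Longrightarrow> G' (0 + h) < G' 0"
    using DERIV_neg_dec_right[OF G' c] by blast
  have "\<exists>z. 0 < z \<and> z < d / 2 \<and> G (d / 2) - G 0 = (d / 2 - 0) * G' z"
    using d(1) G by (intro MVT2) auto
  then obtain z where z: "0 < z" "z < d / 2" "G (d / 2) - G 0 = d / 2 * G' z" by auto
  have "G' z < 0" using d z G0 by simp
  hence "G (d / 2) < G 0" using z(3) mult_pos_neg[of "d / 2" "G' z"] d(1) by linarith
  with min[of "d / 2"] show False by simp
qed

lemma real_partial_cong:
  assumes "openin (Cn_topology n) U" "z \<in> U" "k < n" "\<And>z. z \<in> U \<Longrightarrow> f z = g z"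
    and "real_slice c k f z differentiable (at 0)"
  shows "real_partial c k g z = real_partial c k f z"
  using assms(5) real_slice_cong[of n U z k f g c, OF assms(1-4)] unfolding real_partial_works by (intro real_partialI) blast

lemma dz_cong:
  assumes "C_diff (Suc 0) n U f" "openin (Cn_topology n) U" "z \<in> U" "k < n" "\<And>z. z \<in> U \<Longrightarrow> f z = g z"
  shows "dz k g z = dz k f z" "dzbar k g z = dzbar k f z"
proof -
  have "real_partial c k g z = real_partial c k f z" if "c \<in> {1, \<i>}" for c
    by (rule real_partial_cong[of n U z k f g c, OF assms(2-5)])
       (use C_diff_SucD'(2)[OF assms(1,4) that assms(3)] in \<open>auto intro: differentiableI_vector\<close>)
  thus "dz k g z = dz k f z" "dzbar k g z = dzbar k f z" unfolding dz_def dzbar_def by simp_all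
qed

lemma dz_cnj:
  assumes "C_diff (Suc 0) n U f" "z \<in> U" "k < n"
  shows "dz k (\<lambda>z. cnj (f z)) z = cnj (dzbar k f z)" "dzbar k (\<lambda>z. cnj (f z)) z = cnj (dz k f z)"
proof -
  have "real_partial c k (\<lambda>z. cnj (f z)) z = cnj (real_partial c k f z)" if "c \<in> {1, \<i>}" for c
    using bounded_linear.has_vector_derivative[OF bounded_linear_cnj C_diff_SucD'(2)[OF assms(1,3) that assms(2)]]
    by (intro real_partialI) (simp add: real_slice_def[abs_def])
  thus "dz k (\<lambda>z. cnj (f z)) z = cnj (dzbar k f z)" "dzbar k (\<lambda>z. cnj (f z)) z = cnj (dz k f z)"
    unfolding dz_def dzbar_def by simp_all
qed

text \<open>Only the mixed second derivatives survive the summation over the fourth roots of unity.\<close>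

lemma rotation_sum_second_derivative:
  fixes X P Y X1 Y1 h v w a b :: complex
  defines "T \<equiv> \<lambda>e. (e * e * X + e * cnj e * P + cnj e * cnj e * Y) * v * cnj w
     + 2 * (e * X1 + cnj e * Y1) * (e * a) * cnj w
     + 2 * (e * X1 + cnj e * Y1) * v * cnj (e * b)
     + 2 * h * (e * a) * cnj (e * b)"
  shows "T 1 + T \<i> + T (- 1) + T (- \<i>) =
     4 * (P * v * cnj w + 2 * Y1 * a * cnj w + 2 * X1 * v * cnj b + 2 * h * a * cnj b)"
  unfolding T_def by (simp add: algebra_simps)

text \<open>\<open>N e t\<close> is the squared length of the affine section v + w a over the line z
  + w u, at w = t e. The sum over the four roots of unity e is minimal at t = 0, and its second
  derivative retains exactly the mixed terms, which form the Levi form of the squared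
  length.\<close>

lemma rotated_minimum_hessian:
  fixes H :: "'b \<Rightarrow> 'b \<Rightarrow> (nat \<Rightarrow> complex) \<Rightarrow> complex" and v a :: "'b \<Rightarrow> complex"
  assumes smooth: "\<And>\<alpha> \<beta>. \<alpha> \<in> B \<Longrightarrow> \<beta> \<in> B \<Longrightarrow> C_diff (Suc (Suc 0)) n (Cn n) (H \<alpha> \<beta>)"
    and herm: "\<And>\<alpha> \<beta> x. \<alpha> \<in> B \<Longrightarrow> \<beta> \<in> B \<Longrightarrow> x \<in> Cn n \<Longrightarrow> H \<beta> \<alpha> x = cnj (H \<alpha> \<beta> x)"
    and z: "z \<in> Cn n" and u: "u \<in> Cn n"
  defines "N \<equiv> \<lambda>e (t::real). \<Sum>\<alpha>\<in>B. \<Sum>\<beta>\<in>B. H \<alpha> \<beta> (line_point z u (of_real t * e)) *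
      (v \<alpha> + of_real t * e * a \<alpha>) * cnj (v \<beta> + of_real t * e * a \<beta>)"
  assumes min: "\<And>t. Re (N 1 0 + N \<i> 0 + N (- 1) 0 + N (- \<i>) 0) \<le> Re (N 1 t + N \<i> t + N (- 1) t + N (- \<i>) t)"
  shows "0 \<le> Re (\<Sum>\<alpha>\<in>B. \<Sum>\<beta>\<in>B.
      (\<Sum>p<n. \<Sum>q<n. dz p (dzbar q (H \<alpha> \<beta>)) z * u p * cnj (u q)) * v \<alpha> * cnj (v \<beta>)
      + (\<Sum>q<n. cnj (u q) * dzbar q (H \<alpha> \<beta>) z) * a \<alpha> * cnj (v \<beta>)
      + (\<Sum>p<n. u p * dz p (H \<alpha> \<beta>) z) * v \<alpha> * cnj (a \<beta>)
      + H \<alpha> \<beta> z * a \<alpha> * cnj (a \<beta>))"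
proof -
  define ue where "ue = (\<lambda>e k. e * u k)"
  have ueC: "ue e \<in> Cn n" for e using u unfolding ue_def Cn_def by auto
  have lp: "line_point z u (of_real t * e) = line_point z (ue e) (of_real t)" for t e
    unfolding line_point_def ue_def by (simp add: mult.assoc)
  note C1 = C_diff_SucD[OF smooth]
  define D where "D = (\<lambda>e \<alpha> \<beta> t. directional n (ue e) (H \<alpha> \<beta>) (line_point z (ue e) (complex_of_real t)))"
  define D2 where "D2 = (\<lambda>e \<alpha> \<beta>. \<Sum>p<n. ue e p * directional n (ue e) (dz p (H \<alpha> \<beta>)) z
      + cnj (ue e p) * directional n (ue e) (dzbar p (H \<alpha> \<beta>)) z)"
  have dH: "((\<lambda>t. H \<alpha> \<beta> (line_point z (ue e) (complex_of_real t))) has_vector_derivative D e \<alpha> \<beta> t) (at t)"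
    if "\<alpha> \<in> B" "\<beta> \<in> B" for e \<alpha> \<beta> t
    unfolding D_def by (rule has_directional_derivative[OF C1[OF that] z ueC])
  have dD: "(D e \<alpha> \<beta> has_vector_derivative D2 e \<alpha> \<beta>) (at 0)" if "\<alpha> \<in> B" "\<beta> \<in> B" for e \<alpha> \<beta>
  proof -
    have "((\<lambda>t. \<Sum>p<n. ue e p * dz p (H \<alpha> \<beta>) (line_point z (ue e) (complex_of_real t)) +
        cnj (ue e p) * dzbar p (H \<alpha> \<beta>) (line_point z (ue e) (complex_of_real t)))
      has_vector_derivative D2 e \<alpha> \<beta>) (at 0)"
      unfolding D2_def
    proof (rule has_vector_derivative_sum)
      fix p assume p: "p \<in> {..<n}"
      have "C_diff (Suc 0) n (Cn n) (dz p (H \<alpha> \<beta>))" "C_diff (Suc 0) n (Cn n) (dzbar p (H \<alpha> \<beta>))"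
        using C_diff_dz[OF smooth[OF that] _ openin_Cn] p by auto
      from has_directional_derivative_0[OF this(1) z ueC] has_directional_derivative_0[OF this(2) z ueC]
      show "((\<lambda>t. ue e p * dz p (H \<alpha> \<beta>) (line_point z (ue e) (complex_of_real t)) +
          cnj (ue e p) * dzbar p (H \<alpha> \<beta>) (line_point z (ue e) (complex_of_real t))) has_vector_derivative
        ue e p * directional n (ue e) (dz p (H \<alpha> \<beta>)) z + cnj (ue e p) * directional n (ue e) (dzbar p (H \<alpha> \<beta>)) z) (at 0)"
        by (intro has_vector_derivative_add has_vector_derivative_mult_right)
    qed
    thus ?thesis unfolding D_def directional_def .
  qed
  define w where "w = (\<lambda>e \<alpha> (t::real). v \<alpha> + of_real t * e * a \<alpha>)"
  have dw: "(w e \<alpha> has_vector_derivative e * a \<alpha>) (at t)" for e \<alpha> t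
    unfolding w_def by (auto intro!: derivative_eq_intros simp: has_vector_derivative_def scaleR_conv_of_real algebra_simps)
  have dcw: "((\<lambda>t. cnj (w e \<alpha> t)) has_vector_derivative cnj (e * a \<alpha>)) (at t)" for e \<alpha> t
    by (rule bounded_linear.has_vector_derivative[OF bounded_linear_cnj dw])
  have w0: "w e \<alpha> 0 = v \<alpha>" for e \<alpha> unfolding w_def by simp
  define h where "h = (\<lambda>e \<alpha> \<beta> (t::real). H \<alpha> \<beta> (line_point z (ue e) (of_real t)))"
  have h0: "h e \<alpha> \<beta> 0 = H \<alpha> \<beta> z" for e \<alpha> \<beta> unfolding h_def by simp
  define T1 where "T1 = (\<lambda>e \<alpha> \<beta> t. D e \<alpha> \<beta> t * w e \<alpha> t * cnj (w e \<beta> t) + h e \<alpha> \<beta> t * (e * a \<alpha>) * cnj (w e \<beta> t)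
      + h e \<alpha> \<beta> t * w e \<alpha> t * cnj (e * a \<beta>))"
  define T2 where "T2 = (\<lambda>e \<alpha> \<beta>. D2 e \<alpha> \<beta> * v \<alpha> * cnj (v \<beta>) + 2 * D e \<alpha> \<beta> 0 * (e * a \<alpha>) * cnj (v \<beta>)
      + 2 * D e \<alpha> \<beta> 0 * v \<alpha> * cnj (e * a \<beta>) + 2 * H \<alpha> \<beta> z * (e * a \<alpha>) * cnj (e * a \<beta>))"
  have N: "N e t = (\<Sum>\<alpha>\<in>B. \<Sum>\<beta>\<in>B. h e \<alpha> \<beta> t * w e \<alpha> t * cnj (w e \<beta> t))" for e t
    unfolding N_def h_def w_def lp ..
  have d1: "(N e has_vector_derivative (\<Sum>\<alpha>\<in>B. \<Sum>\<beta>\<in>B. T1 e \<alpha> \<beta> t)) (at t)" for e t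
    unfolding N[abs_def]
  proof (intro has_vector_derivative_sum)
    fix \<alpha> \<beta> assume "\<alpha> \<in> B" "\<beta> \<in> B"
    hence "((h e \<alpha> \<beta>) has_vector_derivative D e \<alpha> \<beta> t) (at t)" using dH unfolding h_def by blast
    from has_vector_derivative_mult[OF has_vector_derivative_mult[OF this dw] dcw]
    show "((\<lambda>t. h e \<alpha> \<beta> t * w e \<alpha> t * cnj (w e \<beta> t)) has_vector_derivative T1 e \<alpha> \<beta> t) (at t)"
      unfolding T1_def by (rule has_vector_derivative_eq_rhs) (simp add: algebra_simps)
  qed
  have d2: "((\<lambda>t. \<Sum>\<alpha>\<in>B. \<Sum>\<beta>\<in>B. T1 e \<alpha> \<beta> t) has_vector_derivative (\<Sum>\<alpha>\<in>B. \<Sum>\<beta>\<in>B. T2 e \<alpha> \<beta>)) (at 0)" for e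
  proof (intro has_vector_derivative_sum)
    fix \<alpha> \<beta> assume ab: "\<alpha> \<in> B" "\<beta> \<in> B"
    hence dh: "((h e \<alpha> \<beta>) has_vector_derivative D e \<alpha> \<beta> t) (at t)" for t using dH unfolding h_def by blast
    note * = has_vector_derivative_mult
    from has_vector_derivative_add[OF has_vector_derivative_add[OF
        *[OF *[OF dD[OF ab, of e] dw[of e \<alpha> 0]] dcw[of e \<beta> 0]]
        *[OF has_vector_derivative_mult_left[OF dh, of "e * a \<alpha>"] dcw[of e \<beta> 0]]]
        has_vector_derivative_mult_left[OF *[OF dh dw[of e \<alpha> 0]], of "cnj (e * a \<beta>)"]]
    show "(T1 e \<alpha> \<beta> has_vector_derivative T2 e \<alpha> \<beta>) (at 0)"
      unfolding T1_def
      by (rule has_vector_derivative_eq_rhs) (simp add: T2_def w0 h0 algebra_simps)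
  qed
  have Re_deriv: "((\<lambda>t. Re (f t)) has_real_derivative Re d) (at t)" if "(f has_vector_derivative d) (at t)" for f d and t :: real
    using bounded_linear.has_vector_derivative[OF bounded_linear_Re that]
    by (simp add: has_real_derivative_iff_has_vector_derivative)
  have pos: "0 \<le> Re ((\<Sum>\<alpha>\<in>B. \<Sum>\<beta>\<in>B. T2 1 \<alpha> \<beta>) + (\<Sum>\<alpha>\<in>B. \<Sum>\<beta>\<in>B. T2 \<i> \<alpha> \<beta>) +
      (\<Sum>\<alpha>\<in>B. \<Sum>\<beta>\<in>B. T2 (- 1) \<alpha> \<beta>) + (\<Sum>\<alpha>\<in>B. \<Sum>\<beta>\<in>B. T2 (- \<i>) \<alpha> \<beta>))"
    by (rule second_derivative_test[where G = "\<lambda>t. Re (N 1 t + N \<i> t + N (- 1) t + N (- \<i>) t)" and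
        G' = "\<lambda>t. Re ((\<Sum>\<alpha>\<in>B. \<Sum>\<beta>\<in>B. T1 1 \<alpha> \<beta> t) + (\<Sum>\<alpha>\<in>B. \<Sum>\<beta>\<in>B. T1 \<i> \<alpha> \<beta> t) +
          (\<Sum>\<alpha>\<in>B. \<Sum>\<beta>\<in>B. T1 (- 1) \<alpha> \<beta> t) + (\<Sum>\<alpha>\<in>B. \<Sum>\<beta>\<in>B. T1 (- \<i>) \<alpha> \<beta> t))"])
       (intro Re_deriv has_vector_derivative_add d1 d2 min)+
  \<comment> \<open>X and Y are the pure second derivatives, which the rotation sum removes; P and Q
    are the two orders of the mixed one.\<close>
  define X where "X = (\<lambda>\<alpha> \<beta>. \<Sum>p<n. \<Sum>q<n. u p * u q * dz q (dz p (H \<alpha> \<beta>)) z)"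
  define Y where "Y = (\<lambda>\<alpha> \<beta>. \<Sum>p<n. \<Sum>q<n. cnj (u p) * cnj (u q) * dzbar q (dzbar p (H \<alpha> \<beta>)) z)"
  define P where "P = (\<lambda>\<alpha> \<beta>. \<Sum>p<n. \<Sum>q<n. u p * cnj (u q) * dzbar q (dz p (H \<alpha> \<beta>)) z)"
  define Q where "Q = (\<lambda>\<alpha> \<beta>. \<Sum>p<n. \<Sum>q<n. cnj (u p) * u q * dz q (dzbar p (H \<alpha> \<beta>)) z)"
  define X1 where "X1 = (\<lambda>\<alpha> \<beta>. \<Sum>p<n. u p * dz p (H \<alpha> \<beta>) z)"
  define Y1 where "Y1 = (\<lambda>\<alpha> \<beta>. \<Sum>p<n. cnj (u p) * dzbar p (H \<alpha> \<beta>) z)"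
  have D2: "D2 e \<alpha> \<beta> = e * e * X \<alpha> \<beta> + e * cnj e * (P \<alpha> \<beta> + Q \<alpha> \<beta>) + cnj e * cnj e * Y \<alpha> \<beta>" for e \<alpha> \<beta>
    unfolding D2_def directional_def X_def Y_def P_def Q_def ue_def
    by (simp add: sum.distrib sum_distrib_left algebra_simps)
  have D0: "D e \<alpha> \<beta> 0 = e * X1 \<alpha> \<beta> + cnj e * Y1 \<alpha> \<beta>" for e \<alpha> \<beta>
    unfolding D_def directional_def X1_def Y1_def ue_def
    by (simp add: sum.distrib sum_distrib_left algebra_simps)
  have T2: "T2 1 \<alpha> \<beta> + T2 \<i> \<alpha> \<beta> + T2 (- 1) \<alpha> \<beta> + T2 (- \<i>) \<alpha> \<beta> =
      4 * ((P \<alpha> \<beta> + Q \<alpha> \<beta>) * v \<alpha> * cnj (v \<beta>) + 2 * Y1 \<alpha> \<beta> * a \<alpha> * cnj (v \<beta>)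
        + 2 * X1 \<alpha> \<beta> * v \<alpha> * cnj (a \<beta>) + 2 * H \<alpha> \<beta> z * a \<alpha> * cnj (a \<beta>))" for \<alpha> \<beta>
    unfolding T2_def D2 D0 by (rule rotation_sum_second_derivative)
  \<comment> \<open>Hermitian symmetry of H exchanges the two orders of mixed differentiation
    together with \<alpha> and \<beta>. After summation against v the two therefore have the same
    real part.\<close>
  have swap: "cnj (P \<alpha> \<beta>) = Q \<beta> \<alpha>" if ab: "\<alpha> \<in> B" "\<beta> \<in> B" for \<alpha> \<beta>
    unfolding P_def Q_def cnj_sum
  proof (intro sum.cong refl)
    fix p q assume pq: "p \<in> {..<n}" "q \<in> {..<n}"
    have e1: "dzbar p (H \<beta> \<alpha>) x = cnj (dz p (H \<alpha> \<beta>) x)" if x: "x \<in> Cn n" for x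
    proof -
      have "dzbar p (H \<beta> \<alpha>) x = dzbar p (\<lambda>x. cnj (H \<alpha> \<beta> x)) x"
      proof (rule dz_cong(2)[OF C_diff_cnj[OF C1[OF ab] openin_Cn] openin_Cn x])
        show "p < n" using pq by simp
        show "cnj (H \<alpha> \<beta> x) = H \<beta> \<alpha> x" if "x \<in> Cn n" for x using herm[OF ab that] ..
      qed
      also have "\<dots> = cnj (dz p (H \<alpha> \<beta>) x)" using pq by (intro dz_cnj(2)[OF C1[OF ab] x]) auto
      finally show ?thesis .
    qed
    have C: "C_diff (Suc 0) n (Cn n) (dz p (H \<alpha> \<beta>))"
      using C_diff_dz(1)[OF smooth[OF ab] _ openin_Cn] pq by auto
    have "dz q (dzbar p (H \<beta> \<alpha>)) z = dz q (\<lambda>x. cnj (dz p (H \<alpha> \<beta>) x)) z"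
    proof (rule dz_cong(1)[OF C_diff_cnj[OF C openin_Cn] openin_Cn z])
      show "q < n" using pq by simp
      show "cnj (dz p (H \<alpha> \<beta>) x) = dzbar p (H \<beta> \<alpha>) x" if "x \<in> Cn n" for x using e1[OF that] ..
    qed
    also have "\<dots> = cnj (dzbar q (dz p (H \<alpha> \<beta>)) z)" using pq by (intro dz_cnj(1)[OF C z]) auto
    finally show "cnj (u p * cnj (u q) * dzbar q (dz p (H \<alpha> \<beta>)) z) = cnj (u p) * u q * dz q (dzbar p (H \<beta> \<alpha>)) z"
      by simp
  qed
  have "Re (\<Sum>\<alpha>\<in>B. \<Sum>\<beta>\<in>B. P \<alpha> \<beta> * v \<alpha> * cnj (v \<beta>)) = Re (cnj (\<Sum>\<alpha>\<in>B. \<Sum>\<beta>\<in>B. P \<alpha> \<beta> * v \<alpha> * cnj (v \<beta>)))"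
    by (simp only: cnj.simps)
  also have "cnj (\<Sum>\<alpha>\<in>B. \<Sum>\<beta>\<in>B. P \<alpha> \<beta> * v \<alpha> * cnj (v \<beta>)) = (\<Sum>\<alpha>\<in>B. \<Sum>\<beta>\<in>B. Q \<beta> \<alpha> * v \<beta> * cnj (v \<alpha>))"
    unfolding cnj_sum by (intro sum.cong refl) (simp add: swap mult_ac)
  also have "\<dots> = (\<Sum>\<alpha>\<in>B. \<Sum>\<beta>\<in>B. Q \<alpha> \<beta> * v \<alpha> * cnj (v \<beta>))" by (rule sum.swap)
  finally have PQ: "Re (\<Sum>\<alpha>\<in>B. \<Sum>\<beta>\<in>B. P \<alpha> \<beta> * v \<alpha> * cnj (v \<beta>)) = Re (\<Sum>\<alpha>\<in>B. \<Sum>\<beta>\<in>B. Q \<alpha> \<beta> * v \<alpha> * cnj (v \<beta>))" .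
  define S where "S = (\<lambda>F. \<Sum>\<alpha>\<in>B. \<Sum>\<beta>\<in>B. F \<alpha> \<beta> :: complex)"
  have S: "S (\<lambda>\<alpha> \<beta>. F \<alpha> \<beta> + G \<alpha> \<beta>) = S F + S G" "S (\<lambda>\<alpha> \<beta>. c * F \<alpha> \<beta>) = c * S F" for F G c
    unfolding S_def by (simp_all add: sum.distrib sum_distrib_left)
  have PQ': "Re (S (\<lambda>\<alpha> \<beta>. P \<alpha> \<beta> * v \<alpha> * cnj (v \<beta>))) = Re (S (\<lambda>\<alpha> \<beta>. Q \<alpha> \<beta> * v \<alpha> * cnj (v \<beta>)))"
    using PQ unfolding S_def .
  have "0 \<le> Re (S (\<lambda>\<alpha> \<beta>. T2 1 \<alpha> \<beta> + T2 \<i> \<alpha> \<beta> + T2 (- 1) \<alpha> \<beta> + T2 (- \<i>) \<alpha> \<beta>))"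
    using pos unfolding S unfolding S_def .
  also have "S (\<lambda>\<alpha> \<beta>. T2 1 \<alpha> \<beta> + T2 \<i> \<alpha> \<beta> + T2 (- 1) \<alpha> \<beta> + T2 (- \<i>) \<alpha> \<beta>) =
      4 * (S (\<lambda>\<alpha> \<beta>. P \<alpha> \<beta> * v \<alpha> * cnj (v \<beta>)) + S (\<lambda>\<alpha> \<beta>. Q \<alpha> \<beta> * v \<alpha> * cnj (v \<beta>)) +
        2 * S (\<lambda>\<alpha> \<beta>. Y1 \<alpha> \<beta> * a \<alpha> * cnj (v \<beta>)) + 2 * S (\<lambda>\<alpha> \<beta>. X1 \<alpha> \<beta> * v \<alpha> * cnj (a \<beta>))
        + 2 * S (\<lambda>\<alpha> \<beta>. H \<alpha> \<beta> z * a \<alpha> * cnj (a \<beta>)))"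
    unfolding T2 S[symmetric] by (simp add: algebra_simps)
  finally have "0 \<le> Re (S (\<lambda>\<alpha> \<beta>. Q \<alpha> \<beta> * v \<alpha> * cnj (v \<beta>)) + S (\<lambda>\<alpha> \<beta>. Y1 \<alpha> \<beta> * a \<alpha> * cnj (v \<beta>)) +
      S (\<lambda>\<alpha> \<beta>. X1 \<alpha> \<beta> * v \<alpha> * cnj (a \<beta>)) + S (\<lambda>\<alpha> \<beta>. H \<alpha> \<beta> z * a \<alpha> * cnj (a \<beta>)))"
    using PQ' by simp
  moreover have "Q \<alpha> \<beta> = (\<Sum>p<n. \<Sum>q<n. dz p (dzbar q (H \<alpha> \<beta>)) z * u p * cnj (u q))" for \<alpha> \<beta>
    unfolding Q_def by (subst sum.swap) (simp add: mult_ac)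
  ultimately show ?thesis unfolding S[symmetric] unfolding S_def Y1_def X1_def by simp
qed

section \<open>The maximum principle\<close>

text \<open>\<open>inverse_metric\<close> is a choice among one-sided inverses, so existence comes
  first: positive definiteness gives a trivial kernel. For square matrices a one-sided inverse is
  two-sided, which is the second claim. Frame labels are transported to initial segments of the
  naturals in order to speak of matrices.\<close>

lemma inverse_metric:
  fixes H :: "'b \<Rightarrow> 'b \<Rightarrow> complex"
  assumes fin: "finite B"
    and pos: "\<And>v. \<exists>\<alpha>\<in>B. v \<alpha> \<noteq> 0 \<Longrightarrow> 0 < Re (\<Sum>\<alpha>\<in>B. \<Sum>\<beta>\<in>B. H \<alpha> \<beta> * v \<alpha> * cnj (v \<beta>))"
  shows "\<forall>\<alpha>\<in>B. \<forall>\<gamma>\<in>B. (\<Sum>\<delta>\<in>B. inverse_metric B H \<gamma> \<delta> * H \<alpha> \<delta>) = (if \<alpha> = \<gamma> then 1 else 0)" (is ?L)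
    and "\<forall>\<beta>\<in>B. \<forall>\<delta>\<in>B. (\<Sum>\<gamma>\<in>B. H \<gamma> \<beta> * inverse_metric B H \<gamma> \<delta>) = (if \<beta> = \<delta> then 1 else 0)" (is ?R)
proof -
  define m where "m = card B"
  obtain f where f: "bij_betw f {..<m} B"
    using ex_bij_betw_nat_finite[OF fin] unfolding m_def lessThan_atLeast0 by blast
  define g where "g = the_inv_into {..<m} f"
  have fB: "f i \<in> B" if "i < m" for i using f that unfolding bij_betw_def by auto
  have gf: "g (f i) = i" if "i < m" for i
    using f that unfolding g_def bij_betw_def by (simp add: the_inv_into_f_f)
  have fg: "f (g x) = x" "g x < m" if "x \<in> B" for x
    using f that unfolding g_def bij_betw_def
    by (simp_all add: f_the_inv_into_f) (metis lessThan_iff order_refl the_inv_into_into)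
  have reidx: "(\<Sum>x\<in>B. F x) = (\<Sum>i<m. F (f i))" for F :: "'b \<Rightarrow> complex"
    by (rule sum.reindex_bij_betw[OF f, symmetric])
  \<comment> \<open>The transpose of the Gram matrix, because the defining identity contracts the
    second index of both factors.\<close>
  define A where "A = Matrix.mat m m (\<lambda>(i, j). H (f j) (f i))"
  have A: "A \<in> carrier_mat m m" unfolding A_def by simp
  have mult: "(X * Y) $$ (i, j) = (\<Sum>k<m. X $$ (i, k) * Y $$ (k, j))"
    if "X \<in> carrier_mat m m" "Y \<in> carrier_mat m m" "i < m" "j < m" for X Y :: "complex mat" and i j
    using that by (simp add: scalar_prod_def lessThan_atLeast0)
  have "Determinant.det A \<noteq> 0"
  proof
    assume "Determinant.det A = 0"
    then obtain v where v: "v \<in> carrier_vec m" "v \<noteq> 0\<^sub>v m" "A *\<^sub>v v = 0\<^sub>v m"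
      unfolding det_0_iff_vec_prod_zero[OF A] by blast
    have Av: "(\<Sum>j<m. H (f j) (f i) * vec_index v j) = 0" if "i < m" for i
      using arg_cong[OF v(3), of "\<lambda>w. vec_index w i"] that v(1)
      by (simp add: A_def scalar_prod_def lessThan_atLeast0)
    obtain j where j: "j < m" "vec_index v j \<noteq> 0" using v(1,2) by (auto simp: vec_eq_iff)
    define w where "w = (\<lambda>x. vec_index v (g x))"
    have "w (f j) \<noteq> 0" unfolding w_def using j gf by simp
    hence "0 < Re (\<Sum>\<alpha>\<in>B. \<Sum>\<beta>\<in>B. H \<alpha> \<beta> * w \<alpha> * cnj (w \<beta>))" using fB j(1) by (intro pos) blast
    also have "(\<Sum>\<alpha>\<in>B. \<Sum>\<beta>\<in>B. H \<alpha> \<beta> * w \<alpha> * cnj (w \<beta>)) =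
        (\<Sum>i<m. \<Sum>j<m. H (f j) (f i) * vec_index v j * cnj (vec_index v i))"
      unfolding reidx w_def by (subst sum.swap) (simp add: gf)
    also have "\<dots> = (\<Sum>i<m. (\<Sum>j<m. H (f j) (f i) * vec_index v j) * cnj (vec_index v i))"
      by (simp add: sum_distrib_right)
    also have "\<dots> = 0" using Av by simp
    finally show False by simp
  qed
  hence "A \<in> Units (ring_mat TYPE(complex) m ())" using det_non_zero_imp_unit[OF A] by simp
  then obtain K where K: "K \<in> carrier_mat m m" "K * A = 1\<^sub>m m"
    unfolding Units_def ring_mat_def by auto
  define P where "P = (\<lambda>K :: 'b \<Rightarrow> 'b \<Rightarrow> complex. \<forall>\<alpha>\<in>B. \<forall>\<gamma>\<in>B.
     (\<Sum>\<delta>\<in>B. K \<gamma> \<delta> * H \<alpha> \<delta>) = (if \<alpha> = \<gamma> then 1 else 0))"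
  have "P (\<lambda>x y. K $$ (g x, g y))"
    unfolding P_def
  proof (intro ballI)
    fix \<alpha> \<gamma> assume ag: "\<alpha> \<in> B" "\<gamma> \<in> B"
    have "(\<Sum>\<delta>\<in>B. K $$ (g \<gamma>, g \<delta>) * H \<alpha> \<delta>) = (\<Sum>k<m. K $$ (g \<gamma>, k) * A $$ (k, g \<alpha>))"
      unfolding reidx A_def using fg ag gf by (intro sum.cong) auto
    also have "\<dots> = (K * A) $$ (g \<gamma>, g \<alpha>)" using mult[OF K(1) A] fg ag by simp
    also have "\<dots> = (if \<alpha> = \<gamma> then 1 else 0)" unfolding K(2) using fg ag by (auto, metis)
    finally show "(\<Sum>\<delta>\<in>B. K $$ (g \<gamma>, g \<delta>) * H \<alpha> \<delta>) = (if \<alpha> = \<gamma> then 1 else 0)" .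
  qed
  moreover have "inverse_metric B H = (SOME K. P K)" unfolding inverse_metric_def P_def ..
  ultimately have PK: "P (inverse_metric B H)" using someI[of P] by simp
  thus ?L unfolding P_def .
  define M where "M = Matrix.mat m m (\<lambda>(i, j). inverse_metric B H (f i) (f j))"
  have M: "M \<in> carrier_mat m m" unfolding M_def by simp
  have "M * A = 1\<^sub>m m"
  proof (rule eq_matI)
    fix i j assume ij: "i < dim_row (1\<^sub>m m :: complex mat)" "j < dim_col (1\<^sub>m m :: complex mat)"
    hence "(M * A) $$ (i, j) = (\<Sum>\<delta>\<in>B. inverse_metric B H (f i) \<delta> * H (f j) \<delta>)"
      unfolding reidx using mult[OF M A] by (simp add: M_def A_def)
    also have "\<dots> = (if f j = f i then 1 else 0)" using PK ij fB unfolding P_def by simp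
    also have "f j = f i \<longleftrightarrow> i = j" using gf ij by (metis index_one_mat(2,3))
    finally show "(M * A) $$ (i, j) = 1\<^sub>m m $$ (i, j)" using ij by simp
  qed (use M A in auto)
  hence AM: "A * M = 1\<^sub>m m" using mat_mult_left_right_inverse[OF M A] by simp
  show ?R
  proof (intro ballI)
    fix \<beta> \<delta> assume bd: "\<beta> \<in> B" "\<delta> \<in> B"
    have "(\<Sum>\<gamma>\<in>B. H \<gamma> \<beta> * inverse_metric B H \<gamma> \<delta>) = (\<Sum>k<m. A $$ (g \<beta>, k) * M $$ (k, g \<delta>))"
      unfolding reidx A_def M_def using fg bd by (intro sum.cong) auto
    also have "\<dots> = (A * M) $$ (g \<beta>, g \<delta>)" using mult[OF A M] fg bd by simp
    also have "\<dots> = (if \<beta> = \<delta> then 1 else 0)" unfolding AM using fg bd by (auto, metis)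
    finally show "(\<Sum>\<gamma>\<in>B. H \<gamma> \<beta> * inverse_metric B H \<gamma> \<delta>) = (if \<beta> = \<delta> then 1 else 0)" .
  qed
qed

text \<open>The maximum principle: \<open>q\<close> is holomorphic along the curve \<open>w \<mapsto> (z + w u, v + w a)\<close>, whose
  direction \<open>a\<close> is the one that makes it horizontal to first order, and \<open>|q|/|v|\<^sup>2\<close> has a maximum there.\<close>

lemma not_RC_positive_at_maximum:
  fixes X :: "'a cmanifold" and F :: "('a, 'i, 'b) vbundle" and K :: "'b \<Rightarrow> 'b \<Rightarrow> complex"
  defines "q \<equiv> \<lambda>v. \<Sum>a\<in>frame F. \<Sum>b\<in>frame F. K a b * v a * v b"
  assumes fin: "finite (frame F)" and h: "hermitian_metric X F h"
    and chart: "(D, \<phi>) \<in> atlas X" "inj_on \<phi> D" "\<phi> ` D = Cn (cdim X)" "D \<subseteq> cover F i"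
    and x0: "x0 \<in> D" and q0: "q v0 \<noteq> 0"
    and max: "\<And>x v. x \<in> D \<Longrightarrow> cmod (q v) * Re (\<Sum>\<alpha>\<in>frame F. \<Sum>\<beta>\<in>frame F. h i x0 \<alpha> \<beta> * v0 \<alpha> * cnj (v0 \<beta>))
      \<le> cmod (q v0) * Re (\<Sum>\<alpha>\<in>frame F. \<Sum>\<beta>\<in>frame F. h i x \<alpha> \<beta> * v \<alpha> * cnj (v \<beta>))"
  shows "\<not> RC_positive_at X F h x0"
proof
  assume RC: "RC_positive_at X F h x0"
  define B where "B = frame F"
  define n where "n = cdim X"
  define z where "z = \<phi> x0"
  define H where "H = (\<lambda>\<alpha> \<beta>. in_chart (D, \<phi>) (\<lambda>y. h i y \<alpha> \<beta>))"
  have inv: "inv_into D \<phi> x \<in> D" if "x \<in> Cn n" for x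
    using inv_into_into[of x \<phi> D] chart(3) that unfolding n_def by simp
  have z: "z \<in> Cn n" "inv_into D \<phi> z = x0" unfolding z_def n_def using chart x0 by auto
  have Hz: "H \<alpha> \<beta> z = h i x0 \<alpha> \<beta>" for \<alpha> \<beta> unfolding H_def in_chart_def using z(2) by simp
  have smooth: "C_diff m n (Cn n) (H \<alpha> \<beta>)" if "\<alpha> \<in> B" "\<beta> \<in> B" for m \<alpha> \<beta>
  proof -
    have "smooth_fun X (cover F i) (\<lambda>x. h i x \<alpha> \<beta>)"
      using h that unfolding hermitian_metric_def B_def by blast
    hence "smooth_Cn n (\<phi> ` (cover F i \<inter> D)) (H \<alpha> \<beta>)"
      using chart(1) unfolding smooth_fun_def H_def n_def by blast
    moreover have "cover F i \<inter> D = D" using chart(4) by blast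
    ultimately show ?thesis using chart(3) unfolding smooth_Cn_def n_def by simp
  qed
  have herm: "H \<beta> \<alpha> x = cnj (H \<alpha> \<beta> x)" if "\<alpha> \<in> B" "\<beta> \<in> B" "x \<in> Cn n" for \<alpha> \<beta> x

  proof -
    have "inv_into D \<phi> x \<in> cover F i" using inv[OF that(3)] chart(4) by blast
    thus ?thesis using h that(1,2) unfolding hermitian_metric_def H_def in_chart_def B_def fst_conv snd_conv by blast
  qed
  have pos: "0 < Re (\<Sum>\<alpha>\<in>B. \<Sum>\<beta>\<in>B. h i x0 \<alpha> \<beta> * v \<alpha> * cnj (v \<beta>))" if "\<exists>\<alpha>\<in>B. v \<alpha> \<noteq> 0" for v
    using h x0 chart(4) that unfolding hermitian_metric_def B_def by blast
  have v0: "\<exists>\<alpha>\<in>B. v0 \<alpha> \<noteq> 0"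
  proof (rule ccontr)
    assume "\<not> ?thesis"
    hence "q v0 = 0" unfolding q_def B_def by (intro sum.neutral ballI) simp
    with q0 show False ..
  qed
  obtain u where u: "u \<in> Cn n" "0 < curvature_pairing X F h (D, \<phi>) i x0 u v0"
  proof -
    have "x0 \<in> fst (D, \<phi>) \<inter> cover F i" using x0 chart(4) by auto
    from RC[unfolded RC_positive_at_def, rule_format, OF chart(1) this v0[unfolded B_def]] that
    show thesis unfolding n_def by blast
  qed
  define J where "J = inverse_metric B (h i x0)"
  define W where "W = (\<lambda>\<beta>. \<Sum>\<alpha>\<in>B. (\<Sum>p<n. u p * dz p (H \<alpha> \<beta>) z) * v0 \<alpha>)"
  \<comment> \<open>Solves h a = - W: the (1,0) covariant derivative of the section v0 + w a in the
    direction u vanishes at z.\<close>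
  define a where "a = (\<lambda>\<gamma>. - (\<Sum>\<delta>\<in>B. J \<gamma> \<delta> * W \<delta>))"
  define N where "N = (\<lambda>e (t::real). \<Sum>\<alpha>\<in>B. \<Sum>\<beta>\<in>B. H \<alpha> \<beta> (line_point z u (of_real t * e)) *
      (v0 \<alpha> + of_real t * e * a \<alpha>) * cnj (v0 \<beta> + of_real t * e * a \<beta>))"
  define N0 where "N0 = Re (\<Sum>\<alpha>\<in>B. \<Sum>\<beta>\<in>B. h i x0 \<alpha> \<beta> * v0 \<alpha> * cnj (v0 \<beta>))"
  have N0: "Re (N e 0) = N0" for e unfolding N_def N0_def by (simp add: Hz)
  have N0pos: "N0 > 0" unfolding N0_def using pos[OF v0] .
  \<comment> \<open>The chart is onto \<complex>^n, so the complex line through z stays in it and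
    the comparison holds for all t.\<close>
  have Nq: "cmod (q (\<lambda>\<alpha>. v0 \<alpha> + of_real t * e * a \<alpha>)) * N0 \<le> cmod (q v0) * Re (N e t)" for e t
    using max[OF inv[OF line_point_Cn[OF z(1) u(1), of "of_real t * e"]], of "\<lambda>\<alpha>. v0 \<alpha> + of_real t * e * a \<alpha>"]
    unfolding N0_def N_def H_def in_chart_def B_def by simp
  \<comment> \<open>q has constant coefficients and degree two. Both the first and the second powers
    of the four roots of unity sum to zero, so only the constant term survives. With the triangle
    inequality this makes the summed length minimal at t = 0.\<close>
  have qsum: "q (\<lambda>\<alpha>. v0 \<alpha> + of_real t * 1 * a \<alpha>) + q (\<lambda>\<alpha>. v0 \<alpha> + of_real t * \<i> * a \<alpha>) +
      q (\<lambda>\<alpha>. v0 \<alpha> + of_real t * (- 1) * a \<alpha>) + q (\<lambda>\<alpha>. v0 \<alpha> + of_real t * (- \<i>) * a \<alpha>) = 4 * q v0" for t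
    unfolding q_def sum_distrib_left sum.distrib[symmetric]
    by (intro sum.cong refl) (simp add: algebra_simps)
  have "Re (N 1 0 + N \<i> 0 + N (- 1) 0 + N (- \<i>) 0) \<le> Re (N 1 t + N \<i> t + N (- 1) t + N (- \<i>) t)" for t
  proof -
    let ?Q = "\<lambda>e. q (\<lambda>\<alpha>. v0 \<alpha> + of_real t * e * a \<alpha>)"
    have "cmod (q v0) * (4 * N0) = cmod (?Q 1 + ?Q \<i> + ?Q (- 1) + ?Q (- \<i>)) * N0"
      unfolding qsum by (simp add: norm_mult)
    also have "\<dots> \<le> (cmod (?Q 1) + cmod (?Q \<i>) + cmod (?Q (- 1)) + cmod (?Q (- \<i>))) * N0"
      using N0pos by (intro mult_right_mono norm_triangle_le add_mono order.refl) auto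
    also have "\<dots> \<le> cmod (q v0) * (Re (N 1 t) + Re (N \<i> t) + Re (N (- 1) t) + Re (N (- \<i>) t))"
      unfolding distrib_left distrib_right by (intro add_mono Nq)
    finally show ?thesis using q0 N0 by simp
  qed
  note min = this
  define S1 where "S1 = (\<Sum>\<alpha>\<in>B. \<Sum>\<beta>\<in>B.
      (\<Sum>p<n. \<Sum>q<n. dz p (dzbar q (H \<alpha> \<beta>)) z * u p * cnj (u q)) * v0 \<alpha> * cnj (v0 \<beta>))"
  define S2 where "S2 = (\<Sum>\<alpha>\<in>B. \<Sum>\<beta>\<in>B. (\<Sum>q<n. cnj (u q) * dzbar q (H \<alpha> \<beta>) z) * a \<alpha> * cnj (v0 \<beta>))"
  define S3 where "S3 = (\<Sum>\<alpha>\<in>B. \<Sum>\<beta>\<in>B. (\<Sum>p<n. u p * dz p (H \<alpha> \<beta>) z) * v0 \<alpha> * cnj (a \<beta>))"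
  define S4 where "S4 = (\<Sum>\<alpha>\<in>B. \<Sum>\<beta>\<in>B. H \<alpha> \<beta> z * a \<alpha> * cnj (a \<beta>))"
  have "0 \<le> Re (S1 + S2 + S3 + S4)"
    using rotated_minimum_hessian[of B n H z u v0 a, OF smooth herm z(1) u(1) min[unfolded N_def]]
    unfolding S1_def S2_def S3_def S4_def sum.distrib[symmetric] .
  \<comment> \<open>Horizontality of the section: for each \<beta> the factor multiplying the
    conjugate of \<open>a \<beta>\<close> is zero.\<close>
  moreover have "S3 + S4 = 0"
  proof -
    have "(\<Sum>\<gamma>\<in>B. h i x0 \<gamma> \<beta> * a \<gamma>) = - W \<beta>" if "\<beta> \<in> B" for \<beta>
    proof -
      have "(\<Sum>\<gamma>\<in>B. h i x0 \<gamma> \<beta> * a \<gamma>) = - (\<Sum>\<gamma>\<in>B. \<Sum>\<delta>\<in>B. h i x0 \<gamma> \<beta> * J \<gamma> \<delta> * W \<delta>)"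
        unfolding a_def by (simp add: sum_negf sum_distrib_left mult.assoc)
      also have "\<dots> = - (\<Sum>\<delta>\<in>B. (\<Sum>\<gamma>\<in>B. h i x0 \<gamma> \<beta> * J \<gamma> \<delta>) * W \<delta>)"
        by (subst sum.swap) (simp add: sum_distrib_right)
      also have "\<dots> = - (\<Sum>\<delta>\<in>B. if \<beta> = \<delta> then W \<delta> else 0)"
        using inverse_metric(2)[OF fin[folded B_def] pos] that unfolding J_def
        by (intro arg_cong[where f = uminus] sum.cong refl) simp
      finally show ?thesis using that fin unfolding B_def by simp
    qed
    hence "(\<Sum>\<beta>\<in>B. (W \<beta> + (\<Sum>\<gamma>\<in>B. h i x0 \<gamma> \<beta> * a \<gamma>)) * cnj (a \<beta>)) = 0" by simp
    moreover have "S3 + S4 = (\<Sum>\<beta>\<in>B. (W \<beta> + (\<Sum>\<gamma>\<in>B. h i x0 \<gamma> \<beta> * a \<gamma>)) * cnj (a \<beta>))"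
      unfolding S3_def S4_def W_def Hz
      by (subst (1 2) sum.swap) (simp add: sum.distrib sum_distrib_right distrib_right)
    ultimately show ?thesis by simp
  qed
  \<comment> \<open>Inserting a = - J W into S2 turns it into minus the term of the curvature that
    is quadratic in first derivatives of h. What follows is reordering of finite sums.\<close>
  moreover have "curvature_pairing X F h (D, \<phi>) i x0 u v0 = - Re (S1 + S2)"
  proof -
    define A' where "A' = (\<lambda>\<gamma>. \<Sum>\<delta>\<in>B. \<Sum>\<alpha>\<in>B. \<Sum>p<n. J \<gamma> \<delta> * u p * dz p (H \<alpha> \<delta>) z * v0 \<alpha>)"
    have J: "a \<gamma> = - A' \<gamma>" for \<gamma>
      unfolding a_def W_def A'_def by (simp add: sum_distrib_left sum_distrib_right mult.assoc)
    have A: "(\<Sum>p<n. \<Sum>q<n. \<Sum>\<alpha>\<in>B. \<Sum>\<beta>\<in>B. f p q \<alpha> \<beta>) = (\<Sum>\<alpha>\<in>B. \<Sum>\<beta>\<in>B. \<Sum>p<n. \<Sum>q<n. f p q \<alpha> \<beta>)" for f :: "nat \<Rightarrow> nat \<Rightarrow> 'b \<Rightarrow> 'b \<Rightarrow> complex"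
    proof -
      have "(\<Sum>p<n. \<Sum>q<n. \<Sum>\<alpha>\<in>B. \<Sum>\<beta>\<in>B. f p q \<alpha> \<beta>) = (\<Sum>p<n. \<Sum>\<alpha>\<in>B. \<Sum>q<n. \<Sum>\<beta>\<in>B. f p q \<alpha> \<beta>)"
        by (intro sum.cong refl sum.swap)
      also have "\<dots> = (\<Sum>\<alpha>\<in>B. \<Sum>p<n. \<Sum>q<n. \<Sum>\<beta>\<in>B. f p q \<alpha> \<beta>)" by (rule sum.swap)
      also have "\<dots> = (\<Sum>\<alpha>\<in>B. \<Sum>p<n. \<Sum>\<beta>\<in>B. \<Sum>q<n. f p q \<alpha> \<beta>)" by (intro sum.cong refl sum.swap)
      also have "\<dots> = (\<Sum>\<alpha>\<in>B. \<Sum>\<beta>\<in>B. \<Sum>p<n. \<Sum>q<n. f p q \<alpha> \<beta>)" by (intro sum.cong refl sum.swap)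
      finally show ?thesis .
    qed
    define G where "G = (\<lambda>\<gamma> \<delta> \<alpha> \<beta> p q. J \<gamma> \<delta> * dz p (H \<alpha> \<delta>) z * dzbar q (H \<gamma> \<beta>) z * u p * cnj (u q) * v0 \<alpha> * cnj (v0 \<beta>))"
    have "(\<Sum>p<n. \<Sum>q<n. \<Sum>\<alpha>\<in>B. \<Sum>\<beta>\<in>B. chern_curvature F h (D, \<phi>) i x0 p q \<alpha> \<beta> * u p * cnj (u q) * v0 \<alpha> * cnj (v0 \<beta>))
      = (\<Sum>p<n. \<Sum>q<n. \<Sum>\<alpha>\<in>B. \<Sum>\<beta>\<in>B. - (dz p (dzbar q (H \<alpha> \<beta>)) z * u p * cnj (u q) * v0 \<alpha> * cnj (v0 \<beta>))
          + (\<Sum>\<gamma>\<in>B. \<Sum>\<delta>\<in>B. G \<gamma> \<delta> \<alpha> \<beta> p q))"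
      unfolding chern_curvature_def Let_def B_def[symmetric] H_def[symmetric] J_def[symmetric] snd_conv z_def[symmetric] G_def
      by (intro sum.cong refl) (simp add: left_diff_distrib sum_distrib_right)
    also have "\<dots> = - S1 + (\<Sum>p<n. \<Sum>q<n. \<Sum>\<alpha>\<in>B. \<Sum>\<beta>\<in>B. \<Sum>\<gamma>\<in>B. \<Sum>\<delta>\<in>B. G \<gamma> \<delta> \<alpha> \<beta> p q)"
      unfolding sum.distrib sum_negf S1_def A by (simp add: sum_distrib_right)
    also have "(\<Sum>p<n. \<Sum>q<n. \<Sum>\<alpha>\<in>B. \<Sum>\<beta>\<in>B. \<Sum>\<gamma>\<in>B. \<Sum>\<delta>\<in>B. G \<gamma> \<delta> \<alpha> \<beta> p q) = - S2"
    proof -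
      have "- S2 = (\<Sum>\<gamma>\<in>B. \<Sum>\<beta>\<in>B. \<Sum>q<n. \<Sum>\<delta>\<in>B. \<Sum>\<alpha>\<in>B. \<Sum>p<n. G \<gamma> \<delta> \<alpha> \<beta> p q)"
      proof -
        have "- S2 = (\<Sum>\<gamma>\<in>B. \<Sum>\<beta>\<in>B. \<Sum>q<n. cnj (u q) * dzbar q (H \<gamma> \<beta>) z * A' \<gamma> * cnj (v0 \<beta>))"
          unfolding S2_def J by (simp add: sum_negf sum_distrib_right)
        thus ?thesis unfolding A'_def G_def
          by (simp add: sum_distrib_left sum_distrib_right mult_ac)
      qed
      also have "\<dots> = (\<Sum>\<gamma>\<in>B. \<Sum>\<beta>\<in>B. \<Sum>q<n. \<Sum>\<alpha>\<in>B. \<Sum>\<delta>\<in>B. \<Sum>p<n. G \<gamma> \<delta> \<alpha> \<beta> p q)"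
        by (intro sum.cong refl sum.swap)
      also have "\<dots> = (\<Sum>\<gamma>\<in>B. \<Sum>\<beta>\<in>B. \<Sum>q<n. \<Sum>\<alpha>\<in>B. \<Sum>p<n. \<Sum>\<delta>\<in>B. G \<gamma> \<delta> \<alpha> \<beta> p q)"
        by (intro sum.cong refl sum.swap)
      also have "\<dots> = (\<Sum>\<gamma>\<in>B. \<Sum>\<beta>\<in>B. \<Sum>q<n. \<Sum>p<n. \<Sum>\<alpha>\<in>B. \<Sum>\<delta>\<in>B. G \<gamma> \<delta> \<alpha> \<beta> p q)"
        by (intro sum.cong refl sum.swap)
      also have "\<dots> = (\<Sum>\<gamma>\<in>B. \<Sum>\<beta>\<in>B. \<Sum>p<n. \<Sum>q<n. \<Sum>\<alpha>\<in>B. \<Sum>\<delta>\<in>B. G \<gamma> \<delta> \<alpha> \<beta> p q)"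
        by (intro sum.cong refl sum.swap)
      also have "\<dots> = (\<Sum>p<n. \<Sum>q<n. \<Sum>\<gamma>\<in>B. \<Sum>\<beta>\<in>B. \<Sum>\<alpha>\<in>B. \<Sum>\<delta>\<in>B. G \<gamma> \<delta> \<alpha> \<beta> p q)"
        by (rule A[symmetric])
      also have "\<dots> = (\<Sum>p<n. \<Sum>q<n. \<Sum>\<beta>\<in>B. \<Sum>\<gamma>\<in>B. \<Sum>\<alpha>\<in>B. \<Sum>\<delta>\<in>B. G \<gamma> \<delta> \<alpha> \<beta> p q)"
        by (intro sum.cong refl sum.swap)
      also have "\<dots> = (\<Sum>p<n. \<Sum>q<n. \<Sum>\<beta>\<in>B. \<Sum>\<alpha>\<in>B. \<Sum>\<gamma>\<in>B. \<Sum>\<delta>\<in>B. G \<gamma> \<delta> \<alpha> \<beta> p q)"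
        by (intro sum.cong refl sum.swap)
      also have "\<dots> = (\<Sum>p<n. \<Sum>q<n. \<Sum>\<alpha>\<in>B. \<Sum>\<beta>\<in>B. \<Sum>\<gamma>\<in>B. \<Sum>\<delta>\<in>B. G \<gamma> \<delta> \<alpha> \<beta> p q)"
        by (intro sum.cong refl sum.swap)
      finally show ?thesis ..
    qed
    finally have "(\<Sum>p<n. \<Sum>q<n. \<Sum>\<alpha>\<in>B. \<Sum>\<beta>\<in>B. chern_curvature F h (D, \<phi>) i x0 p q \<alpha> \<beta> * u p * cnj (u q) * v0 \<alpha> * cnj (v0 \<beta>))
        = - (S1 + S2)" by simp
    thus ?thesis unfolding curvature_pairing_def n_def[symmetric] B_def[symmetric] by (simp only: uminus_complex.sel)
  qed
  ultimately show False using u(2) by (simp add: add.assoc)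
qed

section \<open>Curvature of a quotient of two norms\<close>

text \<open>Holomorphy to second order, the order of the curvature. Derivatives are carried as
  witnesses, so that closure under products and inverses is algebra and no derivative of
  \<open>dz\<close> has to be known beforehand.\<close>

definition holo2 :: "nat \<Rightarrow> (nat \<Rightarrow> complex) set \<Rightarrow> ((nat \<Rightarrow> complex) \<Rightarrow> complex) \<Rightarrow> bool" where
  "holo2 N V f \<longleftrightarrow> (\<exists>f' f''. \<forall>z\<in>V. \<forall>p<N. has_wirtinger p f (f' p z) 0 z \<and>
     (\<forall>q<N. has_wirtinger q (f' p) (f'' p q z) 0 z))"

lemma has_wirtinger_mult_0:
  "has_wirtinger k f a 0 z \<Longrightarrow> has_wirtinger k g c 0 z \<Longrightarrow>
    has_wirtinger k (\<lambda>z. f z * g z) (a * g z + f z * c) 0 z"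
  using has_wirtinger_mult[of k f a 0 z g c 0] by simp

lemma holo2E:
  assumes "holo2 N V f"
  obtains f' f'' where "\<And>z p. z \<in> V \<Longrightarrow> p < N \<Longrightarrow> has_wirtinger p f (f' p z) 0 z"
    "\<And>z p q. z \<in> V \<Longrightarrow> p < N \<Longrightarrow> q < N \<Longrightarrow> has_wirtinger q (f' p) (f'' p q z) 0 z"
proof -
  from assms obtain f' f'' where "\<forall>z\<in>V. \<forall>p<N. has_wirtinger p f (f' p z) 0 z \<and>
     (\<forall>q<N. has_wirtinger q (f' p) (f'' p q z) 0 z)" unfolding holo2_def by (elim exE)
  thus thesis by (intro that[of f' f'']) simp_all
qed

lemma holo2_const: "holo2 N V (\<lambda>z. c)"
  unfolding holo2_def by (intro exI[of _ "\<lambda>_ _. 0"] exI[of _ "\<lambda>_ _ _. 0"]) (simp add: has_wirtinger_const)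

lemma holo2_coord: "holo2 N V (\<lambda>z. z j)"
  unfolding holo2_def
  by (intro exI[of _ "\<lambda>p _. if j = p then 1 else 0"] exI[of _ "\<lambda>_ _ _. 0"])
     (simp add: has_wirtinger_const has_wirtinger_coord[of _ j, simplified])

lemma holo2_add:
  assumes "holo2 N V f" "holo2 N V g"
  shows "holo2 N V (\<lambda>z. f z + g z)"
proof -
  obtain f' f'' where
    f: "\<And>z p. z \<in> V \<Longrightarrow> p < N \<Longrightarrow> has_wirtinger p f (f' p z) 0 z"
       "\<And>z p q. z \<in> V \<Longrightarrow> p < N \<Longrightarrow> q < N \<Longrightarrow> has_wirtinger q (f' p) (f'' p q z) 0 z"
    by (rule holo2E[OF assms(1)]) (rule that)
  obtain g' g'' where
    g: "\<And>z p. z \<in> V \<Longrightarrow> p < N \<Longrightarrow> has_wirtinger p g (g' p z) 0 z"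
       "\<And>z p q. z \<in> V \<Longrightarrow> p < N \<Longrightarrow> q < N \<Longrightarrow> has_wirtinger q (g' p) (g'' p q z) 0 z"
    by (rule holo2E[OF assms(2)]) (rule that)
  note * = f g
  show ?thesis unfolding holo2_def
    by (intro exI[of _ "\<lambda>p z. f' p z + g' p z"] exI[of _ "\<lambda>p q z. f'' p q z + g'' p q z"] ballI allI impI conjI)
       (use has_wirtinger_add[OF *(1) *(3)] has_wirtinger_add[OF *(2) *(4)] in simp_all)
qed

lemma holo2_mult:
  assumes "holo2 N V f" "holo2 N V g"
  shows "holo2 N V (\<lambda>z. f z * g z)"
proof -
  obtain f' f'' where
    f: "\<And>z p. z \<in> V \<Longrightarrow> p < N \<Longrightarrow> has_wirtinger p f (f' p z) 0 z"
       "\<And>z p q. z \<in> V \<Longrightarrow> p < N \<Longrightarrow> q < N \<Longrightarrow> has_wirtinger q (f' p) (f'' p q z) 0 z"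
    by (rule holo2E[OF assms(1)]) (rule that)
  obtain g' g'' where
    g: "\<And>z p. z \<in> V \<Longrightarrow> p < N \<Longrightarrow> has_wirtinger p g (g' p z) 0 z"
       "\<And>z p q. z \<in> V \<Longrightarrow> p < N \<Longrightarrow> q < N \<Longrightarrow> has_wirtinger q (g' p) (g'' p q z) 0 z"
    by (rule holo2E[OF assms(2)]) (rule that)
  note * = f g
  show ?thesis unfolding holo2_def
  proof (intro exI[of _ "\<lambda>p z. f' p z * g z + f z * g' p z"] exI[of _ "\<lambda>p q z. (f'' p q z * g z + f' p z * g' q z) +
        (f' q z * g' p z + f z * g'' p q z)"] ballI allI impI conjI)
    fix z p assume zp: "z \<in> V" "p < N"
    show "has_wirtinger p (\<lambda>z. f z * g z) (f' p z * g z + f z * g' p z) 0 z"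
      using has_wirtinger_mult[OF *(1)[OF zp] *(3)[OF zp]] by simp
    fix q assume q: "q < N"
    from has_wirtinger_add[OF has_wirtinger_mult[OF *(2)[OF zp q] *(3)[OF zp(1) q]]
        has_wirtinger_mult[OF *(1)[OF zp(1) q] *(4)[OF zp q]]]
    show "has_wirtinger q (\<lambda>z. f' p z * g z + f z * g' p z) (f'' p q z * g z + f' p z * g' q z +
        (f' q z * g' p z + f z * g'' p q z)) 0 z" by simp
  qed
qed

lemma holo2_inverse:
  assumes "holo2 N V f" "\<And>z. z \<in> V \<Longrightarrow> f z \<noteq> 0"
  shows "holo2 N V (\<lambda>z. inverse (f z))"
proof -
  obtain f' f'' where
    *: "\<And>z p. z \<in> V \<Longrightarrow> p < N \<Longrightarrow> has_wirtinger p f (f' p z) 0 z"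
       "\<And>z p q. z \<in> V \<Longrightarrow> p < N \<Longrightarrow> q < N \<Longrightarrow> has_wirtinger q (f' p) (f'' p q z) 0 z"
    by (rule holo2E[OF assms(1)]) (rule that)
  have i: "has_wirtinger p (\<lambda>z. inverse (f z)) (- f' p z * (inverse (f z) * inverse (f z))) 0 z"
    if "z \<in> V" "p < N" for p z
    using has_wirtinger_inverse[OF *(1)[OF that] assms(2)[OF that(1)]]
    by (simp add: power2_eq_square divide_inverse)
  have n: "has_wirtinger q (\<lambda>z. - f' p z) (- f'' p q z) 0 z" if "z \<in> V" "p < N" "q < N" for p q z
    using has_wirtinger_mult[OF has_wirtinger_const[of _ "- 1"] *(2)[OF that]] by simp
  have "\<exists>c. has_wirtinger q (\<lambda>z. - f' p z * (inverse (f z) * inverse (f z))) c 0 z"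
    if "z \<in> V" "p < N" "q < N" for p q z
    by (rule exI, rule has_wirtinger_mult_0[OF n[OF that] has_wirtinger_mult_0[OF i[OF that(1,3)] i[OF that(1,3)]]])
  hence "\<forall>p q z. \<exists>c. z \<in> V \<and> p < N \<and> q < N \<longrightarrow>
      has_wirtinger q (\<lambda>z. - f' p z * (inverse (f z) * inverse (f z))) c 0 z"
    by blast
  then obtain F where F: "\<forall>p q z. z \<in> V \<and> p < N \<and> q < N \<longrightarrow>
      has_wirtinger q (\<lambda>z. - f' p z * (inverse (f z) * inverse (f z))) (F p q z) 0 z"
    unfolding choice_iff by (elim exE)
  show ?thesis unfolding holo2_def
    by (intro exI[of _ "\<lambda>p z. - f' p z * (inverse (f z) * inverse (f z))"] exI[of _ F] ballI allI impI conjI i)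
       (use F in blast)+
qed

lemma holo2D:
  assumes "holo2 N V f" "openin (Cn_topology N) V" "z \<in> V" "p < N"
  shows "has_wirtinger p f (dz p f z) 0 z" "q < N \<Longrightarrow> \<exists>a. has_wirtinger p (dz q f) a 0 z"
proof -
  obtain f' f'' where
    *: "\<And>z p. z \<in> V \<Longrightarrow> p < N \<Longrightarrow> has_wirtinger p f (f' p z) 0 z"
       "\<And>z p q. z \<in> V \<Longrightarrow> p < N \<Longrightarrow> q < N \<Longrightarrow> has_wirtinger q (f' p) (f'' p q z) 0 z"
    by (rule holo2E[OF assms(1)]) (rule that)
  have eq: "f' p z = dz p f z" if "z \<in> V" "p < N" for z p using has_wirtinger_dz[OF *(1)[OF that]] ..
  show "has_wirtinger p f (dz p f z) 0 z" using *(1)[OF assms(3,4)] eq assms(3,4) by simp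
  assume q: "q < N"
  have "\<forall>\<^sub>F w in nhds (z p). f' q (z(p := w)) = dz q f (z(p := w))"
    using eventually_fun_upd_in[OF assms(2,3,4)] by (rule eventually_mono) (simp add: eq q)
  from has_wirtinger_transform[OF *(2)[OF assms(3) q assms(4)] this]
  show "\<exists>a. has_wirtinger p (dz q f) a 0 z" by blast
qed

text \<open>The mixed derivative of log \<Sum>|Z j|^2, expanded by the quotient rule: the
  Fubini-Study form pulled back by Z.\<close>

definition log_hessian :: "'j set \<Rightarrow> ('j \<Rightarrow> (nat \<Rightarrow> complex) \<Rightarrow> complex) \<Rightarrow> (nat \<Rightarrow> complex) \<Rightarrow> nat \<Rightarrow> nat \<Rightarrow> complex" where
  "log_hessian J Z z p q =
     ((\<Sum>j\<in>J. Z j z * cnj (Z j z)) * (\<Sum>j\<in>J. dz p (Z j) z * cnj (dz q (Z j) z))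
      - (\<Sum>j\<in>J. dz p (Z j) z * cnj (Z j z)) * (\<Sum>j\<in>J. Z j z * cnj (dz q (Z j) z)))
     / (\<Sum>j\<in>J. Z j z * cnj (Z j z))\<^sup>2"

lemma norm_sum_wirtinger:
  assumes Z: "\<And>j. j \<in> J \<Longrightarrow> holo2 N V (Z j)" and V: "openin (Cn_topology N) V" "z \<in> V" "p < N"
  shows "has_wirtinger p (\<lambda>z. \<Sum>j\<in>J. Z j z * cnj (Z j z))
      (\<Sum>j\<in>J. dz p (Z j) z * cnj (Z j z)) (\<Sum>j\<in>J. Z j z * cnj (dz p (Z j) z)) z"
proof (rule has_wirtinger_sum)
  fix j assume "j \<in> J"
  note * = holo2D(1)[OF Z[OF this] V]
  show "has_wirtinger p (\<lambda>z. Z j z * cnj (Z j z)) (dz p (Z j) z * cnj (Z j z)) (Z j z * cnj (dz p (Z j) z)) z"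
    using has_wirtinger_mult[OF * has_wirtinger_cnj[OF *]] by simp
qed

text \<open>With A the sum of squares, the function differentiated here is the conjugate derivative
  of A divided by A. Thus the Hessian of log A is reached by a quotient rule.\<close>

lemma log_derivative_wirtinger:
  assumes Z: "\<And>j. j \<in> J \<Longrightarrow> holo2 N V (Z j)" and V: "openin (Cn_topology N) V" "z \<in> V" "p < N" "q < N"
    and nz: "(\<Sum>j\<in>J. Z j z * cnj (Z j z)) \<noteq> 0"
  shows "\<exists>b. has_wirtinger p (\<lambda>z. (\<Sum>j\<in>J. Z j z * cnj (dz q (Z j) z)) * inverse (\<Sum>j\<in>J. Z j z * cnj (Z j z)))
      (log_hessian J Z z p q) b z"
proof -
  have "\<forall>j\<in>J. \<exists>a. has_wirtinger p (dz q (Z j)) a 0 z" using holo2D(2)[OF Z V(1-3)] V(4) by blast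
  then obtain a where a: "\<And>j. j \<in> J \<Longrightarrow> has_wirtinger p (dz q (Z j)) (a j) 0 z" unfolding bchoice_iff by blast
  have 1: "has_wirtinger p (\<lambda>z. \<Sum>j\<in>J. Z j z * cnj (dz q (Z j) z))
     (\<Sum>j\<in>J. dz p (Z j) z * cnj (dz q (Z j) z)) (\<Sum>j\<in>J. Z j z * cnj (a j)) z"
  proof (rule has_wirtinger_sum)
    fix j assume "j \<in> J"
    from has_wirtinger_mult[OF holo2D(1)[OF Z[OF this] V(1-3)] has_wirtinger_cnj[OF a[OF this]]]
    show "has_wirtinger p (\<lambda>z. Z j z * cnj (dz q (Z j) z)) (dz p (Z j) z * cnj (dz q (Z j) z)) (Z j z * cnj (a j)) z"
      by simp
  qed
  note 2 = has_wirtinger_mult[OF 1 has_wirtinger_inverse[OF norm_sum_wirtinger[OF Z V(1-3)] nz]]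
  have eq: "(\<Sum>j\<in>J. dz p (Z j) z * cnj (dz q (Z j) z)) * inverse (\<Sum>j\<in>J. Z j z * cnj (Z j z)) +
      (\<Sum>j\<in>J. Z j z * cnj (dz q (Z j) z)) * (- (\<Sum>j\<in>J. dz p (Z j) z * cnj (Z j z)) / (\<Sum>j\<in>J. Z j z * cnj (Z j z))\<^sup>2)
     = log_hessian J Z z p q"
    unfolding log_hessian_def using nz by (simp add: field_simps power2_eq_square)
  show ?thesis using 2 unfolding eq by blast
qed

text \<open>Minus the mixed derivative of log(|\<theta>|^2 A / B) is the Hessian of log B minus that
  of log A. The holomorphic factor \<theta> stands for the change of frame; log |\<theta>|^2 is
  pluriharmonic and drops out.\<close>

lemma line_curvature_formula:
  fixes h :: "('a, 'i, unit) metric" and Z :: "'j \<Rightarrow> (nat \<Rightarrow> complex) \<Rightarrow> complex" and P :: "'l \<Rightarrow> (nat \<Rightarrow> complex) \<Rightarrow> complex"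
    and J :: "'j set" and L :: "'l set"
  defines "A \<equiv> \<lambda>z. \<Sum>j\<in>J. Z j z * cnj (Z j z)" and "B \<equiv> \<lambda>z. \<Sum>j\<in>L. P j z * cnj (P j z)"
  assumes frame: "frame E = {()}"
    and V: "openin (Cn_topology N) V" "snd c x \<in> V" "p < N" "q < N"
    and hol: "holo2 N V \<theta>" "\<And>j. j \<in> J \<Longrightarrow> holo2 N V (Z j)" "\<And>j. j \<in> L \<Longrightarrow> holo2 N V (P j)"
    and nz: "\<And>z. z \<in> V \<Longrightarrow> \<theta> z \<noteq> 0" "\<And>z. z \<in> V \<Longrightarrow> A z \<noteq> 0" "\<And>z. z \<in> V \<Longrightarrow> B z \<noteq> 0"
    and H: "\<And>z. z \<in> V \<Longrightarrow> in_chart c (\<lambda>y. h i y () ()) z = \<theta> z * cnj (\<theta> z) * A z / B z"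
    and x: "in_chart c (\<lambda>y. h i y () ()) (snd c x) = h i x () ()"
  shows "line_curvature E h c i x p q = log_hessian L P (snd c x) p q - log_hessian J Z (snd c x) p q"
proof -
  define z where "z = snd c x"
  have z: "z \<in> V" using V(2) unfolding z_def .
  define H where "H = in_chart c (\<lambda>y. h i y () ())"
  define Ab where "Ab = (\<lambda>q z. \<Sum>j\<in>J. Z j z * cnj (dz q (Z j) z))"
  define Bb where "Bb = (\<lambda>q z. \<Sum>j\<in>L. P j z * cnj (dz q (P j) z))"
  \<comment> \<open>The conjugate logarithmic derivative of H. The first summand is antiholomorphic,
    so a further holomorphic derivative kills it.\<close>
  define l where "l = (\<lambda>q z. cnj (dz q \<theta> z * inverse (\<theta> z)) + Ab q z * inverse (A z) - Bb q z * inverse (B z))"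
  have Hz: "H z = \<theta> z * cnj (\<theta> z) * A z * inverse (B z)" if "z \<in> V" for z
    unfolding H_def H[OF that] by (simp add: divide_inverse)
  have H0: "H z \<noteq> 0" if "z \<in> V" for z using nz[OF that] Hz[OF that] by simp
  have "\<exists>a. has_wirtinger q H a (H z * l q z) z" if zq: "z \<in> V" "q < N" for z q
  proof -
    note t = holo2D(1)[OF hol(1) V(1) zq]
    note tt = has_wirtinger_mult[OF t has_wirtinger_cnj[OF t]]
    note a = norm_sum_wirtinger[OF hol(2) V(1) zq, of J "\<lambda>j. j", folded A_def, folded Ab_def]
    note b = has_wirtinger_inverse[OF norm_sum_wirtinger[OF hol(3) V(1) zq, of L "\<lambda>j. j", folded B_def, folded Bb_def]
       nz(3)[OF zq(1)]]
    note tab = has_wirtinger_mult[OF has_wirtinger_mult[OF tt a] b]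
    have "\<forall>\<^sub>F w in nhds (z q). \<theta> (z(q := w)) * cnj (\<theta> (z(q := w))) * A (z(q := w)) * inverse (B (z(q := w))) = H (z(q := w))"
      using eventually_fun_upd_in[OF V(1) zq] by (rule eventually_mono) (simp add: Hz)
    note fin = has_wirtinger_transform[OF tab this]
    have "((0 * cnj (\<theta> z) + \<theta> z * cnj (dz q \<theta> z)) * A z + \<theta> z * cnj (\<theta> z) * Ab q z) * inverse (B z) +
        \<theta> z * cnj (\<theta> z) * A z * (- Bb q z / (B z)\<^sup>2) = H z * l q z"
      unfolding Hz[OF zq(1)] l_def using nz[OF zq(1)] by (simp add: field_simps power2_eq_square)
    with fin show ?thesis unfolding Ab_def Bb_def by auto
  qed
  then obtain m where m: "\<And>z q. z \<in> V \<Longrightarrow> q < N \<Longrightarrow> has_wirtinger q H (m q z) (H z * l q z) z"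
  proof -
    assume *: "\<And>m. (\<And>z q. z \<in> V \<Longrightarrow> q < N \<Longrightarrow> has_wirtinger q H (m q z) (H z * l q z) z) \<Longrightarrow> thesis"
    assume ex: "\<And>z q. z \<in> V \<Longrightarrow> q < N \<Longrightarrow> \<exists>a. has_wirtinger q H a (H z * l q z) z"
    show thesis
      by (rule *[of "\<lambda>q z. SOME a. has_wirtinger q H a (H z * l q z) z"]) (rule someI_ex[OF ex])
  qed
  have dzH: "dz p H z = m p z" "dzbar q H z = H z * l q z"
    using has_wirtinger_dz[OF m[OF z V(3)]] has_wirtinger_dzbar[OF m[OF z V(4)]] by simp_all
  obtain a where a: "has_wirtinger p (dz q \<theta>) a 0 z" using holo2D(2)[OF hol(1) V(1) z V(3,4)] by blast
  note \<theta>i = has_wirtinger_inverse[OF holo2D(1)[OF hol(1) V(1) z V(3)] nz(1)[OF z]]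
  obtain b1 where l1: "has_wirtinger p (\<lambda>z. cnj (dz q \<theta> z * inverse (\<theta> z))) 0 b1 z"
    using has_wirtinger_cnj[OF has_wirtinger_mult[OF a \<theta>i]] by simp
  obtain b2 where l2: "has_wirtinger p (\<lambda>z. Ab q z * inverse (A z)) (log_hessian J Z z p q) b2 z"
    using log_derivative_wirtinger[OF hol(2) V(1) z V(3,4) nz(2)[OF z, unfolded A_def]] unfolding Ab_def A_def by blast
  obtain b3 where l3: "has_wirtinger p (\<lambda>z. Bb q z * inverse (B z)) (log_hessian L P z p q) b3 z"
    using log_derivative_wirtinger[OF hol(3) V(1) z V(3,4) nz(3)[OF z, unfolded B_def]] unfolding Bb_def B_def by blast
  obtain b where l: "has_wirtinger p (l q) (log_hessian J Z z p q - log_hessian L P z p q) b z"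
    using has_wirtinger_diff[OF has_wirtinger_add[OF l1 l2] l3] unfolding l_def by auto
  have "\<forall>\<^sub>F w in nhds (z p). H (z(p := w)) * l q (z(p := w)) = dzbar q H (z(p := w))"
    using eventually_fun_upd_in[OF V(1) z V(3)]
    by (rule eventually_mono) (simp add: has_wirtinger_dzbar[OF m[OF _ V(4)]])
  from has_wirtinger_transform[OF has_wirtinger_mult[OF m[OF z V(3)] l] this]
  have ddH: "dz p (dzbar q H) z = m p z * l q z + H z * (log_hessian J Z z p q - log_hessian L P z p q)"
    by (rule has_wirtinger_dz)
  have inv: "inverse_metric {()} (h i x) () () = 1 / H z"
  proof -
    define Q where "Q = (\<lambda>K :: unit \<Rightarrow> unit \<Rightarrow> complex. \<forall>\<alpha>\<in>{()}. \<forall>\<gamma>\<in>{()}.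
      (\<Sum>\<delta>\<in>{()}. K \<gamma> \<delta> * h i x \<alpha> \<delta>) = (if \<alpha> = \<gamma> then 1 else 0))"
    have "Q (\<lambda>_ _. 1 / H z)" unfolding Q_def using H0[OF z] x unfolding H_def z_def by simp
    moreover have "inverse_metric {()} (h i x) = (SOME K. Q K)" unfolding inverse_metric_def Q_def ..
    ultimately have "Q (inverse_metric {()} (h i x))" using someI[of Q] by simp
    thus ?thesis unfolding Q_def using x H0[OF z] unfolding H_def z_def by (simp add: field_simps)
  qed
  show ?thesis
    unfolding line_curvature_def chern_curvature_def Let_def frame inv H_def[symmetric] z_def[symmetric]
    using H0[OF z] x by (simp add: dzH ddH H_def[symmetric] z_def[symmetric] inv field_simps)
qed

lemma log_hessian_hermitian: "log_hessian J Z z q p = cnj (log_hessian J Z z p q)"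
  unfolding log_hessian_def by (simp add: mult.commute)

text \<open>The value of the Fubini-Study form at the line of x on the tangent vector represented by
  y.\<close>

definition fubini_study :: "'j set \<Rightarrow> ('j \<Rightarrow> complex) \<Rightarrow> ('j \<Rightarrow> complex) \<Rightarrow> complex" where
  "fubini_study J x y = ((\<Sum>j\<in>J. x j * cnj (x j)) * (\<Sum>j\<in>J. y j * cnj (y j))
     - (\<Sum>j\<in>J. y j * cnj (x j)) * (\<Sum>j\<in>J. x j * cnj (y j))) / (\<Sum>j\<in>J. x j * cnj (x j))\<^sup>2"

lemma log_hessian_form:
  fixes u :: "nat \<Rightarrow> complex"
  shows "(\<Sum>p<N. \<Sum>q<N. log_hessian J Z z p q * u p * cnj (u q)) =
    fubini_study J (\<lambda>j. Z j z) (\<lambda>j. \<Sum>p<N. u p * dz p (Z j) z)"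
proof -
  define A where "A = (\<Sum>j\<in>J. Z j z * cnj (Z j z))"
  have 1: "(\<Sum>j\<in>J. (\<Sum>p<N. u p * dz p (Z j) z) * cnj (\<Sum>p<N. u p * dz p (Z j) z)) =
      (\<Sum>p<N. \<Sum>q<N. (\<Sum>j\<in>J. dz p (Z j) z * cnj (dz q (Z j) z)) * u p * cnj (u q))"
  proof -
    have "(\<Sum>j\<in>J. (\<Sum>p<N. u p * dz p (Z j) z) * cnj (\<Sum>p<N. u p * dz p (Z j) z)) =
      (\<Sum>j\<in>J. \<Sum>p<N. \<Sum>q<N. dz p (Z j) z * cnj (dz q (Z j) z) * u p * cnj (u q))"
      unfolding cnj_sum sum_product by (simp add: mult_ac)
    also have "\<dots> = (\<Sum>p<N. \<Sum>j\<in>J. \<Sum>q<N. dz p (Z j) z * cnj (dz q (Z j) z) * u p * cnj (u q))"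
      by (rule sum.swap)
    also have "\<dots> = (\<Sum>p<N. \<Sum>q<N. \<Sum>j\<in>J. dz p (Z j) z * cnj (dz q (Z j) z) * u p * cnj (u q))"
      by (intro sum.cong refl sum.swap)
    finally show ?thesis by (simp add: sum_distrib_right)
  qed
  have 2: "(\<Sum>j\<in>J. (\<Sum>p<N. u p * dz p (Z j) z) * cnj (Z j z)) = (\<Sum>p<N. (\<Sum>j\<in>J. dz p (Z j) z * cnj (Z j z)) * u p)"
    unfolding sum_distrib_right by (subst sum.swap) (simp add: mult_ac)
  have 3: "(\<Sum>j\<in>J. Z j z * cnj (\<Sum>p<N. u p * dz p (Z j) z)) = (\<Sum>q<N. (\<Sum>j\<in>J. Z j z * cnj (dz q (Z j) z)) * cnj (u q))"
    unfolding cnj_sum sum_distrib_right sum_distrib_left by (subst sum.swap) (simp add: mult_ac)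
  have "(A * (\<Sum>p<N. \<Sum>q<N. D p q * u p * cnj (u q)) - (\<Sum>p<N. E p * u p) * (\<Sum>q<N. F q * cnj (u q))) / A\<^sup>2 =
      (\<Sum>p<N. \<Sum>q<N. (A * D p q - E p * F q) / A\<^sup>2 * u p * cnj (u q))" for D E F
    unfolding sum_product unfolding sum_distrib_left sum_subtractf[symmetric] sum_divide_distrib
    by (intro sum.cong refl) (simp add: algebra_simps diff_divide_distrib)
  thus ?thesis unfolding fubini_study_def 1 2 3 log_hessian_def A_def[symmetric] ..
qed

text \<open>Tangent vectors of projective space are defined modulo x. This freedom later absorbs the
  normalizations imposed by affine charts.\<close>

lemma fubini_study_shift:
  "fubini_study J x (\<lambda>j. y j + c * x j) = fubini_study J x y"
  unfolding fubini_study_def complex_cnj_add complex_cnj_mult distrib_left distrib_right sum.distrib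
  by (simp add: algebra_simps flip: sum_distrib_left sum_distrib_right)

section \<open>Hermitian matrices\<close>

lemma cnj_mult_self: "cnj z * z = complex_of_real ((cmod z)\<^sup>2)"
  by (metis complex_norm_square mult.commute)

text \<open>Completing the square in \<open>x 0\<close> for a form M whose first row and column are
  b times those of G. It serves twice, with M = G and b = 1 and with M = G B and b an eigenvalue, so
  that both are split along the same complement.\<close>

lemma hermitian_form_split:
  fixes G M :: "nat \<Rightarrow> nat \<Rightarrow> complex" and b :: complex
  fixes x :: "nat \<Rightarrow> complex"
  assumes col: "\<forall>i<Suc m. M i 0 = b * G i 0" and row: "\<forall>j<Suc m. M 0 j = b * G 0 j"
    and herm: "\<forall>i<Suc m. G i 0 = cnj (G 0 i)" and G0: "G 0 0 \<noteq> 0"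
  defines "y \<equiv> x 0 + (\<Sum>j<m. G 0 (Suc j) * x (Suc j)) / G 0 0"
  shows "(\<Sum>i<Suc m. \<Sum>j<Suc m. cnj (x i) * M i j * x j) =
    b * G 0 0 * (cnj y * y) + (\<Sum>i<m. \<Sum>j<m. cnj (x (Suc i)) *
      (M (Suc i) (Suc j) - b * G (Suc i) 0 * G 0 (Suc j) / G 0 0) * x (Suc j))"
proof -
  define s where "s = (\<Sum>j<m. G 0 (Suc j) * x (Suc j))"
  have hS: "G (Suc i) 0 = cnj (G 0 (Suc i))" if "i < m" for i
    using herm that by blast
  have s': "cnj s = (\<Sum>i<m. cnj (x (Suc i)) * G (Suc i) 0)"
    unfolding s_def cnj_sum by (intro sum.cong) (auto simp: mult.commute hS)
  have G00: "cnj (G 0 0) = G 0 0" using herm by (metis zero_less_Suc)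
  have 1: "(\<Sum>i<Suc m. \<Sum>j<Suc m. cnj (x i) * M i j * x j) =
     b * G 0 0 * cnj (x 0) * x 0 + b * cnj (x 0) * s + b * cnj s * x 0 +
     (\<Sum>i<m. \<Sum>j<m. cnj (x (Suc i)) * M (Suc i) (Suc j) * x (Suc j))"
    unfolding sum.lessThan_Suc_shift[of _ m] sum.distrib s' s_def sum_distrib_left sum_distrib_right
    using col row hS by (simp add: sum_distrib_left sum_distrib_right mult_ac)
  have 2: "(\<Sum>i<m. \<Sum>j<m. cnj (x (Suc i)) *
      (M (Suc i) (Suc j) - b * G (Suc i) 0 * G 0 (Suc j) / G 0 0) * x (Suc j)) =
     (\<Sum>i<m. \<Sum>j<m. cnj (x (Suc i)) * M (Suc i) (Suc j) * x (Suc j)) - b * (cnj s * s) / G 0 0"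
    unfolding s' unfolding s_def sum_product
    by (simp add: algebra_simps sum_subtractf sum_distrib_left sum_divide_distrib)
  have y: "y = x 0 + s / G 0 0" unfolding y_def s_def ..
  have "b * G 0 0 * (cnj y * y) = b * G 0 0 * cnj (x 0) * x 0 + b * cnj (x 0) * s + b * cnj s * x 0
      + b * (cnj s * s) / G 0 0"
    using G0 G00 by (simp add: y field_simps)
  thus ?thesis unfolding 1 2 by simp
qed

text \<open>G is the Gram matrix of a basis in which a self-adjoint operator has the triangular
  matrix B. The first basis vector is an eigenvector; its G-orthogonal complement is invariant, has
  Gram matrix the Schur complement of G, and carries the operator with the trailing block of B.
  Induction then splits off one nonpositive square at a time.\<close>

lemma triangular_form_nonpos:
  fixes G B :: "nat \<Rightarrow> nat \<Rightarrow> complex"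
  assumes herm: "\<forall>i<m. \<forall>j<m. G j i = cnj (G i j)"
    and pos: "\<And>x. (\<exists>i<m. x i \<noteq> 0) \<Longrightarrow> 0 < Re (\<Sum>i<m. \<Sum>j<m. cnj (x i) * G i j * x j)"
    and upper: "\<forall>i<m. \<forall>j<i. B i j = 0"
    and herm': "\<forall>i<m. \<forall>j<m. (\<Sum>k<m. G j k * B k i) = cnj (\<Sum>k<m. G i k * B k j)"
    and diag: "\<forall>i<m. \<exists>r\<le>0. B i i = complex_of_real r"
  shows "Re (\<Sum>i<m. \<Sum>j<m. cnj (x i) * (\<Sum>k<m. G i k * B k j) * x j) \<le> 0"
  using assms
proof (induction m arbitrary: G B x)
  case 0 then show ?case by simp
next
  case (Suc m)
  note herm = Suc.prems(1)[rule_format] and pos = Suc.prems(2) and upper = Suc.prems(3)[rule_format]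
    and herm' = Suc.prems(4)[rule_format] and diag = Suc.prems(5)[rule_format]
  define M where "M = (\<lambda>i j. \<Sum>k<Suc m. G i k * B k j)"
  obtain b where b: "b \<le> 0" "B 0 0 = complex_of_real b" using diag[of 0] by auto
  have MH: "M j i = cnj (M i j)" if "i < Suc m" "j < Suc m" for i j
    using herm'[OF that] unfolding M_def .
  have M0: "M i 0 = of_real b * G i 0" if "i < Suc m" for i
    unfolding M_def sum.lessThan_Suc_shift using upper b by (simp add: mult.commute)
  have M0': "M 0 j = of_real b * G 0 j" if "j < Suc m" for j
    using MH[of j 0] M0[OF that] herm[of j 0] that
    by (metis complex_cnj_cnj complex_cnj_complex_of_real complex_cnj_mult zero_less_Suc)
  have G00: "Re (G 0 0) > 0" using pos[of "\<lambda>i. if i = 0 then 1 else 0"]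
    by (auto simp: sum.lessThan_Suc_shift simp del: sum.lessThan_Suc)
  hence G0: "G 0 0 \<noteq> 0" by auto
  have G00r: "cnj (G 0 0) = G 0 0" using herm[of 0 0] by (metis zero_less_Suc)
  hence G00': "G 0 0 = of_real (Re (G 0 0))" by (simp add: complex_eq_iff)
  define G' where "G' = (\<lambda>i j. G (Suc i) (Suc j) - G (Suc i) 0 * G 0 (Suc j) / G 0 0)"
  define B' where "B' = (\<lambda>i j. B (Suc i) (Suc j))"
  \<comment> \<open>Taking the Schur complement of G commutes with multiplication by B: the
    off-diagonal entry \<open>B 0 (Suc j)\<close> cancels.\<close>
  have M': "(\<Sum>k<m. G' i k * B' k j) = M (Suc i) (Suc j) - of_real b * G (Suc i) 0 * G 0 (Suc j) / G 0 0"
    if "j < m" for i j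
  proof -
    have "(\<Sum>k<m. G' i k * B' k j) = (\<Sum>k<m. G (Suc i) (Suc k) * B (Suc k) (Suc j))
        - G (Suc i) 0 / G 0 0 * (\<Sum>k<m. G 0 (Suc k) * B (Suc k) (Suc j))"
      unfolding G'_def B'_def by (simp add: algebra_simps sum_subtractf sum_distrib_left)
    also have "(\<Sum>k<m. G (Suc i) (Suc k) * B (Suc k) (Suc j)) = M (Suc i) (Suc j) - G (Suc i) 0 * B 0 (Suc j)"
      unfolding M_def sum.lessThan_Suc_shift by simp
    also have "(\<Sum>k<m. G 0 (Suc k) * B (Suc k) (Suc j)) = M 0 (Suc j) - G 0 0 * B 0 (Suc j)"
      unfolding M_def sum.lessThan_Suc_shift by simp
    also have "M 0 (Suc j) = of_real b * G 0 (Suc j)" using M0' that by simp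
    finally have "(\<Sum>k<m. G' i k * B' k j) = M (Suc i) (Suc j) - G (Suc i) 0 * B 0 (Suc j)
        - G (Suc i) 0 / G 0 0 * (of_real b * G 0 (Suc j) - G 0 0 * B 0 (Suc j))" .
    also have "\<dots> = M (Suc i) (Suc j) - of_real b * G (Suc i) 0 * G 0 (Suc j) / G 0 0"
      using G0 by (simp add: right_diff_distrib)
    finally show ?thesis .
  qed
  have split: "(\<Sum>i<Suc m. \<Sum>j<Suc m. cnj (x i) * M i j * x j) =
      of_real b * G 0 0 * (cnj (x 0 + (\<Sum>j<m. G 0 (Suc j) * x (Suc j)) / G 0 0) *
        (x 0 + (\<Sum>j<m. G 0 (Suc j) * x (Suc j)) / G 0 0))
      + (\<Sum>i<m. \<Sum>j<m. cnj (x (Suc i)) * (\<Sum>k<m. G' i k * B' k j) * x (Suc j))"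
    by (subst hermitian_form_split[of m M "of_real b" G x]) (use M0 M0' G0 in \<open>simp_all add: M' del: sum.lessThan_Suc\<close>, use herm in blast)
  have "Re (\<Sum>i<m. \<Sum>j<m. cnj (x (Suc i)) * (\<Sum>k<m. G' i k * B' k j) * x (Suc j)) \<le> 0"
  proof (rule Suc.IH[of G' B' "\<lambda>i. x (Suc i)"])
    have h: "cnj (G (Suc i) (Suc j)) = G (Suc j) (Suc i)" "cnj (G 0 (Suc j)) = G (Suc j) 0"
      "cnj (G (Suc j) 0) = G 0 (Suc j)" "cnj (M (Suc i) (Suc j)) = M (Suc j) (Suc i)"
      if "i < m" "j < m" for i j
      using that by (metis Suc_mono herm, metis Suc_mono herm zero_less_Suc,
        metis Suc_mono herm zero_less_Suc, metis Suc_mono MH)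
    show "\<forall>i<m. \<forall>j<m. G' j i = cnj (G' i j)"
      using h G00r unfolding G'_def by (auto simp: mult.commute)
    show "\<forall>i<m. \<forall>j<i. B' i j = 0" using upper unfolding B'_def by auto
    show "\<forall>i<m. \<exists>r\<le>0. B' i i = complex_of_real r" using diag unfolding B'_def by auto
    show "\<forall>i<m. \<forall>j<m. (\<Sum>k<m. G' j k * B' k i) = cnj (\<Sum>k<m. G' i k * B' k j)"

    proof (intro allI impI)
      fix i j assume "i < m" "j < m"
      thus "(\<Sum>k<m. G' j k * B' k i) = cnj (\<Sum>k<m. G' i k * B' k j)"
        using G00r by (simp only: M' complex_cnj_diff complex_cnj_mult complex_cnj_divide
          complex_cnj_complex_of_real h) simp
    qed
    fix x' :: "nat \<Rightarrow> complex" assume x': "\<exists>i<m. x' i \<noteq> 0"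
    \<comment> \<open>The component \<open>X 0\<close> makes the completed square vanish, so the
      Schur complement evaluated at x' is G evaluated at X and inherits positivity.\<close>
    define X where "X = (\<lambda>i. case i of 0 \<Rightarrow> - (\<Sum>j<m. G 0 (Suc j) * x' j) / G 0 0 | Suc i \<Rightarrow> x' i)"
    have "0 < Re (\<Sum>i<Suc m. \<Sum>j<Suc m. cnj (X i) * G i j * X j)"
    proof (rule pos)
      from x' obtain i where "i < m" "x' i \<noteq> 0" by blast
      thus "\<exists>i<Suc m. X i \<noteq> 0" by (intro exI[of _ "Suc i"]) (simp add: X_def)
    qed
    also have "(\<Sum>i<Suc m. \<Sum>j<Suc m. cnj (X i) * G i j * X j) =
       (\<Sum>i<m. \<Sum>j<m. cnj (x' i) * G' i j * x' j)"
    proof -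
      have X: "X 0 + (\<Sum>j<m. G 0 (Suc j) * X (Suc j)) / G 0 0 = 0" "\<And>i. X (Suc i) = x' i"
        unfolding X_def by simp_all
      have "(\<Sum>i<Suc m. \<Sum>j<Suc m. cnj (X i) * G i j * X j) = 1 * G 0 0 * (cnj 0 * 0) +
          (\<Sum>i<m. \<Sum>j<m. cnj (X (Suc i)) *
             (G (Suc i) (Suc j) - 1 * G (Suc i) 0 * G 0 (Suc j) / G 0 0) * X (Suc j))"
        by (rule hermitian_form_split[of m G 1 G X, unfolded X(1)]) (simp, simp, use herm in blast, fact G0)
      thus ?thesis unfolding X G'_def by simp
    qed
    finally show "0 < Re (\<Sum>i<m. \<Sum>j<m. cnj (x' i) * G' i j * x' j)" .
  qed
  moreover have "Re (of_real b * G 0 0 * (cnj y * y)) \<le> 0" for y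
  proof -
    have "of_real b * G 0 0 * (cnj y * y) = of_real (b * Re (G 0 0) * (cmod y)\<^sup>2)"
      unfolding cnj_mult_self by (subst G00') simp
    thus ?thesis using b(1) G00 by (simp add: mult_nonpos_nonneg)
  qed
  ultimately show ?case using split unfolding M_def by (metis (no_types, lifting) add_nonpos_nonpos plus_complex.sel(1))
qed

unbundle no vec_syntax

section \<open>Positive eigenvalues counted with multiplicity\<close>

lemma order_prod_linear:
  "Polynomial.order a (\<Prod>e\<leftarrow>es. [:- e, 1:]) = count_list es (a :: complex)"
proof (induction es)
  case (Cons e es)
  have nz: "(\<Prod>e\<leftarrow>es. [:- e, 1:]) \<noteq> 0" by (auto simp: prod_list_zero_iff)
  have "Polynomial.order a [:- e, 1:] = (if a = e then 1 else 0)"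

    by (cases "a = e") (auto intro!: order_0I order_unique_lemma[symmetric])
  with Cons nz show ?case by (simp add: order_mult prod_list_zero_iff del: mult_pCons_left)
qed (simp add: order_0I)

lemma sum_count_list_of_real:
  assumes "finite S"
  shows "(\<Sum>l\<in>S. count_list es (complex_of_real l)) = length (filter (\<lambda>e. e \<in> complex_of_real ` S) es)"
proof (induction es)
  case (Cons e es)
  have "(\<Sum>l\<in>S. if e = complex_of_real l then 1 else 0) = (if e \<in> complex_of_real ` S then 1 else 0 :: nat)"
  proof (cases "e \<in> complex_of_real ` S")
    case True
    then obtain l where l: "l \<in> S" "e = of_real l" by blast
    have "(\<Sum>l\<in>S. if e = complex_of_real l then 1 else 0) = (\<Sum>k\<in>S. if l = k then 1 else 0 :: nat)"
      using l by simp
    with True l assms show ?thesis by simp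
  next
    case False
    hence "(\<Sum>l\<in>S. if e = complex_of_real l then 1 else 0) = (\<Sum>l\<in>S. 0 :: nat)"
      by (intro sum.cong) auto
    with False show ?thesis by simp
  qed
  moreover have "(\<Sum>l\<in>S. count_list (e # es) (complex_of_real l)) =
      (\<Sum>l\<in>S. if e = complex_of_real l then 1 else 0) + (\<Sum>l\<in>S. count_list es (complex_of_real l))"
    unfolding sum.distrib[symmetric] by (intro sum.cong) auto
  ultimately show ?case using Cons by simp
qed simp

lemma hermitian_eigenvalue_real:
  fixes R :: "nat \<Rightarrow> nat \<Rightarrow> complex"
  assumes herm: "\<And>p q. p < N \<Longrightarrow> q < N \<Longrightarrow> R q p = cnj (R p q)"
    and ev: "eigenvalue (Matrix.mat N N (\<lambda>(p, q). R p q)) e"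
  shows "e \<in> \<real>"
proof -
  let ?A = "Matrix.mat N N (\<lambda>(p, q). R p q)"
  obtain v where v: "v \<in> carrier_vec N" "v \<noteq> 0\<^sub>v N" "?A *\<^sub>v v = e \<cdot>\<^sub>v v"
    using ev unfolding eigenvalue_def eigenvector_def by auto
  have Av: "(\<Sum>q<N. R p q * v $ q) = e * v $ p" if "p < N" for p
    using arg_cong[OF v(3), of "\<lambda>w. w $ p"] that v(1)
    by (simp add: scalar_prod_def lessThan_atLeast0)
  define n where "n = (\<Sum>p<N. cnj (v $ p) * v $ p)"
  have n: "n = of_real (\<Sum>p<N. (cmod (v $ p))\<^sup>2)"
    unfolding n_def of_real_sum cnj_mult_self ..
  obtain p where p: "p < N" "v $ p \<noteq> 0" using v(1,2) by (auto simp: vec_eq_iff)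
  have "(\<Sum>p<N. (cmod (v $ p))\<^sup>2) > 0" using p by (intro sum_pos2[of _ p]) auto
  hence n0: "n \<noteq> 0" unfolding n by (metis less_irrefl of_real_eq_0_iff)
  have E: "(\<Sum>p<N. \<Sum>q<N. cnj (v $ p) * R p q * v $ q) = e * n"
  proof -
    have "(\<Sum>q<N. cnj (v $ p) * R p q * v $ q) = e * (cnj (v $ p) * v $ p)" if "p < N" for p
      using arg_cong[OF Av[OF that], of "\<lambda>z. cnj (v $ p) * z"] by (simp add: sum_distrib_left mult_ac)
    thus ?thesis unfolding n_def sum_distrib_left by simp
  qed
  have "cnj (\<Sum>p<N. \<Sum>q<N. cnj (v $ p) * R p q * v $ q) = (\<Sum>p<N. \<Sum>q<N. v $ p * R q p * cnj (v $ q))"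
    unfolding cnj_sum
  proof (intro sum.cong refl)
    fix p q assume "p \<in> {..<N}" "q \<in> {..<N}"
    thus "cnj (cnj (v $ p) * R p q * v $ q) = v $ p * R q p * cnj (v $ q)"
      using herm[of p q] by simp
  qed
  also have "\<dots> = (\<Sum>q<N. \<Sum>p<N. v $ p * R q p * cnj (v $ q))" by (rule sum.swap)
  finally have "cnj (e * n) = e * n" unfolding E[symmetric] by (simp add: mult_ac)
  moreover have "cnj n = n" unfolding n by simp
  ultimately show ?thesis using n0 by (simp add: Reals_cnj_iff)
qed

text \<open>The easy half of the Courant-Fischer principle. With at most one positive eigenvalue
  there is a subspace of codimension at most one on which the form is nonpositive, and it meets the
  plane spanned by u and w. Positivity on all nonzero combinations also guarantees that this is a
  plane.\<close>

lemma two_le_num_positive_eigenvalues: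
  fixes R :: "nat \<Rightarrow> nat \<Rightarrow> complex"
  assumes herm: "\<And>p q. p < N \<Longrightarrow> q < N \<Longrightarrow> R q p = cnj (R p q)"
    and pos: "\<And>a b. a \<noteq> 0 \<or> b \<noteq> 0 \<Longrightarrow>
      0 < Re (\<Sum>p<N. \<Sum>q<N. R p q * (a * u p + b * w p) * cnj (a * u q + b * w q))"
  shows "2 \<le> num_positive_eigenvalues (Matrix.mat N N (\<lambda>(p, q). R p q))"
proof (rule ccontr)
  let ?A = "Matrix.mat N N (\<lambda>(p, q). R p q)"
  assume neg: "\<not> 2 \<le> num_positive_eigenvalues ?A"
  have A: "?A \<in> carrier_mat N N" by simp
  obtain es where es: "char_poly ?A = (\<Prod>a\<leftarrow>es. [:- a, 1:])" "length es = N"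
    using char_poly_factorized[OF A] by blast
  have root: "eigenvalue ?A e \<longleftrightarrow> e \<in> set es" for e
    unfolding eigenvalue_root_char_poly[OF A] es poly_prod_list_zero_iff by auto
  define np where "np = (\<lambda>e. \<exists>r\<le>0. e = complex_of_real r)"
  define S where "S = {l::real. 0 < l \<and> eigenvalue ?A (of_real l)}"
  have "complex_of_real ` S \<subseteq> set es" unfolding S_def root by auto
  hence finS: "finite S" by (rule finite_imageD[OF finite_subset[OF _ finite_set]]) (simp add: inj_on_def)
  have "num_positive_eigenvalues ?A = length (filter (\<lambda>e. e \<in> complex_of_real ` S) es)"
    unfolding num_positive_eigenvalues_def S_def[symmetric] es order_prod_linear
    by (rule sum_count_list_of_real[OF finS])
  also have "filter (\<lambda>e. e \<in> complex_of_real ` S) es = filter (\<lambda>e. \<not> np e) es"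
  proof (rule filter_cong[OF refl])
    fix e assume e: "e \<in> set es"
    have "e \<in> \<real>"
      using e by (intro hermitian_eigenvalue_real[of N R e] herm) (simp_all add: root)
    then obtain r where r: "e = of_real r" by (auto elim: Reals_cases)
    show "e \<in> complex_of_real ` S \<longleftrightarrow> \<not> np e"
      using e unfolding S_def np_def root r by auto
  qed
  finally have l1: "length (filter (\<lambda>e. \<not> np e) es) \<le> 1" using neg by simp
  \<comment> \<open>A Schur form admits any prescribed order of eigenvalues. With the nonpositive
    ones in front, the first m basis vectors span an invariant subspace.\<close>
  define es' where "es' = filter np es @ filter (\<lambda>e. \<not> np e) es"
  define m where "m = length (filter np es)"
  have mN: "m \<le> N" "N \<le> Suc m"
    using sum_length_filter_compl[of np es] l1 es(2) unfolding m_def by auto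
  have "mset es' = mset es" unfolding es'_def by (induction es) auto
  hence "char_poly ?A = (\<Prod>a\<leftarrow>es'. [:- a, 1:])"
    unfolding es by (metis mset_map prod_mset_prod_list)
  moreover obtain B T Q where BTQ: "schur_decomposition ?A es' = (B, T, Q)" by (metis prod_cases3)
  ultimately have sim: "similar_mat_wit ?A B T Q" and up: "upper_triangular B" and dg: "diag_mat B = es'"
    using schur_decomposition[OF A] by blast+
  note simD = similar_mat_witD2[OF A sim]
  have car: "B \<in> carrier_mat N N" "T \<in> carrier_mat N N" "Q \<in> carrier_mat N N" using simD by auto
  have QT: "Q * T = 1\<^sub>m N" and TQ: "T * Q = 1\<^sub>m N" using simD by auto
  have AT: "?A * T = T * B"
  proof -
    have "?A * T = T * B * Q * T" using simD by simp
    also have "\<dots> = T * B * (Q * T)" using car by (simp add: assoc_mult_mat[of _ N N _ N _ N])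
    finally show ?thesis using QT car by simp
  qed
  \<comment> \<open>The Gram matrix of the columns of T, the shape in which
    \<open>triangular_form_nonpos\<close> takes a basis that may fail to be orthonormal.\<close>
  define G where "G = (\<lambda>i j. \<Sum>k<N. cnj (T $$ (k, i)) * T $$ (k, j))"
  have mult: "(X * Y) $$ (i, j) = (\<Sum>k<N. X $$ (i, k) * Y $$ (k, j))"
    if "X \<in> carrier_mat N N" "Y \<in> carrier_mat N N" "i < N" "j < N" for X Y :: "complex mat" and i j
    using that by (simp add: scalar_prod_def lessThan_atLeast0)
  have RT: "(\<Sum>q<N. R p q * T $$ (q, j)) = (\<Sum>k<N. T $$ (p, k) * B $$ (k, j))" if "p < N" "j < N" for p j
  proof -
    have "(\<Sum>q<N. R p q * T $$ (q, j)) = (?A * T) $$ (p, j)"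
      unfolding mult[OF A car(2) that] using that by (intro sum.cong) auto
    thus ?thesis unfolding AT mult[OF car(2,1) that] .
  qed
  have QT': "(\<Sum>k<N. Q $$ (i, k) * T $$ (k, j)) = (if i = j then 1 else 0)" if "i < N" "j < N" for i j
    using arg_cong[OF QT, of "\<lambda>X. X $$ (i, j)"] mult[OF car(3,2) that] that by simp
  have TQ': "(\<Sum>k<N. T $$ (i, k) * Q $$ (k, j)) = (if i = j then 1 else 0)" if "i < N" "j < N" for i j
    using arg_cong[OF TQ, of "\<lambda>X. X $$ (i, j)"] mult[OF car(2,3) that] that by simp
  have upB: "B $$ (i, j) = 0" if "j < i" "i < N" for i j
    using upper_triangularD[OF up that(1)] carrier_matD(1)[OF car(1)] that(2) by blast
  have G_form: "(\<Sum>i<N. \<Sum>j<N. cnj (y i) * G i j * y j) = of_real (\<Sum>k<N. (cmod (\<Sum>j<N. T $$ (k, j) * y j))\<^sup>2)" for y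
  proof -
    have "of_real (\<Sum>k<N. (cmod (\<Sum>j<N. T $$ (k, j) * y j))\<^sup>2) =
        (\<Sum>k<N. cnj (\<Sum>i<N. T $$ (k, i) * y i) * (\<Sum>j<N. T $$ (k, j) * y j))"
      unfolding of_real_sum cnj_mult_self ..
    also have "\<dots> = (\<Sum>k<N. \<Sum>i<N. \<Sum>j<N. cnj (y i) * (cnj (T $$ (k, i)) * T $$ (k, j)) * y j)"
      unfolding cnj_sum sum_product by (simp add: mult_ac)
    also have "\<dots> = (\<Sum>i<N. \<Sum>k<N. \<Sum>j<N. cnj (y i) * (cnj (T $$ (k, i)) * T $$ (k, j)) * y j)"
      by (rule sum.swap)
    also have "\<dots> = (\<Sum>i<N. \<Sum>j<N. \<Sum>k<N. cnj (y i) * (cnj (T $$ (k, i)) * T $$ (k, j)) * y j)"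
      by (intro sum.cong refl sum.swap)
    finally show ?thesis unfolding G_def by (simp add: sum_distrib_left sum_distrib_right)
  qed
  have Gpos: "0 < Re (\<Sum>i<m. \<Sum>j<m. cnj (y i) * G i j * y j)" if y: "\<exists>i<m. y i \<noteq> 0" for y
  proof -
    define y' where "y' = (\<lambda>i. if i < m then y i else 0)"
    have "(\<Sum>i<m. \<Sum>j<m. cnj (y i) * G i j * y j) = (\<Sum>i<N. \<Sum>j<N. cnj (y' i) * G i j * y' j)"
      using mN(1) by (intro sum.mono_neutral_cong_left sum.mono_neutral_cong_left) (auto simp: y'_def)
    also have "\<dots> = of_real (\<Sum>k<N. (cmod (\<Sum>j<N. T $$ (k, j) * y' j))\<^sup>2)" by (rule G_form)
    finally have eq: "(\<Sum>i<m. \<Sum>j<m. cnj (y i) * G i j * y j) =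
      of_real (\<Sum>k<N. (cmod (\<Sum>j<N. T $$ (k, j) * y' j))\<^sup>2)" .
    have "\<exists>k<N. (\<Sum>j<N. T $$ (k, j) * y' j) \<noteq> 0"
    proof (rule ccontr)
      assume "\<not> ?thesis"
      hence 0: "\<And>k. k < N \<Longrightarrow> (\<Sum>j<N. T $$ (k, j) * y' j) = 0" by blast
      obtain i where i: "i < m" "y i \<noteq> 0" using y by blast
      have "0 = (\<Sum>k<N. Q $$ (i, k) * (\<Sum>j<N. T $$ (k, j) * y' j))" using 0 by simp
      also have "\<dots> = (\<Sum>j<N. (\<Sum>k<N. Q $$ (i, k) * T $$ (k, j)) * y' j)"
        unfolding sum_distrib_left sum_distrib_right by (subst sum.swap) (simp add: mult_ac)
      also have "\<dots> = (\<Sum>j<N. if i = j then y' j else 0)"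
        using i mN by (intro sum.cong) (auto simp: QT')
      also have "\<dots> = y i" using i mN by (simp add: y'_def)
      finally show False using i by simp
    qed
    then obtain k where "k < N" "(\<Sum>j<N. T $$ (k, j) * y' j) \<noteq> 0" by blast
    hence "0 < (\<Sum>k<N. (cmod (\<Sum>j<N. T $$ (k, j) * y' j))\<^sup>2)" by (intro sum_pos2[of _ k]) auto
    thus ?thesis unfolding eq by simp
  qed
  define M where "M = (\<lambda>i j. \<Sum>p<N. \<Sum>q<N. cnj (T $$ (p, i)) * R p q * T $$ (q, j))"
  \<comment> \<open>For j < m the column j of B ends above row m by triangularity, so the sum over
    all of N may stop at m.\<close>
  have GB: "(\<Sum>k<m. G i k * B $$ (k, j)) = M i j" if "j < m" for i j
  proof -
    have "M i j = (\<Sum>p<N. cnj (T $$ (p, i)) * (\<Sum>k<N. T $$ (p, k) * B $$ (k, j)))"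
      unfolding M_def using RT that mN by (simp add: mult.assoc flip: sum_distrib_left)
    also have "\<dots> = (\<Sum>k<N. G i k * B $$ (k, j))"
      unfolding G_def sum_distrib_left sum_distrib_right by (subst sum.swap) (simp add: mult_ac)
    also have "\<dots> = (\<Sum>k<m. G i k * B $$ (k, j))"
      using that mN upB by (intro sum.mono_neutral_right) auto
    finally show ?thesis ..
  qed
  have MH: "M j i = cnj (M i j)" for i j
  proof -
    have "cnj (M i j) = (\<Sum>p<N. \<Sum>q<N. T $$ (p, i) * R q p * cnj (T $$ (q, j)))"
      unfolding M_def cnj_sum
    proof (intro sum.cong refl)
      fix p q assume "p \<in> {..<N}" "q \<in> {..<N}"
      thus "cnj (cnj (T $$ (p, i)) * R p q * T $$ (q, j)) = T $$ (p, i) * R q p * cnj (T $$ (q, j))"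
        using herm[of p q] by simp
    qed
    also have "\<dots> = (\<Sum>q<N. \<Sum>p<N. T $$ (p, i) * R q p * cnj (T $$ (q, j)))" by (rule sum.swap)
    finally show ?thesis unfolding M_def by (simp add: mult_ac)
  qed
  have Bd: "\<exists>r\<le>0. B $$ (i, i) = complex_of_real r" if "i < m" for i
  proof -
    have "B $$ (i, i) = es' ! i" using car that mN unfolding dg[symmetric] diag_mat_def by simp
    also have "\<dots> = filter np es ! i" using that unfolding es'_def m_def by (simp add: nth_append)
    finally have "B $$ (i, i) \<in> set (filter np es)" using nth_mem[of i "filter np es"] that m_def by metis
    thus ?thesis unfolding np_def by simp
  qed
  have le: "Re (\<Sum>i<m. \<Sum>j<m. cnj (y i) * M i j * y j) \<le> 0" for y
  proof -
    have "Re (\<Sum>i<m. \<Sum>j<m. cnj (y i) * (\<Sum>k<m. G i k * B $$ (k, j)) * y j) \<le> 0"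
    proof (rule triangular_form_nonpos)
      show "\<forall>i<m. \<forall>j<m. G j i = cnj (G i j)" unfolding G_def by (simp add: mult.commute)
      show "\<forall>i<m. \<forall>j<i. B $$ (i, j) = 0" using upB mN by auto
      show "\<forall>i<m. \<forall>j<m. (\<Sum>k<m. G j k * B $$ (k, i)) = cnj (\<Sum>k<m. G i k * B $$ (k, j))"
      proof (intro allI impI)
        fix i j assume "i < m" "j < m"
        thus "(\<Sum>k<m. G j k * B $$ (k, i)) = cnj (\<Sum>k<m. G i k * B $$ (k, j))"
          using MH[of j i] by (simp only: GB)
      qed
      show "\<forall>i<m. \<exists>r\<le>0. B $$ (i, i) = complex_of_real r" using Bd by blast
      show "\<And>x. \<exists>i<m. x i \<noteq> 0 \<Longrightarrow> 0 < Re (\<Sum>i<m. \<Sum>j<m. cnj (x i) * G i j * x j)" by (rule Gpos)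
    qed
    also have "(\<Sum>i<m. \<Sum>j<m. cnj (y i) * (\<Sum>k<m. G i k * B $$ (k, j)) * y j) =
        (\<Sum>i<m. \<Sum>j<m. cnj (y i) * M i j * y j)"
      by (intro sum.cong refl) (simp only: GB lessThan_iff)
    finally show ?thesis .
  qed
  \<comment> \<open>Coordinate m of the conjugated vector in the basis T: a single equation for the
    two unknowns a and b. If m = N the index lies outside the matrix and the equation is merely one
    more condition; \<open>y0\<close> is then vacuous.\<close>
  define f where "f = (\<lambda>x. \<Sum>k<N. Q $$ (m, k) * cnj (x k))"
  have f: "f (\<lambda>k. a * u k + b * w k) = cnj a * f u + cnj b * f w" for a b
    unfolding f_def by (simp add: algebra_simps sum.distrib sum_distrib_left)
  obtain a b where ab: "a \<noteq> 0 \<or> b \<noteq> 0" "f (\<lambda>k. a * u k + b * w k) = 0"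
  proof (cases "f w = 0")
    case True then show ?thesis using that[of 0 1] f[of 0 1] by simp
  next
    case False then show ?thesis using that[of "cnj (f w)" "- cnj (f u)"] f[of "cnj (f w)" "- cnj (f u)"] by simp
  qed
  \<comment> \<open>The curvature form conjugates its second argument, the matrix form above its
    first; conjugating the vector reconciles them.\<close>
  define x where "x = (\<lambda>k. cnj (a * u k + b * w k))"
  define y where "y = (\<lambda>i. \<Sum>k<N. Q $$ (i, k) * x k)"
  have y0: "y i = 0" if "i < N" "\<not> i < m" for i
  proof -
    have "i = m" using that mN by simp
    thus ?thesis using ab(2) unfolding y_def x_def f_def by simp
  qed
  have xy: "x p = (\<Sum>j<m. T $$ (p, j) * y j)" if "p < N" for p
  proof -
    have "(\<Sum>j<m. T $$ (p, j) * y j) = (\<Sum>j<N. T $$ (p, j) * y j)"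
      using mN y0 by (intro sum.mono_neutral_left) auto
    also have "\<dots> = (\<Sum>k<N. (\<Sum>j<N. T $$ (p, j) * Q $$ (j, k)) * x k)"
      unfolding y_def sum_distrib_left sum_distrib_right by (subst sum.swap) (simp add: mult_ac)
    also have "\<dots> = (\<Sum>k<N. if p = k then x k else 0)"
      using that by (intro sum.cong) (auto simp: TQ')
    finally show ?thesis using that by simp
  qed
  have "(\<Sum>p<N. \<Sum>q<N. R p q * (a * u p + b * w p) * cnj (a * u q + b * w q)) =
      (\<Sum>p<N. \<Sum>q<N. cnj (x p) * R p q * x q)"
    unfolding x_def by (simp add: mult_ac)
  also have "\<dots> = (\<Sum>p<N. \<Sum>q<N. \<Sum>i<m. \<Sum>j<m. cnj (y i) * (cnj (T $$ (p, i)) * R p q * T $$ (q, j)) * y j)"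
  proof (intro sum.cong refl)
    fix p q assume pq: "p \<in> {..<N}" "q \<in> {..<N}"
    have "cnj (x p) * R p q * x q = (\<Sum>i<m. cnj (T $$ (p, i)) * cnj (y i)) * R p q * (\<Sum>j<m. T $$ (q, j) * y j)"
      using xy pq by simp
    also have "\<dots> = (\<Sum>i<m. \<Sum>j<m. cnj (y i) * (cnj (T $$ (p, i)) * R p q * T $$ (q, j)) * y j)"
      unfolding sum_distrib_right sum_distrib_left by (subst sum.swap) (simp add: mult_ac)
    finally show "cnj (x p) * R p q * x q = \<dots>" .
  qed
  also have "\<dots> = (\<Sum>p<N. \<Sum>i<m. \<Sum>q<N. \<Sum>j<m. cnj (y i) * (cnj (T $$ (p, i)) * R p q * T $$ (q, j)) * y j)"
    by (intro sum.cong refl sum.swap)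
  also have "\<dots> = (\<Sum>i<m. \<Sum>p<N. \<Sum>q<N. \<Sum>j<m. cnj (y i) * (cnj (T $$ (p, i)) * R p q * T $$ (q, j)) * y j)"
    by (rule sum.swap)
  also have "\<dots> = (\<Sum>i<m. \<Sum>p<N. \<Sum>j<m. \<Sum>q<N. cnj (y i) * (cnj (T $$ (p, i)) * R p q * T $$ (q, j)) * y j)"
    by (intro sum.cong refl sum.swap)
  also have "\<dots> = (\<Sum>i<m. \<Sum>j<m. \<Sum>p<N. \<Sum>q<N. cnj (y i) * (cnj (T $$ (p, i)) * R p q * T $$ (q, j)) * y j)"
    by (intro sum.cong refl sum.swap)
  also have "\<dots> = (\<Sum>i<m. \<Sum>j<m. cnj (y i) * M i j * y j)"
    unfolding M_def by (simp add: sum_distrib_left sum_distrib_right)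
  finally show False using pos[OF ab(1)] le[of y] by simp
qed

section \<open>Projective space\<close>

text \<open>Smoothness serves the metrics, second-order holomorphy the transition functions and the
  curvature. Openness of U is included so that one family of closure rules gives everything at
  once.\<close>

definition nice :: "nat \<Rightarrow> (nat \<Rightarrow> complex) set \<Rightarrow> ((nat \<Rightarrow> complex) \<Rightarrow> complex) \<Rightarrow> bool" where
  "nice n U f \<longleftrightarrow> openin (Cn_topology n) U \<and> smooth_Cn n U f \<and> holo2 n U f"

lemma nice_const: "openin (Cn_topology n) U \<Longrightarrow> nice n U (\<lambda>z. c)"
  unfolding nice_def smooth_Cn_def by (simp add: C_diff_const holo2_const)

lemma nice_coord: "openin (Cn_topology n) U \<Longrightarrow> nice n U (\<lambda>z. z j)"
  unfolding nice_def smooth_Cn_def by (simp add: C_diff_coord holo2_coord)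

lemma nice_add: "nice n U f \<Longrightarrow> nice n U g \<Longrightarrow> nice n U (\<lambda>z. f z + g z)"
  unfolding nice_def smooth_Cn_def by (simp add: C_diff_add holo2_add)

lemma nice_mult: "nice n U f \<Longrightarrow> nice n U g \<Longrightarrow> nice n U (\<lambda>z. f z * g z)"
  unfolding nice_def smooth_Cn_def by (simp add: C_diff_mult holo2_mult)

lemma nice_uminus:
  assumes "nice n U f" shows "nice n U (\<lambda>z. - f z)"
proof -
  have "nice n U (\<lambda>z. (- 1) * f z)"
    by (rule nice_mult[OF nice_const assms]) (use assms in \<open>simp add: nice_def\<close>)
  thus ?thesis by simp
qed

lemma nice_diff:
  assumes "nice n U f" "nice n U g" shows "nice n U (\<lambda>z. f z - g z)"
  using nice_add[OF assms(1) nice_uminus[OF assms(2)]] by simp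

lemma nice_inverse: "nice n U f \<Longrightarrow> (\<And>z. z \<in> U \<Longrightarrow> f z \<noteq> 0) \<Longrightarrow> nice n U (\<lambda>z. inverse (f z))"
  unfolding nice_def smooth_Cn_def by (simp add: C_diff_inverse holo2_inverse)

lemma nice_divide: "nice n U f \<Longrightarrow> nice n U g \<Longrightarrow> (\<And>z. z \<in> U \<Longrightarrow> g z \<noteq> 0) \<Longrightarrow> nice n U (\<lambda>z. f z / g z)"
  unfolding divide_inverse by (rule nice_mult[OF _ nice_inverse])

lemma nice_if: "nice n U f \<Longrightarrow> nice n U g \<Longrightarrow> nice n U (\<lambda>z. if b then f z else g z)"
  by (cases b) simp_all

lemma nice_continuous: "nice n U f \<Longrightarrow> continuous_on U f"
  unfolding nice_def smooth_Cn_def using C_diff_continuous by blast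

lemma nice_holomorphic_Cn:
  assumes "nice n U f" "\<And>z. z \<in> U \<Longrightarrow> f z = g z"
  shows "holomorphic_Cn n U g"
  unfolding holomorphic_Cn_def
proof (intro conjI ballI allI impI)
  show "continuous_on U g" using nice_continuous[OF assms(1)] assms(2) by (simp cong: continuous_on_cong)
  fix z k assume z: "z \<in> U" "k < n"
  have U: "openin (Cn_topology n) U" and h: "holo2 n U f" using assms(1) unfolding nice_def by auto
  have "\<forall>\<^sub>F w in nhds (z k). f (z(k := w)) = g (z(k := w))"
    using eventually_fun_upd_in[OF U z] by (rule eventually_mono) (rule assms(2))
  from has_wirtinger_transform[OF holo2D(1)[OF h U z] this]
  show "(\<lambda>w. g (z(k := w))) field_differentiable at (z k)"
    unfolding has_wirtinger_def field_differentiable_def has_field_derivative_def by auto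
qed

lemma openin_nonzero:
  assumes "openin (Cn_topology n) U" "continuous_on U f"
  shows "openin (Cn_topology n) {z \<in> U. f z \<noteq> (0::complex)}"
proof -
  have "openin (top_of_set U) (U \<inter> f -` (- {0}))"
    by (rule continuous_openin_preimage_gen[OF assms(2)]) auto
  moreover have "U \<inter> f -` (- {0}) = {z \<in> U. f z \<noteq> 0}" by auto
  ultimately show ?thesis using openin_trans assms(1) unfolding Cn_topology_def by metis
qed

section \<open>Lines in \<complex>^4 and their affine coordinates\<close>

definition line :: "(nat \<Rightarrow> complex) \<Rightarrow> (nat \<Rightarrow> complex) set" where
  "line z = {(\<lambda>k. c * z k) |c. True}"

text \<open>An arbitrary nonzero vector of the line; whatever is computed from it has to be shown
  invariant under scaling.\<close>

definition rep :: "(nat \<Rightarrow> complex) set \<Rightarrow> nat \<Rightarrow> complex" where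
  "rep L = (SOME z. z \<in> Cn 4 \<and> z \<noteq> (\<lambda>_. 0) \<and> L = line z)"

lemma line_scale: "c \<noteq> 0 \<Longrightarrow> line (\<lambda>k. c * z k) = line z"
proof -
  assume c: "c \<noteq> 0"
  have "\<exists>d. (\<lambda>k. e * z k) = (\<lambda>k. d * (c * z k))" for e
    by (rule exI[of _ "e / c"]) (use c in simp)
  moreover have "\<exists>d. (\<lambda>k. e * (c * z k)) = (\<lambda>k. d * z k)" for e
    by (rule exI[of _ "e * c"]) (simp add: mult.assoc)
  ultimately show ?thesis unfolding line_def by auto
qed

lemma line_eqD:
  assumes "line z = line z'" "z \<noteq> (\<lambda>_. 0)"
  obtains c where "c \<noteq> 0" "z = (\<lambda>k. c * z' k)"
proof -
  have "z \<in> line z" unfolding line_def by (auto intro!: exI[of _ 1])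
  then obtain c where c: "z = (\<lambda>k. c * z' k)" using assms(1) unfolding line_def by auto
  moreover have "c \<noteq> 0" using assms(2) c by auto
  ultimately show ?thesis using that by blast
qed

lemma rep_line:
  assumes "z \<in> Cn 4" "z \<noteq> (\<lambda>_. 0)"
  obtains c where "c \<noteq> 0" "rep (line z) = (\<lambda>k. c * z k)"
proof -
  define P where "P = (\<lambda>z'. z' \<in> Cn 4 \<and> z' \<noteq> (\<lambda>_. 0) \<and> line z = line z')"
  have "rep (line z) = (SOME z'. P z')" unfolding rep_def P_def ..
  moreover have "P z" using assms unfolding P_def by simp
  ultimately have "P (rep (line z))" using someI[of P] by simp
  hence "line (rep (line z)) = line z" "rep (line z) \<noteq> (\<lambda>_. 0)" unfolding P_def by simp_all
  thus thesis using that by (rule line_eqD)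
qed

definition P3_domain :: "nat \<Rightarrow> (nat \<Rightarrow> complex) set set" where
  "P3_domain i = {line z |z. z \<in> Cn 4 \<and> z i \<noteq> 0}"

definition skip :: "nat \<Rightarrow> nat \<Rightarrow> nat" where
  "skip i k = (if k < i then k else Suc k)"

definition P3_coord :: "nat \<Rightarrow> (nat \<Rightarrow> complex) set \<Rightarrow> nat \<Rightarrow> complex" where
  "P3_coord i L k = (if k < 3 then rep L (skip i k) / rep L i else 0)"

definition P3 :: "(nat \<Rightarrow> complex) set cmanifold" where
  "P3 = \<lparr> points = {line z |z. z \<in> Cn 4 \<and> z \<noteq> (\<lambda>_. 0)}, cdim = 3,
     atlas = {(P3_domain i, P3_coord i) |i. i < 4} \<rparr>"

text \<open>Inverse of the affine chart. For i < 4 its values depend on \<zeta> 0, \<zeta> 1,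
  \<zeta> 2 alone, so the same map serves the charts of the flag manifold, whose coordinate \<zeta>
  3 belongs to the fibre.\<close>

definition homog :: "nat \<Rightarrow> (nat \<Rightarrow> complex) \<Rightarrow> nat \<Rightarrow> complex" where
  "homog i \<zeta> k = (if k = i then 1 else if k < i then \<zeta> k else if k < 4 then \<zeta> (k - 1) else 0)"

lemma homog_i [simp]: "homog i \<zeta> i = 1"
  unfolding homog_def by simp

lemma homog_Cn: "i < 4 \<Longrightarrow> homog i \<zeta> \<in> Cn 4"
  unfolding homog_def Cn_def by auto

lemma homog_nonzero: "homog i \<zeta> \<noteq> (\<lambda>_. 0)"
  by (metis homog_i zero_neq_one)

lemma homog_skip: "k < 3 \<Longrightarrow> homog i \<zeta> (skip i k) = \<zeta> k"
  unfolding homog_def skip_def by auto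

lemma P3_coord_line:
  assumes "z \<in> Cn 4" "z i \<noteq> 0"
  shows "P3_coord i (line z) = (\<lambda>k. if k < 3 then z (skip i k) / z i else 0)"
proof -
  have "z \<noteq> (\<lambda>_. 0)" using assms(2) by auto
  then obtain c where "c \<noteq> 0" "rep (line z) = (\<lambda>k. c * z k)" using rep_line[OF assms(1)] by blast
  thus ?thesis unfolding P3_coord_def by (auto simp: fun_eq_iff)
qed

lemma P3_coord_homog: "i < 4 \<Longrightarrow> \<zeta> \<in> Cn 3 \<Longrightarrow> P3_coord i (line (homog i \<zeta>)) = \<zeta>"
  by (simp add: P3_coord_line homog_Cn homog_skip fun_eq_iff) (simp add: Cn_def)

lemma homog_coord:
  assumes "i < 4" "z \<in> Cn 4" "z i \<noteq> 0"
  shows "homog i (P3_coord i (line z)) = (\<lambda>k. (1 / z i) * z k)"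
  using assms unfolding P3_coord_line[OF assms(2,3)] homog_def skip_def Cn_def
  by (auto simp: fun_eq_iff)

lemma line_homog_coord:
  assumes "i < 4" "L \<in> P3_domain i"
  shows "line (homog i (P3_coord i L)) = L"
proof -
  obtain z where z: "z \<in> Cn 4" "z i \<noteq> 0" "L = line z" using assms(2) unfolding P3_domain_def by auto
  show ?thesis unfolding z(3) homog_coord[OF assms(1) z(1,2)] using z(2) by (intro line_scale) simp
qed

lemma P3_coord_Cn: "P3_coord i L \<in> Cn 3"
  unfolding P3_coord_def Cn_def by simp

lemma line_in_P3_domain:
  assumes "z \<in> Cn 4" "z \<noteq> (\<lambda>_. 0)"
  shows "line z \<in> P3_domain j \<longleftrightarrow> z j \<noteq> 0"
proof
  assume "line z \<in> P3_domain j"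
  then obtain z' where "line z = line z'" "z' j \<noteq> 0" unfolding P3_domain_def by auto
  thus "z j \<noteq> 0" using line_eqD[OF _ assms(2)] by (metis mult_eq_0_iff)
qed (use assms in \<open>auto simp: P3_domain_def\<close>)

lemma line_homog_in_domain: "i < 4 \<Longrightarrow> line (homog i \<zeta>) \<in> P3_domain i"
  by (simp add: line_in_P3_domain homog_Cn homog_nonzero)

lemma P3_coord_inj: "i < 4 \<Longrightarrow> inj_on (P3_coord i) (P3_domain i)"
  by (metis inj_onI line_homog_coord)

lemma P3_coord_image:
  assumes "i < 4"
  shows "P3_coord i ` (W \<inter> P3_domain i) = {\<zeta> \<in> Cn 3. line (homog i \<zeta>) \<in> W}"
proof (intro equalityI subsetI)
  fix \<zeta> assume "\<zeta> \<in> P3_coord i ` (W \<inter> P3_domain i)"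
  then show "\<zeta> \<in> {\<zeta> \<in> Cn 3. line (homog i \<zeta>) \<in> W}"
    using line_homog_coord[OF assms] P3_coord_Cn by auto
next
  fix \<zeta> assume "\<zeta> \<in> {\<zeta> \<in> Cn 3. line (homog i \<zeta>) \<in> W}"
  then show "\<zeta> \<in> P3_coord i ` (W \<inter> P3_domain i)"
    using P3_coord_homog[OF assms, of \<zeta>] line_homog_in_domain[OF assms, of \<zeta>]
    by (intro image_eqI[of _ _ "line (homog i \<zeta>)"]) auto
qed

lemma P3_coord_image_domain: "i < 4 \<Longrightarrow> P3_coord i ` P3_domain i = Cn 3"
  using P3_coord_image[of i UNIV] by simp

lemma P3_coord_image_overlap:
  "i < 4 \<Longrightarrow> P3_coord i ` (P3_domain j \<inter> P3_domain i) = {\<zeta> \<in> Cn 3. homog i \<zeta> j \<noteq> 0}"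
  by (simp add: P3_coord_image line_in_P3_domain homog_Cn homog_nonzero)

lemma in_chart_P3:
  assumes "i < 4" "\<zeta> \<in> Cn 3"
  shows "in_chart (P3_domain i, P3_coord i) f \<zeta> = f (line (homog i \<zeta>))"
proof -
  have "inv_into (P3_domain i) (P3_coord i) \<zeta> = line (homog i \<zeta>)"
    using inv_into_f_eq[OF P3_coord_inj[OF assms(1)] line_homog_in_domain[OF assms(1)] P3_coord_homog[OF assms]] .
  thus ?thesis unfolding in_chart_def by simp
qed

lemma nice_homog:
  assumes "openin (Cn_topology n) U" shows "nice n U (\<lambda>\<zeta>. homog i \<zeta> k)"
  unfolding homog_def by (intro nice_if nice_const nice_coord assms)

lemma openin_homog_nonzero: "openin (Cn_topology n) {\<zeta> \<in> Cn n. homog i \<zeta> j \<noteq> 0}"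
  by (rule openin_nonzero[OF openin_Cn nice_continuous[OF nice_homog[OF openin_Cn]]])

lemma openin_P3:
  "openin (manifold_topology P3) W \<longleftrightarrow> W \<subseteq> points P3 \<and>
     (\<forall>i<4. openin (Cn_topology 3) {\<zeta> \<in> Cn 3. line (homog i \<zeta>) \<in> W})"
proof -
  have "\<forall>(D, \<phi>)\<in>atlas P3. inj_on \<phi> D" unfolding P3_def using P3_coord_inj by auto
  note * = openin_manifold_topology[OF this, of W]
  have "(\<forall>(D, \<phi>)\<in>atlas P3. Q D \<phi>) \<longleftrightarrow> (\<forall>i<4. Q (P3_domain i) (P3_coord i))" for Q
    unfolding P3_def by auto
  moreover have "cdim P3 = 3" unfolding P3_def by simp
  ultimately show ?thesis unfolding * by (simp add: P3_coord_image)
qed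

lemma topspace_P3: "topspace (manifold_topology P3) = points P3"
proof (rule antisym)
  show "topspace (manifold_topology P3) \<subseteq> points P3"
    using openin_P3[of "topspace (manifold_topology P3)"] by simp
  have "openin (manifold_topology P3) (points P3)"
  proof -
    have "{\<zeta> \<in> Cn 3. line (homog i \<zeta>) \<in> points P3} = Cn 3" if "i < 4" for i
      using homog_Cn[OF that] homog_nonzero unfolding P3_def by auto
    thus ?thesis unfolding openin_P3 using openin_Cn by simp
  qed
  thus "points P3 \<subseteq> topspace (manifold_topology P3)" by (rule openin_subset)
qed

lemma P3_domain_subset: "P3_domain i \<subseteq> points P3"
  unfolding P3_domain_def P3_def by auto

lemma openin_P3_domain: "openin (manifold_topology P3) (P3_domain i)"
  unfolding openin_P3 using P3_domain_subset openin_homog_nonzero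
  by (simp add: line_in_P3_domain homog_Cn homog_nonzero)

text \<open>Dividing by a coordinate of largest modulus puts every line into the closed unit
  polydisc of some chart. These four polydiscs carry all the compactness arguments.\<close>

lemma P3_cover:
  assumes "L \<in> points P3"
  obtains i \<zeta> where "i < 4" "\<zeta> \<in> Cn 3" "\<And>k. cmod (\<zeta> k) \<le> 1" "L = line (homog i \<zeta>)"
proof -
  obtain z where z: "z \<in> Cn 4" "z \<noteq> (\<lambda>_. 0)" "L = line z" using assms unfolding P3_def by auto
  have "Max ((\<lambda>k. cmod (z k)) ` {..<4::nat}) \<in> (\<lambda>k. cmod (z k)) ` {..<4::nat}"
    by (rule Max_in) (simp_all add: lessThan_empty_iff)
  then obtain i where i': "i < 4" "Max ((\<lambda>k. cmod (z k)) ` {..<4::nat}) = cmod (z i)" by auto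
  have i: "i < 4" "cmod (z k) \<le> cmod (z i)" if "k < 4" for k
    using i' that by (auto simp flip: i'(2) intro!: Max_ge)
  have zi: "z i \<noteq> 0"
  proof
    assume "z i = 0"
    hence "z k = 0" for k using i(2)[of k] z(1) unfolding Cn_def by (cases "k < 4") auto
    with z(2) show False by auto
  qed
  have L: "L \<in> P3_domain i" using z zi unfolding P3_domain_def by auto
  show ?thesis
  proof (rule that[of i "P3_coord i L"])
    show "cmod (P3_coord i L k) \<le> 1" for k
    proof (cases "k < 3")
      case True
      hence "skip i k < 4" unfolding skip_def by simp
      thus ?thesis unfolding z(3) P3_coord_line[OF z(1) zi] using i(2)[of "skip i k"] zi
        by (simp add: norm_divide divide_le_eq_1)
    qed (simp add: P3_coord_def)
  qed (use i'(1) P3_coord_Cn line_homog_coord[OF i'(1) L] in auto)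
qed

section \<open>Compactness, Hausdorff property and second countability\<close>

lemma compact_polydisc: "compact {\<zeta> \<in> Cn n. \<forall>k. cmod (\<zeta> k) \<le> 1}"
proof -
  have "{\<zeta> \<in> Cn n. \<forall>k. cmod (\<zeta> k) \<le> 1} = Pi\<^sub>E UNIV (\<lambda>k. if k < n then cball 0 1 else {0})"
  proof (rule Set.set_eqI)
    fix \<zeta> :: "nat \<Rightarrow> complex"
    have "(cmod (\<zeta> k) \<le> 1 \<and> (k \<ge> n \<longrightarrow> \<zeta> k = 0)) \<longleftrightarrow> \<zeta> k \<in> (if k < n then cball 0 1 else {0})" for k
      by (cases "k < n") auto
    thus "\<zeta> \<in> {\<zeta> \<in> Cn n. \<forall>k. cmod (\<zeta> k) \<le> 1} \<longleftrightarrow> \<zeta> \<in> Pi\<^sub>E UNIV (\<lambda>k. if k < n then cball 0 1 else {0})"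
      unfolding Cn_def PiE_iff by (simp only: mem_Collect_eq Ball_def UNIV_I extensional_UNIV simp_thms) blast
  qed
  moreover have "compactin (product_topology (\<lambda>k. euclidean) UNIV) (Pi\<^sub>E UNIV (\<lambda>k. if k < n then cball 0 1 else {0::complex}))"
    unfolding compactin_PiE by auto
  ultimately show ?thesis by (simp add: euclidean_product_topology)
qed

lemma continuous_map_homog:
  assumes "i < 4"
  shows "continuous_map (Cn_topology 3) (manifold_topology P3) (\<lambda>\<zeta>. line (homog i \<zeta>))"
  unfolding continuous_map topspace_P3
proof (intro conjI allI impI)
  show "(\<lambda>\<zeta>. line (homog i \<zeta>)) ` topspace (Cn_topology 3) \<subseteq> points P3"
    using homog_Cn[OF assms] homog_nonzero unfolding P3_def by auto
  fix W assume "openin (manifold_topology P3) W"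
  thus "openin (Cn_topology 3) {\<zeta> \<in> topspace (Cn_topology 3). line (homog i \<zeta>) \<in> W}"
    using assms unfolding openin_P3 by (simp add: Cn_topology_def)
qed

lemma compact_P3: "compact_space (manifold_topology P3)"
proof -
  define K where "K = {\<zeta> \<in> Cn 3. \<forall>k. cmod (\<zeta> k) \<le> 1}"
  have K: "compactin (Cn_topology 3) K"
    unfolding Cn_topology_def compactin_subtopology K_def using compact_polydisc[of 3] by auto
  have "compactin (manifold_topology P3) (\<Union>i\<in>{..<4}. (\<lambda>\<zeta>. line (homog i \<zeta>)) ` K)"
  proof (intro compactin_Union)
    show "compactin (manifold_topology P3) S" if S: "S \<in> (\<lambda>i. (\<lambda>\<zeta>. line (homog i \<zeta>)) ` K) ` {..<4}" for S
    proof -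
      obtain i where "i < 4" "S = (\<lambda>\<zeta>. line (homog i \<zeta>)) ` K" using S by auto
      thus ?thesis using image_compactin[OF K continuous_map_homog] by simp
    qed
  qed simp
  moreover have "(\<Union>i\<in>{..<4}. (\<lambda>\<zeta>. line (homog i \<zeta>)) ` K) = points P3"
  proof (intro equalityI subsetI)
    fix L assume "L \<in> points P3"
    then obtain i \<zeta> where i: "i < 4" "\<zeta> \<in> Cn 3" "\<And>k. cmod (\<zeta> k) \<le> 1" "L = line (homog i \<zeta>)"
      by (rule P3_cover) (rule that)
    hence "\<zeta> \<in> K" unfolding K_def by simp
    with i show "L \<in> (\<Union>i\<in>{..<4}. (\<lambda>\<zeta>. line (homog i \<zeta>)) ` K)" by (intro UN_I[of i]) auto
  qed (use homog_Cn homog_nonzero in \<open>auto simp: P3_def\<close>)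
  ultimately show ?thesis unfolding compact_space_def topspace_P3 by simp
qed

text \<open>The orthogonal projection of \<complex>^4 onto the line, as a matrix. It is a continuous
  injection into a space of functions, from which both separation and countability are
  inherited.\<close>

definition projector :: "(nat \<Rightarrow> complex) set \<Rightarrow> nat \<times> nat \<Rightarrow> complex" where
  "projector L = (\<lambda>(p, q). rep L p * cnj (rep L q) / (\<Sum>k<4. rep L k * cnj (rep L k)))"

lemma norm_sum_nonzero:
  assumes "z \<in> Cn 4" "z \<noteq> (\<lambda>_. 0)"
  shows "(\<Sum>k<4. z k * cnj (z k)) = of_real (\<Sum>k<4. (cmod (z k))\<^sup>2)" "0 < (\<Sum>k<4. (cmod (z k))\<^sup>2)"
proof -
  show "(\<Sum>k<4. z k * cnj (z k)) = of_real (\<Sum>k<4. (cmod (z k))\<^sup>2)"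
    unfolding of_real_sum cnj_mult_self[symmetric] by (simp add: mult.commute)
  obtain k where "z k \<noteq> 0" using assms(2) by auto
  hence "k < 4" using assms(1) unfolding Cn_def by (metis (mono_tags, lifting) mem_Collect_eq not_le)
  thus "0 < (\<Sum>k<4. (cmod (z k))\<^sup>2)" using \<open>z k \<noteq> 0\<close> by (intro sum_pos2[of _ k]) auto
qed

lemma projector_line:
  assumes "z \<in> Cn 4" "z \<noteq> (\<lambda>_. 0)"
  shows "projector (line z) (p, q) = z p * cnj (z q) / (\<Sum>k<4. z k * cnj (z k))"
proof -
  obtain c where c: "c \<noteq> 0" "rep (line z) = (\<lambda>k. c * z k)" using rep_line[OF assms] .
  have "(\<Sum>k<4. rep (line z) k * cnj (rep (line z) k)) = c * cnj c * (\<Sum>k<4. z k * cnj (z k))"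
    unfolding c(2) by (simp add: sum_distrib_left mult_ac)
  thus ?thesis unfolding projector_def using c by (simp add: mult_ac)
qed

lemma projector_inj: "inj_on projector (points P3)"
proof (rule inj_onI)
  fix L L' assume L: "L \<in> points P3" "L' \<in> points P3" and eq: "projector L = projector L'"
  obtain z where z: "z \<in> Cn 4" "z \<noteq> (\<lambda>_. 0)" "L = line z" using L unfolding P3_def by auto
  obtain z' where z': "z' \<in> Cn 4" "z' \<noteq> (\<lambda>_. 0)" "L' = line z'" using L unfolding P3_def by auto
  define s where "s = (\<Sum>k<4. z k * cnj (z k))"
  define s' where "s' = (\<Sum>k<4. z' k * cnj (z' k))"
  have s: "s \<noteq> 0" "s' \<noteq> 0" using norm_sum_nonzero[OF z(1,2)] norm_sum_nonzero[OF z'(1,2)]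
    unfolding s_def s'_def by (metis less_irrefl of_real_eq_0_iff)+
  have pq: "z p * cnj (z q) / s = z' p * cnj (z' q) / s'" for p q
    using fun_cong[OF eq, of "(p, q)"] unfolding z(3) z'(3) projector_line[OF z(1,2)] projector_line[OF z'(1,2)] s_def s'_def .
  obtain q where q: "z q \<noteq> 0" using z(2) by auto
  \<comment> \<open>Column q of the two projection matrices, for a q with z q nonzero, exhibits z as
    a multiple of z'.\<close>
  define c where "c = s * cnj (z' q) / (s' * cnj (z q))"
  have "z p = c * z' p" for p
    using pq[of p q] q s unfolding c_def by (simp add: field_simps)
  hence zc: "z = (\<lambda>p. c * z' p)" by auto
  hence "c \<noteq> 0" using z(2) by auto
  thus "L = L'" unfolding z(3) z'(3) using line_scale[of c z'] zc by simp
qed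

lemma projector_continuous: "continuous_map (manifold_topology P3) euclidean projector"
  unfolding continuous_map
proof (intro conjI allI impI)
  fix T :: "(nat \<times> nat \<Rightarrow> complex) set" assume "openin euclidean T"
  hence T: "open T" by simp
  show "openin (manifold_topology P3) {x \<in> topspace (manifold_topology P3). projector x \<in> T}"
    unfolding openin_P3 topspace_P3
  proof (intro conjI allI impI)
    fix i :: nat assume i: "i < 4"
    have eq: "projector (line (homog i \<zeta>)) (p, q) = homog i \<zeta> p * cnj (homog i \<zeta> q) / (\<Sum>k<4. homog i \<zeta> k * cnj (homog i \<zeta> k))" for \<zeta> p q
      by (rule projector_line[OF homog_Cn[OF i] homog_nonzero])
    have c: "continuous_on (Cn 3) (\<lambda>\<zeta>. homog i \<zeta> k)" for k
      by (rule nice_continuous[OF nice_homog[OF openin_Cn]])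
    have nz: "(\<Sum>k<4. homog i \<zeta> k * cnj (homog i \<zeta> k)) \<noteq> 0" for \<zeta>
      using norm_sum_nonzero[OF homog_Cn[OF i] homog_nonzero, of \<zeta>] by (metis less_irrefl of_real_eq_0_iff)
    have "continuous_on (Cn 3) (\<lambda>\<zeta>. projector (line (homog i \<zeta>)))"
    proof (rule continuous_on_coordinatewise_then_product)
      fix pq :: "nat \<times> nat"
      obtain p q where pq: "pq = (p, q)" by (cases pq)
      show "continuous_on (Cn 3) (\<lambda>\<zeta>. projector (line (homog i \<zeta>)) pq)"
        unfolding pq eq by (intro continuous_intros c) (use nz in simp)
    qed
    from continuous_openin_preimage_gen[OF this T]
    have "openin (Cn_topology 3) (Cn 3 \<inter> (\<lambda>\<zeta>. projector (line (homog i \<zeta>))) -` T)"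
      unfolding Cn_topology_def .
    also have "Cn 3 \<inter> (\<lambda>\<zeta>. projector (line (homog i \<zeta>))) -` T = {\<zeta> \<in> Cn 3. line (homog i \<zeta>) \<in> {x \<in> points P3. projector x \<in> T}}"
      using homog_Cn[OF i] homog_nonzero unfolding P3_def by auto
    finally show "openin (Cn_topology 3) {\<zeta> \<in> Cn 3. line (homog i \<zeta>) \<in> {x \<in> points P3. projector x \<in> T}}" .
  qed auto
qed simp

lemma P3_manifold: "compact_complex_manifold P3"
proof -
  let ?T = "manifold_topology P3"
  have inj: "inj_on projector (topspace ?T)" using projector_inj by (simp add: topspace_P3)
  have cont: "continuous_map ?T (subtopology euclidean (projector ` topspace ?T)) projector"
    using projector_continuous by (simp add: continuous_map_in_subtopology)
  have "Hausdorff_space ?T"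
    using Hausdorff_space_injective_preimage[OF Hausdorff_space_euclidean projector_continuous inj] .
  \<comment> \<open>A continuous injection from a compact space into a Hausdorff space is a
    homeomorphism onto its image.\<close>
  moreover have "homeomorphic_map ?T (subtopology euclidean (projector ` topspace ?T)) projector"
    by (rule continuous_imp_homeomorphic_map[OF cont compact_P3 Hausdorff_space_subtopology[OF Hausdorff_space_euclidean] _ inj]) simp
  hence "?T homeomorphic_space subtopology euclidean (projector ` topspace ?T)"
    by (rule homeomorphic_map_imp_homeomorphic_space)
  moreover have "second_countable (subtopology euclidean (projector ` topspace ?T))"
  proof (rule second_countable_subtopology)
    obtain B :: "(nat \<times> nat \<Rightarrow> complex) set set" where B: "countable B" "topological_basis B"
      using ex_countable_basis by blast
    show "second_countable (euclidean :: (nat \<times> nat \<Rightarrow> complex) topology)"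
      unfolding second_countable_def
    proof (intro exI[of _ B] conjI ballI allI impI)
      fix U :: "(nat \<times> nat \<Rightarrow> complex) set" and x assume "openin euclidean U \<and> x \<in> U"
      thus "\<exists>V\<in>B. x \<in> V \<and> V \<subseteq> U" using B(2) topological_basisE by (metis open_openin)
    qed (use B topological_basis_open in auto)
  qed
  ultimately have top: "Hausdorff_space ?T" "second_countable ?T"
    using homeomorphic_space_second_countability by blast+
  have "complex_manifold P3"
    unfolding complex_manifold_def
  proof (intro conjI top)
    show "(\<Union>(D, \<phi>)\<in>atlas P3. D) = points P3"
    proof (intro equalityI subsetI)
      fix L assume "L \<in> points P3"
      then obtain i \<zeta> where "i < 4" "L = line (homog i \<zeta>)" using P3_cover by metis
      thus "L \<in> (\<Union>(D, \<phi>)\<in>atlas P3. D)" using line_homog_in_domain unfolding P3_def by auto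
    qed (use P3_domain_subset in \<open>auto simp: P3_def\<close>)
    show "\<forall>(D, \<phi>)\<in>atlas P3. inj_on \<phi> D \<and> openin (Cn_topology (cdim P3)) (\<phi> ` D)"
      unfolding P3_def using P3_coord_inj P3_coord_image_domain openin_Cn by auto
    have ov: "openin (Cn_topology 3) (P3_coord i ` (P3_domain i \<inter> P3_domain j))"
      "\<forall>k<3. holomorphic_Cn 3 (P3_coord i ` (P3_domain i \<inter> P3_domain j)) (in_chart (P3_domain i, P3_coord i) (\<lambda>x. P3_coord j x k))"
      if i: "i < 4" and j: "j < 4" for i j
    proof -
      have im: "P3_coord i ` (P3_domain i \<inter> P3_domain j) = {\<zeta> \<in> Cn 3. homog i \<zeta> j \<noteq> 0}"
        using P3_coord_image_overlap[OF i, of j] by (simp add: Int_commute)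
      show "openin (Cn_topology 3) (P3_coord i ` (P3_domain i \<inter> P3_domain j))"
        unfolding im by (rule openin_homog_nonzero)
      show "\<forall>k<3. holomorphic_Cn 3 (P3_coord i ` (P3_domain i \<inter> P3_domain j)) (in_chart (P3_domain i, P3_coord i) (\<lambda>x. P3_coord j x k))"
        unfolding im
      proof (intro allI impI)
        fix k :: nat assume k: "k < 3"
        show "holomorphic_Cn 3 {\<zeta> \<in> Cn 3. homog i \<zeta> j \<noteq> 0} (in_chart (P3_domain i, P3_coord i) (\<lambda>x. P3_coord j x k))"
        proof (rule nice_holomorphic_Cn)
          show "nice 3 {\<zeta> \<in> Cn 3. homog i \<zeta> j \<noteq> 0} (\<lambda>\<zeta>. homog i \<zeta> (skip j k) / homog i \<zeta> j)"
            by (intro nice_divide nice_homog openin_homog_nonzero) auto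
          show "homog i \<zeta> (skip j k) / homog i \<zeta> j = in_chart (P3_domain i, P3_coord i) (\<lambda>x. P3_coord j x k) \<zeta>"
            if "\<zeta> \<in> {\<zeta> \<in> Cn 3. homog i \<zeta> j \<noteq> 0}" for \<zeta>
            using that k by (simp add: in_chart_P3[OF i] P3_coord_line[OF homog_Cn[OF i]])
        qed
      qed
    qed
    show "\<forall>(D, \<phi>)\<in>atlas P3. \<forall>(D', \<phi>')\<in>atlas P3.
        openin (Cn_topology (cdim P3)) (\<phi> ` (D \<inter> D')) \<and>
        (\<forall>k<cdim P3. holomorphic_Cn (cdim P3) (\<phi> ` (D \<inter> D')) (in_chart (D, \<phi>) (\<lambda>x. \<phi>' x k)))"
      unfolding P3_def using ov by auto
  qed
  thus ?thesis unfolding compact_complex_manifold_def using compact_P3 by blast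
qed

section \<open>The null-correlation bundle\<close>

text \<open>The index that the symplectic form pairs with i: 0 with 1, and 2 with 3.\<close>

definition partner :: "nat \<Rightarrow> nat" where
  "partner i = (if even i then Suc i else i - 1)"

text \<open>The two indices of the other symplectic pair. Together with i and its partner they
  exhaust the four coordinates; modulo z they are the coordinates of the symplectic complement where
  z i does not vanish.\<close>

definition fidx :: "nat \<Rightarrow> nat \<Rightarrow> nat" where
  "fidx i \<gamma> = (if i < 2 then 2 + \<gamma> else \<gamma>)"

definition sform :: "(nat \<Rightarrow> complex) \<Rightarrow> (nat \<Rightarrow> complex) \<Rightarrow> complex" where
  "sform z w = z 0 * w 1 - z 1 * w 0 + z 2 * w 3 - z 3 * w 2"

text \<open>The vector of the symplectic complement of z with i-th entry 0 and entries z i * v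
  \<gamma> at \<open>fidx i \<gamma>\<close>; orthogonality to z determines the partner entry. The
  factor z i clears the denominator, which makes the map bilinear in z and v.\<close>

definition lift :: "nat \<Rightarrow> (nat \<Rightarrow> complex) \<Rightarrow> (nat \<Rightarrow> complex) \<Rightarrow> nat \<Rightarrow> complex" where
  "lift i z v k =
     (if k = partner i then (if even i then - 1 else 1) * (z (fidx i 0) * v 1 - z (fidx i 1) * v 0)
      else if k = fidx i 0 then z i * v 0 else if k = fidx i 1 then z i * v 1 else 0)"

text \<open>Coordinates of the class of w modulo z: the representative with i-th entry 0 is formed
  and its free entries are read.\<close>

definition quot :: "nat \<Rightarrow> (nat \<Rightarrow> complex) \<Rightarrow> (nat \<Rightarrow> complex) \<Rightarrow> nat \<Rightarrow> complex" where
  "quot i z w \<gamma> = w (fidx i \<gamma>) - w i * z (fidx i \<gamma>) / z i"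

definition std_vec :: "nat \<Rightarrow> nat \<Rightarrow> complex" where
  "std_vec \<beta> \<gamma> = (if \<gamma> = \<beta> then 1 else 0)"

text \<open>Division by z j compensates the factor built into \<open>lift j\<close>.\<close>

definition transition :: "nat \<Rightarrow> nat \<Rightarrow> (nat \<Rightarrow> complex) \<Rightarrow> nat \<Rightarrow> nat \<Rightarrow> complex" where
  "transition i j z \<alpha> \<beta> = quot i z (lift j z (std_vec \<beta>)) \<alpha> / z j"

lemma index_cases: "i < (4::nat) \<Longrightarrow> i = 0 \<or> i = 1 \<or> i = 2 \<or> i = 3"
  by auto

lemma less_two_cases: "\<gamma> < (2::nat) \<Longrightarrow> \<gamma> = 0 \<or> \<gamma> = 1"
  by auto

lemma partner_simps [simp]: "partner 0 = 1" "partner (Suc 0) = 0" "partner 2 = 3" "partner 3 = 2"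
  by (simp_all add: partner_def)

lemma fidx_simps [simp]:
  "fidx 0 0 = 2" "fidx (Suc 0) 0 = 2" "fidx 2 0 = 0" "fidx 3 0 = 0"
  "fidx 0 (Suc 0) = 3" "fidx (Suc 0) (Suc 0) = 3" "fidx 2 (Suc 0) = Suc 0" "fidx 3 (Suc 0) = Suc 0"
  by (simp_all add: fidx_def eval_nat_numeral)

lemma lift_simps [simp]:
  "lift 0 z v 0 = 0" "lift 0 z v (Suc 0) = z 3 * v 0 - z 2 * v 1" "lift 0 z v 2 = z 0 * v 0" "lift 0 z v 3 = z 0 * v 1"
  "lift (Suc 0) z v 0 = z 2 * v 1 - z 3 * v 0" "lift (Suc 0) z v (Suc 0) = 0" "lift (Suc 0) z v 2 = z 1 * v 0" "lift (Suc 0) z v 3 = z 1 * v 1"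
  "lift 2 z v 0 = z 2 * v 0" "lift 2 z v (Suc 0) = z 2 * v 1" "lift 2 z v 2 = 0" "lift 2 z v 3 = z 1 * v 0 - z 0 * v 1"
  "lift 3 z v 0 = z 3 * v 0" "lift 3 z v (Suc 0) = z 3 * v 1" "lift 3 z v 2 = z 0 * v 1 - z 1 * v 0" "lift 3 z v 3 = 0"
  by (simp_all add: lift_def)

lemma fidx_less: "\<gamma> < 2 \<Longrightarrow> fidx i \<gamma> < 4"
  by (simp add: fidx_def)

text \<open>The relation \<open>sform z (lift i z v) = 0\<close> is quadratic in z; this is its
  polarization. It serves as the derivative of the isotropy condition in a base direction x.\<close>

lemma sform_lift_polar: "i < 4 \<Longrightarrow> sform z (lift i x v) + sform x (lift i z v) = 0"
  by (drule index_cases) (elim disjE; simp add: sform_def algebra_simps)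

lemma sform_lift: "i < 4 \<Longrightarrow> sform z (lift i z v) = 0"
  using sform_lift_polar[of i z z v] by simp

lemma lift_i: "i < 4 \<Longrightarrow> lift i z v i = 0"
  by (drule index_cases) (elim disjE; simp)

lemma lift_fidx: "i < 4 \<Longrightarrow> \<gamma> < 2 \<Longrightarrow> lift i z v (fidx i \<gamma>) = z i * v \<gamma>"
  by (drule index_cases, drule less_two_cases) (elim disjE; simp)

lemma quot_lift: "i < 4 \<Longrightarrow> \<gamma> < 2 \<Longrightarrow> quot i z (lift i z v) \<gamma> = z i * v \<gamma>"
  unfolding quot_def by (simp add: lift_i lift_fidx)

lemma lift_cong: "(\<And>\<gamma>. \<gamma> < 2 \<Longrightarrow> v \<gamma> = v' \<gamma>) \<Longrightarrow> lift i z v = lift i z v'"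
  unfolding lift_def by (auto simp: fun_eq_iff)

lemma lift_scale: "lift i z (\<lambda>\<gamma>. c * v \<gamma>) = (\<lambda>k. c * lift i z v k)"
  unfolding lift_def by (auto simp: fun_eq_iff algebra_simps)

lemma lift_scale_left: "lift i (\<lambda>k. c * z k) v = (\<lambda>k. c * lift i z v k)"
  unfolding lift_def by (auto simp: fun_eq_iff algebra_simps)

lemma lift_linear: "lift i z v k = lift i z (std_vec 0) k * v 0 + lift i z (std_vec 1) k * v 1"
  unfolding lift_def std_vec_def by (simp add: algebra_simps)

lemma quot_scale: "quot i z (\<lambda>k. c * w k) \<gamma> = c * quot i z w \<gamma>"
  unfolding quot_def by (simp add: algebra_simps)

lemma quot_scale_left: "c \<noteq> 0 \<Longrightarrow> quot i (\<lambda>k. c * z k) w \<gamma> = quot i z w \<gamma>"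
  unfolding quot_def by simp

lemma quot_shift: "z i \<noteq> 0 \<Longrightarrow> quot i z (\<lambda>k. w k + c * z k) \<gamma> = quot i z w \<gamma>"
  unfolding quot_def by (simp add: field_simps)

text \<open>\<open>lift\<close> returns z i times the representative with i-th entry 0. In the
  partner entry the agreement comes from w lying in the symplectic complement, elsewhere from the
  definitions.\<close>

lemma lift_quot:
  assumes "i < 4" "z i \<noteq> 0" "sform z w = 0" "k < 4"
  shows "lift i z (quot i z w) k = z i * w k - w i * z k"
proof -
  have "lift i z (quot i z w) (partner i) = z i * w (partner i) - w i * z (partner i)"
    using index_cases[OF assms(1)] assms(3)
    by (elim disjE; simp add: quot_def sform_def; simp add: algebra_simps; algebra)
  moreover have "k = partner i \<or> k = i \<or> (\<exists>\<gamma><2. k = fidx i \<gamma>)"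
    using index_cases[OF assms(1)] index_cases[OF assms(4)]
    by (elim disjE; simp add: less_2_cases_iff ex_disj_distrib conj_disj_distribR)
  moreover have "lift i z (quot i z w) (fidx i \<gamma>) = z i * w (fidx i \<gamma>) - w i * z (fidx i \<gamma>)" if "\<gamma> < 2" for \<gamma>
    using assms(2) that by (simp add: lift_fidx[OF assms(1) that] quot_def right_diff_distrib)
  ultimately show ?thesis using lift_i[OF assms(1)] by (auto simp: mult.commute)
qed

lemma quot_cong: "i < 4 \<Longrightarrow> \<gamma> < 2 \<Longrightarrow> (\<And>k. k < 4 \<Longrightarrow> w k = w' k) \<Longrightarrow> quot i z w \<gamma> = quot i z w' \<gamma>"
  unfolding quot_def using fidx_less by simp

text \<open>The symplectic form descends to z\<bottom>/z, and with i-th entries normalized to 0 only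
  the pair of free coordinates contributes. So every frame is unimodular for one and the same area
  form.\<close>

lemma sform_quot:
  assumes "i < 4" "z i \<noteq> 0" "sform z w = 0" "sform z w' = 0"
  shows "quot i z w 0 * quot i z w' 1 - quot i z w 1 * quot i z w' 0 = sform w w'"
proof -
  obtain r r' where r: "w i = r * z i" "w' i = r' * z i"
    using assms(2) by (metis nonzero_eq_divide_eq)
  have q: "quot i z w \<gamma> = w (fidx i \<gamma>) - r * z (fidx i \<gamma>)" "quot i z w' \<gamma> = w' (fidx i \<gamma>) - r' * z (fidx i \<gamma>)" for \<gamma>
    unfolding quot_def r using assms(2) by simp_all
  have "quot i z w 0 * quot i z w' 1 - quot i z w 1 * quot i z w' 0 =
      sform (\<lambda>k. w k - r * z k) (\<lambda>k. w' k - r' * z k)"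
    unfolding q using index_cases[OF assms(1)] r by (elim disjE; simp add: sform_def)
  also have "\<dots> = sform w w' + r' * sform z w - r * sform z w'"
    unfolding sform_def by (simp add: algebra_simps)
  finally show ?thesis using assms(3,4) by simp
qed

lemma transition_sum: "(\<Sum>\<beta><2. transition i j z \<alpha> \<beta> * v \<beta>) = quot i z (lift j z v) \<alpha> / z j"
proof -
  have "(\<Sum>\<beta><2. transition i j z \<alpha> \<beta> * v \<beta>) = transition i j z \<alpha> 0 * v 0 + transition i j z \<alpha> 1 * v 1"
    by (simp add: numeral_2_eq_2)
  also have "\<dots> = quot i z (lift j z v) \<alpha> / z j"
    unfolding transition_def quot_def lift_linear[of j z v] by (simp add: field_simps add_divide_distrib diff_divide_distrib)
  finally show ?thesis .
qed

lemma quot_lift_quot: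
  assumes "i < 4" "j < 4" "z j \<noteq> 0" "z i \<noteq> 0" "sform z w = 0" "\<gamma> < 2"
  shows "quot i z (lift j z (quot j z w)) \<gamma> / z j = quot i z w \<gamma>"
proof -
  have "quot i z (lift j z (quot j z w)) \<gamma> = quot i z (\<lambda>k. z j * w k + (- w j) * z k) \<gamma>"
    using assms by (intro quot_cong) (simp_all add: lift_quot)
  also have "\<dots> = z j * quot i z w \<gamma>"
    using quot_shift[of z i "\<lambda>k. z j * w k" "- w j"] assms(4) quot_scale by simp
  finally show ?thesis using assms(3) by simp
qed

lemma transition_scale: "c \<noteq> 0 \<Longrightarrow> transition i j (\<lambda>k. c * z k) = transition i j z"
  unfolding transition_def lift_scale_left quot_scale quot_scale_left by (simp add: fun_eq_iff quot_scale_left)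

lemma transition_self: "i < 4 \<Longrightarrow> z i \<noteq> 0 \<Longrightarrow> \<alpha> < 2 \<Longrightarrow> transition i i z \<alpha> \<beta> = std_vec \<beta> \<alpha>"
  unfolding transition_def by (simp add: quot_lift)

lemma transition_compose:
  assumes "i < 4" "j < 4" "k < 4" "z i \<noteq> 0" "z j \<noteq> 0" "\<alpha> < 2"
  shows "(\<Sum>\<beta><2. transition i j z \<alpha> \<beta> * transition j k z \<beta> \<gamma>) = transition i k z \<alpha> \<gamma>"
proof -
  have "(\<Sum>\<beta><2. transition i j z \<alpha> \<beta> * transition j k z \<beta> \<gamma>) =
      quot i z (lift j z (\<lambda>\<beta>. transition j k z \<beta> \<gamma>)) \<alpha> / z j" by (rule transition_sum)
  also have "(\<lambda>\<beta>. transition j k z \<beta> \<gamma>) = (\<lambda>\<beta>. (1 / z k) * quot j z (lift k z (std_vec \<gamma>)) \<beta>)"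
    by (simp add: transition_def)
  also have "quot i z (lift j z \<dots>) \<alpha> / z j = (1 / z k) * (quot i z (lift j z (quot j z (lift k z (std_vec \<gamma>)))) \<alpha> / z j)"
    unfolding lift_scale quot_scale by simp
  also have "\<dots> = (1 / z k) * quot i z (lift k z (std_vec \<gamma>)) \<alpha>"
    by (rule arg_cong[where f = "\<lambda>t. (1 / z k) * t"], rule quot_lift_quot) (use assms in \<open>auto simp: sform_lift\<close>)
  finally show ?thesis by (simp add: transition_def)
qed

text \<open>The areas of the lifted basis vectors agree in the frames i and j and equal (z j)^2,
  which the two divisions by z j cancel.\<close>

lemma transition_det:
  assumes "i < 4" "j < 4" "z i \<noteq> 0" "z j \<noteq> 0"
  shows "transition i j z 0 0 * transition i j z 1 1 - transition i j z 1 0 * transition i j z 0 1 = 1"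
proof -
  have "quot i z (lift j z (std_vec 0)) 0 * quot i z (lift j z (std_vec 1)) 1 -
      quot i z (lift j z (std_vec 0)) 1 * quot i z (lift j z (std_vec 1)) 0 =
      sform (lift j z (std_vec 0)) (lift j z (std_vec 1))"
    using assms by (intro sform_quot) (auto simp: sform_lift)
  also have "\<dots> = quot j z (lift j z (std_vec 0)) 0 * quot j z (lift j z (std_vec 1)) 1 -
      quot j z (lift j z (std_vec 0)) 1 * quot j z (lift j z (std_vec 1)) 0"
    using assms by (intro sform_quot[symmetric]) (auto simp: sform_lift)
  also have "\<dots> = z j * z j" using assms(2) by (simp add: quot_lift std_vec_def)
  finally show ?thesis unfolding transition_def using assms(4) by (simp add: field_simps)
qed

text \<open>E is given by the inverse transposes of the transition matrices of z\<bottom>/z, so that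
  its dual has literally the entries of \<open>transition\<close>. The cover is indexed by all
  natural numbers, hence empty from 4 on.\<close>

definition NC :: "((nat \<Rightarrow> complex) set, nat, nat) vbundle" where
  "NC = \<lparr> frame = {..<2}, cover = (\<lambda>i. if i < 4 then P3_domain i else {}),
     cocycle = (\<lambda>i j x \<alpha> \<beta>. transition j i (rep x) \<beta> \<alpha>) \<rparr>"

lemma transition_rep:
  assumes "z \<in> Cn 4" "z \<noteq> (\<lambda>_. 0)"
  shows "transition i j (rep (line z)) = transition i j z"
proof -
  obtain c where "c \<noteq> 0" "rep (line z) = (\<lambda>k. c * z k)" using rep_line[OF assms] .
  thus ?thesis using transition_scale by simp
qed

lemma nice_lift:
  assumes "openin (Cn_topology n) U" "\<And>k. nice n U (\<lambda>\<zeta>. Z \<zeta> k)" "\<And>\<gamma>. nice n U (\<lambda>\<zeta>. V \<zeta> \<gamma>)"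
  shows "nice n U (\<lambda>\<zeta>. lift i (Z \<zeta>) (V \<zeta>) k)"
  unfolding lift_def by (intro nice_if nice_mult nice_diff nice_const assms)

lemma nice_quot:
  assumes "\<And>k. nice n U (\<lambda>\<zeta>. Z \<zeta> k)" "\<And>k. nice n U (\<lambda>\<zeta>. W \<zeta> k)" "\<And>\<zeta>. \<zeta> \<in> U \<Longrightarrow> Z \<zeta> i \<noteq> 0"
  shows "nice n U (\<lambda>\<zeta>. quot i (Z \<zeta>) (W \<zeta>) \<gamma>)"
  unfolding quot_def by (intro nice_diff nice_mult nice_divide assms)

lemma P3_coord_image_overlap2:
  "m < 4 \<Longrightarrow> P3_coord m ` (P3_domain i \<inter> P3_domain j \<inter> P3_domain m) =
     {\<zeta> \<in> {\<zeta> \<in> Cn 3. homog m \<zeta> i \<noteq> 0}. homog m \<zeta> j \<noteq> 0}"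
  by (auto simp: P3_coord_image line_in_P3_domain homog_Cn homog_nonzero)

lemma NC_bundle: "holomorphic_vbundle P3 NC"
  unfolding holomorphic_vbundle_def
proof (intro conjI allI ballI)
  show "finite (frame NC)" "frame NC \<noteq> {}" unfolding NC_def by (auto simp: lessThan_empty_iff)
  show "openin (manifold_topology P3) (cover NC i)" for i
    unfolding NC_def by (simp add: openin_P3_domain)
  show "(\<Union>i. cover NC i) = points P3"
  proof (intro equalityI subsetI)
    fix x assume "x \<in> points P3"
    then obtain i \<zeta> where "i < 4" "\<zeta> \<in> Cn 3" "\<And>k. cmod (\<zeta> k) \<le> 1" "x = line (homog i \<zeta>)"
      by (rule P3_cover) (rule that)
    thus "x \<in> (\<Union>i. cover NC i)" using line_homog_in_domain unfolding NC_def by auto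
  qed (use P3_domain_subset in \<open>auto simp: NC_def split: if_splits\<close>)
next
  fix i j \<alpha> \<beta>
  show "holomorphic_fun P3 (cover NC i \<inter> cover NC j) (\<lambda>x. cocycle NC i j x \<alpha> \<beta>)"
    unfolding holomorphic_fun_def
  proof (clarify)
    fix D \<phi> assume "(D, \<phi>) \<in> atlas P3"
    then obtain m where m: "m < 4" "D = P3_domain m" "\<phi> = P3_coord m" unfolding P3_def by auto
    have "holomorphic_Cn 3 (\<phi> ` (cover NC i \<inter> cover NC j \<inter> D)) (in_chart (D, \<phi>) (\<lambda>x. cocycle NC i j x \<alpha> \<beta>))"
    proof (cases "i < 4 \<and> j < 4")
      case True
      define U where "U = {\<zeta> \<in> {\<zeta> \<in> Cn 3. homog m \<zeta> i \<noteq> 0}. homog m \<zeta> j \<noteq> 0}"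
      have U: "openin (Cn_topology 3) U"
        unfolding U_def
        by (rule openin_nonzero[OF openin_homog_nonzero nice_continuous[OF nice_homog[OF openin_homog_nonzero]]])
      have im: "\<phi> ` (cover NC i \<inter> cover NC j \<inter> D) = U"
        unfolding U_def m NC_def using P3_coord_image_overlap2[OF m(1)] True by simp
      show ?thesis unfolding im
      proof (rule nice_holomorphic_Cn)
        show "nice 3 U (\<lambda>\<zeta>. transition j i (homog m \<zeta>) \<beta> \<alpha>)"
          unfolding transition_def
          by (intro nice_divide nice_quot nice_lift nice_homog nice_const U) (auto simp: U_def)
        show "transition j i (homog m \<zeta>) \<beta> \<alpha> = in_chart (D, \<phi>) (\<lambda>x. cocycle NC i j x \<alpha> \<beta>) \<zeta>" if "\<zeta> \<in> U" for \<zeta>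
          using that unfolding U_def m by (simp add: in_chart_P3[OF m(1)] NC_def transition_rep homog_Cn m(1) homog_nonzero)
      qed
    next
      case False
      hence "cover NC i \<inter> cover NC j = {}" unfolding NC_def by auto
      thus ?thesis unfolding holomorphic_Cn_def by simp
    qed
    thus "holomorphic_Cn (cdim P3) (\<phi> ` (cover NC i \<inter> cover NC j \<inter> D)) (in_chart (D, \<phi>) (\<lambda>x. cocycle NC i j x \<alpha> \<beta>))"
      unfolding P3_def by simp
  qed
next
  fix i x \<alpha> \<beta> assume x: "x \<in> cover NC i" and a: "\<alpha> \<in> frame NC" "\<beta> \<in> frame NC"
  then obtain z where z: "i < 4" "z \<in> Cn 4" "z i \<noteq> 0" "x = line z"
    unfolding NC_def P3_domain_def by (auto split: if_splits)
  have "z \<noteq> (\<lambda>_. 0)" using z(3) by auto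
  thus "cocycle NC i i x \<alpha> \<beta> = (if \<alpha> = \<beta> then 1 else 0)"
    using z a by (simp add: NC_def transition_rep transition_self std_vec_def)
next
  fix i j k x \<alpha> \<gamma> assume x: "x \<in> cover NC i \<inter> cover NC j \<inter> cover NC k" and a: "\<alpha> \<in> frame NC" "\<gamma> \<in> frame NC"
  then obtain z where z: "i < 4" "z \<in> Cn 4" "z i \<noteq> 0" "x = line z"
    unfolding NC_def P3_domain_def by (auto split: if_splits)
  have nz: "z \<noteq> (\<lambda>_. 0)" using z(3) by auto
  have jk: "j < 4" "k < 4" "z j \<noteq> 0" "z k \<noteq> 0"
    using x line_in_P3_domain[OF z(2) nz] unfolding NC_def z(4) by (auto split: if_splits)
  show "cocycle NC i k x \<alpha> \<gamma> = (\<Sum>\<beta>\<in>frame NC. cocycle NC i j x \<alpha> \<beta> * cocycle NC j k x \<beta> \<gamma>)"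
    using transition_compose[of k j i z \<gamma> \<alpha>] z jk a
    by (simp add: NC_def transition_rep[OF z(2) nz] mult.commute)
qed

section \<open>Tangent directions of positive curvature\<close>

definition ip :: "(nat \<Rightarrow> complex) \<Rightarrow> (nat \<Rightarrow> complex) \<Rightarrow> complex" where
  "ip x y = (\<Sum>k<4. x k * cnj (y k))"

definition wedge :: "(nat \<Rightarrow> complex) \<Rightarrow> (nat \<Rightarrow> complex) \<Rightarrow> nat \<times> nat \<Rightarrow> complex" where
  "wedge x y = (\<lambda>(k, l). x k * y l - x l * y k)"

abbreviation I2 :: "(nat \<times> nat) set" where "I2 \<equiv> {..<4} \<times> {..<4}"

text \<open>The quaternionic structure of \<complex>^4 as a quaternionic plane: antilinear, with
  square -1, and turning the symplectic form into the Hermitian product.\<close>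

definition qconj :: "(nat \<Rightarrow> complex) \<Rightarrow> nat \<Rightarrow> complex" where
  "qconj x k = (if k = 0 then - cnj (x 1) else if k = 1 then cnj (x 0)
     else if k = 2 then - cnj (x 3) else if k = 3 then cnj (x 2) else 0)"

lemma sum4: "(\<Sum>k<4. f k) = f 0 + f 1 + f 2 + f (3::nat)" for f :: "nat \<Rightarrow> complex"
  by (simp add: eval_nat_numeral)

lemma ip_add: "ip (\<lambda>k. x k + y k) z = ip x z + ip y z" "ip z (\<lambda>k. x k + y k) = ip z x + ip z y"
  unfolding ip_def by (simp_all add: algebra_simps sum.distrib)

lemma ip_scale: "ip (\<lambda>k. c * x k) z = c * ip x z" "ip z (\<lambda>k. c * x k) = cnj c * ip z x"
  unfolding ip_def by (simp_all add: algebra_simps sum_distrib_left)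

lemma ip_diff: "ip (\<lambda>k. x k - y k) z = ip x z - ip y z" "ip z (\<lambda>k. x k - y k) = ip z x - ip z y"
  unfolding ip_def by (simp_all add: algebra_simps sum_subtractf)

lemma ip_cnj: "cnj (ip x y) = ip y x"
  unfolding ip_def by (simp add: mult.commute)

lemma ip_qconj: "ip y (qconj x) = sform x y" "ip (qconj x) y = cnj (sform x y)" "ip (qconj x) (qconj y) = ip y x"
  unfolding ip_def sum4 qconj_def sform_def by (simp_all add: algebra_simps)

lemma sform_qconj: "sform z (qconj w) = ip z w" "sform (qconj w) z = - ip z w"
  unfolding ip_def sum4 qconj_def sform_def by (simp_all add: algebra_simps)

lemma sform_simps: "sform x x = 0" "sform y x = - sform x y"
  "sform x (\<lambda>k. y k + z k) = sform x y + sform x z" "sform x (\<lambda>k. y k - z k) = sform x y - sform x z"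
  "sform x (\<lambda>k. c * y k) = c * sform x y" "sform (\<lambda>k. y k + z k) x = sform y x + sform z x"
  "sform (\<lambda>k. y k - z k) x = sform y x - sform z x" "sform (\<lambda>k. c * y k) x = c * sform y x"
  unfolding sform_def by (simp_all add: algebra_simps)

lemma ip_pos:
  assumes "k < 4" "x k \<noteq> 0"
  shows "ip x x = of_real (\<Sum>k<4. (cmod (x k))\<^sup>2)" "0 < (\<Sum>k<4. (cmod (x k))\<^sup>2)"
proof -
  show "ip x x = of_real (\<Sum>k<4. (cmod (x k))\<^sup>2)"
    unfolding ip_def of_real_sum cnj_mult_self[symmetric] by (simp add: mult.commute)
  show "0 < (\<Sum>k<4. (cmod (x k))\<^sup>2)" using assms by (intro sum_pos2[of _ k]) auto
qed

text \<open>The Cauchy-Binet identity; the factor 2 appears because the sum runs over ordered pairs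
  of indices.\<close>

lemma wedge_ip:
  "(\<Sum>j\<in>I2. wedge x y j * cnj (wedge x' y' j)) = 2 * (ip x x' * ip y y' - ip x y' * ip y x')"
proof -
  have 1: "ip a b * ip c d = (\<Sum>k<4. \<Sum>l<4. a k * cnj (b k) * (c l * cnj (d l)))" for a b c d
    unfolding ip_def sum_product ..
  have 2: "ip a b * ip c d = (\<Sum>k<4. \<Sum>l<4. a l * cnj (b l) * (c k * cnj (d k)))" for a b c d
    unfolding 1 by (rule sum.swap)
  have "(\<Sum>j\<in>I2. wedge x y j * cnj (wedge x' y' j)) =
      (\<Sum>k<4. \<Sum>l<4. (x k * y l - x l * y k) * cnj (x' k * y' l - x' l * y' k))"
    unfolding wedge_def sum.cartesian_product by (simp add: split_def)
  also have "\<dots> = (\<Sum>k<4. \<Sum>l<4. x k * cnj (x' k) * (y l * cnj (y' l)) - x k * cnj (y' k) * (y l * cnj (x' l))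
      - x l * cnj (y' l) * (y k * cnj (x' k)) + x l * cnj (x' l) * (y k * cnj (y' k)))"
    by (intro sum.cong refl) (simp add: algebra_simps)
  also have "\<dots> = ip x x' * ip y y' - ip x y' * ip y x' - ip x y' * ip y x' + ip x x' * ip y y'"
    unfolding sum.distrib sum_subtractf 1[symmetric] 2[symmetric] ..
  finally show ?thesis by simp
qed

lemma fubini_study_orthogonal:
  assumes "(\<Sum>j\<in>J. y j * cnj (x j)) = 0" "(\<Sum>j\<in>J. x j * cnj (x j)) \<noteq> 0"
  shows "fubini_study J x y = (\<Sum>j\<in>J. y j * cnj (y j)) / (\<Sum>j\<in>J. x j * cnj (x j))"
  unfolding fubini_study_def assms(1) using assms(2) by (simp add: power2_eq_square)

text \<open>Strict Cauchy-Schwarz: the entries i and j show that y is no multiple of x, so its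
  component orthogonal to x is nonzero.\<close>

lemma fubini_study_pos:
  assumes fin: "finite J" and j: "i \<in> J" "j \<in> J" "x i \<noteq> 0" "y i = 0" "y j \<noteq> 0"
  shows "0 < Re (fubini_study J x y)"
proof -
  have nrm: "(\<Sum>j\<in>J. f j * cnj (f j)) = of_real (\<Sum>j\<in>J. (cmod (f j))\<^sup>2)" for f :: "'a \<Rightarrow> complex"
    unfolding of_real_sum cnj_mult_self[symmetric] by (simp add: mult.commute)
  define X where "X = (\<Sum>j\<in>J. (cmod (x j))\<^sup>2)"
  have X: "X > 0" unfolding X_def using fin j by (intro sum_pos2[of _ i]) auto
  define c where "c = (\<Sum>j\<in>J. y j * cnj (x j)) / of_real X"
  define y' where "y' = (\<lambda>j. y j + (- c) * x j)"
  have "(\<Sum>j\<in>J. y' j * cnj (x j)) = (\<Sum>j\<in>J. y j * cnj (x j)) - c * (\<Sum>j\<in>J. x j * cnj (x j))"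
    unfolding y'_def by (simp add: algebra_simps sum_subtractf sum_distrib_left)
  also have "\<dots> = 0" unfolding nrm X_def[symmetric] c_def using X by simp
  finally have orth: "(\<Sum>j\<in>J. y' j * cnj (x j)) = 0" .
  have "fubini_study J x y = fubini_study J x y'" unfolding y'_def by (rule fubini_study_shift[symmetric])
  also have "\<dots> = of_real (\<Sum>j\<in>J. (cmod (y' j))\<^sup>2) / of_real X"
    using fubini_study_orthogonal[OF orth] X unfolding nrm X_def[symmetric] by simp
  finally have eq: "fubini_study J x y = of_real ((\<Sum>j\<in>J. (cmod (y' j))\<^sup>2) / X)" by simp
  have "\<exists>k\<in>J. y' k \<noteq> 0"
  proof (rule ccontr)
    assume "\<not> ?thesis"
    hence "y' i = 0" "y' j = 0" using j by auto
    hence "c = 0" using j unfolding y'_def by simp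
    with \<open>y' j = 0\<close> j show False unfolding y'_def by simp
  qed
  then obtain k where "k \<in> J" "y' k \<noteq> 0" by blast
  hence "0 < (\<Sum>j\<in>J. (cmod (y' j))\<^sup>2)" using fin by (intro sum_pos2[of _ k]) auto
  thus ?thesis unfolding eq using X by simp
qed

text \<open>With \<open>w\<close> made orthogonal to \<open>z\<close>, the quaternionic structure \<open>j\<close> gives an orthogonal basis \<open>z, w, jz, jw\<close>;
  the two directions are \<open>(\<delta>z, \<delta>w) = (0, jw)\<close> and \<open>(jw, (|w|\<^sup>2/|z|\<^sup>2) jz)\<close>.\<close>

lemma positive_directions:
  assumes zw: "sform z w = 0" and nz: "k < 4" "l < 4" "wedge z w (k, l) \<noteq> 0"
  obtains x1 y1 x2 y2 where
    "sform x1 w + sform z y1 = 0" "sform x2 w + sform z y2 = 0"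
    "\<And>a b. a \<noteq> 0 \<or> b \<noteq> 0 \<Longrightarrow>
      0 < Re (fubini_study I2 (wedge z w) (\<lambda>j. a * (wedge x1 w j + wedge z y1 j) + b * (wedge x2 w j + wedge z y2 j))
         - fubini_study {..<4} z (\<lambda>k. a * x1 k + b * x2 k))"
proof -
  define n where "n = (\<Sum>k<4. (cmod (z k))\<^sup>2)"
  have "z k \<noteq> 0 \<or> z l \<noteq> 0" using nz(3) unfolding wedge_def by auto
  hence n: "ip z z = of_real n" "n > 0" using ip_pos nz unfolding n_def by blast+
  \<comment> \<open>The coefficient of the orthogonal projection of w to z; the wedge product with z
    does not notice its removal.\<close>
  define \<kappa> where "\<kappa> = ip w z / of_real n"
  define v where "v = (\<lambda>k. w k - \<kappa> * z k)"
  have vz: "ip v z = 0" unfolding v_def ip_diff ip_scale n(1) \<kappa>_def using n(2) by simp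
  hence zv: "ip z v = 0" using ip_cnj[of v z] by simp
  have sv: "sform z v = 0" unfolding v_def sform_simps(4,5) zw by (simp add: sform_simps(1))
  hence sv': "sform v z = 0" using sform_simps(2)[of v z] by simp
  have w: "w = (\<lambda>k. v k + \<kappa> * z k)" unfolding v_def by simp
  define m where "m = (\<Sum>k<4. (cmod (v k))\<^sup>2)"
  have "wedge z w (k, l) = z k * v l - z l * v k" unfolding w wedge_def by (simp add: algebra_simps)
  hence "v k \<noteq> 0 \<or> v l \<noteq> 0" using nz(3) by auto
  hence m: "ip v v = of_real m" "m > 0" using ip_pos nz unfolding m_def by blast+
  define r where "r = complex_of_real (m / n)"
  \<comment> \<open>The first summand, with r = |v|^2/|z|^2, balances the linearized isotropy
    condition, in which the direction jv contributes -|v|^2. The second cancels the cross terms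
    coming from the component \<kappa> z of w.\<close>
  define y2 where "y2 = (\<lambda>k. r * qconj z k + \<kappa> * qconj v k)"
  define A where "A = wedge z (qconj v)"
  define B where "B = wedge (qconj v) v"
  define C where "C = wedge z (qconj z)"
  have Aeq: "wedge (\<lambda>k. 0) w j + wedge z (qconj v) j = A j" for j
    unfolding A_def wedge_def by (simp add: split_def)
  have Beq: "wedge (qconj v) w j + wedge z y2 j = B j + r * C j" for j
    unfolding B_def C_def y2_def w wedge_def by (simp add: split_def algebra_simps)
  have P: "wedge z w = wedge z v" unfolding w wedge_def by (simp add: fun_eq_iff algebra_simps)
  \<comment> \<open>A, B and C are orthogonal to each other and to z \<and> v, so the Fubini-Study
    form reduces to quotients of squared norms.\<close>
  have orths: "(\<Sum>j\<in>I2. A j * cnj (wedge z v j)) = 0" "(\<Sum>j\<in>I2. B j * cnj (wedge z v j)) = 0"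
    "(\<Sum>j\<in>I2. C j * cnj (wedge z v j)) = 0" "(\<Sum>j\<in>I2. A j * cnj (B j)) = 0" "(\<Sum>j\<in>I2. B j * cnj (A j)) = 0"
    "(\<Sum>j\<in>I2. A j * cnj (C j)) = 0" "(\<Sum>j\<in>I2. C j * cnj (A j)) = 0"
    "(\<Sum>j\<in>I2. B j * cnj (C j)) = 0" "(\<Sum>j\<in>I2. C j * cnj (B j)) = 0"
    unfolding A_def B_def C_def wedge_ip ip_qconj by (simp_all add: vz zv sv sv' sform_simps(1) sform_qconj)
  have norms: "(\<Sum>j\<in>I2. A j * cnj (A j)) = of_real (2 * n * m)" "(\<Sum>j\<in>I2. B j * cnj (B j)) = of_real (2 * m * m)"
    "(\<Sum>j\<in>I2. C j * cnj (C j)) = of_real (2 * n * n)" "(\<Sum>j\<in>I2. wedge z v j * cnj (wedge z v j)) = of_real (2 * n * m)"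
    unfolding A_def B_def C_def wedge_ip ip_qconj by (simp_all add: vz zv sv sv' sform_simps(1) sform_qconj n(1) m(1))
  show ?thesis
  proof (rule that[of "\<lambda>k. 0" "qconj v" "qconj v" y2])
    show "sform (\<lambda>k. 0) w + sform z (qconj v) = 0"
      unfolding sform_qconj zv by (simp add: sform_def)
    have "ip w v = of_real m" unfolding w ip_add ip_scale zv m(1) by simp
    thus "sform (qconj v) w + sform z y2 = 0"
      unfolding y2_def sform_simps(3,5) sform_qconj zv n(1) r_def using n(2) by simp
    fix a b :: complex assume ab: "a \<noteq> 0 \<or> b \<noteq> 0"
    define D where "D = (\<lambda>j. a * (wedge (\<lambda>k. 0) w j + wedge z (qconj v) j) + b * (wedge (qconj v) w j + wedge z y2 j))"
    have D: "D = (\<lambda>j. a * A j + b * B j + b * r * C j)" unfolding D_def Aeq Beq by (simp add: algebra_simps)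
    have "(\<Sum>j\<in>I2. D j * cnj (wedge z v j)) = a * (\<Sum>j\<in>I2. A j * cnj (wedge z v j)) +
        b * (\<Sum>j\<in>I2. B j * cnj (wedge z v j)) + b * r * (\<Sum>j\<in>I2. C j * cnj (wedge z v j))"
      unfolding D sum_distrib_left sum.distrib[symmetric] by (intro sum.cong refl) (simp add: algebra_simps)
    hence o: "(\<Sum>j\<in>I2. D j * cnj (wedge z v j)) = 0" unfolding orths by simp
    have "(\<Sum>j\<in>I2. D j * cnj (D j)) = (\<Sum>j\<in>I2. a * cnj a * (A j * cnj (A j)) + b * cnj b * (B j * cnj (B j))
        + b * cnj b * r * r * (C j * cnj (C j)) + a * cnj b * (A j * cnj (B j)) + b * cnj a * (B j * cnj (A j))
        + a * cnj b * r * (A j * cnj (C j)) + b * cnj a * r * (C j * cnj (A j))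
        + b * cnj b * r * (B j * cnj (C j)) + b * cnj b * r * (C j * cnj (B j)))"
      unfolding D by (intro sum.cong refl) (simp add: algebra_simps r_def)
    also have "\<dots> = a * cnj a * of_real (2 * n * m) + b * cnj b * of_real (2 * m * m) + b * cnj b * r * r * of_real (2 * n * n)"
      unfolding sum.distrib sum_distrib_left[symmetric] orths norms by simp
    also have "\<dots> = of_real ((cmod a)\<^sup>2 * (2 * n * m) + (cmod b)\<^sup>2 * (4 * m * m))"
      using n(2) unfolding r_def mult.commute[of a] mult.commute[of b] cnj_mult_self by (simp add: field_simps power2_eq_square)
    finally have DD: "(\<Sum>j\<in>I2. D j * cnj (D j)) = of_real ((cmod a)\<^sup>2 * (2 * n * m) + (cmod b)\<^sup>2 * (4 * m * m))" .
    have "((cmod a)\<^sup>2 * (2 * n * m) + (cmod b)\<^sup>2 * (4 * m * m)) / (2 * n * m) = (cmod a)\<^sup>2 + (cmod b)\<^sup>2 * (2 * m / n)"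
      using n(2) m(2) by (simp add: field_simps)
    moreover have "fubini_study I2 (wedge z w) D =
        of_real (((cmod a)\<^sup>2 * (2 * n * m) + (cmod b)\<^sup>2 * (4 * m * m)) / (2 * n * m))"
      unfolding P of_real_divide norms(4)[symmetric] DD[symmetric]
      by (rule fubini_study_orthogonal[OF o]) (use n(2) m(2) in \<open>simp add: norms\<close>)
    ultimately have f1: "fubini_study I2 (wedge z w) D = of_real ((cmod a)\<^sup>2 + (cmod b)\<^sup>2 * (2 * m / n))"
      by simp
    have "ip (\<lambda>k. b * qconj v k) z = 0" unfolding ip_scale ip_qconj sv' by simp
    hence "fubini_study {..<4} z (\<lambda>k. b * qconj v k) = ip (\<lambda>k. b * qconj v k) (\<lambda>k. b * qconj v k) / ip z z"
      using fubini_study_orthogonal[of "\<lambda>k. b * qconj v k" z "{..<4}"] n unfolding ip_def by auto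
    also have "\<dots> = (cnj b * b) * ip v v / ip z z" unfolding ip_scale ip_qconj(3) by simp
    also have "\<dots> = of_real ((cmod b)\<^sup>2 * (m / n))" unfolding cnj_mult_self n(1) m(1) by simp
    finally have f2: "fubini_study {..<4} z (\<lambda>k. b * qconj v k) = of_real ((cmod b)\<^sup>2 * (m / n))" .
    \<comment> \<open>In the second direction B and r C contribute m/n each, while the base metric
      subtracts m/n only once.\<close>
    have "fubini_study I2 (wedge z w) D - fubini_study {..<4} z (\<lambda>k. a * 0 + b * qconj v k) =
        of_real ((cmod a)\<^sup>2 + (cmod b)\<^sup>2 * (m / n))"
      unfolding f1 using f2 by (simp add: algebra_simps)
    moreover have "0 < (cmod a)\<^sup>2 + (cmod b)\<^sup>2 * (m / n)"
    proof (cases "b = 0")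
      case False
      thus ?thesis using n(2) m(2) by (intro add_nonneg_pos) auto
    qed (use ab in simp)
    ultimately show "0 < Re (fubini_study I2 (wedge z w) (\<lambda>j. a * (wedge (\<lambda>k. 0) w j + wedge z (qconj v) j) + b * (wedge (qconj v) w j + wedge z y2 j))
         - fubini_study {..<4} z (\<lambda>k. a * 0 + b * qconj v k))"
      unfolding D_def[symmetric] by simp
  qed
qed

section \<open>Tangent vectors in the coordinates of the flag manifold\<close>

definition has_dir :: "nat \<Rightarrow> (nat \<Rightarrow> complex) \<Rightarrow> ((nat \<Rightarrow> complex) \<Rightarrow> complex) \<Rightarrow> complex \<Rightarrow> (nat \<Rightarrow> complex) \<Rightarrow> bool" where
  "has_dir N u f d z \<longleftrightarrow> (\<exists>f'. (\<forall>p<N. has_wirtinger p f (f' p) 0 z) \<and> d = (\<Sum>p<N. u p * f' p))"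

lemma has_dirD: "has_dir N u f d z \<Longrightarrow> (\<Sum>p<N. u p * dz p f z) = d"
  unfolding has_dir_def
proof (elim exE conjE)
  fix f' assume f: "\<forall>p<N. has_wirtinger p f (f' p) 0 z" "d = (\<Sum>p<N. u p * f' p)"
  show "(\<Sum>p<N. u p * dz p f z) = d"
    unfolding f(2) using f(1) has_wirtinger_dz by (intro sum.cong refl) fastforce
qed

lemma has_dir_eq: "has_dir N u f d z \<Longrightarrow> d = e \<Longrightarrow> has_dir N u f e z"
  by simp

lemma has_dir_if: "has_dir N u f d z \<Longrightarrow> has_dir N u g e z \<Longrightarrow>
    has_dir N u (\<lambda>z. if b then f z else g z) (if b then d else e) z"
  by (cases b) simp_all

lemma has_dir_const: "has_dir N u (\<lambda>z. c) 0 z"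
  unfolding has_dir_def by (intro exI[of _ "\<lambda>_. 0"]) (simp add: has_wirtinger_const)

lemma has_dir_coord: "j < N \<Longrightarrow> has_dir N u (\<lambda>z. z j) (u j) z"
  unfolding has_dir_def
proof (intro exI[of _ "\<lambda>p. if j = p then 1 else 0"] conjI allI impI)
  assume "j < N"
  thus "u j = (\<Sum>p<N. u p * (if j = p then 1 else 0))" by (simp add: if_distrib cong: if_cong)
qed (rule has_wirtinger_coord)

lemma has_dir_mult: "has_dir N u f d z \<Longrightarrow> has_dir N u g e z \<Longrightarrow> has_dir N u (\<lambda>z. f z * g z) (d * g z + f z * e) z"
  unfolding has_dir_def
proof (elim exE conjE)
  fix f' g' assume f: "\<forall>p<N. has_wirtinger p f (f' p) 0 z" "d = (\<Sum>p<N. u p * f' p)"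
    and g: "\<forall>p<N. has_wirtinger p g (g' p) 0 z" "e = (\<Sum>p<N. u p * g' p)"
  show "\<exists>h. (\<forall>p<N. has_wirtinger p (\<lambda>z. f z * g z) (h p) 0 z) \<and> d * g z + f z * e = (\<Sum>p<N. u p * h p)"
    using f(1) g(1) unfolding f(2) g(2)
    by (intro exI[of _ "\<lambda>p. f' p * g z + f z * g' p"] conjI allI impI has_wirtinger_mult_0)
       (simp_all add: algebra_simps sum.distrib sum_distrib_left)
qed

lemma has_dir_add: "has_dir N u f d z \<Longrightarrow> has_dir N u g e z \<Longrightarrow> has_dir N u (\<lambda>z. f z + g z) (d + e) z"
  unfolding has_dir_def
proof (elim exE conjE)
  fix f' g' assume f: "\<forall>p<N. has_wirtinger p f (f' p) 0 z" "d = (\<Sum>p<N. u p * f' p)"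
    and g: "\<forall>p<N. has_wirtinger p g (g' p) 0 z" "e = (\<Sum>p<N. u p * g' p)"
  have "has_wirtinger p (\<lambda>z. f z + g z) (f' p + g' p) 0 z" if "p < N" for p
    using has_wirtinger_add[of p f "f' p" 0 z g "g' p" 0] f(1) g(1) that by simp
  thus "\<exists>h. (\<forall>p<N. has_wirtinger p (\<lambda>z. f z + g z) (h p) 0 z) \<and> d + e = (\<Sum>p<N. u p * h p)"
    unfolding f(2) g(2) by (intro exI[of _ "\<lambda>p. f' p + g' p"]) (simp add: algebra_simps sum.distrib)
qed

lemma has_dir_diff: "has_dir N u f d z \<Longrightarrow> has_dir N u g e z \<Longrightarrow> has_dir N u (\<lambda>z. f z - g z) (d - e) z"
  using has_dir_add[of N u f d z "\<lambda>z. (- 1) * g z" "- e"] has_dir_mult[OF has_dir_const[of N u "- 1"], of g e z] by simp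

lemma has_dir_cmult: "has_dir N u f d z \<Longrightarrow> has_dir N u (\<lambda>z. c * f z) (c * d) z"
  using has_dir_mult[OF has_dir_const, of N u f d z c] by simp

definition homog_dir :: "nat \<Rightarrow> (nat \<Rightarrow> complex) \<Rightarrow> nat \<Rightarrow> complex" where
  "homog_dir m u k = (if k = m then 0 else if k < m then u k else if k < 4 then u (k - 1) else 0)"

lemma has_dir_homog: "m < 4 \<Longrightarrow> has_dir 4 u (\<lambda>\<zeta>. homog m \<zeta> k) (homog_dir m u k) \<zeta>"
  unfolding homog_def homog_dir_def by (auto intro: has_dir_const has_dir_coord)

text \<open>Affine coordinates on the projective line of the fibre: component \<alpha> is normalized
  to 1, the other one is the last chart coordinate.\<close>

definition fibre_coord :: "nat \<Rightarrow> (nat \<Rightarrow> complex) \<Rightarrow> nat \<Rightarrow> complex" where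
  "fibre_coord \<alpha> \<zeta> \<gamma> = (if \<gamma> = \<alpha> then 1 else \<zeta> 3)"

definition fibre_dir :: "nat \<Rightarrow> (nat \<Rightarrow> complex) \<Rightarrow> nat \<Rightarrow> complex" where
  "fibre_dir \<alpha> u \<gamma> = (if \<gamma> = \<alpha> then 0 else u 3)"

lemma has_dir_fibre: "has_dir 4 u (\<lambda>\<zeta>. fibre_coord \<alpha> \<zeta> \<gamma>) (fibre_dir \<alpha> u \<gamma>) \<zeta>"
  unfolding fibre_coord_def fibre_dir_def by (auto intro: has_dir_const has_dir_coord)

definition plane_vec :: "nat \<Rightarrow> nat \<Rightarrow> nat \<Rightarrow> (nat \<Rightarrow> complex) \<Rightarrow> nat \<Rightarrow> complex" where
  "plane_vec m i \<alpha> \<zeta> = lift i (homog m \<zeta>) (fibre_coord \<alpha> \<zeta>)"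

text \<open>The product rule for \<open>lift\<close>, which is bilinear.\<close>

definition plane_dir :: "nat \<Rightarrow> nat \<Rightarrow> nat \<Rightarrow> (nat \<Rightarrow> complex) \<Rightarrow> (nat \<Rightarrow> complex) \<Rightarrow> nat \<Rightarrow> complex" where
  "plane_dir m i \<alpha> \<zeta> u k = lift i (homog_dir m u) (fibre_coord \<alpha> \<zeta>) k + lift i (homog m \<zeta>) (fibre_dir \<alpha> u) k"

lemma has_dir_plane: "m < 4 \<Longrightarrow> has_dir 4 u (\<lambda>\<zeta>. plane_vec m i \<alpha> \<zeta> k) (plane_dir m i \<alpha> \<zeta> u k) \<zeta>"
proof -
  assume m: "m < 4"
  note r = has_dir_mult[OF has_dir_homog[OF m] has_dir_fibre]
  have "has_dir 4 u (\<lambda>\<zeta>. lift i (homog m \<zeta>) (fibre_coord \<alpha> \<zeta>) k)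
     (if k = partner i then (if even i then - 1 else 1) *
        ((homog_dir m u (fidx i 0) * fibre_coord \<alpha> \<zeta> 1 + homog m \<zeta> (fidx i 0) * fibre_dir \<alpha> u 1)
       - (homog_dir m u (fidx i 1) * fibre_coord \<alpha> \<zeta> 0 + homog m \<zeta> (fidx i 1) * fibre_dir \<alpha> u 0))
      else if k = fidx i 0 then homog_dir m u i * fibre_coord \<alpha> \<zeta> 0 + homog m \<zeta> i * fibre_dir \<alpha> u 0
      else if k = fidx i 1 then homog_dir m u i * fibre_coord \<alpha> \<zeta> 1 + homog m \<zeta> i * fibre_dir \<alpha> u 1 else 0) \<zeta>"
    unfolding lift_def
    by (intro has_dir_if has_dir_cmult has_dir_diff r has_dir_const)
  thus ?thesis unfolding plane_vec_def
    by (rule has_dir_eq) (simp add: plane_dir_def lift_def algebra_simps)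
qed

lemma has_dir_wedge:
  assumes "m < 4"
  shows "has_dir 4 u (\<lambda>\<zeta>. wedge (homog m \<zeta>) (plane_vec m i \<alpha> \<zeta>) j)
     (wedge (homog_dir m u) (plane_vec m i \<alpha> \<zeta>) j + wedge (homog m \<zeta>) (plane_dir m i \<alpha> \<zeta> u) j) \<zeta>"
proof -
  obtain k l where j: "j = (k, l)" by (cases j)
  note r = has_dir_mult[OF has_dir_homog[OF assms] has_dir_plane[OF assms]]
  have "has_dir 4 u (\<lambda>\<zeta>. homog m \<zeta> k * plane_vec m i \<alpha> \<zeta> l - homog m \<zeta> l * plane_vec m i \<alpha> \<zeta> k)
     ((homog_dir m u k * plane_vec m i \<alpha> \<zeta> l + homog m \<zeta> k * plane_dir m i \<alpha> \<zeta> u l) -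
      (homog_dir m u l * plane_vec m i \<alpha> \<zeta> k + homog m \<zeta> l * plane_dir m i \<alpha> \<zeta> u k)) \<zeta>"
    by (rule has_dir_diff[OF r r])
  thus ?thesis unfolding j wedge_def prod.case
    by (rule has_dir_eq) (simp add: algebra_simps)
qed

lemma homog_dir_skip:
  assumes "m < 4" "x m = 0" "k < 4"
  shows "homog_dir m (\<lambda>p. if p < 3 then x (skip m p) else t) k = x k"
  using assms unfolding homog_dir_def skip_def by auto

text \<open>An infinitesimal deformation (x, y) of the flag (z, w) need not respect the
  normalizations of the chart. Adding multiples of z to x, and of z and w to y, achieves this
  without leaving the tangent vector; the changes appear as d z and c (z \<and> w), to which the
  Fubini-Study form is blind.\<close>

lemma realize_tangent:
  assumes m: "m < 4" and i: "i < 4" and \<alpha>: "\<alpha> < 2" and zi: "homog m \<zeta> i \<noteq> 0"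
    and L: "sform x (plane_vec m i \<alpha> \<zeta>) + sform (homog m \<zeta>) y = 0"
  obtains u c d where
    "\<And>k. k < 4 \<Longrightarrow> homog_dir m u k = x k + d * homog m \<zeta> k"
    "\<And>j. j \<in> I2 \<Longrightarrow> wedge (homog_dir m u) (plane_vec m i \<alpha> \<zeta>) j + wedge (homog m \<zeta>) (plane_dir m i \<alpha> \<zeta> u) j =
       wedge x (plane_vec m i \<alpha> \<zeta>) j + wedge (homog m \<zeta>) y j + c * wedge (homog m \<zeta>) (plane_vec m i \<alpha> \<zeta>) j"
proof -
  define z where "z = homog m \<zeta>"
  define v where "v = fibre_coord \<alpha> \<zeta>"
  define w where "w = lift i z v"
  have zm: "z m = 1" unfolding z_def by simp
  have zi: "z i \<noteq> 0" using zi unfolding z_def .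
  have v\<alpha>: "v \<alpha> = 1" unfolding v_def fibre_coord_def by simp
  \<comment> \<open>The chart fixes entry m of z to 1, so its derivative has to be 0 there.\<close>
  define x' where "x' = (\<lambda>k. x k + (- x m) * z k)"
  \<comment> \<open>A lifted vector has i-th entry 0 and entry z i at
    \<open>fidx i \<alpha>\<close>. The constants c2 and c1 make y' obey the derivatives of these
    two rules; t then solves for the motion of the remaining fibre coordinate.\<close>
  define c2 where "c2 = - y i / z i"
  define c1 where "c1 = (x' i - y (fidx i \<alpha>) - c2 * z (fidx i \<alpha>)) / z i"
  define y' where "y' = (\<lambda>k. y k + (c1 * w k + c2 * z k))"
  define \<beta> where "\<beta> = 1 - \<alpha>"
  have \<beta>: "\<beta> < 2" "\<beta> \<noteq> \<alpha>" "\<And>\<gamma>. \<gamma> < 2 \<Longrightarrow> \<gamma> = \<alpha> \<or> \<gamma> = \<beta>" unfolding \<beta>_def using \<alpha> by presburger+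
  define t where "t = (y' (fidx i \<beta>) - x' i * v \<beta>) / z i"
  define u where "u = (\<lambda>p. if p < 3 then x' (skip m p) else t)"
  have hd: "homog_dir m u k = x' k" if "k < 4" for k
    unfolding u_def using m that by (intro homog_dir_skip) (simp_all add: x'_def zm)
  define dw where "dw = plane_dir m i \<alpha> \<zeta> u"
  have dw: "dw k = lift i x' v k + lift i z (fibre_dir \<alpha> u) k" if "k < 4" for k
  proof -
    have "lift i (homog_dir m u) v k = lift i x' v k"
    proof -
      have "homog_dir m u (fidx i 0) = x' (fidx i 0)" "homog_dir m u (fidx i 1) = x' (fidx i 1)" "homog_dir m u i = x' i"
        using hd fidx_less[of 0 i] fidx_less[of 1 i] i by auto
      thus ?thesis unfolding lift_def by (simp only:)
    qed
    thus ?thesis unfolding dw_def plane_dir_def z_def v_def by simp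
  qed
  have pv: "plane_vec m i \<alpha> \<zeta> = w" unfolding plane_vec_def w_def z_def v_def ..
  have y'i: "y' i = 0" unfolding y'_def c2_def using zi by (simp add: w_def lift_i[OF i])
  have y'\<alpha>: "y' (fidx i \<alpha>) = x' i"
    unfolding y'_def c1_def w_def lift_fidx[OF i \<alpha>] v\<alpha> using zi by simp
  have sw: "sform z w = 0" unfolding w_def using sform_lift[OF i] .
  have sy': "sform x' w + sform z y' = 0"
    using L unfolding x'_def y'_def sform_simps(3,5,6,8) sw sform_simps(1) pv z_def[symmetric] by simp
  have sdw: "sform x' w + sform z dw = 0"
  proof -
    have "sform z dw = sform z (lift i x' v) + sform z (lift i z (fibre_dir \<alpha> u))"
      unfolding sform_simps(3)[symmetric] using dw by (simp add: sform_def)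
    thus ?thesis using sform_lift_polar[OF i, of z x' v] sform_lift[OF i] unfolding w_def by (simp add: add.commute)
  qed
  \<comment> \<open>Three of the four entries agree by the choice of c1, c2 and t. The partner entry
    follows because both vectors satisfy the same linearized isotropy condition and z i is
    nonzero.\<close>
  have eq: "dw k = y' k" if k: "k = i \<or> (\<exists>\<gamma><2. k = fidx i \<gamma>)" for k
  proof -
    have "dw i = y' i" using i by (simp add: dw lift_i y'i)
    moreover have "dw (fidx i \<alpha>) = y' (fidx i \<alpha>)"
      using fidx_less[OF \<alpha>] by (simp add: dw lift_fidx i \<alpha> v\<alpha> y'\<alpha> fibre_dir_def)
    moreover have "dw (fidx i \<beta>) = y' (fidx i \<beta>)"
      using fidx_less[OF \<beta>(1)] zi \<beta>(2) by (simp add: dw lift_fidx i \<beta>(1) fibre_dir_def u_def t_def)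
    ultimately show ?thesis using k \<beta>(3) by metis
  qed
  have "sform z (\<lambda>k. dw k - y' k) = 0" unfolding sform_simps(4) using sy' sdw by (metis add_left_cancel right_minus_eq)
  moreover have "dw (fidx i 0) = y' (fidx i 0)" "dw (fidx i 1) = y' (fidx i 1)" "dw i = y' i"
    using eq by (metis zero_less_numeral, metis one_less_numeral_iff semiring_norm(76), blast)
  ultimately have "dw (partner i) - y' (partner i) = 0"
    using index_cases[OF i] zi
    by (elim disjE) (auto simp: sform_def)
  moreover have "k = partner i \<or> k = i \<or> (\<exists>\<gamma><2. k = fidx i \<gamma>)" if "k < 4" for k
    using index_cases[OF i] index_cases[OF that]
    by (elim disjE; simp add: less_2_cases_iff ex_disj_distrib conj_disj_distribR)
  ultimately have dwy: "dw k = y' k" if "k < 4" for k using eq[of k] that by (metis right_minus_eq)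
  show ?thesis
  proof (rule that[of u "- x m" "- x m + c1"])
    show "homog_dir m u k = x k + - x m * homog m \<zeta> k" if "k < 4" for k
      using hd[OF that] unfolding x'_def z_def .
    fix j assume "j \<in> I2"
    then obtain k l where j: "j = (k, l)" "k < 4" "l < 4" by auto
    show "wedge (homog_dir m u) (plane_vec m i \<alpha> \<zeta>) j + wedge (homog m \<zeta>) (plane_dir m i \<alpha> \<zeta> u) j =
       wedge x (plane_vec m i \<alpha> \<zeta>) j + wedge (homog m \<zeta>) y j + (- x m + c1) * wedge (homog m \<zeta>) (plane_vec m i \<alpha> \<zeta>) j"
      unfolding pv z_def[symmetric] dw_def[symmetric] j(1) wedge_def prod.case hd[OF j(2)] hd[OF j(3)] dwy[OF j(2)] dwy[OF j(3)]
      unfolding x'_def y'_def by (simp add: algebra_simps)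
  qed
qed

section \<open>The flag manifold and the metric on the hyperplane bundle\<close>

abbreviation NCd :: "((nat \<Rightarrow> complex) set, nat, nat) vbundle" where "NCd \<equiv> dual_bundle NC"

lemma NCd_simps [simp]: "frame NCd = {..<2}" "cover NCd i = (if i < 4 then P3_domain i else {})"
  "cocycle NCd i j x \<alpha> \<beta> = transition i j (rep x) \<alpha> \<beta>" "frame NC = {..<2}"
  "cover NC i = (if i < 4 then P3_domain i else {})"
  unfolding dual_bundle_def NC_def by simp_all

lemma rank_NC [simp]: "rank NC = 2" "rank NCd = 2"
  unfolding rank_def by simp_all

text \<open>The class of w modulo z as a vector of the dual bundle, recorded in all frames at once
  as \<open>fibre\<close> demands.\<close>

definition fibre_vec :: "(nat \<Rightarrow> complex) \<Rightarrow> (nat \<Rightarrow> complex) \<Rightarrow> nat \<Rightarrow> nat \<Rightarrow> complex" where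
  "fibre_vec z w = (\<lambda>i \<gamma>. if i < 4 \<and> z i \<noteq> 0 \<and> \<gamma> < 2 then quot i z w \<gamma> else 0)"

definition plane :: "(nat \<Rightarrow> complex) \<Rightarrow> (nat \<Rightarrow> complex) \<Rightarrow> (nat \<Rightarrow> nat \<Rightarrow> complex) set" where
  "plane z w = {(\<lambda>i \<alpha>. c * fibre_vec z w i \<alpha>) |c. True}"

lemma fibre_vec_in_fibre:
  assumes z: "z \<in> Cn 4" "z \<noteq> (\<lambda>_. 0)" and s: "sform z w = 0"
  shows "fibre_vec z w \<in> fibre NCd (line z)"
  unfolding fibre_def
proof (intro CollectI conjI allI impI ballI)
  fix i \<alpha> assume "line z \<notin> cover NCd i \<or> \<alpha> \<notin> frame NCd"
  thus "fibre_vec z w i \<alpha> = 0"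
    unfolding fibre_vec_def by (auto simp: line_in_P3_domain[OF z] split: if_splits)
next
  fix i j \<alpha> assume ij: "line z \<in> cover NCd i \<inter> cover NCd j" and a: "\<alpha> \<in> frame NCd"
  hence ij: "i < 4" "j < 4" "z i \<noteq> 0" "z j \<noteq> 0"
    by (auto simp: line_in_P3_domain[OF z] split: if_splits)
  have "(\<Sum>\<beta>\<in>frame NCd. cocycle NCd i j (line z) \<alpha> \<beta> * fibre_vec z w j \<beta>) =
      (\<Sum>\<beta><2. transition i j z \<alpha> \<beta> * quot j z w \<beta>)"
    using ij by (simp add: fibre_vec_def transition_rep[OF z])
  also have "\<dots> = quot i z w \<alpha>" using ij a s by (simp add: transition_sum quot_lift_quot)
  finally show "fibre_vec z w i \<alpha> = (\<Sum>\<beta>\<in>frame NCd. cocycle NCd i j (line z) \<alpha> \<beta> * fibre_vec z w j \<beta>)"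
    using ij a by (simp add: fibre_vec_def)
qed

text \<open>The components in one frame determine a vector of the fibre, and lifting them produces a
  w that represents it.\<close>

lemma fibre_eq_fibre_vec:
  assumes z: "z \<in> Cn 4" "z \<noteq> (\<lambda>_. 0)" and i: "i < 4" "z i \<noteq> 0" and v: "v \<in> fibre NCd (line z)"
  shows "v j \<gamma> = fibre_vec z (lift i z (v i)) j \<gamma> / z i"
proof (cases "j < 4 \<and> z j \<noteq> 0 \<and> \<gamma> < 2")
  case True
  have x: "line z \<in> cover NCd j \<inter> cover NCd i" using True i by (simp add: line_in_P3_domain[OF z])
  have "v j \<gamma> = (\<Sum>\<beta>\<in>frame NCd. cocycle NCd j i (line z) \<gamma> \<beta> * v i \<beta>)"
    using v x True unfolding fibre_def by auto
  also have "\<dots> = quot j z (lift i z (v i)) \<gamma> / z i"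
    by (simp add: transition_rep[OF z] transition_sum)
  finally show ?thesis using True by (simp add: fibre_vec_def)
next
  case False
  hence "line z \<notin> cover NCd j \<or> \<gamma> \<notin> frame NCd" by (auto simp: line_in_P3_domain[OF z])
  hence "v j \<gamma> = 0" using v unfolding fibre_def by blast
  moreover have "fibre_vec z (lift i z (v i)) j \<gamma> = 0"
    unfolding fibre_vec_def if_not_P[OF False] ..
  ultimately show ?thesis by simp
qed

lemma normalized_plane:
  assumes "fibre_vec z w i \<alpha> \<noteq> 0"
  shows "normalized_vector (i, \<alpha>) (plane z w) = (\<lambda>j \<gamma>. fibre_vec z w j \<gamma> / fibre_vec z w i \<alpha>)"
  unfolding normalized_vector_def prod.case
proof (rule the_equality)
  show "(\<lambda>j \<gamma>. fibre_vec z w j \<gamma> / fibre_vec z w i \<alpha>) \<in> plane z w \<and> fibre_vec z w i \<alpha> / fibre_vec z w i \<alpha> = 1"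
    unfolding plane_def using assms by (auto intro!: exI[of _ "1 / fibre_vec z w i \<alpha>"])
  fix v assume "v \<in> plane z w \<and> v i \<alpha> = 1"
  then obtain c where "v = (\<lambda>j \<gamma>. c * fibre_vec z w j \<gamma>)" "c * fibre_vec z w i \<alpha> = 1" unfolding plane_def by auto
  thus "v = (\<lambda>j \<gamma>. fibre_vec z w j \<gamma> / fibre_vec z w i \<alpha>)" using assms by (auto simp: fun_eq_iff field_simps)
qed

section \<open>Charts of the flag manifold\<close>

definition plane_point :: "nat \<Rightarrow> nat \<Rightarrow> nat \<Rightarrow> (nat \<Rightarrow> complex) \<Rightarrow> ((nat \<Rightarrow> complex) set, nat) proj_point" where
  "plane_point m i \<alpha> \<zeta> = (line (homog m \<zeta>), plane (homog m \<zeta>) (plane_vec m i \<alpha> \<zeta>))"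

abbreviation P3_chart :: "nat \<Rightarrow> (nat \<Rightarrow> complex) set chart" where
  "P3_chart m \<equiv> (P3_domain m, P3_coord m)"

definition flag_domain :: "nat \<Rightarrow> nat \<Rightarrow> nat \<Rightarrow> ((nat \<Rightarrow> complex) set, nat) proj_point set" where
  "flag_domain m i \<alpha> = fst (proj_chart P3 NCd (P3_chart m) (i, \<alpha>))"

definition flag_coord :: "nat \<Rightarrow> nat \<Rightarrow> nat \<Rightarrow> ((nat \<Rightarrow> complex) set, nat) proj_point \<Rightarrow> nat \<Rightarrow> complex" where
  "flag_coord m i \<alpha> = snd (proj_chart P3 NCd (P3_chart m) (i, \<alpha>))"

text \<open>The base chart m and the bundle frame i vary independently, so the image of a flag chart
  is the part of \<complex>^4 where frame i is defined.\<close>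

definition flag_region :: "nat \<Rightarrow> nat \<Rightarrow> (nat \<Rightarrow> complex) set" where
  "flag_region m i = {\<zeta> \<in> Cn 4. homog m \<zeta> i \<noteq> 0}"

lemma sform_plane_vec: "i < 4 \<Longrightarrow> sform (homog m \<zeta>) (plane_vec m i \<alpha> \<zeta>) = 0"
  unfolding plane_vec_def by (rule sform_lift)

lemma quot_plane_vec: "i < 4 \<Longrightarrow> \<gamma> < 2 \<Longrightarrow> quot i (homog m \<zeta>) (plane_vec m i \<alpha> \<zeta>) \<gamma> = homog m \<zeta> i * fibre_coord \<alpha> \<zeta> \<gamma>"
  unfolding plane_vec_def by (rule quot_lift)

lemma plane_in_lines:
  assumes z: "z \<in> Cn 4" "z \<noteq> (\<lambda>_. 0)" "sform z w = 0" and nz: "fibre_vec z w i \<alpha> \<noteq> 0"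
  shows "(line z, plane z w) \<in> proj_points P3 NCd"
proof -
  have "fibre_vec z w \<noteq> (\<lambda>_ _. 0)" using nz by auto
  hence "plane z w \<in> lines_in_fibre NCd (line z)"
    using fibre_vec_in_fibre[OF z] unfolding lines_in_fibre_def plane_def by auto
  thus ?thesis using z unfolding proj_points_def P3_def by auto
qed

lemma plane_in_cover:
  assumes z: "z \<in> Cn 4" "z \<noteq> (\<lambda>_. 0)" "sform z w = 0"
  shows "(line z, plane z w) \<in> proj_cover P3 NCd (i, \<alpha>) \<longleftrightarrow> fibre_vec z w i \<alpha> \<noteq> 0"
proof
  assume "(line z, plane z w) \<in> proj_cover P3 NCd (i, \<alpha>)"
  then obtain v where "v \<in> plane z w" "v i \<alpha> \<noteq> 0" unfolding proj_cover_def by auto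
  thus "fibre_vec z w i \<alpha> \<noteq> 0" unfolding plane_def by auto
next
  assume nz: "fibre_vec z w i \<alpha> \<noteq> 0"
  hence "i < 4" "z i \<noteq> 0" "\<alpha> < 2" unfolding fibre_vec_def by (auto split: if_splits)
  moreover have "fibre_vec z w \<in> plane z w" unfolding plane_def by (auto intro!: exI[of _ 1])
  ultimately show "(line z, plane z w) \<in> proj_cover P3 NCd (i, \<alpha>)"
    unfolding proj_cover_def using plane_in_lines[OF z nz] nz by (auto simp: line_in_P3_domain[OF z(1,2)])
qed

lemma plane_point_cover:
  assumes "m < 4" "i < 4"
  shows "plane_point m i \<alpha> \<zeta> \<in> proj_cover P3 NCd (j, \<beta>) \<longleftrightarrow>
    j < 4 \<and> \<beta> < 2 \<and> homog m \<zeta> j \<noteq> 0 \<and> quot j (homog m \<zeta>) (plane_vec m i \<alpha> \<zeta>) \<beta> \<noteq> 0"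
  unfolding plane_point_def plane_in_cover[OF homog_Cn[OF assms(1)] homog_nonzero sform_plane_vec[OF assms(2)]]
  by (auto simp: fibre_vec_def)

lemma plane_point_domain:
  assumes "m < 4" "i < 4" "\<alpha> < 2" "\<zeta> \<in> flag_region m i"
  shows "plane_point m i \<alpha> \<zeta> \<in> flag_domain m i \<alpha>"
proof -
  have "plane_point m i \<alpha> \<zeta> \<in> proj_cover P3 NCd (i, \<alpha>)"
    using assms unfolding plane_point_cover[OF assms(1,2)] flag_region_def by (simp add: quot_plane_vec fibre_coord_def)
  moreover have "fst (plane_point m i \<alpha> \<zeta>) \<in> P3_domain m"
    unfolding plane_point_def using line_homog_in_domain[OF assms(1)] by simp
  ultimately show ?thesis unfolding flag_domain_def proj_chart_def by (auto simp: split_def)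
qed

lemma flag_coord_plane_point:
  assumes "m < 4" "i < 4" "\<alpha> < 2" "\<zeta> \<in> flag_region m i"
  shows "flag_coord m i \<alpha> (plane_point m i \<alpha> \<zeta>) = \<zeta>"
proof (rule ext)
  fix k :: nat
  let ?z = "homog m \<zeta>" and ?w = "plane_vec m i \<alpha> \<zeta>"
  have zi: "?z i \<noteq> 0" and \<zeta>: "\<zeta> \<in> Cn 4" using assms(4) unfolding flag_region_def by auto
  have fv: "fibre_vec ?z ?w i \<gamma> = ?z i * fibre_coord \<alpha> \<zeta> \<gamma>" if "\<gamma> < 2" for \<gamma>
    unfolding fibre_vec_def using assms(2) zi that by (simp add: quot_plane_vec)
  have a: "fibre_vec ?z ?w i \<alpha> = ?z i" using fv[OF assms(3)] by (simp add: fibre_coord_def)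
  have nv: "normalized_vector (i, \<alpha>) (plane ?z ?w) i \<gamma> = fibre_coord \<alpha> \<zeta> \<gamma>" if "\<gamma> < 2" for \<gamma>
    using normalized_plane[of ?z ?w i \<alpha>] zi fv[OF that] unfolding a by simp
  consider "k < 3" | "k = 3" | "k > 3" by linarith
  thus "flag_coord m i \<alpha> (plane_point m i \<alpha> \<zeta>) k = \<zeta> k"
  proof cases
    case 1
    have "P3_coord m (line ?z) k = \<zeta> k"
      using 1 homog_skip[OF 1] by (simp add: P3_coord_line[OF homog_Cn[OF assms(1)]])
    thus ?thesis using 1 unfolding flag_coord_def proj_chart_def plane_point_def by (simp add: P3_def)
  next
    case 2
    define \<beta> where "\<beta> = (if 0 < \<alpha> then 0 else Suc 0)"
    have \<beta>: "\<beta> < 2" "\<beta> \<noteq> \<alpha>" unfolding \<beta>_def by auto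
    have "flag_coord m i \<alpha> (plane_point m i \<alpha> \<zeta>) k = normalized_vector (i, \<alpha>) (plane ?z ?w) i \<beta>"
      using 2 unfolding flag_coord_def proj_chart_def plane_point_def \<beta>_def by (simp add: P3_def)
    thus ?thesis using nv[OF \<beta>(1)] 2 \<beta>(2) by (simp add: fibre_coord_def)
  next
    case 3
    thus ?thesis using \<zeta> unfolding flag_coord_def proj_chart_def plane_point_def Cn_def by (simp add: P3_def)
  qed
qed

lemma flag_domain_point:
  assumes m: "m < 4" and y: "y \<in> flag_domain m i \<alpha>"
  obtains \<zeta> where "i < 4" "\<alpha> < 2" "\<zeta> \<in> flag_region m i" "y = plane_point m i \<alpha> \<zeta>"
proof -
  obtain x L where y': "y = (x, L)" by (cases y)
  have yc: "(x, L) \<in> proj_cover P3 NCd (i, \<alpha>)" and xm: "x \<in> P3_domain m"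
    using y unfolding flag_domain_def proj_chart_def y' by auto
  hence i: "i < 4" and \<alpha>: "\<alpha> < 2" and xi: "x \<in> P3_domain i" and pp: "(x, L) \<in> proj_points P3 NCd"
    and ex: "\<exists>v\<in>L. v i \<alpha> \<noteq> 0" unfolding proj_cover_def by (auto split: if_splits)
  define \<zeta>0 where "\<zeta>0 = P3_coord m x"
  define z where "z = homog m \<zeta>0"
  have x: "x = line z" unfolding z_def \<zeta>0_def using line_homog_coord[OF m xm] ..
  have z: "z \<in> Cn 4" "z \<noteq> (\<lambda>_. 0)" unfolding z_def using homog_Cn[OF m] homog_nonzero by auto
  have zi: "z i \<noteq> 0" using xi unfolding x line_in_P3_domain[OF z] .
  obtain v where v: "v \<in> fibre NCd x" "L = {(\<lambda>i \<alpha>. c * v i \<alpha>) |c. True}"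
    using pp unfolding proj_points_def lines_in_fibre_def by auto
  have va: "v i \<alpha> \<noteq> 0" using ex unfolding v(2) by auto
  \<comment> \<open>The fourth coordinate is the ratio of the two fibre components; 1 - \<alpha> is
    the other index.\<close>
  define \<zeta> where "\<zeta> = \<zeta>0(3 := v i (1 - \<alpha>) / v i \<alpha>)"
  have "\<zeta>0 \<in> Cn 3" unfolding \<zeta>0_def by (rule P3_coord_Cn)
  hence \<zeta>4: "\<zeta> \<in> Cn 4" unfolding \<zeta>_def Cn_def by auto
  have hz: "homog m \<zeta> = z" unfolding z_def \<zeta>_def homog_def using m by (auto simp: fun_eq_iff)
  have reg: "\<zeta> \<in> flag_region m i" unfolding flag_region_def using \<zeta>4 zi hz by simp
  have fc: "v i \<gamma> = v i \<alpha> * fibre_coord \<alpha> \<zeta> \<gamma>" if "\<gamma> < 2" for \<gamma>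
  proof (cases "\<gamma> = \<alpha>")
    case False
    hence "\<gamma> = 1 - \<alpha>" using that \<alpha> by auto
    thus ?thesis using False va by (simp add: fibre_coord_def \<zeta>_def)
  qed (simp add: fibre_coord_def)
  have "lift i z (v i) = lift i z (\<lambda>\<gamma>. v i \<alpha> * fibre_coord \<alpha> \<zeta> \<gamma>)" by (rule lift_cong) (rule fc)
  hence lf: "lift i z (v i) = (\<lambda>k. v i \<alpha> * plane_vec m i \<alpha> \<zeta> k)" unfolding plane_vec_def hz lift_scale .
  have fv: "fibre_vec z (lift i z (v i)) j \<gamma> = v i \<alpha> * fibre_vec z (plane_vec m i \<alpha> \<zeta>) j \<gamma>" for j \<gamma>
    unfolding lf fibre_vec_def quot_scale by simp
  define d where "d = v i \<alpha> / z i"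
  have d: "d \<noteq> 0" unfolding d_def using va zi by simp
  have vd: "v j \<gamma> = d * fibre_vec z (plane_vec m i \<alpha> \<zeta>) j \<gamma>" for j \<gamma>
    by (rule trans[OF fibre_eq_fibre_vec[OF z i zi v(1)[unfolded x]]]) (simp add: fv d_def)
  have "L = plane z (plane_vec m i \<alpha> \<zeta>)"
  proof (intro equalityI subsetI)
    fix l assume "l \<in> L"
    then obtain c where "l = (\<lambda>j \<gamma>. c * v j \<gamma>)" unfolding v(2) by auto
    hence "l = (\<lambda>j \<gamma>. (c * d) * fibre_vec z (plane_vec m i \<alpha> \<zeta>) j \<gamma>)"
      by (simp only: vd mult.assoc)
    thus "l \<in> plane z (plane_vec m i \<alpha> \<zeta>)" unfolding plane_def by blast
  next
    fix l assume "l \<in> plane z (plane_vec m i \<alpha> \<zeta>)"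
    then obtain c where c: "l = (\<lambda>j \<gamma>. c * fibre_vec z (plane_vec m i \<alpha> \<zeta>) j \<gamma>)" unfolding plane_def by auto
    have "l = (\<lambda>j \<gamma>. (c / d) * v j \<gamma>)" unfolding c vd using d by simp
    thus "l \<in> L" unfolding v(2) by blast
  qed
  thus ?thesis using that[OF i \<alpha> reg] unfolding y' plane_point_def hz x by simp
qed

lemma flag_coord_image:
  assumes "m < 4" "i < 4" "\<alpha> < 2"
  shows "flag_coord m i \<alpha> ` (W \<inter> flag_domain m i \<alpha>) = {\<zeta> \<in> flag_region m i. plane_point m i \<alpha> \<zeta> \<in> W}"
proof (intro equalityI subsetI)
  fix \<zeta> assume "\<zeta> \<in> flag_coord m i \<alpha> ` (W \<inter> flag_domain m i \<alpha>)"
  then obtain y where y: "y \<in> W" "y \<in> flag_domain m i \<alpha>" "\<zeta> = flag_coord m i \<alpha> y" by auto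
  obtain \<zeta>' where "\<zeta>' \<in> flag_region m i" "y = plane_point m i \<alpha> \<zeta>'" by (rule flag_domain_point[OF assms(1) y(2)])
  thus "\<zeta> \<in> {\<zeta> \<in> flag_region m i. plane_point m i \<alpha> \<zeta> \<in> W}" using y flag_coord_plane_point[OF assms] by simp
next
  fix \<zeta> assume "\<zeta> \<in> {\<zeta> \<in> flag_region m i. plane_point m i \<alpha> \<zeta> \<in> W}"
  thus "\<zeta> \<in> flag_coord m i \<alpha> ` (W \<inter> flag_domain m i \<alpha>)"
    using flag_coord_plane_point[OF assms, of \<zeta>] plane_point_domain[OF assms, of \<zeta>]
    by (intro image_eqI[of _ _ "plane_point m i \<alpha> \<zeta>"]) auto
qed

lemma in_chart_flag:
  assumes "m < 4" "i < 4" "\<alpha> < 2" "\<zeta> \<in> flag_region m i"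
  shows "in_chart (flag_domain m i \<alpha>, flag_coord m i \<alpha>) f \<zeta> = f (plane_point m i \<alpha> \<zeta>)"
proof -
  have "inj_on (flag_coord m i \<alpha>) (flag_domain m i \<alpha>)"
  proof (rule inj_onI)
    fix y y' assume yy: "y \<in> flag_domain m i \<alpha>" "y' \<in> flag_domain m i \<alpha>" "flag_coord m i \<alpha> y = flag_coord m i \<alpha> y'"
    obtain \<zeta> where "\<zeta> \<in> flag_region m i" "y = plane_point m i \<alpha> \<zeta>" by (rule flag_domain_point[OF assms(1) yy(1)])
    moreover obtain \<zeta>' where "\<zeta>' \<in> flag_region m i" "y' = plane_point m i \<alpha> \<zeta>'" by (rule flag_domain_point[OF assms(1) yy(2)])
    ultimately show "y = y'" using yy(3) flag_coord_plane_point[OF assms(1-3)] by simp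
  qed
  hence "inv_into (flag_domain m i \<alpha>) (flag_coord m i \<alpha>) \<zeta> = plane_point m i \<alpha> \<zeta>"
    by (rule inv_into_f_eq) (rule plane_point_domain[OF assms], rule flag_coord_plane_point[OF assms])
  thus ?thesis unfolding in_chart_def by simp
qed

text \<open>The frame of O(1) is dual to the normalized vector of the tautological line, so its
  squared length is |z|^2/|z \<and> w|^2 for w in that class. The factor |z i|^2 in the numerator
  compensates the z i in \<open>lift\<close>, and the quotient is invariant under rescaling of
  \<open>rep\<close>.\<close>

definition flag_metric :: "(((nat \<Rightarrow> complex) set, nat) proj_point, nat \<times> nat, unit) metric" where
  "flag_metric = (\<lambda>(i, \<alpha>) (x, L) _ _.
     (\<Sum>k<4. rep x k * cnj (rep x k)) * (rep x i * cnj (rep x i)) /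
     (\<Sum>j\<in>I2. wedge (rep x) (lift i (rep x) (normalized_vector (i, \<alpha>) L i)) j *
        cnj (wedge (rep x) (lift i (rep x) (normalized_vector (i, \<alpha>) L i)) j)))"

text \<open>Frees the metric from the arbitrary \<open>rep\<close>: in a chart, z and w become
  explicit polynomials in the coordinates. The factor \<open>quot i z w \<alpha>\<close> is
  holomorphic there and carries the whole dependence on the frame.\<close>

lemma flag_metric_plane:
  assumes z: "z \<in> Cn 4" "z \<noteq> (\<lambda>_. 0)" "sform z w = 0" and nz: "fibre_vec z w i \<alpha> \<noteq> 0"
  shows "flag_metric (i, \<alpha>) (line z, plane z w) a b =
    quot i z w \<alpha> * cnj (quot i z w \<alpha>) * (\<Sum>k<4. z k * cnj (z k)) / (\<Sum>j\<in>I2. wedge z w j * cnj (wedge z w j))"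
proof -
  have i: "i < 4" "z i \<noteq> 0" "\<alpha> < 2" using nz unfolding fibre_vec_def by (auto split: if_splits)
  define q where "q = quot i z w \<alpha>"
  have fq: "fibre_vec z w i \<alpha> = q" unfolding fibre_vec_def q_def using i by simp
  hence q: "q \<noteq> 0" using nz by simp
  obtain c where c: "c \<noteq> 0" "rep (line z) = (\<lambda>k. c * z k)" using rep_line[OF z(1,2)] .
  have "lift i z (normalized_vector (i, \<alpha>) (plane z w) i) = lift i z (\<lambda>\<gamma>. (1 / q) * quot i z w \<gamma>)"
    by (rule lift_cong) (use i in \<open>simp add: normalized_plane[OF nz] fq\<close>, simp add: fibre_vec_def)
  hence "lift i (rep (line z)) (normalized_vector (i, \<alpha>) (plane z w) i) = (\<lambda>k. c * (1 / q * lift i z (quot i z w) k))"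
    unfolding c(2) lift_scale_left lift_scale by simp
  moreover have "wedge (\<lambda>k. c * z k) (\<lambda>k. c * (1 / q * lift i z (quot i z w) k)) j = (c * c * z i / q) * wedge z w j"
    if j: "j \<in> I2" for j
  proof -
    obtain k l where kl: "j = (k, l)" "k < 4" "l < 4" using j by auto
    show ?thesis unfolding kl(1) wedge_def prod.case lift_quot[OF i(1,2) z(3) kl(2)] lift_quot[OF i(1,2) z(3) kl(3)]
      using q by (simp add: field_simps)
  qed
  ultimately have W: "(\<Sum>j\<in>I2. wedge (rep (line z)) (lift i (rep (line z)) (normalized_vector (i, \<alpha>) (plane z w) i)) j *
        cnj (wedge (rep (line z)) (lift i (rep (line z)) (normalized_vector (i, \<alpha>) (plane z w) i)) j)) =
      (c * c * z i / q) * cnj (c * c * z i / q) * (\<Sum>j\<in>I2. wedge z w j * cnj (wedge z w j))"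
    unfolding sum_distrib_left c(2) by (intro sum.cong) (simp_all add: mult_ac)
  have A: "(\<Sum>k<4. rep (line z) k * cnj (rep (line z) k)) = c * cnj c * (\<Sum>k<4. z k * cnj (z k))"
    unfolding c(2) by (simp add: sum_distrib_left mult_ac)
  show ?thesis unfolding flag_metric_def prod.case W A unfolding q_def[symmetric] c(2)
    using c(1) q i(2) by (simp add: field_simps)
qed

lemma P_dual_simps: "cdim (P_dual P3 NC) = 4" "cdim P3 = 3"
  "atlas (P_dual P3 NC) = {(flag_domain m i \<alpha>, flag_coord m i \<alpha>) |m i \<alpha>. m < 4 \<and> \<alpha> < 2}"
  "points (P_dual P3 NC) = proj_points P3 NCd"
proof -
  show "cdim (P_dual P3 NC) = 4" "cdim P3 = 3" "points (P_dual P3 NC) = proj_points P3 NCd"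
    unfolding projectivization_def by (simp_all add: P3_def)
  have "atlas P3 = {P3_chart m |m. m < 4}" unfolding P3_def by simp
  hence "atlas (P_dual P3 NC) = {proj_chart P3 NCd (P3_chart m) (i, \<alpha>) |m i \<alpha>. m < 4 \<and> \<alpha> < 2}"
    unfolding projectivization_def by (simp, blast)
  thus "atlas (P_dual P3 NC) = {(flag_domain m i \<alpha>, flag_coord m i \<alpha>) |m i \<alpha>. m < 4 \<and> \<alpha> < 2}"
    unfolding flag_domain_def flag_coord_def prod.collapse .
qed

lemma hyperplane_simps: "frame (hyperplane_bundle P3 NC) = {()}"
  "cover (hyperplane_bundle P3 NC) = proj_cover P3 NCd"
  "cocycle (hyperplane_bundle P3 NC) (i, \<alpha>) (j, \<beta>) (x, L) a b = normalized_vector (i, \<alpha>) L j \<beta>"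
  unfolding hyperplane_bundle_def tautological_bundle_def dual_bundle_def by simp_all

lemma openin_flag_region: "openin (Cn_topology 4) (flag_region m i)"
  unfolding flag_region_def by (rule openin_homog_nonzero)

lemma nice_plane_vec:
  assumes "openin (Cn_topology n) U" shows "nice n U (\<lambda>\<zeta>. plane_vec m i \<alpha> \<zeta> k)"
proof -
  have "nice n U (\<lambda>\<zeta>. fibre_coord \<alpha> \<zeta> \<gamma>)" for \<gamma>
    unfolding fibre_coord_def by (intro nice_if nice_const nice_coord assms)
  thus ?thesis unfolding plane_vec_def by (intro nice_lift nice_homog assms)
qed

lemma nice_wedge:
  assumes "openin (Cn_topology n) U"
  shows "nice n U (\<lambda>\<zeta>. wedge (homog m \<zeta>) (plane_vec m i \<alpha> \<zeta>) j)"
  unfolding wedge_def split_def by (intro nice_diff nice_mult nice_homog nice_plane_vec assms)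

lemma wedge_plane_vec:
  assumes "i < 4" "\<gamma> < 2"
  shows "wedge (homog m \<zeta>) (plane_vec m i \<alpha> \<zeta>) (i, fidx i \<gamma>) = homog m \<zeta> i * homog m \<zeta> i * fibre_coord \<alpha> \<zeta> \<gamma>"
  unfolding wedge_def plane_vec_def by (simp add: lift_i lift_fidx assms)

lemma norm_sum_pos:
  fixes f :: "'a \<Rightarrow> complex"
  assumes "finite J" "j \<in> J" "f j \<noteq> 0"
  shows "(\<Sum>j\<in>J. f j * cnj (f j)) = of_real (\<Sum>j\<in>J. (cmod (f j))\<^sup>2)" "0 < (\<Sum>j\<in>J. (cmod (f j))\<^sup>2)"
proof -
  show "(\<Sum>j\<in>J. f j * cnj (f j)) = of_real (\<Sum>j\<in>J. (cmod (f j))\<^sup>2)"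
    unfolding of_real_sum cnj_mult_self[symmetric] by (simp add: mult.commute)
  show "0 < (\<Sum>j\<in>J. (cmod (f j))\<^sup>2)" using assms by (intro sum_pos2[of _ j]) auto
qed

lemma plane_norm_pos:
  assumes "z \<in> Cn 4" "z \<noteq> (\<lambda>_. 0)" "fibre_vec z w i \<alpha> \<noteq> 0"
  obtains j where "j \<in> I2" "wedge z w j \<noteq> 0"
proof -
  have i: "i < 4" "z i \<noteq> 0" "\<alpha> < 2" "quot i z w \<alpha> \<noteq> 0" using assms(3) unfolding fibre_vec_def by (auto split: if_splits)
  have "wedge z w (i, fidx i \<alpha>) = z i * quot i z w \<alpha>"
    unfolding wedge_def quot_def using i(2) by (simp add: field_simps)
  thus ?thesis using that[of "(i, fidx i \<alpha>)"] i fidx_less[OF i(3)] by auto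
qed

lemma proj_cover_plane:
  assumes "y \<in> proj_cover P3 NCd (i, \<alpha>)"
  obtains z w where "z \<in> Cn 4" "z \<noteq> (\<lambda>_. 0)" "sform z w = 0" "fibre_vec z w i \<alpha> \<noteq> 0" "y = (line z, plane z w)"
proof -
  obtain x L where y: "y = (x, L)" by (cases y)
  have i: "i < 4" "x \<in> P3_domain i" "\<alpha> < 2" using assms unfolding proj_cover_def y by (auto split: if_splits)
  hence "y \<in> flag_domain i i \<alpha>" using assms unfolding flag_domain_def proj_chart_def y by auto
  then obtain \<zeta> where \<zeta>: "\<zeta> \<in> flag_region i i" "y = plane_point i i \<alpha> \<zeta>"
    by (rule flag_domain_point[OF i(1)]) (rule that)
  note z = homog_Cn[OF i(1), of \<zeta>] homog_nonzero[of i \<zeta>] sform_plane_vec[OF i(1), of i \<zeta> \<alpha>]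
  have "fibre_vec (homog i \<zeta>) (plane_vec i i \<alpha> \<zeta>) i \<alpha> \<noteq> 0"
    using assms unfolding \<zeta>(2) plane_point_def plane_in_cover[OF z] .
  from that[OF z this] show ?thesis using \<zeta>(2) unfolding plane_point_def by blast
qed

text \<open>Curvature is tested in all pairs of a chart and a frame. This is the part of the chart
  (m, i, \<alpha>) where the frame (j, \<beta>) of O(1) exists.\<close>

definition overlap_region :: "nat \<Rightarrow> nat \<Rightarrow> nat \<Rightarrow> nat \<Rightarrow> nat \<Rightarrow> (nat \<Rightarrow> complex) set" where
  "overlap_region m i \<alpha> j \<beta> = {\<zeta> \<in> {\<zeta> \<in> flag_region m i. homog m \<zeta> j \<noteq> 0}. quot j (homog m \<zeta>) (plane_vec m i \<alpha> \<zeta>) \<beta> \<noteq> 0}"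

lemma overlap_region:
  "openin (Cn_topology 4) (overlap_region m i \<alpha> j \<beta>)"
  "nice 4 (overlap_region m i \<alpha> j \<beta>) (\<lambda>\<zeta>. quot j (homog m \<zeta>) (plane_vec m i \<alpha> \<zeta>) \<beta>)"
proof -
  define U where "U = {\<zeta> \<in> flag_region m i. homog m \<zeta> j \<noteq> 0}"
  have U: "openin (Cn_topology 4) U"
    unfolding U_def by (rule openin_nonzero[OF openin_flag_region nice_continuous[OF nice_homog[OF openin_flag_region]]])
  have "nice 4 U (\<lambda>\<zeta>. quot j (homog m \<zeta>) (plane_vec m i \<alpha> \<zeta>) \<beta>)"
    by (intro nice_quot nice_homog nice_plane_vec U) (simp add: U_def)
  thus V: "openin (Cn_topology 4) (overlap_region m i \<alpha> j \<beta>)"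
    unfolding overlap_region_def U_def[symmetric] by (intro openin_nonzero U nice_continuous)
  show "nice 4 (overlap_region m i \<alpha> j \<beta>) (\<lambda>\<zeta>. quot j (homog m \<zeta>) (plane_vec m i \<alpha> \<zeta>) \<beta>)"
    by (intro nice_quot nice_homog nice_plane_vec V) (simp add: overlap_region_def)
qed

lemma flag_metric_chart:
  assumes m: "m < 4" and i: "i < 4" and \<alpha>: "\<alpha> < 2" and j: "j < 4" and \<beta>: "\<beta> < 2"
    and \<zeta>: "\<zeta> \<in> overlap_region m i \<alpha> j \<beta>"
  shows "in_chart (flag_domain m i \<alpha>, flag_coord m i \<alpha>) (\<lambda>y. flag_metric (j, \<beta>) y () ()) \<zeta> =
    quot j (homog m \<zeta>) (plane_vec m i \<alpha> \<zeta>) \<beta> * cnj (quot j (homog m \<zeta>) (plane_vec m i \<alpha> \<zeta>) \<beta>) *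
    (\<Sum>k<4. homog m \<zeta> k * cnj (homog m \<zeta> k)) /
    (\<Sum>l\<in>I2. wedge (homog m \<zeta>) (plane_vec m i \<alpha> \<zeta>) l * cnj (wedge (homog m \<zeta>) (plane_vec m i \<alpha> \<zeta>) l))"
proof -
  have reg: "\<zeta> \<in> flag_region m i" "homog m \<zeta> j \<noteq> 0" "quot j (homog m \<zeta>) (plane_vec m i \<alpha> \<zeta>) \<beta> \<noteq> 0"
    using \<zeta> unfolding overlap_region_def by auto
  hence "fibre_vec (homog m \<zeta>) (plane_vec m i \<alpha> \<zeta>) j \<beta> \<noteq> 0" unfolding fibre_vec_def using j \<beta> by simp
  from flag_metric_plane[OF homog_Cn[OF m] homog_nonzero sform_plane_vec[OF i] this]
  show ?thesis unfolding in_chart_flag[OF m i \<alpha> reg(1)] plane_point_def .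
qed

lemma flag_nonzero:
  assumes "i < 4" "\<alpha> < 2" "\<zeta> \<in> flag_region m i"
  shows "(\<Sum>l\<in>I2. wedge (homog m \<zeta>) (plane_vec m i \<alpha> \<zeta>) l * cnj (wedge (homog m \<zeta>) (plane_vec m i \<alpha> \<zeta>) l)) \<noteq> 0"
    and "m < 4 \<Longrightarrow> (\<Sum>k<4. homog m \<zeta> k * cnj (homog m \<zeta> k)) \<noteq> 0"
proof -
  have "wedge (homog m \<zeta>) (plane_vec m i \<alpha> \<zeta>) (i, fidx i \<alpha>) \<noteq> 0"
    using assms unfolding wedge_plane_vec[OF assms(1,2)] by (simp add: fibre_coord_def flag_region_def)
  note pos = norm_sum_pos[where f = "wedge (homog m \<zeta>) (plane_vec m i \<alpha> \<zeta>)" and J = I2, OF _ _ this]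
  have fin: "finite I2" "(i, fidx i \<alpha>) \<in> I2" using assms(1) fidx_less[OF assms(2)] by simp_all
  show "(\<Sum>l\<in>I2. wedge (homog m \<zeta>) (plane_vec m i \<alpha> \<zeta>) l * cnj (wedge (homog m \<zeta>) (plane_vec m i \<alpha> \<zeta>) l)) \<noteq> 0"
    unfolding pos(1)[OF fin] of_real_eq_0_iff using pos(2)[OF fin] by (rule less_imp_neq[THEN not_sym])
next
  assume "m < 4"
  note pos = norm_sum_nonzero[OF homog_Cn[OF this] homog_nonzero, of \<zeta>]
  show "(\<Sum>k<4. homog m \<zeta> k * cnj (homog m \<zeta> k)) \<noteq> 0"
    unfolding pos(1) of_real_eq_0_iff using pos(2) by (rule less_imp_neq[THEN not_sym])
qed

lemma flag_coord_cover_image: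
  assumes m: "m < 4" and i: "i < 4" and \<alpha>: "\<alpha> < 2" and j: "j < 4" and \<beta>: "\<beta> < 2"
  shows "flag_coord m i \<alpha> ` (proj_cover P3 NCd (j, \<beta>) \<inter> flag_domain m i \<alpha>) = overlap_region m i \<alpha> j \<beta>"
  unfolding flag_coord_image[OF m i \<alpha>] overlap_region_def plane_point_cover[OF m i] using j \<beta> by auto

lemma flag_hermitian_metric: "hermitian_metric (P_dual P3 NC) (hyperplane_bundle P3 NC) flag_metric"
  unfolding hermitian_metric_def hyperplane_simps(1,2)
proof (intro conjI allI ballI impI)
  fix j\<beta> :: "nat \<times> nat" and a b :: unit
  obtain j \<beta> where j\<beta>: "j\<beta> = (j, \<beta>)" by (cases j\<beta>)
  have a: "a = ()" "b = ()" by simp_all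
  show "smooth_fun (P_dual P3 NC) (proj_cover P3 NCd j\<beta>) (\<lambda>x. flag_metric j\<beta> x a b)"
    unfolding smooth_fun_def P_dual_simps j\<beta> a
  proof clarify
    fix m i \<alpha> :: nat assume m: "m < 4" and \<alpha>: "\<alpha> < 2"
    show "smooth_Cn 4 (flag_coord m i \<alpha> ` (proj_cover P3 NCd (j, \<beta>) \<inter> flag_domain m i \<alpha>))
       (in_chart (flag_domain m i \<alpha>, flag_coord m i \<alpha>) (\<lambda>x. flag_metric (j, \<beta>) x () ()))"
    proof (cases "i < 4 \<and> j < 4 \<and> \<beta> < 2")
      case True
      hence t: "i < 4" "j < 4" "\<beta> < 2" by auto
      define V where "V = overlap_region m i \<alpha> j \<beta>"
      note V = overlap_region[of m i \<alpha> j \<beta>, folded V_def]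
      have sm: "C_diff r 4 V f" if "nice 4 V f" for r f using that unfolding nice_def smooth_Cn_def by blast
      have VS: "V \<subseteq> flag_region m i" unfolding V_def overlap_region_def by auto
      show ?thesis unfolding flag_coord_cover_image[OF m t(1) \<alpha> t(2,3)] V_def[symmetric] smooth_Cn_def
      proof
        fix r
        have "C_diff r 4 V (\<lambda>\<zeta>. quot j (homog m \<zeta>) (plane_vec m i \<alpha> \<zeta>) \<beta> * cnj (quot j (homog m \<zeta>) (plane_vec m i \<alpha> \<zeta>) \<beta>) *
          (\<Sum>k<4. homog m \<zeta> k * cnj (homog m \<zeta> k)) *
          inverse (\<Sum>l\<in>I2. wedge (homog m \<zeta>) (plane_vec m i \<alpha> \<zeta>) l * cnj (wedge (homog m \<zeta>) (plane_vec m i \<alpha> \<zeta>) l)))"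
          by (intro C_diff_mult C_diff_sum C_diff_inverse C_diff_cnj sm V nice_homog nice_wedge)
             (use flag_nonzero(1)[OF t(1) \<alpha>] VS in blast)
        thus "C_diff r 4 V (in_chart (flag_domain m i \<alpha>, flag_coord m i \<alpha>) (\<lambda>x. flag_metric (j, \<beta>) x () ()))"
          by (rule C_diff_cong[OF V(1)])
             (simp add: flag_metric_chart[OF m t(1) \<alpha> t(2,3)] V_def divide_inverse)
      qed
    next
      case False
      have "proj_cover P3 NCd (j, \<beta>) \<inter> flag_domain m i \<alpha> = {}"
        using False unfolding proj_cover_def flag_domain_def proj_chart_def by (auto split: if_splits)
      moreover have "C_diff r n {} f" for r n f by (induction r arbitrary: f) auto
      ultimately show ?thesis unfolding smooth_Cn_def by simp
    qed
  qed
next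
  fix j\<beta> y and a b :: unit assume y: "y \<in> proj_cover P3 NCd j\<beta>"
  obtain j \<beta> where j\<beta>: "j\<beta> = (j, \<beta>)" by (cases j\<beta>)
  obtain z w where z: "z \<in> Cn 4" "z \<noteq> (\<lambda>_. 0)" "sform z w = 0" "fibre_vec z w j \<beta> \<noteq> 0" "y = (line z, plane z w)"
    by (rule proj_cover_plane[OF y[unfolded j\<beta>]])
  show "flag_metric j\<beta> y b a = cnj (flag_metric j\<beta> y a b)"
    unfolding j\<beta> z(5) flag_metric_plane[OF z(1-4)] by (simp add: mult.commute)
next
  fix j\<beta> y and v :: "unit \<Rightarrow> complex" assume y: "y \<in> proj_cover P3 NCd j\<beta>" and v: "\<exists>a\<in>{()}. v a \<noteq> 0"
  obtain j \<beta> where j\<beta>: "j\<beta> = (j, \<beta>)" by (cases j\<beta>)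
  obtain z w where z: "z \<in> Cn 4" "z \<noteq> (\<lambda>_. 0)" "sform z w = 0" "fibre_vec z w j \<beta> \<noteq> 0" "y = (line z, plane z w)"
    by (rule proj_cover_plane[OF y[unfolded j\<beta>]])
  obtain l where l: "l \<in> I2" "wedge z w l \<noteq> 0" by (rule plane_norm_pos[OF z(1,2,4)])
  note B = norm_sum_pos[where f = "wedge z w" and J = I2, OF _ l, simplified finite_SigmaI finite_lessThan]
  have q: "quot j z w \<beta> \<noteq> 0" using z(4) unfolding fibre_vec_def by (auto split: if_splits)
  have e: "flag_metric j\<beta> y () () * v () * cnj (v ()) = of_real ((cmod (quot j z w \<beta>))\<^sup>2 * (\<Sum>k<4. (cmod (z k))\<^sup>2) /
      (\<Sum>j\<in>I2. (cmod (wedge z w j))\<^sup>2) * (cmod (v ()))\<^sup>2)"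
    unfolding j\<beta> z(5) flag_metric_plane[OF z(1-4)] B(1) norm_sum_nonzero(1)[OF z(1,2)]
    by (simp add: complex_norm_square mult.assoc del: of_real_power)
  have "0 < Re (flag_metric j\<beta> y () () * v () * cnj (v ()))"
    unfolding e Re_complex_of_real using q v norm_sum_nonzero(2)[OF z(1,2)] B(2)
    by (intro mult_pos_pos divide_pos_pos) auto
  thus "0 < Re (\<Sum>\<alpha>\<in>{()}. \<Sum>\<beta>'\<in>{()}. flag_metric j\<beta> y \<alpha> \<beta>' * v \<alpha> * cnj (v \<beta>'))" by simp
next
  fix i\<alpha> j\<beta> y and c d :: unit assume y: "y \<in> proj_cover P3 NCd i\<alpha> \<inter> proj_cover P3 NCd j\<beta>"
  obtain i \<alpha> where i\<alpha>: "i\<alpha> = (i, \<alpha>)" by (cases i\<alpha>)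
  obtain j \<beta> where j\<beta>: "j\<beta> = (j, \<beta>)" by (cases j\<beta>)
  have y1: "y \<in> proj_cover P3 NCd (i, \<alpha>)" using y i\<alpha> by simp
  obtain z w where z: "z \<in> Cn 4" "z \<noteq> (\<lambda>_. 0)" "sform z w = 0" "fibre_vec z w i \<alpha> \<noteq> 0" "y = (line z, plane z w)"
    by (rule proj_cover_plane[OF y1])
  have zj: "fibre_vec z w j \<beta> \<noteq> 0" using y plane_in_cover[OF z(1-3)] unfolding j\<beta> z(5) by simp
  have q: "fibre_vec z w i \<alpha> = quot i z w \<alpha>" "fibre_vec z w j \<beta> = quot j z w \<beta>"
    using z(4) zj unfolding fibre_vec_def by (auto split: if_splits)
  show "flag_metric j\<beta> y c d = (\<Sum>a\<in>{()}. \<Sum>b\<in>{()}. flag_metric i\<alpha> y a b *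
      cocycle (hyperplane_bundle P3 NC) i\<alpha> j\<beta> y a c * cnj (cocycle (hyperplane_bundle P3 NC) i\<alpha> j\<beta> y b d))"
    unfolding i\<alpha> j\<beta> z(5) hyperplane_simps
    using z(4) by (simp add: flag_metric_plane[OF z(1-4)] flag_metric_plane[OF z(1-3) zj] normalized_plane[OF z(4)] q)
qed

text \<open>The curvature formula for a quotient of norms, with numerator z, denominator z \<and> w,
  and \<theta> the frame-dependent factor, which contributes nothing.\<close>

lemma flag_curvature_form:
  assumes m: "m < 4" and i: "i < 4" and \<alpha>: "\<alpha> < 2" and j: "j < 4" and \<beta>: "\<beta> < 2"
    and \<zeta>: "\<zeta> \<in> overlap_region m i \<alpha> j \<beta>"
  defines "R \<equiv> line_curvature (hyperplane_bundle P3 NC) flag_metric (flag_domain m i \<alpha>, flag_coord m i \<alpha>) (j, \<beta>) (plane_point m i \<alpha> \<zeta>)"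
  shows "\<And>p q. p < 4 \<Longrightarrow> q < 4 \<Longrightarrow> R q p = cnj (R p q)"
    and "(\<Sum>p<4. \<Sum>q<4. R p q * u p * cnj (u q)) =
      fubini_study I2 (wedge (homog m \<zeta>) (plane_vec m i \<alpha> \<zeta>))
        (\<lambda>l. \<Sum>p<4. u p * dz p (\<lambda>\<zeta>. wedge (homog m \<zeta>) (plane_vec m i \<alpha> \<zeta>) l) \<zeta>)
      - fubini_study {..<4} (homog m \<zeta>) (\<lambda>k. \<Sum>p<4. u p * dz p (\<lambda>\<zeta>. homog m \<zeta> k) \<zeta>)"
proof -
  define V where "V = overlap_region m i \<alpha> j \<beta>"
  note V = overlap_region[of m i \<alpha> j \<beta>, folded V_def]
  have VS: "V \<subseteq> flag_region m i" unfolding V_def overlap_region_def by auto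
  have \<zeta>V: "\<zeta> \<in> V" using \<zeta> unfolding V_def .
  have coord: "snd (flag_domain m i \<alpha>, flag_coord m i \<alpha>) (plane_point m i \<alpha> \<zeta>) = \<zeta>"
    using flag_coord_plane_point[OF m i \<alpha>] \<zeta>V VS by auto
  have h2: "holo2 4 V f" if "nice 4 V f" for f using that unfolding nice_def by blast
  have R: "R p q = log_hessian I2 (\<lambda>l \<zeta>. wedge (homog m \<zeta>) (plane_vec m i \<alpha> \<zeta>) l) \<zeta> p q
      - log_hessian {..<4} (\<lambda>k \<zeta>. homog m \<zeta> k) \<zeta> p q" if pq: "p < 4" "q < 4" for p q
    unfolding R_def
  proof (rule line_curvature_formula[where V = V and N = 4 and c = "(flag_domain m i \<alpha>, flag_coord m i \<alpha>)"
        and x = "plane_point m i \<alpha> \<zeta>" and \<theta> = "\<lambda>\<zeta>. quot j (homog m \<zeta>) (plane_vec m i \<alpha> \<zeta>) \<beta>", unfolded coord])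
    show "frame (hyperplane_bundle P3 NC) = {()}" by (rule hyperplane_simps)
    show "openin (Cn_topology 4) V" by (rule V)
    show "\<zeta> \<in> V" by (rule \<zeta>V)
    show "holo2 4 V (\<lambda>\<zeta>. quot j (homog m \<zeta>) (plane_vec m i \<alpha> \<zeta>) \<beta>)" by (rule h2[OF V(2)])
    show "holo2 4 V (\<lambda>\<zeta>. homog m \<zeta> k)" for k by (rule h2[OF nice_homog[OF V(1)]])
    show "holo2 4 V (\<lambda>\<zeta>. wedge (homog m \<zeta>) (plane_vec m i \<alpha> \<zeta>) l)" for l by (rule h2[OF nice_wedge[OF V(1)]])
    show "quot j (homog m z) (plane_vec m i \<alpha> z) \<beta> \<noteq> 0" if "z \<in> V" for z
      using that unfolding V_def overlap_region_def by simp
    show "(\<Sum>k<4. homog m z k * cnj (homog m z k)) \<noteq> 0" if "z \<in> V" for z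
      using flag_nonzero(2)[OF i \<alpha> _ m] VS that by blast
    show "(\<Sum>l\<in>I2. wedge (homog m z) (plane_vec m i \<alpha> z) l * cnj (wedge (homog m z) (plane_vec m i \<alpha> z) l)) \<noteq> 0" if "z \<in> V" for z
      using flag_nonzero(1)[OF i \<alpha>] VS that by blast
    show "in_chart (flag_domain m i \<alpha>, flag_coord m i \<alpha>) (\<lambda>y. flag_metric (j, \<beta>) y () ()) z =
      quot j (homog m z) (plane_vec m i \<alpha> z) \<beta> * cnj (quot j (homog m z) (plane_vec m i \<alpha> z) \<beta>) *
      (\<Sum>k<4. homog m z k * cnj (homog m z k)) /
      (\<Sum>l\<in>I2. wedge (homog m z) (plane_vec m i \<alpha> z) l * cnj (wedge (homog m z) (plane_vec m i \<alpha> z) l))" if "z \<in> V" for z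
      using flag_metric_chart[OF m i \<alpha> j \<beta>] that unfolding V_def .
    show "in_chart (flag_domain m i \<alpha>, flag_coord m i \<alpha>) (\<lambda>y. flag_metric (j, \<beta>) y () ()) \<zeta> =
        flag_metric (j, \<beta>) (plane_point m i \<alpha> \<zeta>) () ()"
      using in_chart_flag[OF m i \<alpha>] \<zeta>V VS by blast
  qed (use pq in auto)
  show "R q p = cnj (R p q)" if "p < 4" "q < 4" for p q
    unfolding R[OF that] R[OF that(2,1)] complex_cnj_diff log_hessian_hermitian[symmetric] ..
  have "(\<Sum>p<4. \<Sum>q<4. R p q * u p * cnj (u q)) =
      (\<Sum>p<4. \<Sum>q<4. log_hessian I2 (\<lambda>l \<zeta>. wedge (homog m \<zeta>) (plane_vec m i \<alpha> \<zeta>) l) \<zeta> p q * u p * cnj (u q)) -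
      (\<Sum>p<4. \<Sum>q<4. log_hessian {..<4} (\<lambda>k \<zeta>. homog m \<zeta> k) \<zeta> p q * u p * cnj (u q))"
    unfolding sum_subtractf[symmetric] by (intro sum.cong refl) (simp add: R left_diff_distrib)
  thus "(\<Sum>p<4. \<Sum>q<4. R p q * u p * cnj (u q)) =
      fubini_study I2 (wedge (homog m \<zeta>) (plane_vec m i \<alpha> \<zeta>))
        (\<lambda>l. \<Sum>p<4. u p * dz p (\<lambda>\<zeta>. wedge (homog m \<zeta>) (plane_vec m i \<alpha> \<zeta>) l) \<zeta>)
      - fubini_study {..<4} (homog m \<zeta>) (\<lambda>k. \<Sum>p<4. u p * dz p (\<lambda>\<zeta>. homog m \<zeta> k) \<zeta>)"
    unfolding log_hessian_form by simp
qed

lemma fubini_study_cong: "(\<And>j. j \<in> J \<Longrightarrow> y j = y' j) \<Longrightarrow> fubini_study J x y = fubini_study J x y'"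
  unfolding fubini_study_def by simp

text \<open>Along a fibre z is at rest, so the subtracted form vanishes and the Pluecker vector
  moves in a direction not proportional to itself. For the eigenvalues, the quaternionic directions
  in homogeneous coordinates span a plane on which the form is positive.\<close>

lemma NC_weakly_RC_positive: "weakly_RC_positive P3 NC"
  unfolding weakly_RC_positive_def
proof (intro exI[of _ flag_metric] conjI flag_hermitian_metric ballI allI impI)
  fix y c and j\<beta> :: "nat \<times> nat"
  assume c: "c \<in> atlas (P_dual P3 NC)" and y: "y \<in> fst c \<inter> cover (hyperplane_bundle P3 NC) j\<beta>"
  obtain j \<beta> where j\<beta>: "j\<beta> = (j, \<beta>)" by (cases j\<beta>)
  obtain m i \<alpha> where m: "m < 4" and \<alpha>: "\<alpha> < 2" and c': "c = (flag_domain m i \<alpha>, flag_coord m i \<alpha>)"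
    using c unfolding P_dual_simps by auto
  have yD: "y \<in> flag_domain m i \<alpha>" and yC: "y \<in> proj_cover P3 NCd (j, \<beta>)" using y unfolding c' hyperplane_simps j\<beta> by auto
  obtain \<zeta> where i: "i < 4" and reg: "\<zeta> \<in> flag_region m i" and y': "y = plane_point m i \<alpha> \<zeta>"
    by (rule flag_domain_point[OF m yD])
  have j: "j < 4" "\<beta> < 2" and ov: "\<zeta> \<in> overlap_region m i \<alpha> j \<beta>"
    using yC reg unfolding y' plane_point_cover[OF m i] overlap_region_def by auto
  define R where "R = line_curvature (hyperplane_bundle P3 NC) flag_metric c j\<beta> y"
  have Rd: "R = line_curvature (hyperplane_bundle P3 NC) flag_metric (flag_domain m i \<alpha>, flag_coord m i \<alpha>) (j, \<beta>) (plane_point m i \<alpha> \<zeta>)"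
    unfolding R_def c' j\<beta> y' ..
  note form = flag_curvature_form[OF m i \<alpha> j ov, folded Rd]
  let ?z = "homog m \<zeta>" and ?w = "plane_vec m i \<alpha> \<zeta>"
  have zi: "?z i \<noteq> 0" using reg unfolding flag_region_def by simp
  have dP: "(\<Sum>p<4. u p * dz p (\<lambda>\<zeta>. wedge (homog m \<zeta>) (plane_vec m i \<alpha> \<zeta>) l) \<zeta>) =
      wedge (homog_dir m u) ?w l + wedge ?z (plane_dir m i \<alpha> \<zeta> u) l" for u l
    by (rule has_dirD[OF has_dir_wedge[OF m]])
  have dZ: "(\<Sum>p<4. u p * dz p (\<lambda>\<zeta>. homog m \<zeta> k) \<zeta>) = homog_dir m u k" for u k
    by (rule has_dirD[OF has_dir_homog[OF m]])
  have fib: "0 < Re (\<Sum>p<4. \<Sum>q<4. R p q * u p * cnj (u q))"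
    if u: "u \<in> Cn 4" "u \<noteq> (\<lambda>_. 0)" "\<forall>k<3. u k = 0" for u
  proof -
    have u3: "u 3 \<noteq> 0"
    proof
      assume "u 3 = 0"
      hence "u k = 0" for k using u(1,3) unfolding Cn_def by (cases "k < 3"; cases "k = 3") auto
      with u(2) show False by auto
    qed
    have hd: "homog_dir m u k = 0" for k using u(3) m unfolding homog_dir_def by auto
    have l0: "lift i (homog_dir m u) v k = 0" for v k unfolding lift_def hd by simp
    define \<gamma> where "\<gamma> = 1 - \<alpha>"
    have \<gamma>: "\<gamma> < 2" "\<gamma> \<noteq> \<alpha>" unfolding \<gamma>_def using \<alpha> by presburger+
    have 1: "fubini_study {..<4} ?z (homog_dir m u) = 0" unfolding fubini_study_def hd by simp
    have D: "wedge (homog_dir m u) ?w l + wedge ?z (plane_dir m i \<alpha> \<zeta> u) l = wedge ?z (lift i ?z (fibre_dir \<alpha> u)) l" for l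
      unfolding wedge_def plane_dir_def l0 hd by (simp add: split_def)
    have w: "wedge ?z (lift i ?z v) (i, fidx i \<delta>) = ?z i * ?z i * v \<delta>" if "\<delta> < 2" for v \<delta>
      unfolding wedge_def by (simp add: lift_i i lift_fidx[OF i that])
    have "0 < Re (fubini_study I2 (wedge ?z ?w) (wedge ?z (lift i ?z (fibre_dir \<alpha> u))))"
    proof (rule fubini_study_pos)
      show "(i, fidx i \<alpha>) \<in> I2" "(i, fidx i \<gamma>) \<in> I2" using i fidx_less \<alpha> \<gamma> by auto
      show "wedge ?z ?w (i, fidx i \<alpha>) \<noteq> 0" using zi by (simp add: wedge_plane_vec[OF i \<alpha>] fibre_coord_def)
      show "wedge ?z (lift i ?z (fibre_dir \<alpha> u)) (i, fidx i \<alpha>) = 0" by (simp add: w[OF \<alpha>] fibre_dir_def)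
      show "wedge ?z (lift i ?z (fibre_dir \<alpha> u)) (i, fidx i \<gamma>) \<noteq> 0"
        using zi u3 \<gamma>(2) by (simp add: w[OF \<gamma>(1)] fibre_dir_def)
    qed simp
    thus ?thesis unfolding form(2) dP dZ D 1 by simp
  qed
  have "wedge ?z ?w (i, fidx i \<alpha>) \<noteq> 0" using zi by (simp add: wedge_plane_vec[OF i \<alpha>] fibre_coord_def)
  then obtain x1 y1 x2 y2 where
    t: "sform x1 ?w + sform ?z y1 = 0" "sform x2 ?w + sform ?z y2 = 0" and
    pos: "\<And>a b. a \<noteq> 0 \<or> b \<noteq> 0 \<Longrightarrow>
      0 < Re (fubini_study I2 (wedge ?z ?w) (\<lambda>j. a * (wedge x1 ?w j + wedge ?z y1 j) + b * (wedge x2 ?w j + wedge ?z y2 j))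
         - fubini_study {..<4} ?z (\<lambda>k. a * x1 k + b * x2 k))"
    by (rule positive_directions[OF sform_plane_vec[OF i] i fidx_less[OF \<alpha>]]) (rule that)
  \<comment> \<open>The homogeneous directions become chart vectors; the corrections c1 and d1, and
    c2 and d2 below, disappear by \<open>fubini_study_shift\<close>.\<close>
  obtain u1 c1 d1 where u1: "\<And>k. k < 4 \<Longrightarrow> homog_dir m u1 k = x1 k + d1 * ?z k"
    "\<And>j. j \<in> I2 \<Longrightarrow> wedge (homog_dir m u1) ?w j + wedge ?z (plane_dir m i \<alpha> \<zeta> u1) j = wedge x1 ?w j + wedge ?z y1 j + c1 * wedge ?z ?w j"
    by (rule realize_tangent[OF m i \<alpha> zi t(1)]) (rule that)
  obtain u2 c2 d2 where u2: "\<And>k. k < 4 \<Longrightarrow> homog_dir m u2 k = x2 k + d2 * ?z k"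
    "\<And>j. j \<in> I2 \<Longrightarrow> wedge (homog_dir m u2) ?w j + wedge ?z (plane_dir m i \<alpha> \<zeta> u2) j = wedge x2 ?w j + wedge ?z y2 j + c2 * wedge ?z ?w j"
    by (rule realize_tangent[OF m i \<alpha> zi t(2)]) (rule that)
  have "2 \<le> num_positive_eigenvalues (Matrix.mat 4 4 (\<lambda>(p, q). R p q))"
  proof (rule two_le_num_positive_eigenvalues[OF form(1)])
    fix a b :: complex assume ab: "a \<noteq> 0 \<or> b \<noteq> 0"
    define u where "u = (\<lambda>p. a * u1 p + b * u2 p)"
    have lin: "(\<Sum>p<4. u p * f p) = a * (\<Sum>p<4. u1 p * f p) + b * (\<Sum>p<4. u2 p * f p)" for f :: "nat \<Rightarrow> complex"
      unfolding u_def by (simp add: algebra_simps sum.distrib sum_distrib_left)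
    have e1: "fubini_study I2 (wedge ?z ?w) (\<lambda>l. \<Sum>p<4. u p * dz p (\<lambda>\<zeta>. wedge (homog m \<zeta>) (plane_vec m i \<alpha> \<zeta>) l) \<zeta>) =
        fubini_study I2 (wedge ?z ?w) (\<lambda>j. a * (wedge x1 ?w j + wedge ?z y1 j) + b * (wedge x2 ?w j + wedge ?z y2 j))"
    proof -
      have "fubini_study I2 (wedge ?z ?w) (\<lambda>l. \<Sum>p<4. u p * dz p (\<lambda>\<zeta>. wedge (homog m \<zeta>) (plane_vec m i \<alpha> \<zeta>) l) \<zeta>) =
        fubini_study I2 (wedge ?z ?w) (\<lambda>j. (a * (wedge x1 ?w j + wedge ?z y1 j) + b * (wedge x2 ?w j + wedge ?z y2 j))
          + (a * c1 + b * c2) * wedge ?z ?w j)"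
        by (rule fubini_study_cong) (simp only: lin dP u1(2) u2(2), simp add: algebra_simps)
      thus ?thesis unfolding fubini_study_shift .
    qed
    have e2: "fubini_study {..<4} ?z (\<lambda>k. \<Sum>p<4. u p * dz p (\<lambda>\<zeta>. homog m \<zeta> k) \<zeta>) =
        fubini_study {..<4} ?z (\<lambda>k. a * x1 k + b * x2 k)"
    proof -
      have "fubini_study {..<4} ?z (\<lambda>k. \<Sum>p<4. u p * dz p (\<lambda>\<zeta>. homog m \<zeta> k) \<zeta>) =
        fubini_study {..<4} ?z (\<lambda>k. (a * x1 k + b * x2 k) + (a * d1 + b * d2) * ?z k)"
        by (rule fubini_study_cong) (simp only: lin dZ u1(1) u2(1) lessThan_iff, simp add: algebra_simps)
      thus ?thesis unfolding fubini_study_shift .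
    qed
    have "0 < Re (\<Sum>p<4. \<Sum>q<4. R p q * u p * cnj (u q))"
      unfolding form(2) e1 e2 by (rule pos[OF ab])
    thus "0 < Re (\<Sum>p<4. \<Sum>q<4. R p q * (a * u1 p + b * u2 p) * cnj (a * u1 q + b * u2 q))"
      unfolding u_def .
  qed
  thus "let N = cdim (P_dual P3 NC); R = line_curvature (hyperplane_bundle P3 NC) flag_metric c j\<beta> y
     in (\<forall>u\<in>Cn N. u \<noteq> (\<lambda>_. 0) \<and> (\<forall>k<cdim P3. u k = 0) \<longrightarrow> 0 < Re (\<Sum>p<N. \<Sum>q<N. R p q * u p * cnj (u q))) \<and>
        rank NC \<le> num_positive_eigenvalues (Matrix.mat N N (\<lambda>(p, q). R p q))"
    unfolding Let_def P_dual_simps R_def[symmetric] using fib by simp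
qed

section \<open>Bundles with an invariant quadratic form\<close>

text \<open>Vectors are functions on the whole label type. Setting them to 0 off B embeds the sphere
  as a closed subset of a compact product.\<close>

lemma compact_unit_sphere:
  fixes B :: "'b set"
  assumes "finite B"
  shows "compact {v :: 'b \<Rightarrow> complex. (\<forall>b. b \<notin> B \<longrightarrow> v b = 0) \<and> (\<Sum>b\<in>B. (cmod (v b))\<^sup>2) = 1}"
proof -
  define P where "P = (Pi\<^sub>E UNIV (\<lambda>b. if b \<in> B then cball 0 1 else {0}) :: ('b \<Rightarrow> complex) set)"
  have "compact P"
  proof -
    have "compactin (product_topology (\<lambda>b. euclidean) UNIV) P"
      unfolding P_def compactin_PiE by auto
    thus ?thesis by (simp add: euclidean_product_topology)
  qed
  moreover have "closed {v :: 'b \<Rightarrow> complex. (\<Sum>b\<in>B. (cmod (v b))\<^sup>2) = 1}"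
    by (intro closed_Collect_eq continuous_intros continuous_on_product_coordinates)
  ultimately have "compact (P \<inter> {v. (\<Sum>b\<in>B. (cmod (v b))\<^sup>2) = 1})" by (rule compact_Int_closed)
  moreover have "v \<in> P \<longleftrightarrow> (\<forall>b. b \<notin> B \<longrightarrow> v b = 0)" if v: "(\<Sum>b\<in>B. (cmod (v b))\<^sup>2) = 1" for v
  proof -
    have "cmod (v b) \<le> 1" if "b \<in> B" for b
    proof -
      have "(cmod (v b))\<^sup>2 \<le> 1" using member_le_sum[where f = "\<lambda>b. (cmod (v b))\<^sup>2", OF that _ assms] v by simp
      thus ?thesis by (simp add: abs_square_le_1)
    qed
    thus ?thesis unfolding P_def by (auto simp: PiE_iff split: if_splits)
  qed
  hence "P \<inter> {v. (\<Sum>b\<in>B. (cmod (v b))\<^sup>2) = 1} = {v. (\<forall>b. b \<notin> B \<longrightarrow> v b = 0) \<and> (\<Sum>b\<in>B. (cmod (v b))\<^sup>2) = 1}"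
    by blast
  ultimately show ?thesis by simp
qed

lemma hermitian_form_transform:
  fixes H G :: "'b \<Rightarrow> 'b \<Rightarrow> complex"
  shows "(\<Sum>\<gamma>\<in>B. \<Sum>\<delta>\<in>B. (\<Sum>\<alpha>\<in>B. \<Sum>\<beta>\<in>B. H \<alpha> \<beta> * G \<alpha> \<gamma> * cnj (G \<beta> \<delta>)) * v \<gamma> * cnj (v \<delta>)) =
    (\<Sum>\<alpha>\<in>B. \<Sum>\<beta>\<in>B. H \<alpha> \<beta> * (\<Sum>\<gamma>\<in>B. G \<alpha> \<gamma> * v \<gamma>) * cnj (\<Sum>\<gamma>\<in>B. G \<beta> \<gamma> * v \<gamma>))"
proof -
  have "(\<Sum>\<gamma>\<in>B. \<Sum>\<delta>\<in>B. (\<Sum>\<alpha>\<in>B. \<Sum>\<beta>\<in>B. H \<alpha> \<beta> * G \<alpha> \<gamma> * cnj (G \<beta> \<delta>)) * v \<gamma> * cnj (v \<delta>)) =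
      (\<Sum>(\<gamma>, \<delta>)\<in>B \<times> B. \<Sum>(\<alpha>, \<beta>)\<in>B \<times> B. H \<alpha> \<beta> * (G \<alpha> \<gamma> * v \<gamma>) * cnj (G \<beta> \<delta> * v \<delta>))"
    unfolding sum.cartesian_product[symmetric] by (simp add: sum_distrib_left sum_distrib_right mult_ac)
  also have "\<dots> = (\<Sum>(\<alpha>, \<beta>)\<in>B \<times> B. \<Sum>(\<gamma>, \<delta>)\<in>B \<times> B. H \<alpha> \<beta> * (G \<alpha> \<gamma> * v \<gamma>) * cnj (G \<beta> \<delta> * v \<delta>))"
    unfolding split_def by (rule sum.swap)
  also have "\<dots> = (\<Sum>\<alpha>\<in>B. \<Sum>\<beta>\<in>B. H \<alpha> \<beta> * (\<Sum>\<gamma>\<in>B. G \<alpha> \<gamma> * v \<gamma>) * cnj (\<Sum>\<gamma>\<in>B. G \<beta> \<gamma> * v \<gamma>))"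
    unfolding sum.cartesian_product[symmetric] cnj_sum mult.assoc sum_product
    unfolding sum_distrib_left split_conv mult.assoc ..
  finally show ?thesis .
qed

text \<open>The quotient of |q| by the squared length is independent of the frame and of scaling,
  hence a function on a compact projectivized bundle. Its maximum is found on four products of a
  polydisc and a unit sphere, and there the maximum principle excludes RC-positivity.\<close>

lemma invariant_quadratic_form_not_RC_positive:
  fixes F :: "((nat \<Rightarrow> complex) set, nat, 'b) vbundle" and K :: "'b \<Rightarrow> 'b \<Rightarrow> complex"
  defines "q \<equiv> \<lambda>v. \<Sum>a\<in>frame F. \<Sum>b\<in>frame F. K a b * v a * v b"
  assumes fin: "finite (frame F)" and cover: "\<And>i. cover F i = (if i < 4 then P3_domain i else {})"
    and inv: "\<And>i j x v. x \<in> cover F i \<inter> cover F j \<Longrightarrow> q (\<lambda>\<alpha>. \<Sum>\<beta>\<in>frame F. cocycle F i j x \<alpha> \<beta> * v \<beta>) = q v"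
    and q1: "q v1 \<noteq> 0"
  shows "\<not> RC_positive P3 F"
proof
  assume "RC_positive P3 F"
  then obtain h where h: "hermitian_metric P3 F h" and RC: "\<forall>x\<in>points P3. RC_positive_at P3 F h x"
    unfolding RC_positive_def by blast
  define B where "B = frame F"
  define N where "N = (\<lambda>i x v. Re (\<Sum>\<alpha>\<in>B. \<Sum>\<beta>\<in>B. h i x \<alpha> \<beta> * v \<alpha> * cnj (v \<beta>)))"
  define p where "p = (\<lambda>i \<zeta>. line (homog i \<zeta>))"
  define D where "D = {\<zeta> \<in> Cn 3. \<forall>k. cmod (\<zeta> k) \<le> 1}"
  define S where "S = {v :: 'b \<Rightarrow> complex. (\<forall>b. b \<notin> B \<longrightarrow> v b = 0) \<and> (\<Sum>b\<in>B. (cmod (v b))\<^sup>2) = 1}"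
  have B: "finite B" using fin unfolding B_def .
  have pD: "p i \<zeta> \<in> P3_domain i" if "i < 4" for i \<zeta> unfolding p_def by (rule line_homog_in_domain[OF that])
  have pos: "0 < N i x v" if "i < 4" "x \<in> P3_domain i" "\<exists>b\<in>B. v b \<noteq> 0" for i x v
  proof -
    have "x \<in> cover F i" using that cover[of i] by simp
    thus ?thesis using h that(3) unfolding hermitian_metric_def N_def B_def by blast
  qed
  have Nq: "N j x v = N i x (\<lambda>\<alpha>. \<Sum>\<beta>\<in>B. cocycle F i j x \<alpha> \<beta> * v \<beta>)"
    if "x \<in> cover F i \<inter> cover F j" for i j x v
  proof -
    have t: "h j x \<gamma> \<delta> = (\<Sum>\<alpha>\<in>B. \<Sum>\<beta>\<in>B. h i x \<alpha> \<beta> * cocycle F i j x \<alpha> \<gamma> * cnj (cocycle F i j x \<beta> \<delta>))"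
      if "\<gamma> \<in> B" "\<delta> \<in> B" for \<gamma> \<delta>
      using h \<open>x \<in> cover F i \<inter> cover F j\<close> that unfolding hermitian_metric_def B_def by blast
    show ?thesis unfolding N_def hermitian_form_transform[symmetric]
      by (intro arg_cong[where f = Re] sum.cong refl) (simp add: t)
  qed
  have N_scale: "N i x (\<lambda>b. of_real c * v b) = c\<^sup>2 * N i x v" for i x c v
  proof -
    have "(\<Sum>\<alpha>\<in>B. \<Sum>\<beta>\<in>B. h i x \<alpha> \<beta> * (of_real c * v \<alpha>) * cnj (of_real c * v \<beta>)) =
        of_real (c\<^sup>2) * (\<Sum>\<alpha>\<in>B. \<Sum>\<beta>\<in>B. h i x \<alpha> \<beta> * v \<alpha> * cnj (v \<beta>))"
      unfolding sum_distrib_left by (intro sum.cong refl) (simp add: power2_eq_square)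
    thus ?thesis unfolding N_def by simp
  qed
  have q_scale: "cmod (q (\<lambda>b. of_real c * v b)) = c\<^sup>2 * cmod (q v)" for c v
  proof -
    have "q (\<lambda>b. of_real c * v b) = of_real (c\<^sup>2) * q v"
      unfolding q_def sum_distrib_left by (intro sum.cong refl) (simp add: power2_eq_square)
    thus ?thesis by (simp add: norm_mult norm_power)
  qed
  have cong: "N i x v = N i x w" "q v = q w" if "\<And>b. b \<in> B \<Longrightarrow> v b = w b" for i x v w
    unfolding N_def q_def B_def[symmetric] using that by simp_all
  have "S \<noteq> {}"
  proof -
    have "B \<noteq> {}" using q1 unfolding q_def B_def by auto
    then obtain b where b: "b \<in> B" by blast
    have "(\<Sum>c\<in>B. (cmod (if c = b then 1 else 0))\<^sup>2) = (\<Sum>c\<in>B. if c = b then 1 else 0)"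
      by (rule sum.cong) auto
    also have "\<dots> = (1::real)" using b B by (simp only: sum.delta if_True)
    finally have "(\<lambda>c. if c = b then 1 else 0) \<in> S" unfolding S_def using b by auto
    thus ?thesis by blast
  qed
  have S0: "\<exists>b\<in>B. v b \<noteq> 0" if "v \<in> S" for v
  proof (rule ccontr)
    assume "\<not> (\<exists>b\<in>B. v b \<noteq> 0)"
    hence "(\<Sum>b\<in>B. (cmod (v b))\<^sup>2) = 0" by simp
    thus False using that unfolding S_def by simp
  qed
  have cont: "continuous_on (D \<times> S) (\<lambda>(\<zeta>, v). cmod (q v) / N i (p i \<zeta>) v)" if i: "i < 4" for i
  proof -
    have ch: "continuous_on D (\<lambda>\<zeta>. h i (p i \<zeta>) \<alpha> \<beta>)" if "\<alpha> \<in> B" "\<beta> \<in> B" for \<alpha> \<beta>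
    proof -
      have "smooth_fun P3 (cover F i) (\<lambda>x. h i x \<alpha> \<beta>)"
        using h that unfolding hermitian_metric_def B_def by blast
      hence s: "smooth_fun P3 (P3_domain i) (\<lambda>x. h i x \<alpha> \<beta>)" using i cover[of i] by simp
      have c: "(P3_domain i, P3_coord i) \<in> atlas P3" unfolding P3_def using i by auto
      have "smooth_Cn 3 (P3_coord i ` (P3_domain i \<inter> P3_domain i)) (in_chart (P3_domain i, P3_coord i) (\<lambda>x. h i x \<alpha> \<beta>))"
        using bspec[OF s[unfolded smooth_fun_def] c] unfolding split_conv P_dual_simps(2) .
      hence "C_diff 0 3 (Cn 3) (in_chart (P3_domain i, P3_coord i) (\<lambda>x. h i x \<alpha> \<beta>))"
        unfolding smooth_Cn_def Int_absorb P3_coord_image_domain[OF i] by blast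
      hence "continuous_on D (in_chart (P3_domain i, P3_coord i) (\<lambda>x. h i x \<alpha> \<beta>))"
        unfolding C_diff.simps by (rule continuous_on_subset) (auto simp: D_def)
      moreover have "in_chart (P3_domain i, P3_coord i) (\<lambda>x. h i x \<alpha> \<beta>) \<zeta> = h i (p i \<zeta>) \<alpha> \<beta>" if "\<zeta> \<in> D" for \<zeta>
        using in_chart_P3[OF i] that unfolding D_def p_def by blast
      ultimately show ?thesis by (simp cong: continuous_on_cong)
    qed
    have c1: "continuous_on (D \<times> S) (\<lambda>y. h i (p i (fst y)) \<alpha> \<beta>)" if "\<alpha> \<in> B" "\<beta> \<in> B" for \<alpha> \<beta>
      by (rule continuous_on_compose2[OF ch[OF that] continuous_on_fst]) (auto intro: continuous_on_id)
    have c2: "continuous_on (D \<times> S) (\<lambda>y. snd y b)" for b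
      using continuous_on_compose2[where f = snd and s = "D \<times> S", OF continuous_on_product_coordinates[of b] continuous_on_snd[OF continuous_on_id]] by simp
    show ?thesis unfolding split_def N_def q_def B_def[symmetric]
    proof (intro continuous_on_divide continuous_on_norm continuous_on_Re continuous_on_sum continuous_on_mult continuous_on_const
        continuous_on_cnj c1 c2 ballI)
      fix y assume y: "y \<in> D \<times> S"
      show "Re (\<Sum>\<alpha>\<in>B. \<Sum>\<beta>\<in>B. h i (p i (fst y)) \<alpha> \<beta> * snd y \<alpha> * cnj (snd y \<beta>)) \<noteq> 0"
      proof -
        have "snd y \<in> S" using y unfolding mem_Times_iff by (rule conjunct2)
        from pos[OF i pD[OF i] S0[OF this], of "fst y"] show ?thesis unfolding N_def by (rule less_imp_neq[THEN not_sym])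
      qed
    qed
  qed
  define m where "m = (\<lambda>i y. cmod (q (snd y)) / N i (p i (fst y)) (snd y))"
  have m: "m i (\<zeta>, v) = cmod (q v) / N i (p i \<zeta>) v" for i \<zeta> v unfolding m_def fst_conv snd_conv ..
  have "\<exists>y\<in>D \<times> S. \<forall>y'\<in>D \<times> S. m i y' \<le> m i y" if "i < 4" for i
  proof (rule continuous_attains_sup)
    show "compact (D \<times> S)" unfolding D_def S_def by (intro compact_Times compact_polydisc compact_unit_sphere B)
    have "(\<lambda>_. 0) \<in> D" unfolding D_def Cn_def by simp
    thus "D \<times> S \<noteq> {}" using \<open>S \<noteq> {}\<close> by blast
    show "continuous_on (D \<times> S) (m i)" using cont[OF that] unfolding m_def split_def .
  qed
  hence "\<forall>i\<in>{..<4}. \<exists>y. y \<in> D \<times> S \<and> (\<forall>y'\<in>D \<times> S. m i y' \<le> m i y)"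
    unfolding Bex_def by (intro ballI) (simp only: lessThan_iff)
  from bchoice[OF this] obtain Y where Y': "\<forall>i\<in>{..<4}. Y i \<in> D \<times> S \<and> (\<forall>y'\<in>D \<times> S. m i y' \<le> m i (Y i))" by (rule exE)
  have Y: "Y i \<in> D \<times> S" "\<And>\<zeta> v. \<zeta> \<in> D \<Longrightarrow> v \<in> S \<Longrightarrow> m i (\<zeta>, v) \<le> m i (Y i)" if "i < 4" for i
    using bspec[OF Y', of i] that by simp_all
  define M where "M = (\<lambda>i. m i (Y i))"
  \<comment> \<open>The chart with the largest of the four maxima is the one in which the maximum
    principle is applied.\<close>
  have "Max (M ` {..<4::nat}) \<in> M ` {..<4}" by (rule Max_in) (simp_all add: lessThan_empty_iff)
  then obtain i where i: "i < 4" "M i = Max (M ` {..<4})" by auto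
  have Mi: "M j \<le> M i" if "j < 4" for j unfolding i(2) using that by (intro Max_ge) auto
  have le: "cmod (q v) \<le> M i * N j (p j \<zeta>) v" if j: "j < 4" and \<zeta>: "\<zeta> \<in> D" and v: "\<exists>b\<in>B. v b \<noteq> 0" for j \<zeta> v
  proof -
    define s where "s = (\<Sum>b\<in>B. (cmod (v b))\<^sup>2)"
    have s: "0 < s" unfolding s_def using v B by (auto intro: sum_pos2)
    define c where "c = 1 / sqrt s"
    have c: "c\<^sup>2 = 1 / s" unfolding c_def using s by (simp add: power_divide)
    define w where "w = (\<lambda>b. if b \<in> B then of_real c * v b else 0)"
    have "(\<Sum>b\<in>B. (cmod (w b))\<^sup>2) = c\<^sup>2 * s" unfolding s_def sum_distrib_left w_def
      by (intro sum.cong refl) (simp add: norm_mult power_mult_distrib)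
    hence "w \<in> S" unfolding S_def using c s by (simp add: w_def)
    from Y(2)[OF j \<zeta> this] have "cmod (q w) / N j (p j \<zeta>) w \<le> M i" using Mi[OF j] unfolding M_def m by linarith
    moreover have "q w = q (\<lambda>b. of_real c * v b)" by (rule cong) (simp add: w_def)
    hence "cmod (q w) = cmod (q v) / s" using q_scale[of c v] c by simp
    moreover have "N j (p j \<zeta>) w = N j (p j \<zeta>) (\<lambda>b. of_real c * v b)" by (rule cong) (simp add: w_def)
    hence "N j (p j \<zeta>) w = N j (p j \<zeta>) v / s" using N_scale[of j "p j \<zeta>" c v] c by simp
    ultimately have "cmod (q v) / N j (p j \<zeta>) v \<le> M i" using s by simp
    thus ?thesis using pos[OF j pD[OF j] v, of \<zeta>] by (simp add: pos_divide_le_eq)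
  qed
  \<comment> \<open>The maximum principle wants the bound on the whole affine chart i, beyond its
    polydisc. A point far out lies in the polydisc of another chart j, and invariance of q and of
    the length carries the estimate over.\<close>
  have bound: "cmod (q v) \<le> M i * N i x v" if x: "x \<in> P3_domain i" for x v
  proof (cases "\<exists>b\<in>B. v b \<noteq> 0")
    case False
    hence "q v = 0" unfolding q_def B_def[symmetric] by auto
    moreover have "N i x v = 0" unfolding N_def using False by auto
    ultimately show ?thesis by simp
  next
    case True
    have "x \<in> points P3" using x P3_domain_subset by blast
    then obtain j \<zeta> where j: "j < 4" "\<zeta> \<in> Cn 3" "\<And>k. cmod (\<zeta> k) \<le> 1" "x = line (homog j \<zeta>)"
      by (rule P3_cover) (rule that)
    have xj: "x \<in> P3_domain j" using pD[OF j(1), of \<zeta>] unfolding p_def j(4) .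
    define w where "w = (\<lambda>\<alpha>. \<Sum>\<beta>\<in>B. cocycle F j i x \<alpha> \<beta> * v \<beta>)"
    have ov: "x \<in> cover F j \<inter> cover F i" using x xj i(1) j(1) unfolding cover by simp
    have Nw: "N i x v = N j x w" unfolding w_def by (rule Nq[OF ov])
    have qw: "q w = q v" unfolding w_def B_def by (rule inv[OF ov])
    have "\<exists>b\<in>B. w b \<noteq> 0"
    proof (rule ccontr)
      assume "\<not> (\<exists>b\<in>B. w b \<noteq> 0)"
      hence "N j x w = 0" unfolding N_def by auto
      thus False using pos[OF i(1) x True] Nw by simp
    qed
    from le[OF j(1) _ this, of \<zeta>] show ?thesis unfolding Nw qw[symmetric] using j unfolding D_def p_def by simp
  qed
  define x0 where "x0 = p i (fst (Y i))"
  define v0 where "v0 = snd (Y i)"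
  have x0: "x0 \<in> P3_domain i" unfolding x0_def by (rule pD[OF i(1)])
  have v0: "v0 \<in> S" using Y(1)[OF i(1)] unfolding v0_def by auto
  have N0: "0 < N i x0 v0" by (rule pos[OF i(1) x0 S0[OF v0]])
  have M: "M i = cmod (q v0) / N i x0 v0" unfolding M_def m_def x0_def v0_def ..
  have q0: "q v0 \<noteq> 0"
  proof
    assume "q v0 = 0"
    hence "M i = 0" unfolding M by simp
    with bound[OF x0, of v1] q1 show False by simp
  qed
  have "\<not> RC_positive_at P3 F h x0"
  proof (rule not_RC_positive_at_maximum[where K = K and i = i and D = "P3_domain i" and \<phi> = "P3_coord i"
        and ?v0.0 = v0, OF fin h])
    show "(P3_domain i, P3_coord i) \<in> atlas P3" unfolding P3_def using i by auto
    show "inj_on (P3_coord i) (P3_domain i)" by (rule P3_coord_inj[OF i(1)])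
    show "P3_coord i ` P3_domain i = Cn (cdim P3)" unfolding P_dual_simps by (rule P3_coord_image_domain[OF i(1)])
    show "P3_domain i \<subseteq> cover F i" using i(1) cover by simp
    show "x0 \<in> P3_domain i" by (rule x0)
    show "(\<Sum>a\<in>frame F. \<Sum>b\<in>frame F. K a b * v0 a * v0 b) \<noteq> 0" using q0 unfolding q_def .
    fix x v assume x: "x \<in> P3_domain i"
    have "cmod (q v) * N i x0 v0 \<le> M i * N i x v * N i x0 v0"
      using bound[OF x, of v] N0 by (intro mult_right_mono) auto
    also have "\<dots> = cmod (q v0) * N i x v" unfolding M using N0 by simp
    finally show "cmod (\<Sum>a\<in>frame F. \<Sum>b\<in>frame F. K a b * v a * v b) * Re (\<Sum>\<alpha>\<in>frame F. \<Sum>\<beta>\<in>frame F. h i x0 \<alpha> \<beta> * v0 \<alpha> * cnj (v0 \<beta>))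
      \<le> cmod (\<Sum>a\<in>frame F. \<Sum>b\<in>frame F. K a b * v0 a * v0 b) * Re (\<Sum>\<alpha>\<in>frame F. \<Sum>\<beta>\<in>frame F. h i x \<alpha> \<beta> * v \<alpha> * cnj (v \<beta>))"
      unfolding N_def B_def q_def .
  qed
  moreover have "x0 \<in> points P3" using x0 P3_domain_subset by blast
  ultimately show False using RC by blast
qed

section \<open>Symmetric powers\<close>

lemma NC_cocycle_det:
  assumes "x \<in> cover NC i \<inter> cover NC j"
  shows "cocycle NC i j x 0 0 * cocycle NC i j x 1 1 - cocycle NC i j x 1 0 * cocycle NC i j x 0 1 = 1"
proof -
  have ij: "i < 4" "j < 4" "x \<in> P3_domain i" "x \<in> P3_domain j"
    using assms unfolding NC_def by (auto split: if_splits)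
  obtain z where z: "z \<in> Cn 4" "z i \<noteq> 0" "x = line z" using ij(3) unfolding P3_domain_def by auto
  have nz: "z \<noteq> (\<lambda>_. 0)" using z(2) by auto
  have zj: "z j \<noteq> 0" using ij(4) line_in_P3_domain[OF z(1) nz] unfolding z(3) by simp
  show ?thesis using transition_det[OF ij(2,1) zj z(2)]
    unfolding NC_def by (simp add: z(3) transition_rep[OF z(1) nz] mult.commute)
qed

lemma det_mat_2: "Determinant.det (Matrix.mat 2 2 (\<lambda>(a, b). f a b)) = f 0 0 * f 1 1 - f 1 0 * (f 0 1 :: complex)"
proof -
  define A where "A = Matrix.mat 2 2 (\<lambda>(a, b). f a b)"
  have A: "A \<in> carrier_mat 2 2" unfolding A_def by simp
  have d: "Determinant.det (mat_delete A i 0) = mat_delete A i 0 $$ (0, 0)" for i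
    by (rule det_single) (simp add: A_def mat_delete_def)
  have "Determinant.det A = (\<Sum>i<2. A $$ (i, 0) * cofactor A i 0)"
    by (rule laplace_expansion_column[OF A]) simp
  also have "\<dots> = f 0 0 * f 1 1 - f 1 0 * f 0 1"
    unfolding cofactor_def d by (simp add: numeral_2_eq_2 mat_delete_def A_def)
  finally show ?thesis unfolding A_def .
qed

text \<open>For k = 0 the bundle is det E, whose transition functions are 1; the square of the
  coordinate is then an invariant quadratic form.\<close>

lemma sym_power_0_det_not_RC_positive: "\<not> RC_positive P3 (tensor_bundle (sym_power 0 NC) (det_bundle NC))"
  (is "\<not> RC_positive P3 ?F")
proof (rule invariant_quadratic_form_not_RC_positive[where K = "\<lambda>_ _. 1" and ?v1.0 = "\<lambda>_. 1"])
  have fr: "frame ?F = {({#}, ())}"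
    unfolding tensor_bundle_def sym_power_def det_bundle_def by auto
  show "finite (frame ?F)" "(\<Sum>a\<in>frame ?F. \<Sum>b\<in>frame ?F. 1 * 1 * 1) \<noteq> (0::complex)" unfolding fr by simp_all
  have cov: "cover ?F i = cover NC i" for i unfolding tensor_bundle_def sym_power_def det_bundle_def by simp
  show "cover ?F i = (if i < 4 then P3_domain i else {})" for i unfolding cov by (simp add: NC_def)
  fix i j x and v :: "nat multiset \<times> unit \<Rightarrow> complex" assume "x \<in> cover ?F i \<inter> cover ?F j"
  hence "cocycle NC i j x 0 0 * cocycle NC i j x 1 1 - cocycle NC i j x 1 0 * cocycle NC i j x 0 1 = 1"
    unfolding cov by (rule NC_cocycle_det)
  hence "cocycle ?F i j x ({#}, ()) ({#}, ()) = 1"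
    unfolding tensor_bundle_def sym_power_def det_bundle_def rank_NC by (simp add: det_mat_2)
  thus "(\<Sum>a\<in>frame ?F. \<Sum>b\<in>frame ?F. 1 * (\<Sum>\<beta>\<in>frame ?F. cocycle ?F i j x a \<beta> * v \<beta>) * (\<Sum>\<beta>\<in>frame ?F. cocycle ?F i j x b \<beta> * v \<beta>)) =
      (\<Sum>a\<in>frame ?F. \<Sum>b\<in>frame ?F. 1 * v a * v b)"
    unfolding fr by simp
qed

section \<open>Symmetric powers inside tensor powers\<close>

primrec words :: "nat \<Rightarrow> nat list set" where
  "words 0 = {[]}"
| "words (Suc k) = (#) 0 ` words k \<union> (#) 1 ` words k"

lemma words_iff: "w \<in> words k \<longleftrightarrow> length w = k \<and> set w \<subseteq> {..<2}"
proof (induction k arbitrary: w)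
  case (Suc k)
  have "w \<in> words (Suc k) \<longleftrightarrow> (\<exists>c u. w = c # u \<and> (c = 0 \<or> c = 1) \<and> u \<in> words k)" by auto
  also have "\<dots> \<longleftrightarrow> (\<exists>c u. w = c # u \<and> c < 2 \<and> length u = k \<and> set u \<subseteq> {..<2})"
    unfolding Suc.IH by (simp add: less_2_cases_iff)
  also have "\<dots> \<longleftrightarrow> length w = Suc k \<and> set w \<subseteq> {..<2}" by (cases w) auto
  finally show ?case .
qed auto

lemma finite_words: "finite (words k)"
  by (induction k) auto

lemma sum_words_Suc: "(\<Sum>w\<in>words (Suc k). f w) = (\<Sum>w\<in>words k. f (0 # w) + f (1 # w))"
  unfolding words.simps
  by (subst sum.union_disjoint) (auto simp: finite_words sum.reindex sum.distrib)

definition flip :: "nat list \<Rightarrow> nat list" where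
  "flip = map (\<lambda>c. 1 - c)"

text \<open>The product over the letters of the area form of e_c and e_(1-c), which is 1 for c = 0
  and -1 for c = 1.\<close>

definition word_sign :: "nat list \<Rightarrow> complex" where
  "word_sign w = (- 1) ^ count (mset w) 1"

definition word_prod :: "(nat \<Rightarrow> nat \<Rightarrow> complex) \<Rightarrow> nat list \<Rightarrow> nat list \<Rightarrow> complex" where
  "word_prod g w u = prod_list (map2 g w u)"

lemma flip_words: "w \<in> words k \<Longrightarrow> flip w \<in> words k"
  unfolding words_iff flip_def by auto

text \<open>The \<open>k\<close>-th tensor power of the area form on \<open>\<complex>\<^sup>2\<close> is invariant under \<open>SL\<^sub>2\<close>.\<close>

lemma sum_word_prod:
  assumes det: "g 0 0 * g 1 1 - g 1 0 * g 0 1 = 1"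
  shows "u \<in> words k \<Longrightarrow> u' \<in> words k \<Longrightarrow>
    (\<Sum>w\<in>words k. word_sign w * word_prod g w u * word_prod g (flip w) u') = (if u' = flip u then word_sign u else 0)"
proof (induction k arbitrary: u u')
  case 0
  thus ?case by (simp add: word_prod_def flip_def)
next
  case (Suc k)
  obtain a v a' v' where u: "u = a # v" "u' = a' # v'" "v \<in> words k" "v' \<in> words k" "a < 2" "a' < 2"
    using Suc.prems unfolding words.simps by auto
  \<comment> \<open>The first letter splits off as a factor, the area of the columns a and a' of g.
    By the determinant condition it is 0, 1 or -1.\<close>
  define \<omega> where "\<omega> = g 0 a * g 1 a' - g 1 a * g 0 a'"
  have "(\<Sum>w\<in>words (Suc k). word_sign w * word_prod g w u * word_prod g (flip w) u') =
      \<omega> * (\<Sum>w\<in>words k. word_sign w * word_prod g w v * word_prod g (flip w) v')"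
    unfolding sum_words_Suc sum_distrib_left u \<omega>_def
    by (intro sum.cong refl) (simp add: word_sign_def word_prod_def flip_def algebra_simps)
  also have "\<dots> = \<omega> * (if v' = flip v then word_sign v else 0)" unfolding Suc.IH[OF u(3,4)] ..
  also have "\<omega> = (if a' = 1 - a then (if a = 0 then 1 else - 1) else 0)"
  proof -
    have "a = 0 \<or> a = 1" "a' = 0 \<or> a' = 1" using u(5,6) by auto
    moreover have "g 0 1 * g 1 0 - g 1 1 * g 0 0 = - 1" using det by (simp add: algebra_simps)
    ultimately show ?thesis unfolding \<omega>_def using det by (elim disjE) (simp_all add: mult.commute)
  qed
  also have "\<dots> * (if v' = flip v then word_sign v else 0) = (if u' = flip u then word_sign u else 0)"
    using u(5) unfolding u(1,2) flip_def word_sign_def by (auto simp: less_2_cases_iff)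
  finally show ?case .
qed

text \<open>Permuting both words simultaneously leaves the product unchanged, and it only rearranges
  the summation over all orderings of A.\<close>

lemma sum_permutations_cong:
  assumes "mset u = mset u'" "size A = length u"
  shows "(\<Sum>w\<in>permutations_of_multiset A. word_prod g w u) = (\<Sum>w\<in>permutations_of_multiset A. word_prod g w u')"
    and "(\<Sum>w\<in>permutations_of_multiset A. word_prod g u w) = (\<Sum>w\<in>permutations_of_multiset A. word_prod g u' w)"
proof -
  obtain p where p: "p permutes {..<length u'}" "permute_list p u' = u" using mset_eq_permutation[OF assms(1)] .
  have len: "length u' = length u" using assms(1) by (rule mset_eq_length[symmetric])
  have l: "length w = length u'" if "w \<in> permutations_of_multiset A" for w
    using that assms(2) len unfolding permutations_of_multiset_def by auto
  have inj: "inj_on (permute_list p) (permutations_of_multiset A)"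
  proof (rule inj_onI)
    fix v w assume vw: "v \<in> permutations_of_multiset A" "w \<in> permutations_of_multiset A" "permute_list p v = permute_list p w"
    have "v ! i = w ! i" if "i < length u'" for i
    proof -
      have "i \<in> p ` {..<length u'}" unfolding permutes_image[OF p(1)] using that by simp
      then obtain k where k: "k < length u'" "p k = i" by auto
      have "permute_list p v ! k = v ! i" "permute_list p w ! k = w ! i"
        using permute_list_nth[of p v k] permute_list_nth[of p w k] p(1) l[OF vw(1)] l[OF vw(2)] k by auto
      thus ?thesis using vw(3) by simp
    qed
    thus "v = w" using l[OF vw(1)] l[OF vw(2)] by (intro nth_equalityI) auto
  qed
  have into: "permute_list p ` permutations_of_multiset A \<subseteq> permutations_of_multiset A"
  proof
    fix w assume "w \<in> permute_list p ` permutations_of_multiset A"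
    then obtain w' where w: "w = permute_list p w'" "w' \<in> permutations_of_multiset A" by blast
    have "mset w = mset w'" unfolding w(1) by (rule mset_permute_list) (use p(1) l[OF w(2)] in simp)
    thus "w \<in> permutations_of_multiset A" using w(2) unfolding permutations_of_multiset_def by simp
  qed
  have bij: "bij_betw (permute_list p) (permutations_of_multiset A) (permutations_of_multiset A)"
    unfolding bij_betw_def using inj endo_inj_surj[OF finite_permutations_of_multiset into inj] by simp
  have inv: "word_prod g (permute_list p v) (permute_list p w) = word_prod g v w"
    if "length v = length u'" "length w = length u'" for v w
  proof -
    have P: "prod_list (map (\<lambda>(a, b). g a b) xs) = prod_mset (image_mset (\<lambda>(a, b). g a b) (mset xs))" for xs
      unfolding mset_map[symmetric] prod_mset_prod_list ..
    have z: "permute_list p (zip v w) = zip (permute_list p v) (permute_list p w)"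
    proof (rule permute_list_zip[OF p(1)])
      show "{..<length u'} = {..<length v}" "length v = length w" unfolding that by (rule refl)+
    qed
    have "length (zip v w) = length u'" unfolding length_zip that by (rule min.idem)
    hence "p permutes {..<length (zip v w)}" using p(1) by (simp only:)
    hence "mset (zip (permute_list p v) (permute_list p w)) = mset (zip v w)"
      unfolding z[symmetric] by (rule mset_permute_list)
    thus ?thesis unfolding word_prod_def P by (rule arg_cong)
  qed
  have "(\<Sum>w\<in>permutations_of_multiset A. word_prod g w u) = (\<Sum>w\<in>permutations_of_multiset A. word_prod g (permute_list p w) u)"
    by (rule sum.reindex_bij_betw[OF bij, symmetric])
  also have "\<dots> = (\<Sum>w\<in>permutations_of_multiset A. word_prod g w u')"
    unfolding p(2)[symmetric] by (rule sum.cong[OF refl]) (rule inv[OF l refl])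
  finally show "(\<Sum>w\<in>permutations_of_multiset A. word_prod g w u) = (\<Sum>w\<in>permutations_of_multiset A. word_prod g w u')" .
  have "(\<Sum>w\<in>permutations_of_multiset A. word_prod g u w) = (\<Sum>w\<in>permutations_of_multiset A. word_prod g u (permute_list p w))"
    by (rule sum.reindex_bij_betw[OF bij, symmetric])
  also have "\<dots> = (\<Sum>w\<in>permutations_of_multiset A. word_prod g u' w)"
    unfolding p(2)[symmetric] by (rule sum.cong[OF refl]) (rule inv[OF refl l])
  finally show "(\<Sum>w\<in>permutations_of_multiset A. word_prod g u w) = (\<Sum>w\<in>permutations_of_multiset A. word_prod g u' w)" .
qed

text \<open>The sum over all pairs of orderings is evaluated in two ways. The left side is the
  convention of \<open>sym_power\<close>, which averages over the output word; the right side is the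
  action on symmetric tensors.\<close>

lemma average_permutations:
  fixes g :: "nat \<Rightarrow> nat \<Rightarrow> complex"
  assumes "length w = length u"
  shows "(\<Sum>w'\<in>permutations_of_multiset (mset w). word_prod g w' u) / card (permutations_of_multiset (mset w)) =
    (\<Sum>u'\<in>permutations_of_multiset (mset u). word_prod g w u') / card (permutations_of_multiset (mset u))"
proof -
  define P where "P = permutations_of_multiset (mset w)"
  define Q where "Q = permutations_of_multiset (mset u)"
  have 1: "(\<Sum>u'\<in>Q. \<Sum>w'\<in>P. word_prod g w' u') = (\<Sum>u'\<in>Q. \<Sum>w'\<in>P. word_prod g w' u)"
  proof (rule sum.cong[OF refl])
    fix u' assume "u' \<in> Q"
    hence u': "mset u' = mset u" unfolding Q_def by (rule permutations_of_multisetD)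
    have "size (mset w) = length u'" using assms mset_eq_length[OF u'] by simp
    thus "(\<Sum>w'\<in>P. word_prod g w' u') = (\<Sum>w'\<in>P. word_prod g w' u)"
      unfolding P_def by (rule sum_permutations_cong(1)[OF u'])
  qed
  have 2: "(\<Sum>w'\<in>P. \<Sum>u'\<in>Q. word_prod g w' u') = (\<Sum>w'\<in>P. \<Sum>u'\<in>Q. word_prod g w u')"
  proof (rule sum.cong[OF refl])
    fix w' assume "w' \<in> P"
    hence w': "mset w' = mset w" unfolding P_def by (rule permutations_of_multisetD)
    have "size (mset u) = length w'" using assms mset_eq_length[OF w'] by simp
    thus "(\<Sum>u'\<in>Q. word_prod g w' u') = (\<Sum>u'\<in>Q. word_prod g w u')"
      unfolding Q_def by (rule sum_permutations_cong(2)[OF w'])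
  qed
  have "of_nat (card Q) * (\<Sum>w'\<in>P. word_prod g w' u) = (\<Sum>u'\<in>Q. \<Sum>w'\<in>P. word_prod g w' u')"
    unfolding 1 sum_constant ..
  also have "\<dots> = (\<Sum>w'\<in>P. \<Sum>u'\<in>Q. word_prod g w' u')" by (rule sum.swap)
  also have "\<dots> = of_nat (card P) * (\<Sum>u'\<in>Q. word_prod g w u')" unfolding 2 sum_constant ..
  finally have e: "of_nat (card Q) * (\<Sum>w'\<in>P. word_prod g w' u) = of_nat (card P) * (\<Sum>u'\<in>Q. word_prod g w u')" .
  have "card (permutations_of_multiset A) \<noteq> 0" for A :: "nat multiset"
    by (simp only: card_0_eq finite_permutations_of_multiset permutations_of_multiset_not_empty not_False_eq_True)
  hence nz: "of_nat (card P) \<noteq> (0::complex)" "of_nat (card Q) \<noteq> (0::complex)" unfolding P_def Q_def of_nat_eq_0_iff by blast+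
  show ?thesis unfolding P_def[symmetric] Q_def[symmetric] frac_eq_eq[OF nz] using e by (simp only: mult.commute)
qed

lemma sum_words_by_multiset:
  "(\<Sum>w\<in>words k. f w) = (\<Sum>b\<in>frame (sym_power k NC). \<Sum>w\<in>permutations_of_multiset b. f w)"
  "finite (frame (sym_power k NC))"
proof -
  have fr: "frame (sym_power k NC) = mset ` words k"
  proof (intro equalityI subsetI)
    fix a assume a: "a \<in> frame (sym_power k NC)"
    obtain w where "a = mset w" using ex_mset[of a] by metis
    thus "a \<in> mset ` words k" using a unfolding sym_power_def by (auto simp: words_iff)
  qed (auto simp: sym_power_def words_iff)
  show fin: "finite (frame (sym_power k NC))" unfolding fr by (simp add: finite_words)
  have "{w \<in> words k. mset w = b} = permutations_of_multiset b" if "b \<in> frame (sym_power k NC)" for b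
    using that unfolding sym_power_def permutations_of_multiset_def by (auto simp: words_iff)
  thus "(\<Sum>w\<in>words k. f w) = (\<Sum>b\<in>frame (sym_power k NC). \<Sum>w\<in>permutations_of_multiset b. f w)"
    using sum.group[OF finite_words fin, of mset k f] unfolding fr by simp
qed

text \<open>The embedding of S^k into the tensor power: a monomial is spread evenly over its
  orderings.\<close>

definition word_coeff :: "(nat multiset \<Rightarrow> complex) \<Rightarrow> nat list \<Rightarrow> complex" where
  "word_coeff v w = v (mset w) / of_nat (card (permutations_of_multiset (mset w)))"

text \<open>Equivariance of the embedding: the transition matrix of \<open>sym_power\<close> becomes
  the tensor power of g. The weights in \<open>word_coeff\<close> are exactly those of
  \<open>average_permutations\<close>.\<close>

lemma word_coeff_cocycle:
  assumes w: "w \<in> words k"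
  shows "word_coeff (\<lambda>a. \<Sum>b\<in>frame (sym_power k NC). cocycle (sym_power k NC) i j x a b * v b) w =
    (\<Sum>u\<in>words k. word_prod (cocycle NC i j x) w u * word_coeff v u)"
proof -
  define g where "g = cocycle NC i j x"
  define c where "c = (\<lambda>a :: nat multiset. of_nat (card (permutations_of_multiset a)) :: complex)"
  have "(\<Sum>u\<in>words k. word_prod g w u * word_coeff v u) =
      (\<Sum>b\<in>frame (sym_power k NC). \<Sum>u\<in>permutations_of_multiset b. word_prod g w u * word_coeff v u)"
    by (rule sum_words_by_multiset)
  also have "\<dots> = (\<Sum>b\<in>frame (sym_power k NC). cocycle (sym_power k NC) i j x (mset w) b * v b / c (mset w))"
  proof (rule sum.cong[OF refl])
    fix b assume b: "b \<in> frame (sym_power k NC)"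
    define s where "s = sorted_list_of_multiset b"
    have s: "mset s = b" unfolding s_def by simp
    have len: "length w = length s" using w b s unfolding words_iff sym_power_def by auto
    have "(\<Sum>u\<in>permutations_of_multiset b. word_prod g w u * word_coeff v u) =
        (\<Sum>u\<in>permutations_of_multiset b. word_prod g w u) / c b * v b"
      unfolding sum_divide_distrib sum_distrib_right
      by (intro sum.cong refl) (simp add: word_coeff_def c_def permutations_of_multisetD)
    also have "\<dots> = (\<Sum>w'\<in>permutations_of_multiset (mset w). word_prod g w' s) / c (mset w) * v b"
      using average_permutations[OF len, of g] unfolding s c_def by simp
    also have "\<dots> = cocycle (sym_power k NC) i j x (mset w) b * v b / c (mset w)"
      unfolding sym_power_def word_prod_def s_def g_def by simp
    finally show "(\<Sum>u\<in>permutations_of_multiset b. word_prod g w u * word_coeff v u) = \<dots>" .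
  qed
  finally show ?thesis unfolding g_def word_coeff_def c_def sum_divide_distrib by (rule sym)
qed

text \<open>The k-th tensor power of the area form, restricted to symmetric tensors.\<close>

definition word_form :: "nat \<Rightarrow> (nat multiset \<Rightarrow> complex) \<Rightarrow> complex" where
  "word_form k v = (\<Sum>w\<in>words k. word_sign w * word_coeff v w * word_coeff v (flip w))"

lemma word_form_cocycle:
  assumes "x \<in> cover NC i \<inter> cover NC j"
  shows "word_form k (\<lambda>a. \<Sum>b\<in>frame (sym_power k NC). cocycle (sym_power k NC) i j x a b * v b) = word_form k v"
proof -
  define g where "g = cocycle NC i j x"
  note S = sum_word_prod[OF NC_cocycle_det[OF assms], folded g_def]
  have "word_form k (\<lambda>a. \<Sum>b\<in>frame (sym_power k NC). cocycle (sym_power k NC) i j x a b * v b) =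
      (\<Sum>w\<in>words k. word_sign w * (\<Sum>u\<in>words k. word_prod g w u * word_coeff v u) * (\<Sum>u\<in>words k. word_prod g (flip w) u * word_coeff v u))"
    unfolding word_form_def g_def by (intro sum.cong refl) (simp only: word_coeff_cocycle flip_words)
  also have "\<dots> = (\<Sum>w\<in>words k. \<Sum>(u, u')\<in>words k \<times> words k.
      word_coeff v u * word_coeff v u' * (word_sign w * word_prod g w u * word_prod g (flip w) u'))"
    unfolding sum.cartesian_product[symmetric] mult.assoc sum_product
    unfolding sum_distrib_left by (intro sum.cong refl) (simp add: mult_ac)
  also have "\<dots> = (\<Sum>(u, u')\<in>words k \<times> words k. word_coeff v u * word_coeff v u' *
      (\<Sum>w\<in>words k. word_sign w * word_prod g w u * word_prod g (flip w) u'))"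
    unfolding split_def sum_distrib_left by (rule sum.swap)
  also have "\<dots> = (\<Sum>(u, u')\<in>words k \<times> words k. word_coeff v u * word_coeff v u' * (if u' = flip u then word_sign u else 0))"
    by (intro sum.cong refl) (auto simp: S)
  also have "\<dots> = (\<Sum>u\<in>words k. \<Sum>u'\<in>words k. if u' = flip u then word_sign u * word_coeff v u * word_coeff v u' else 0)"
    unfolding sum.cartesian_product[symmetric] by (intro sum.cong refl) (simp add: mult_ac)
  also have "\<dots> = word_form k v"
    unfolding word_form_def by (intro sum.cong refl) (simp add: finite_words flip_words)
  finally show ?thesis .
qed

text \<open>Collects words by their multisets, to bring the form into the matrix shape in which the
  maximum principle takes it.\<close>

lemma word_form_quadratic:
  obtains K where "\<And>v. word_form k v = (\<Sum>a\<in>frame (sym_power k NC). \<Sum>b\<in>frame (sym_power k NC). K a b * v a * v b)"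
proof
  define B where "B = frame (sym_power k NC)"
  define c where "c = (\<lambda>a :: nat multiset. of_nat (card (permutations_of_multiset a)) :: complex)"
  define K where "K = (\<lambda>a b. \<Sum>w\<in>words k. if mset (flip w) = b then (if mset w = a then word_sign w / (c a * c b) else 0) else 0)"
  have fin: "finite B" unfolding B_def by (rule sum_words_by_multiset)
  have mB: "mset w \<in> B" if "w \<in> words k" for w using that unfolding B_def sym_power_def words_iff by auto
  fix v
  have "(\<Sum>a\<in>B. \<Sum>b\<in>B. K a b * v a * v b) = (\<Sum>a\<in>B. \<Sum>b\<in>B. \<Sum>w\<in>words k.
      if mset (flip w) = b then (if mset w = a then word_sign w / (c a * c b) * v a * v b else 0) else 0)"
    unfolding K_def sum_distrib_right by (intro sum.cong refl) simp
  also have "\<dots> = (\<Sum>a\<in>B. \<Sum>w\<in>words k. \<Sum>b\<in>B.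
      if mset (flip w) = b then (if mset w = a then word_sign w / (c a * c b) * v a * v b else 0) else 0)"
    by (rule sum.cong[OF refl]) (rule sum.swap)
  also have "\<dots> = (\<Sum>w\<in>words k. \<Sum>a\<in>B. \<Sum>b\<in>B.
      if mset (flip w) = b then (if mset w = a then word_sign w / (c a * c b) * v a * v b else 0) else 0)"
    by (rule sum.swap)
  also have "\<dots> = word_form k v"
    unfolding word_form_def
    by (intro sum.cong refl) (simp add: fin mB flip_words sum.delta' word_coeff_def c_def)
  finally show "word_form k v = (\<Sum>a\<in>frame (sym_power k NC). \<Sum>b\<in>frame (sym_power k NC). K a b * v a * v b)"
    unfolding B_def by simp
qed

text \<open>The balanced monomial e_0^m e_1^m is fixed by the exchange of letters, and all its
  orderings have the same sign (-1)^m, so nothing cancels. For odd k the flip reverses the sign of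
  every word and the form vanishes identically.\<close>

lemma word_form_nonzero:
  assumes "even k" obtains v where "word_form k v \<noteq> 0"
proof -
  obtain m where "k = 2 * m" using assms by (rule evenE)
  hence k: "k = m + m" by simp
  define M where "M = mset (replicate m 0 @ replicate m (1::nat))"
  define P where "P = permutations_of_multiset M"
  define v :: "nat multiset \<Rightarrow> complex" where "v = (\<lambda>a. if a = M then 1 else 0)"
  have "image_mset (\<lambda>c. 1 - c) M = M" unfolding M_def by (simp add: union_commute)
  hence fl: "mset (flip w) = M" if "mset w = M" for w unfolding flip_def mset_map that .
  have sg: "word_sign w = (- 1) ^ m" if "mset w = M" for w unfolding word_sign_def that unfolding M_def by simp
  have PW: "{w \<in> words k. mset w = M} = P"
  proof -
    have "w \<in> words k" if w: "mset w = M" for w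
    proof -
      have "size (mset w) = k" "set_mset (mset w) \<subseteq> {..<2}" unfolding w M_def k by auto
      thus ?thesis unfolding words_iff by simp
    qed
    thus ?thesis unfolding P_def permutations_of_multiset_def by auto
  qed
  have "word_form k v = (\<Sum>w\<in>words k. if mset w = M then (- 1) ^ m / (of_nat (card P))\<^sup>2 else 0)"
    unfolding word_form_def
    by (intro sum.cong refl) (auto simp: word_coeff_def v_def fl sg P_def power2_eq_square)
  also have "\<dots> = of_nat (card P) * ((- 1) ^ m / (of_nat (card P))\<^sup>2)"
    by (simp add: sum.inter_filter[symmetric] finite_words PW)
  also have "\<dots> \<noteq> 0" unfolding P_def by simp
  finally show ?thesis by (rule that)
qed

lemma even_sym_power_not_RC_positive:
  assumes "even k" shows "\<not> RC_positive P3 (sym_power k NC)"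
proof -
  obtain K where K: "\<And>v. word_form k v = (\<Sum>a\<in>frame (sym_power k NC). \<Sum>b\<in>frame (sym_power k NC). K a b * v a * v b)"
    by (rule word_form_quadratic[of k]) (rule that)
  obtain v where v: "word_form k v \<noteq> 0" by (rule word_form_nonzero[OF assms])
  have cov: "cover (sym_power k NC) i = cover NC i" for i unfolding sym_power_def by simp
  show ?thesis
  proof (rule invariant_quadratic_form_not_RC_positive[where K = K and ?v1.0 = v])
    show "finite (frame (sym_power k NC))" by (rule sum_words_by_multiset)
    show "cover (sym_power k NC) i = (if i < 4 then P3_domain i else {})" for i unfolding cov by (simp add: NC_def)
    show "(\<Sum>a\<in>frame (sym_power k NC). \<Sum>b\<in>frame (sym_power k NC). K a b * v a * v b) \<noteq> 0"
      using v unfolding K .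
    fix i j x u assume "x \<in> cover (sym_power k NC) i \<inter> cover (sym_power k NC) j"
    hence "x \<in> cover NC i \<inter> cover NC j" unfolding cov .
    from word_form_cocycle[OF this, of k u, unfolded K]
    show "(\<Sum>a\<in>frame (sym_power k NC). \<Sum>b\<in>frame (sym_power k NC).
        K a b * (\<Sum>\<beta>\<in>frame (sym_power k NC). cocycle (sym_power k NC) i j x a \<beta> * u \<beta>) *
          (\<Sum>\<beta>\<in>frame (sym_power k NC). cocycle (sym_power k NC) i j x b \<beta> * u \<beta>)) =
      (\<Sum>a\<in>frame (sym_power k NC). \<Sum>b\<in>frame (sym_power k NC). K a b * u a * u b)" .
  qed
qed

theorem corollary1p4:
  shows "\<not> (\<forall>(X :: pt cmanifold) (E :: (pt, nat, nat) vbundle) r.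
            compact_complex_manifold X \<and> holomorphic_vbundle X E \<and> frame E = {..<r} \<and>
            weakly_RC_positive X E \<longrightarrow>
            (\<forall>k. RC_positive X (tensor_bundle (sym_power k E) (det_bundle E))))
       \<and> \<not> (\<forall>(X :: pt cmanifold) (E :: (pt, nat, nat) vbundle) r.
            compact_complex_manifold X \<and> holomorphic_vbundle X E \<and> frame E = {..<r} \<and>
            weakly_RC_positive X E \<longrightarrow>
            (\<exists>k0. \<forall>k\<ge>k0. RC_positive X (sym_power k E)))"
proof (intro conjI notI)
  have hyps: "compact_complex_manifold P3 \<and> holomorphic_vbundle P3 NC \<and> frame NC = {..<2} \<and> weakly_RC_positive P3 NC"
    by (intro conjI P3_manifold NC_bundle NC_weakly_RC_positive NCd_simps)
  {
    assume *: "\<forall>(X :: pt cmanifold) (E :: (pt, nat, nat) vbundle) r.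
            compact_complex_manifold X \<and> holomorphic_vbundle X E \<and> frame E = {..<r} \<and>
            weakly_RC_positive X E \<longrightarrow>
            (\<forall>k. RC_positive X (tensor_bundle (sym_power k E) (det_bundle E)))"
    \<comment> \<open>The first assertion fails already for the exponent 0.\<close>
    from mp[OF *[THEN spec, THEN spec, THEN spec] hyps] show False
      using sym_power_0_det_not_RC_positive by blast
  next
    assume *: "\<forall>(X :: pt cmanifold) (E :: (pt, nat, nat) vbundle) r.
            compact_complex_manifold X \<and> holomorphic_vbundle X E \<and> frame E = {..<r} \<and>
            weakly_RC_positive X E \<longrightarrow>
            (\<exists>k0. \<forall>k\<ge>k0. RC_positive X (sym_power k E))"
    from mp[OF *[THEN spec, THEN spec, THEN spec] hyps] obtain k0 where "\<forall>k\<ge>k0. RC_positive P3 (sym_power k NC)" ..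
    \<comment> \<open>An even exponent beyond the alleged threshold k0.\<close>
    hence "RC_positive P3 (sym_power (2 * k0) NC)" by simp
    thus False using even_sym_power_not_RC_positive[of "2 * k0"] by simp
  }
qed

end
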